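(* Let $\mathcal{M}$ be a finite abelian category over a field $\Bbbk$, and let $\mathbf{T}=(T,\mu,\eta)$ be a linear monad on $\mathcal{M}$ whose underlying functor $T$ admits a double left adjoint $T^{\mathrm{lla}}=(T^{\mathrm{la}})^{\mathrm{la}}$ and a double right adjoint $T^{\mathrm{rra}}=(T^{\mathrm{ra}})^{\mathrm{ra}}$. Then the Nakayama functor of the finite abelian category $\mathbf{T}\text{-mod}$ of $\mathbf{T}$-modules is given (up to natural isomorphism) by the composition $$\mathbf{T}\text{-mod}\xrightarrow{\ \mathbf{T}^{\mathrm{la}}\otimes_{\mathbf{T}}(-)\ }\mathbf{T}^{\mathrm{lla}}\text{-mod}\xrightarrow{\ \widetilde{\mathbb{N}}\ }\mathbf{T}\text{-mod},$$ where $\widetilde{\mathbb{N}}(M,a_M)=(\mathbb{N}_{\mathcal{M}}(M),\widetilde a_M)$ and $\widetilde a_M$ is the composition $$T(\mathbb{N}_{\mathcal{M}}(M))\xrightarrow{\ \phi_{T^{\mathrm{lla}}}(M)\ }\mathbb{N}_{\mathcal{M}}(T^{\mathrm{lla}}(M))\xrightarrow{\ \mathbb{N}_{\mathcal{M}}(a_M)\ }\mathbb{N}_{\mathcal{M}}(M).$$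
   Context: A finite abelian category is a $\Bbbk$-linear category equivalent to the category of finite-dimensional left modules over a finite-dimensional $\Bbbk$-algebra. For a functor $F$, $F^{\mathrm{la}}$ and $F^{\mathrm{ra}}$ denote a left and a right adjoint; $F^{\mathrm{lla}}=(F^{\mathrm{la}})^{\mathrm{la}}$, $F^{\mathrm{rra}}=(F^{\mathrm{ra}})^{\mathrm{ra}}$, and "admits a double left adjoint" means that $F^{\mathrm{la}}$ and $F^{\mathrm{lla}}$ exist (similarly on the right, and for triple adjoints). For an object $M$ of a finite abelian category $\mathcal{M}$, the copower $(-)\otimes M:\mathrm{Vec}\to\mathcal{M}$ is the left adjoint of $\mathrm{Hom}_{\mathcal{M}}(M,-)$, where $\mathrm{Vec}$ is the category of finite-dimensional vector spaces. The Nakayama functor is $\mathbb{N}_{\mathcal{M}}(M)=\int^{X\in\mathcal{M}}\mathrm{Hom}_{\mathcal{M}}(M,X)^*\otimes X$ (a coend); let $i_{M,X}:\mathrm{Hom}_{\mathcal{M}}(M,X)^*\otimes X\to\mathbb{N}_{\mathcal{M}}(M)$ be the universal dinatural transformation. Canonical isomorphism: let $G:\mathcal{M}\to\mathcal{N}$ be a linear functor between finite abelian categories admitting a triple right adjoint (equivalently, $G^{\mathrm{rra}}$ exists and is right exact). Then $\phi_G(M):G^{\mathrm{rra}}\mathbb{N}_{\mathcal{M}}(M)\to\mathbb{N}_{\mathcal{N}}(G(M))$ is the natural isomorphism characterized by: for all $X\in\mathcal{M}$, $\phi_G(M)\circ G^{\mathrm{rra}}(i_{M,X})$ is the composite $\mathrm{Hom}_{\mathcal{M}}(M,X)^*\otimes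 G^{\mathrm{rra}}(X)\xrightarrow{t^*\otimes\mathrm{id}}\mathrm{Hom}_{\mathcal{N}}(G(M),G^{\mathrm{rra}}(X))^*\otimes G^{\mathrm{rra}}(X)\xrightarrow{i_{G(M),G^{\mathrm{rra}}(X)}}\mathbb{N}_{\mathcal{N}}(G(M))$ (using that $G^{\mathrm{rra}}$ preserves copowers and colimits), where $t:\mathrm{Hom}_{\mathcal{N}}(G(M),G^{\mathrm{rra}}(X))\cong\mathrm{Hom}_{\mathcal{M}}(M,G^{\mathrm{ra}}G^{\mathrm{rra}}(X))\to\mathrm{Hom}_{\mathcal{M}}(M,X)$ is the adjunction isomorphism followed by composition with the counit of $G^{\mathrm{ra}}\dashv G^{\mathrm{rra}}$. For $G=T^{\mathrm{lla}}$ one has $G^{\mathrm{rra}}=T$. A $\mathbf{T}$-module is a pair $(M,a_M)$ with $M\in\mathcal{M}$ and $a_M:T(M)\to M$ associative and unital (an Eilenberg–Moore algebra). Structures on adjoints. Let $u:\mathrm{id}\to TT^{\mathrm{la}}$, $e:T^{\mathrm{la}}T\to\mathrm{id}$ be the unit and counit of $T^{\mathrm{la}}\dashv T$, and $e':T^{\mathrm{lla}}T^{\mathrm{la}}\to\mathrm{id}$ the counit of $T^{\mathrm{lla}}\dashv T^{\mathrm{la}}$. Let $\delta:T^{\mathrm{la}}\to T^{\mathrm{la}}T^{\mathrm{la}}$ and $T^{\mathrm{la}}\to\mathrm{id}$ be the conjugates (mates) of $\mu$ and $\eta$; they make $T^{\mathrm{la}}$ a comonad, and their conjugates make $T^{\mathrm{lla}}$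 a monad, denoted $\mathbf{T}^{\mathrm{lla}}$. $T^{\mathrm{la}}$ has a right $\mathbf{T}$-action $b=(e\,T^{\mathrm{la}})\circ(T^{\mathrm{la}}\mu T^{\mathrm{la}})\circ(T^{\mathrm{la}}T\,u):T^{\mathrm{la}}T\to T^{\mathrm{la}}$ and a left $\mathbf{T}^{\mathrm{lla}}$-action $a^{\ell}=(e'T^{\mathrm{la}})\circ(T^{\mathrm{lla}}\delta):T^{\mathrm{lla}}T^{\mathrm{la}}\to T^{\mathrm{la}}$, making it a $\mathbf{T}^{\mathrm{lla}}$-$\mathbf{T}$-bimodule $\mathbf{T}^{\mathrm{la}}$. For $\mathbf{M}=(M,a_M)\in\mathbf{T}\text{-mod}$, $\mathbf{T}^{\mathrm{la}}\otimes_{\mathbf{T}}\mathbf{M}$ is the coequalizer of $b_M,\,T^{\mathrm{la}}(a_M):T^{\mathrm{la}}T(M)\rightrightarrows T^{\mathrm{la}}(M)$, equipped with the $\mathbf{T}^{\mathrm{lla}}$-module structure induced by $a^{\ell}_M$. *)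

theory Defs
  imports "HOL-Algebra.Module"
begin

section \<open>Vector spaces\<close>

text \<open>A vector space over the field \<open>K\<close> is a \<^term>\<open>module K V\<close> of HOL-Algebra; the
  \<open>mult\<close> and \<open>one\<close> components that the record type inherits from rings are irrelevant, except
  for algebras, where they carry the multiplication.  Linear maps are extensional, so that
  equal maps are equal as HOL functions and the linear forms on \<open>V\<close> form a vector space.\<close>

definition linear_maps ::
    "'k ring \<Rightarrow> ('k, 'v) module \<Rightarrow> ('k, 'w) module \<Rightarrow> ('v \<Rightarrow> 'w) set" where
  "linear_maps K V W =
     {h \<in> carrier V \<rightarrow>\<^sub>E carrier W.
        (\<forall>x\<in>carrier V. \<forall>y\<in>carrier V. h (x \<oplus>\<^bsub>V\<^esub> y) = h x \<oplus>\<^bsub>W\<^esub> h y) \<and>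
        (\<forall>c\<in>carrier K. \<forall>x\<in>carrier V. h (c \<odot>\<^bsub>V\<^esub> x) = c \<odot>\<^bsub>W\<^esub> h x)}"

definition fd_space :: "'k ring \<Rightarrow> ('k, 'v) module \<Rightarrow> bool" where
  "fd_space K V \<longleftrightarrow> module K V \<and>
     (\<exists>S. finite S \<and> S \<subseteq> carrier V \<and>
        (\<forall>v\<in>carrier V. \<exists>c\<in>S \<rightarrow> carrier K. v = (\<Oplus>\<^bsub>V\<^esub>s\<in>S. c s \<odot>\<^bsub>V\<^esub> s)))"

definition scalars :: "'k ring \<Rightarrow> ('k, 'k) module" where
  "scalars K = \<lparr>carrier = carrier K, mult = mult K, one = one K,
     zero = zero K, add = add K, smult = mult K\<rparr>"

definition dual :: "'k ring \<Rightarrow> ('k, 'v) module \<Rightarrow> ('k, 'v \<Rightarrow> 'k) module" where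
  "dual K V = \<lparr>carrier = linear_maps K V (scalars K), mult = undefined, one = undefined,
     zero = (\<lambda>x\<in>carrier V. \<zero>\<^bsub>K\<^esub>),
     add = (\<lambda>\<xi> \<zeta>. \<lambda>x\<in>carrier V. \<xi> x \<oplus>\<^bsub>K\<^esub> \<zeta> x),
     smult = (\<lambda>c \<xi>. \<lambda>x\<in>carrier V. c \<otimes>\<^bsub>K\<^esub> \<xi> x)\<rparr>"

text \<open>For a linear map \<open>h : V \<rightarrow> W\<close>, \<open>dual_map V h\<close> is \<open>h\<^sup>* : W\<^sup>* \<rightarrow> V\<^sup>*\<close>.\<close>

definition dual_map :: "('k, 'v) module \<Rightarrow> ('v \<Rightarrow> 'w) \<Rightarrow> ('w \<Rightarrow> 'k) \<Rightarrow> ('v \<Rightarrow> 'k)" where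
  "dual_map V h \<xi> = (\<lambda>x\<in>carrier V. \<xi> (h x))"


section \<open>Linear categories, functors, natural transformations\<close>

record ('k, 'o, 'm) lincat =
  Obj :: "'o set"
  Arr :: "'m set"
  Dom :: "'m \<Rightarrow> 'o"
  Cod :: "'m \<Rightarrow> 'o"
  Id :: "'o \<Rightarrow> 'm"
  Comp :: "'m \<Rightarrow> 'm \<Rightarrow> 'm"  (infixl "\<cdot>\<index>" 70)
  HZero :: "'o \<Rightarrow> 'o \<Rightarrow> 'm"
  HAdd :: "'m \<Rightarrow> 'm \<Rightarrow> 'm"
  HSmult :: "'k \<Rightarrow> 'm \<Rightarrow> 'm"

definition Hom :: "('k, 'o, 'm) lincat \<Rightarrow> 'o \<Rightarrow> 'o \<Rightarrow> ('k, 'm) module" where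
  "Hom C X Y = \<lparr>carrier = {f \<in> Arr C. Dom C f = X \<and> Cod C f = Y},
     mult = undefined, one = undefined,
     zero = HZero C X Y, add = HAdd C, smult = HSmult C\<rparr>"

abbreviation hom_set :: "('k, 'o, 'm) lincat \<Rightarrow> 'o \<Rightarrow> 'o \<Rightarrow> 'm set" where
  "hom_set C X Y \<equiv> carrier (Hom C X Y)"

definition category :: "('k, 'o, 'm) lincat \<Rightarrow> bool" where
  "category C \<longleftrightarrow>
     (\<forall>f\<in>Arr C. Dom C f \<in> Obj C \<and> Cod C f \<in> Obj C) \<and>
     (\<forall>X\<in>Obj C. Id C X \<in> hom_set C X X) \<and>
     (\<forall>f\<in>Arr C. \<forall>g\<in>Arr C. Cod C f = Dom C g \<longrightarrow>
        g \<cdot>\<^bsub>C\<^esub> f \<in> hom_set C (Dom C f) (Cod C g)) \<and>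
     (\<forall>f\<in>Arr C. f \<cdot>\<^bsub>C\<^esub> Id C (Dom C f) = f \<and> Id C (Cod C f) \<cdot>\<^bsub>C\<^esub> f = f) \<and>
     (\<forall>f\<in>Arr C. \<forall>g\<in>Arr C. \<forall>h\<in>Arr C. Cod C f = Dom C g \<and> Cod C g = Dom C h \<longrightarrow>
        h \<cdot>\<^bsub>C\<^esub> (g \<cdot>\<^bsub>C\<^esub> f) = (h \<cdot>\<^bsub>C\<^esub> g) \<cdot>\<^bsub>C\<^esub> f)"

definition linear_category :: "'k ring \<Rightarrow> ('k, 'o, 'm) lincat \<Rightarrow> bool" where
  "linear_category K C \<longleftrightarrow> category C \<and>
     (\<forall>X\<in>Obj C. \<forall>Y\<in>Obj C. module K (Hom C X Y)) \<and>
     (\<forall>X\<in>Obj C. \<forall>Y\<in>Obj C. \<forall>Z\<in>Obj C.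
        \<forall>f\<in>hom_set C X Y. \<forall>f'\<in>hom_set C X Y. \<forall>g\<in>hom_set C Y Z. \<forall>g'\<in>hom_set C Y Z.
          g \<cdot>\<^bsub>C\<^esub> HAdd C f f' = HAdd C (g \<cdot>\<^bsub>C\<^esub> f) (g \<cdot>\<^bsub>C\<^esub> f') \<and>
          HAdd C g g' \<cdot>\<^bsub>C\<^esub> f = HAdd C (g \<cdot>\<^bsub>C\<^esub> f) (g' \<cdot>\<^bsub>C\<^esub> f) \<and>
          (\<forall>c\<in>carrier K. g \<cdot>\<^bsub>C\<^esub> HSmult C c f = HSmult C c (g \<cdot>\<^bsub>C\<^esub> f) \<and>
             HSmult C c g \<cdot>\<^bsub>C\<^esub> f = HSmult C c (g \<cdot>\<^bsub>C\<^esub> f)))"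

record ('o, 'm, 'p, 'n) ftr =
  FO :: "'o \<Rightarrow> 'p"
  FA :: "'m \<Rightarrow> 'n"

definition is_functor ::
    "('k, 'o, 'm) lincat \<Rightarrow> ('k, 'p, 'n) lincat \<Rightarrow> ('o, 'm, 'p, 'n) ftr \<Rightarrow> bool" where
  "is_functor C D F \<longleftrightarrow> category C \<and> category D \<and>
     (\<forall>X\<in>Obj C. FO F X \<in> Obj D \<and> FA F (Id C X) = Id D (FO F X)) \<and>
     (\<forall>f\<in>Arr C. FA F f \<in> hom_set D (FO F (Dom C f)) (FO F (Cod C f))) \<and>
     (\<forall>f\<in>Arr C. \<forall>g\<in>Arr C. Cod C f = Dom C g \<longrightarrow>
        FA F (g \<cdot>\<^bsub>C\<^esub> f) = FA F g \<cdot>\<^bsub>D\<^esub> FA F f)"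

definition linear_functor ::
    "'k ring \<Rightarrow> ('k, 'o, 'm) lincat \<Rightarrow> ('k, 'p, 'n) lincat \<Rightarrow> ('o, 'm, 'p, 'n) ftr \<Rightarrow> bool" where
  "linear_functor K C D F \<longleftrightarrow>
     linear_category K C \<and> linear_category K D \<and> is_functor C D F \<and>
     (\<forall>X\<in>Obj C. \<forall>Y\<in>Obj C. \<forall>f\<in>hom_set C X Y.
        (\<forall>g\<in>hom_set C X Y. FA F (HAdd C f g) = HAdd D (FA F f) (FA F g)) \<and>
        (\<forall>c\<in>carrier K. FA F (HSmult C c f) = HSmult D c (FA F f)))"

definition ftr_id :: "('o, 'm, 'o, 'm) ftr" where
  "ftr_id = \<lparr>FO = (\<lambda>X. X), FA = (\<lambda>f. f)\<rparr>"

definition ftr_comp ::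
    "('p, 'n, 'q, 'l) ftr \<Rightarrow> ('o, 'm, 'p, 'n) ftr \<Rightarrow> ('o, 'm, 'q, 'l) ftr" where
  "ftr_comp G F = \<lparr>FO = (\<lambda>X. FO G (FO F X)), FA = (\<lambda>f. FA G (FA F f))\<rparr>"

definition nat_trans ::
    "('k, 'o, 'm) lincat \<Rightarrow> ('k, 'p, 'n) lincat \<Rightarrow> ('o, 'm, 'p, 'n) ftr \<Rightarrow>
     ('o, 'm, 'p, 'n) ftr \<Rightarrow> ('o \<Rightarrow> 'n) \<Rightarrow> bool" where
  "nat_trans C D F G t \<longleftrightarrow> is_functor C D F \<and> is_functor C D G \<and>
     (\<forall>X\<in>Obj C. t X \<in> hom_set D (FO F X) (FO G X)) \<and>
     (\<forall>f\<in>Arr C. t (Cod C f) \<cdot>\<^bsub>D\<^esub> FA F f = FA G f \<cdot>\<^bsub>D\<^esub> t (Dom C f))"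

definition is_iso :: "('k, 'o, 'm) lincat \<Rightarrow> 'm \<Rightarrow> bool" where
  "is_iso C f \<longleftrightarrow> f \<in> Arr C \<and>
     (\<exists>g\<in>hom_set C (Cod C f) (Dom C f).
        g \<cdot>\<^bsub>C\<^esub> f = Id C (Dom C f) \<and> f \<cdot>\<^bsub>C\<^esub> g = Id C (Cod C f))"

definition naturally_isomorphic ::
    "('k, 'o, 'm) lincat \<Rightarrow> ('k, 'p, 'n) lincat \<Rightarrow> ('o, 'm, 'p, 'n) ftr \<Rightarrow>
     ('o, 'm, 'p, 'n) ftr \<Rightarrow> bool" where
  "naturally_isomorphic C D F G \<longleftrightarrow>
     (\<exists>t. nat_trans C D F G t \<and> (\<forall>X\<in>Obj C. is_iso D (t X)))"

definition linearly_equivalent ::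
    "'k ring \<Rightarrow> ('k, 'o, 'm) lincat \<Rightarrow> ('k, 'p, 'n) lincat \<Rightarrow> bool" where
  "linearly_equivalent K C D \<longleftrightarrow>
     (\<exists>F G. linear_functor K C D F \<and> linear_functor K D C G \<and>
        naturally_isomorphic C C (ftr_comp G F) ftr_id \<and> naturally_isomorphic D D (ftr_comp F G) ftr_id)"


section \<open>Finite abelian categories\<close>

definition fd_algebra :: "'k ring \<Rightarrow> ('k, 'a) module \<Rightarrow> bool" where
  "fd_algebra K A \<longleftrightarrow> ring A \<and> fd_space K A \<and>
     (\<forall>c\<in>carrier K. \<forall>x\<in>carrier A. \<forall>y\<in>carrier A.
        (c \<odot>\<^bsub>A\<^esub> x) \<otimes>\<^bsub>A\<^esub> y = c \<odot>\<^bsub>A\<^esub> (x \<otimes>\<^bsub>A\<^esub> y) \<and>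
        x \<otimes>\<^bsub>A\<^esub> (c \<odot>\<^bsub>A\<^esub> y) = c \<odot>\<^bsub>A\<^esub> (x \<otimes>\<^bsub>A\<^esub> y))"

text \<open>A left \<open>A\<close>-module is a pair \<open>(V, r)\<close> of a vector space and an action \<open>r a v = a v\<close>.\<close>

definition fd_left_module ::
    "'k ring \<Rightarrow> ('k, 'a) module \<Rightarrow> ('k, 'v) module \<times> ('a \<Rightarrow> 'v \<Rightarrow> 'v) \<Rightarrow> bool" where
  "fd_left_module K A = (\<lambda>(V, r). fd_space K V \<and>
     (\<forall>a\<in>carrier A. \<forall>v\<in>carrier V. r a v \<in> carrier V) \<and>
     (\<forall>a\<in>carrier A. \<forall>v\<in>carrier V. \<forall>w\<in>carrier V. r a (v \<oplus>\<^bsub>V\<^esub> w) = r a v \<oplus>\<^bsub>V\<^esub> r a w) \<and>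
     (\<forall>a\<in>carrier A. \<forall>b\<in>carrier A. \<forall>v\<in>carrier V. r (a \<oplus>\<^bsub>A\<^esub> b) v = r a v \<oplus>\<^bsub>V\<^esub> r b v) \<and>
     (\<forall>c\<in>carrier K. \<forall>a\<in>carrier A. \<forall>v\<in>carrier V.
        r (c \<odot>\<^bsub>A\<^esub> a) v = c \<odot>\<^bsub>V\<^esub> r a v \<and> r a (c \<odot>\<^bsub>V\<^esub> v) = c \<odot>\<^bsub>V\<^esub> r a v) \<and>
     (\<forall>a\<in>carrier A. \<forall>b\<in>carrier A. \<forall>v\<in>carrier V. r (a \<otimes>\<^bsub>A\<^esub> b) v = r a (r b v)) \<and>
     (\<forall>v\<in>carrier V. r \<one>\<^bsub>A\<^esub> v = v))"

type_synonym ('k, 'a, 'v) lmod = "('k, 'v) module \<times> ('a \<Rightarrow> 'v \<Rightarrow> 'v)"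

text \<open>The category of finite-dimensional left \<open>A\<close>-modules with underlying set in the type \<open>'v\<close>.
  Arrows are triples (source, map, target).\<close>

definition fd_mod ::
    "'k ring \<Rightarrow> ('k, 'a) module \<Rightarrow>
     ('k, ('k, 'a, 'v) lmod, ('k, 'a, 'v) lmod \<times> ('v \<Rightarrow> 'v) \<times> ('k, 'a, 'v) lmod) lincat" where
  "fd_mod K A = \<lparr>
     Obj = {X. fd_left_module K A X},
     Arr = {(X, h, Y). fd_left_module K A X \<and> fd_left_module K A Y \<and>
        h \<in> linear_maps K (fst X) (fst Y) \<and>
        (\<forall>a\<in>carrier A. \<forall>v\<in>carrier (fst X). h (snd X a v) = snd Y a (h v))},
     Dom = (\<lambda>(X, h, Y). X),
     Cod = (\<lambda>(X, h, Y). Y),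
     Id = (\<lambda>X. (X, \<lambda>v\<in>carrier (fst X). v, X)),
     Comp = (\<lambda>(Y', g, Z) (X, h, Y). (X, \<lambda>v\<in>carrier (fst X). g (h v), Z)),
     HZero = (\<lambda>X Y. (X, \<lambda>v\<in>carrier (fst X). \<zero>\<^bsub>fst Y\<^esub>, Y)),
     HAdd = (\<lambda>(X, h, Y) (X', g, Y'). (X, \<lambda>v\<in>carrier (fst X). h v \<oplus>\<^bsub>fst Y\<^esub> g v, Y)),
     HSmult = (\<lambda>c (X, h, Y). (X, \<lambda>v\<in>carrier (fst X). c \<odot>\<^bsub>fst Y\<^esub> h v, Y))\<rparr>"

text \<open>Every finite-dimensional algebra and every finite-dimensional vector space over \<open>K\<close> is
  isomorphic to one with underlying set in \<open>nat \<Rightarrow> 'k\<close>, as this type contains all \<open>K\<^sup>n\<close>;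
  hence fixing this type loses no generality.\<close>

definition finite_abelian :: "'k ring \<Rightarrow> ('k, 'o, 'm) lincat \<Rightarrow> bool" where
  "finite_abelian K C \<longleftrightarrow> linear_category K C \<and>
     (\<exists>A :: ('k, nat \<Rightarrow> 'k) module. fd_algebra K A \<and>
        linearly_equivalent K C
          (fd_mod K A :: ('k, ('k, nat \<Rightarrow> 'k, nat \<Rightarrow> 'k) lmod, _) lincat))"


section \<open>Adjunctions and mates\<close>

text \<open>\<open>F : C \<rightarrow> D\<close> is left adjoint to \<open>G : D \<rightarrow> C\<close> with unit \<open>u\<close> and counit \<open>e\<close>.\<close>

definition adjunction ::
    "('k, 'o, 'm) lincat \<Rightarrow> ('k, 'p, 'n) lincat \<Rightarrow> ('o, 'm, 'p, 'n) ftr \<Rightarrow>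
     ('p, 'n, 'o, 'm) ftr \<Rightarrow> ('o \<Rightarrow> 'm) \<Rightarrow> ('p \<Rightarrow> 'n) \<Rightarrow> bool" where
  "adjunction C D F G u e \<longleftrightarrow> is_functor C D F \<and> is_functor D C G \<and>
     nat_trans C C ftr_id (ftr_comp G F) u \<and> nat_trans D D (ftr_comp F G) ftr_id e \<and>
     (\<forall>X\<in>Obj C. e (FO F X) \<cdot>\<^bsub>D\<^esub> FA F (u X) = Id D (FO F X)) \<and>
     (\<forall>Y\<in>Obj D. FA G (e Y) \<cdot>\<^bsub>C\<^esub> u (FO G Y) = Id C (FO G Y))"

definition has_double_right_adjoint ::
    "('k, 'o, 'm) lincat \<Rightarrow> ('o, 'm, 'o, 'm) ftr \<Rightarrow> bool" where
  "has_double_right_adjoint C F \<longleftrightarrow>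
     (\<exists>R u e R' u' e'. adjunction C C F R u e \<and> adjunction C C R R' u' e')"

text \<open>Unit and counit of the composite adjunction \<open>F' F \<stileturn> G G'\<close> of \<open>F \<stileturn> G\<close> (unit \<open>u\<close>,
  counit \<open>e\<close>) and \<open>F' \<stileturn> G'\<close> (unit \<open>u'\<close>, counit \<open>e'\<close>), for endofunctors of \<open>C\<close>.\<close>

definition comp_unit ::
    "('k, 'o, 'm) lincat \<Rightarrow> ('o, 'm, 'o, 'm) ftr \<Rightarrow> ('o, 'm, 'o, 'm) ftr \<Rightarrow>
     ('o \<Rightarrow> 'm) \<Rightarrow> ('o \<Rightarrow> 'm) \<Rightarrow> 'o \<Rightarrow> 'm" where
  "comp_unit C F G u u' X = FA G (u' (FO F X)) \<cdot>\<^bsub>C\<^esub> u X"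

definition comp_counit ::
    "('k, 'o, 'm) lincat \<Rightarrow> ('o, 'm, 'o, 'm) ftr \<Rightarrow> ('o, 'm, 'o, 'm) ftr \<Rightarrow>
     ('o \<Rightarrow> 'm) \<Rightarrow> ('o \<Rightarrow> 'm) \<Rightarrow> 'o \<Rightarrow> 'm" where
  "comp_counit C F' G' e e' X = e' X \<cdot>\<^bsub>C\<^esub> FA F' (e (FO G' X))"

text \<open>If \<open>F \<stileturn> G\<close> with unit \<open>u\<close> and \<open>F' \<stileturn> G'\<close> with counit \<open>e'\<close>, the conjugate of
  \<open>\<alpha> : G \<rightarrow> G'\<close> is the transformation
  \<open>F' \<rightarrow> F' G F \<rightarrow> F' G' F \<rightarrow> F\<close> (via \<open>u\<close>, \<open>\<alpha>\<close> and \<open>e'\<close>).\<close>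

definition conjugate ::
    "('k, 'o, 'm) lincat \<Rightarrow> ('o, 'm, 'o, 'm) ftr \<Rightarrow> ('o \<Rightarrow> 'm) \<Rightarrow>
     ('o, 'm, 'o, 'm) ftr \<Rightarrow> ('o \<Rightarrow> 'm) \<Rightarrow> ('o \<Rightarrow> 'm) \<Rightarrow> 'o \<Rightarrow> 'm" where
  "conjugate C F u F' e' \<alpha> X =
     e' (FO F X) \<cdot>\<^bsub>C\<^esub> (FA F' (\<alpha> (FO F X)) \<cdot>\<^bsub>C\<^esub> FA F' (u X))"


section \<open>Monads and their modules\<close>

definition monad ::
    "('k, 'o, 'm) lincat \<Rightarrow> ('o, 'm, 'o, 'm) ftr \<Rightarrow> ('o \<Rightarrow> 'm) \<Rightarrow> ('o \<Rightarrow> 'm) \<Rightarrow> bool" where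
  "monad C T \<mu> \<eta> \<longleftrightarrow> is_functor C C T \<and>
     nat_trans C C (ftr_comp T T) T \<mu> \<and> nat_trans C C ftr_id T \<eta> \<and>
     (\<forall>X\<in>Obj C. \<mu> X \<cdot>\<^bsub>C\<^esub> \<mu> (FO T X) = \<mu> X \<cdot>\<^bsub>C\<^esub> FA T (\<mu> X) \<and>
        \<mu> X \<cdot>\<^bsub>C\<^esub> \<eta> (FO T X) = Id C (FO T X) \<and> \<mu> X \<cdot>\<^bsub>C\<^esub> FA T (\<eta> X) = Id C (FO T X))"

definition monad_modules ::
    "('k, 'o, 'm) lincat \<Rightarrow> ('o, 'm, 'o, 'm) ftr \<Rightarrow> ('o \<Rightarrow> 'm) \<Rightarrow> ('o \<Rightarrow> 'm) \<Rightarrow> ('o \<times> 'm) set" where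
  "monad_modules C T \<mu> \<eta> =
     {(M, a). M \<in> Obj C \<and> a \<in> hom_set C (FO T M) M \<and>
        a \<cdot>\<^bsub>C\<^esub> \<mu> M = a \<cdot>\<^bsub>C\<^esub> FA T a \<and> a \<cdot>\<^bsub>C\<^esub> \<eta> M = Id C M}"

text \<open>Arrows of the category of modules are triples (source, underlying arrow, target).\<close>

type_synonym ('o, 'm) tarr = "('o \<times> 'm) \<times> 'm \<times> ('o \<times> 'm)"

definition tmod ::
    "('k, 'o, 'm) lincat \<Rightarrow> ('o, 'm, 'o, 'm) ftr \<Rightarrow> ('o \<Rightarrow> 'm) \<Rightarrow> ('o \<Rightarrow> 'm) \<Rightarrow>
     ('k, 'o \<times> 'm, ('o, 'm) tarr) lincat" where
  "tmod C T \<mu> \<eta> = \<lparr>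
     Obj = monad_modules C T \<mu> \<eta>,
     Arr = {(x, f, y). x \<in> monad_modules C T \<mu> \<eta> \<and> y \<in> monad_modules C T \<mu> \<eta> \<and>
        f \<in> hom_set C (fst x) (fst y) \<and> f \<cdot>\<^bsub>C\<^esub> snd x = snd y \<cdot>\<^bsub>C\<^esub> FA T f},
     Dom = (\<lambda>(x, f, y). x),
     Cod = (\<lambda>(x, f, y). y),
     Id = (\<lambda>x. (x, Id C (fst x), x)),
     Comp = (\<lambda>(y', g, z) (x, f, y). (x, g \<cdot>\<^bsub>C\<^esub> f, z)),
     HZero = (\<lambda>x y. (x, HZero C (fst x) (fst y), y)),
     HAdd = (\<lambda>(x, f, y) (x', g, y'). (x, HAdd C f g, y)),
     HSmult = (\<lambda>c (x, f, y). (x, HSmult C c f, y))\<rparr>"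


section \<open>Copowers, coends and the Nakayama functor\<close>

text \<open>\<open>(Q, j)\<close> is a copower of \<open>X\<close> by \<open>V\<close>: the linear map \<open>j : V \<rightarrow> Hom(X, Q)\<close> is a universal
  arrow from \<open>V\<close> to the functor \<open>Hom(X, -)\<close>, i.e. the component at \<open>V\<close> of the unit of
  \<open>(-) \<otimes> X \<stileturn> Hom(X, -)\<close>.\<close>

definition is_copower ::
    "'k ring \<Rightarrow> ('k, 'o, 'm) lincat \<Rightarrow> ('k, 'v) module \<Rightarrow> 'o \<Rightarrow> 'o \<Rightarrow> ('v \<Rightarrow> 'm) \<Rightarrow> bool" where
  "is_copower K C V X Q j \<longleftrightarrow> Q \<in> Obj C \<and> j \<in> linear_maps K V (Hom C X Q) \<and>
     (\<forall>Y\<in>Obj C. \<forall>h\<in>linear_maps K V (Hom C X Y).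
        \<exists>!f. f \<in> hom_set C Q Y \<and> (\<forall>v\<in>carrier V. f \<cdot>\<^bsub>C\<^esub> j v = h v))"

text \<open>A choice of copowers \<open>ten V X = V \<otimes> X\<close> with universal maps \<open>tj V X\<close>.  The vector spaces
  range over those with underlying set in a type \<open>'v\<close>; for the Nakayama functor this is
  \<open>'m \<Rightarrow> 'k\<close>, which contains the duals of all hom spaces.\<close>

definition copowers ::
    "'k ring \<Rightarrow> ('k, 'o, 'm) lincat \<Rightarrow> (('k, 'v) module \<Rightarrow> 'o \<Rightarrow> 'o) \<Rightarrow>
     (('k, 'v) module \<Rightarrow> 'o \<Rightarrow> 'v \<Rightarrow> 'm) \<Rightarrow> bool" where
  "copowers K C ten tj \<longleftrightarrow>
     (\<forall>V X. fd_space K V \<and> X \<in> Obj C \<longrightarrow> is_copower K C V X (ten V X) (tj V X))"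

text \<open>\<open>g \<otimes> f : V \<otimes> X \<rightarrow> W \<otimes> Y\<close> for a linear map \<open>g : V \<rightarrow> W\<close> and an arrow \<open>f : X \<rightarrow> Y\<close>.\<close>

definition ten_map ::
    "('k, 'o, 'm) lincat \<Rightarrow> (('k, 'v) module \<Rightarrow> 'o \<Rightarrow> 'o) \<Rightarrow>
     (('k, 'v) module \<Rightarrow> 'o \<Rightarrow> 'v \<Rightarrow> 'm) \<Rightarrow>
     ('k, 'v) module \<Rightarrow> ('k, 'v) module \<Rightarrow> ('v \<Rightarrow> 'v) \<Rightarrow> 'm \<Rightarrow> 'm" where
  "ten_map C ten tj V W g f =
     (THE p. p \<in> hom_set C (ten V (Dom C f)) (ten W (Cod C f)) \<and>
        (\<forall>v\<in>carrier V. p \<cdot>\<^bsub>C\<^esub> tj V (Dom C f) v = tj W (Cod C f) (g v) \<cdot>\<^bsub>C\<^esub> f))"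

text \<open>A functor \<open>S : C\<^sup>o\<^sup>p \<times> C \<rightarrow> D\<close> is given by \<open>SO X Y = S(X, Y)\<close> and, for \<open>f : X \<rightarrow> X'\<close> and
  \<open>g : Y \<rightarrow> Y'\<close>, \<open>SA f g = S(f, g) : S(X', Y) \<rightarrow> S(X, Y')\<close>.\<close>

definition dinatural ::
    "('k, 'o, 'm) lincat \<Rightarrow> ('k, 'p, 'n) lincat \<Rightarrow> ('o \<Rightarrow> 'o \<Rightarrow> 'p) \<Rightarrow> ('m \<Rightarrow> 'm \<Rightarrow> 'n) \<Rightarrow>
     'p \<Rightarrow> ('o \<Rightarrow> 'n) \<Rightarrow> bool" where
  "dinatural C D SO SA Z i \<longleftrightarrow> Z \<in> Obj D \<and>
     (\<forall>X\<in>Obj C. i X \<in> hom_set D (SO X X) Z) \<and>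
     (\<forall>f\<in>Arr C. i (Dom C f) \<cdot>\<^bsub>D\<^esub> SA f (Id C (Dom C f)) = i (Cod C f) \<cdot>\<^bsub>D\<^esub> SA (Id C (Cod C f)) f)"

definition is_coend ::
    "('k, 'o, 'm) lincat \<Rightarrow> ('k, 'p, 'n) lincat \<Rightarrow> ('o \<Rightarrow> 'o \<Rightarrow> 'p) \<Rightarrow> ('m \<Rightarrow> 'm \<Rightarrow> 'n) \<Rightarrow>
     'p \<Rightarrow> ('o \<Rightarrow> 'n) \<Rightarrow> bool" where
  "is_coend C D SO SA Z i \<longleftrightarrow> dinatural C D SO SA Z i \<and>
     (\<forall>Z' i'. dinatural C D SO SA Z' i' \<longrightarrow>
        (\<exists>!h. h \<in> hom_set D Z Z' \<and> (\<forall>X\<in>Obj C. h \<cdot>\<^bsub>D\<^esub> i X = i' X)))"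

text \<open>The functor \<open>(Y, X) \<mapsto> Hom(M, Y)\<^sup>* \<otimes> X\<close> on objects and arrows.\<close>

definition nak_obj ::
    "'k ring \<Rightarrow> ('k, 'o, 'm) lincat \<Rightarrow> (('k, 'm \<Rightarrow> 'k) module \<Rightarrow> 'o \<Rightarrow> 'o) \<Rightarrow>
     'o \<Rightarrow> 'o \<Rightarrow> 'o \<Rightarrow> 'o" where
  "nak_obj K C ten M Y X = ten (dual K (Hom C M Y)) X"

definition nak_arr ::
    "'k ring \<Rightarrow> ('k, 'o, 'm) lincat \<Rightarrow> (('k, 'm \<Rightarrow> 'k) module \<Rightarrow> 'o \<Rightarrow> 'o) \<Rightarrow>
     (('k, 'm \<Rightarrow> 'k) module \<Rightarrow> 'o \<Rightarrow> ('m \<Rightarrow> 'k) \<Rightarrow> 'm) \<Rightarrow> 'o \<Rightarrow> 'm \<Rightarrow> 'm \<Rightarrow> 'm" where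
  "nak_arr K C ten tj M f g =
     ten_map C ten tj (dual K (Hom C M (Cod C f))) (dual K (Hom C M (Dom C f)))
       (dual_map (Hom C M (Dom C f)) (\<lambda>h. f \<cdot>\<^bsub>C\<^esub> h)) g"

text \<open>\<open>N\<close> with \<open>i M X : Hom(M, X)\<^sup>* \<otimes> X \<rightarrow> N(M)\<close> is a Nakayama functor of \<open>C\<close>, formed with the
  copowers \<open>(ten, tj)\<close>.  The last clause is the functoriality of the coend in the parameter \<open>M\<close>.\<close>

definition nakayama ::
    "'k ring \<Rightarrow> ('k, 'o, 'm) lincat \<Rightarrow> (('k, 'm \<Rightarrow> 'k) module \<Rightarrow> 'o \<Rightarrow> 'o) \<Rightarrow>
     (('k, 'm \<Rightarrow> 'k) module \<Rightarrow> 'o \<Rightarrow> ('m \<Rightarrow> 'k) \<Rightarrow> 'm) \<Rightarrow>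
     ('o, 'm, 'o, 'm) ftr \<Rightarrow> ('o \<Rightarrow> 'o \<Rightarrow> 'm) \<Rightarrow> bool" where
  "nakayama K C ten tj N i \<longleftrightarrow> copowers K C ten tj \<and> is_functor C C N \<and>
     (\<forall>M\<in>Obj C. is_coend C C (nak_obj K C ten M) (nak_arr K C ten tj M) (FO N M) (i M)) \<and>
     (\<forall>f\<in>Arr C. \<forall>X\<in>Obj C.
        FA N f \<cdot>\<^bsub>C\<^esub> i (Dom C f) X =
        i (Cod C f) X \<cdot>\<^bsub>C\<^esub>
          ten_map C ten tj (dual K (Hom C (Dom C f) X)) (dual K (Hom C (Cod C f) X))
            (dual_map (Hom C (Cod C f) X) (\<lambda>h. h \<cdot>\<^bsub>C\<^esub> f)) (Id C X))"

definition is_nakayama_functor ::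
    "'k ring \<Rightarrow> ('k, 'o, 'm) lincat \<Rightarrow> ('o, 'm, 'o, 'm) ftr \<Rightarrow> bool" where
  "is_nakayama_functor K C N \<longleftrightarrow> (\<exists>ten tj i. nakayama K C ten tj N i)"


section \<open>The canonical isomorphism\<close>

text \<open>The comparison \<open>V \<otimes> F(X) \<rightarrow> F(V \<otimes> X)\<close>; it is invertible if \<open>F\<close> preserves copowers.\<close>

definition ten_comparison ::
    "('k, 'o, 'm) lincat \<Rightarrow> (('k, 'v) module \<Rightarrow> 'o \<Rightarrow> 'o) \<Rightarrow>
     (('k, 'v) module \<Rightarrow> 'o \<Rightarrow> 'v \<Rightarrow> 'm) \<Rightarrow> ('o, 'm, 'o, 'm) ftr \<Rightarrow>
     ('k, 'v) module \<Rightarrow> 'o \<Rightarrow> 'm" where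
  "ten_comparison C ten tj F V X =
     (THE p. p \<in> hom_set C (ten V (FO F X)) (FO F (ten V X)) \<and>
        (\<forall>v\<in>carrier V. p \<cdot>\<^bsub>C\<^esub> tj V (FO F X) v = FA F (tj V X v)))"

text \<open>Here \<open>G \<stileturn> G'\<close> with unit \<open>u\<close> and \<open>G' \<stileturn> G''\<close> with counit \<open>e\<close> (endofunctors of \<open>C\<close>), so
  \<open>G' = G\<^sup>r\<^sup>a\<close> and \<open>G'' = G\<^sup>r\<^sup>r\<^sup>a\<close>.  The map \<open>t : Hom(G M, G'' X) \<rightarrow> Hom(M, X)\<close> is the adjunction
  isomorphism \<open>f \<mapsto> G'(f) u\<close> followed by composition with \<open>e\<close>.\<close>

definition can_t ::
    "('k, 'o, 'm) lincat \<Rightarrow> ('o, 'm, 'o, 'm) ftr \<Rightarrow> ('o \<Rightarrow> 'm) \<Rightarrow> ('o \<Rightarrow> 'm) \<Rightarrow>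
     'o \<Rightarrow> 'o \<Rightarrow> 'm \<Rightarrow> 'm" where
  "can_t C G' u e M X f = e X \<cdot>\<^bsub>C\<^esub> (FA G' f \<cdot>\<^bsub>C\<^esub> u M)"

definition can_phi ::
    "'k ring \<Rightarrow> ('k, 'o, 'm) lincat \<Rightarrow> (('k, 'm \<Rightarrow> 'k) module \<Rightarrow> 'o \<Rightarrow> 'o) \<Rightarrow>
     (('k, 'm \<Rightarrow> 'k) module \<Rightarrow> 'o \<Rightarrow> ('m \<Rightarrow> 'k) \<Rightarrow> 'm) \<Rightarrow>
     ('o, 'm, 'o, 'm) ftr \<Rightarrow> ('o \<Rightarrow> 'o \<Rightarrow> 'm) \<Rightarrow>
     ('o, 'm, 'o, 'm) ftr \<Rightarrow> ('o, 'm, 'o, 'm) ftr \<Rightarrow> ('o, 'm, 'o, 'm) ftr \<Rightarrow>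
     ('o \<Rightarrow> 'm) \<Rightarrow> ('o \<Rightarrow> 'm) \<Rightarrow> 'o \<Rightarrow> 'm" where
  "can_phi K C ten tj N i G G' G'' u e M =
     (THE p. p \<in> hom_set C (FO G'' (FO N M)) (FO N (FO G M)) \<and>
        (\<forall>X\<in>Obj C.
           p \<cdot>\<^bsub>C\<^esub> (FA G'' (i M X) \<cdot>\<^bsub>C\<^esub> ten_comparison C ten tj G'' (dual K (Hom C M X)) X) =
           i (FO G M) (FO G'' X) \<cdot>\<^bsub>C\<^esub>
             ten_map C ten tj (dual K (Hom C M X)) (dual K (Hom C (FO G M) (FO G'' X)))
               (dual_map (Hom C (FO G M) (FO G'' X)) (can_t C G' u e M X)) (Id C (FO G'' X))))"

text \<open>The functor \<open>(M, a) \<mapsto> (N M, N(a) \<phi>\<^sub>G(M))\<close> from \<open>G\<close>-modules to \<open>G''\<close>-modules.\<close>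

definition nak_lift ::
    "'k ring \<Rightarrow> ('k, 'o, 'm) lincat \<Rightarrow> (('k, 'm \<Rightarrow> 'k) module \<Rightarrow> 'o \<Rightarrow> 'o) \<Rightarrow>
     (('k, 'm \<Rightarrow> 'k) module \<Rightarrow> 'o \<Rightarrow> ('m \<Rightarrow> 'k) \<Rightarrow> 'm) \<Rightarrow>
     ('o, 'm, 'o, 'm) ftr \<Rightarrow> ('o \<Rightarrow> 'o \<Rightarrow> 'm) \<Rightarrow>
     ('o, 'm, 'o, 'm) ftr \<Rightarrow> ('o, 'm, 'o, 'm) ftr \<Rightarrow> ('o, 'm, 'o, 'm) ftr \<Rightarrow>
     ('o \<Rightarrow> 'm) \<Rightarrow> ('o \<Rightarrow> 'm) \<Rightarrow> ('o \<times> 'm, ('o, 'm) tarr, 'o \<times> 'm, ('o, 'm) tarr) ftr" where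
  "nak_lift K C ten tj N i G G' G'' u e =
     (let ob = (\<lambda>(M, a). (FO N M, FA N a \<cdot>\<^bsub>C\<^esub> can_phi K C ten tj N i G G' G'' u e M))
      in \<lparr>FO = ob, FA = (\<lambda>(x, f, y). (ob x, FA N f, ob y))\<rparr>)"


section \<open>The structures on the adjoints of a monad\<close>

text \<open>Throughout, \<open>L = T\<^sup>l\<^sup>a\<close> with unit \<open>u\<close> and counit \<open>e\<close> of \<open>L \<stileturn> T\<close>, and \<open>LL = T\<^sup>l\<^sup>l\<^sup>a\<close> with
  unit \<open>u'\<close> and counit \<open>e'\<close> of \<open>LL \<stileturn> L\<close>.\<close>

definition la_comult ::
    "('k, 'o, 'm) lincat \<Rightarrow> ('o, 'm, 'o, 'm) ftr \<Rightarrow> ('o \<Rightarrow> 'm) \<Rightarrow>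
     ('o, 'm, 'o, 'm) ftr \<Rightarrow> ('o \<Rightarrow> 'm) \<Rightarrow> ('o \<Rightarrow> 'm) \<Rightarrow> 'o \<Rightarrow> 'm" where
  "la_comult C T \<mu> L u e = conjugate C (ftr_comp L L) (comp_unit C L T u u) L e \<mu>"

definition la_counit ::
    "('k, 'o, 'm) lincat \<Rightarrow> ('o \<Rightarrow> 'm) \<Rightarrow> ('o, 'm, 'o, 'm) ftr \<Rightarrow> ('o \<Rightarrow> 'm) \<Rightarrow> 'o \<Rightarrow> 'm" where
  "la_counit C \<eta> L e = conjugate C ftr_id (Id C) L e \<eta>"

definition lla_mult ::
    "('k, 'o, 'm) lincat \<Rightarrow> ('o, 'm, 'o, 'm) ftr \<Rightarrow> ('o \<Rightarrow> 'm) \<Rightarrow>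
     ('o, 'm, 'o, 'm) ftr \<Rightarrow> ('o \<Rightarrow> 'm) \<Rightarrow> ('o \<Rightarrow> 'm) \<Rightarrow>
     ('o, 'm, 'o, 'm) ftr \<Rightarrow> ('o \<Rightarrow> 'm) \<Rightarrow> ('o \<Rightarrow> 'm) \<Rightarrow> 'o \<Rightarrow> 'm" where
  "lla_mult C T \<mu> L u e LL u' e' =
     conjugate C LL u' (ftr_comp LL LL) (comp_counit C LL L e' e') (la_comult C T \<mu> L u e)"

definition lla_unit ::
    "('k, 'o, 'm) lincat \<Rightarrow> ('o \<Rightarrow> 'm) \<Rightarrow> ('o, 'm, 'o, 'm) ftr \<Rightarrow> ('o \<Rightarrow> 'm) \<Rightarrow>
     ('o, 'm, 'o, 'm) ftr \<Rightarrow> ('o \<Rightarrow> 'm) \<Rightarrow> 'o \<Rightarrow> 'm" where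
  "lla_unit C \<eta> L e LL u' = conjugate C LL u' ftr_id (Id C) (la_counit C \<eta> L e)"

definition la_right_action ::
    "('k, 'o, 'm) lincat \<Rightarrow> ('o, 'm, 'o, 'm) ftr \<Rightarrow> ('o \<Rightarrow> 'm) \<Rightarrow>
     ('o, 'm, 'o, 'm) ftr \<Rightarrow> ('o \<Rightarrow> 'm) \<Rightarrow> ('o \<Rightarrow> 'm) \<Rightarrow> 'o \<Rightarrow> 'm" where
  "la_right_action C T \<mu> L u e M =
     e (FO L M) \<cdot>\<^bsub>C\<^esub> (FA L (\<mu> (FO L M)) \<cdot>\<^bsub>C\<^esub> FA L (FA T (u M)))"

definition la_left_action ::
    "('k, 'o, 'm) lincat \<Rightarrow> ('o, 'm, 'o, 'm) ftr \<Rightarrow> ('o \<Rightarrow> 'm) \<Rightarrow>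
     ('o, 'm, 'o, 'm) ftr \<Rightarrow> ('o \<Rightarrow> 'm) \<Rightarrow> ('o \<Rightarrow> 'm) \<Rightarrow>
     ('o, 'm, 'o, 'm) ftr \<Rightarrow> ('o \<Rightarrow> 'm) \<Rightarrow> 'o \<Rightarrow> 'm" where
  "la_left_action C T \<mu> L u e LL e' M =
     e' (FO L M) \<cdot>\<^bsub>C\<^esub> FA LL (la_comult C T \<mu> L u e M)"

definition is_coequalizer ::
    "('k, 'o, 'm) lincat \<Rightarrow> 'm \<Rightarrow> 'm \<Rightarrow> 'o \<Rightarrow> 'm \<Rightarrow> bool" where
  "is_coequalizer C f g Q q \<longleftrightarrow>
     f \<in> Arr C \<and> g \<in> Arr C \<and> Dom C f = Dom C g \<and> Cod C f = Cod C g \<and> Q \<in> Obj C \<and>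
     q \<in> hom_set C (Cod C f) Q \<and> q \<cdot>\<^bsub>C\<^esub> f = q \<cdot>\<^bsub>C\<^esub> g \<and>
     (\<forall>Z\<in>Obj C. \<forall>h\<in>hom_set C (Cod C f) Z. h \<cdot>\<^bsub>C\<^esub> f = h \<cdot>\<^bsub>C\<^esub> g \<longrightarrow>
        (\<exists>!k. k \<in> hom_set C Q Z \<and> k \<cdot>\<^bsub>C\<^esub> q = h))"

text \<open>A choice, for each \<open>T\<close>-module \<open>x = (M, a)\<close>, of the coequalizer \<open>q x : L(M) \<rightarrow> Q x\<close>
  whose target is the underlying object of \<open>T\<^sup>l\<^sup>a \<otimes>\<^sub>T x\<close>.\<close>

definition tensor_coequalizers ::
    "('k, 'o, 'm) lincat \<Rightarrow> ('o, 'm, 'o, 'm) ftr \<Rightarrow> ('o \<Rightarrow> 'm) \<Rightarrow> ('o \<Rightarrow> 'm) \<Rightarrow>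
     ('o, 'm, 'o, 'm) ftr \<Rightarrow> ('o \<Rightarrow> 'm) \<Rightarrow> ('o \<Rightarrow> 'm) \<Rightarrow>
     ('o \<times> 'm \<Rightarrow> 'o) \<Rightarrow> ('o \<times> 'm \<Rightarrow> 'm) \<Rightarrow> bool" where
  "tensor_coequalizers C T \<mu> \<eta> L u e Q q \<longleftrightarrow>
     (\<forall>x\<in>monad_modules C T \<mu> \<eta>.
        is_coequalizer C (la_right_action C T \<mu> L u e (fst x)) (FA L (snd x)) (Q x) (q x))"

text \<open>The functor \<open>T\<^sup>l\<^sup>a \<otimes>\<^sub>T (-)\<close> from \<open>T\<close>-modules to \<open>T\<^sup>l\<^sup>l\<^sup>a\<close>-modules.\<close>

definition tensor_functor ::
    "('k, 'o, 'm) lincat \<Rightarrow> ('o, 'm, 'o, 'm) ftr \<Rightarrow> ('o \<Rightarrow> 'm) \<Rightarrow>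
     ('o, 'm, 'o, 'm) ftr \<Rightarrow> ('o \<Rightarrow> 'm) \<Rightarrow> ('o \<Rightarrow> 'm) \<Rightarrow>
     ('o, 'm, 'o, 'm) ftr \<Rightarrow> ('o \<Rightarrow> 'm) \<Rightarrow>
     ('o \<times> 'm \<Rightarrow> 'o) \<Rightarrow> ('o \<times> 'm \<Rightarrow> 'm) \<Rightarrow>
     ('o \<times> 'm, ('o, 'm) tarr, 'o \<times> 'm, ('o, 'm) tarr) ftr" where
  "tensor_functor C T \<mu> L u e LL e' Q q =
     (let ob = (\<lambda>x. (Q x, THE r. r \<in> hom_set C (FO LL (Q x)) (Q x) \<and>
                  r \<cdot>\<^bsub>C\<^esub> FA LL (q x) = q x \<cdot>\<^bsub>C\<^esub> la_left_action C T \<mu> L u e LL e' (fst x)))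
      in \<lparr>FO = ob,
          FA = (\<lambda>(x, f, y). (ob x,
                  THE g. g \<in> hom_set C (Q x) (Q y) \<and> g \<cdot>\<^bsub>C\<^esub> q x = q y \<cdot>\<^bsub>C\<^esub> FA L f,
                  ob y))\<rparr>)"

end

theory Submission
  imports Defs
begin

text \<open>Copowers only serve to form the coend that defines a Nakayama functor: a dinatural family
  \<open>Hom(M, X)\<^sup>* \<otimes> X \<rightarrow> Z\<close> is a family of linear maps \<open>Hom(M, X)\<^sup>* \<rightarrow> Hom(X, Z)\<close> that is natural in \<open>X\<close>, and
  \<open>N(M)\<close> is the object that represents these families.  In this form the statement is a computation
  with universal arrows.

  Let \<open>x\<close> be a \<open>T\<close>-module and \<open>P = T\<^sup>l\<^sup>a \<otimes>\<^sub>T x\<close>.  The transpose of the coequalizer \<open>T\<^sup>l\<^sup>a(M) \<rightarrow> P\<close> is a module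
  map \<open>\<sigma> : x \<rightarrow> T(P)\<close>, and it is universal: \<open>k \<mapsto> T(k) \<sigma>\<close> is a bijection from the arrows \<open>P \<rightarrow> X\<close> onto the
  module maps from \<open>x\<close> to the free module \<open>T(X)\<close>.  So the functor \<open>T\<^sup>l\<^sup>a \<otimes>\<^sub>T -\<close> is left adjoint to the free
  module functor; its functoriality, the coaction \<open>P \<rightarrow> T\<^sup>l\<^sup>a(P)\<close>, which is the transpose of the
  \<open>T\<^sup>l\<^sup>l\<^sup>a\<close>-action, and all equations between them are derived from this bijection.

  Every module \<open>z\<close> is a quotient of the free module on its underlying object.  Hence a natural family
  \<open>Hom(x, z)\<^sup>* \<rightarrow> Hom(z, y)\<close>, for all modules \<open>z\<close>, is determined by its values on free modules, which are
  linear maps \<open>Hom(P, X)\<^sup>* \<rightarrow> Hom(X, y)\<close>, natural in \<open>X\<close>; that is, an arrow \<open>N(P) \<rightarrow> y\<close>.  The families that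
  arise in this way belong to the arrows that are linear for a certain action of \<open>T\<close> on \<open>N(P)\<close>.  To
  find it, note that the bijection turns the composition of module maps with \<open>\<mu>\<close> into a map \<open>st\<close> from
  \<open>Hom(P, T(X))\<close> to \<open>Hom(P, X)\<close>, namely \<open>f \<mapsto> e T\<^sup>l\<^sup>a(f) \<rho>\<close> with the coaction \<open>\<rho>\<close> (lemma \<open>st_sigma\<close>); and the
  action \<open>N(a) \<phi> : T(N(P)) \<rightarrow> N(P)\<close> is given by the dual of the same map (lemma \<open>nact_iota\<close>).
  So the composite functor represents the families on the category of modules (lemmas \<open>iotaT_rep\<close>
  and \<open>tmod_nak_functor\<close>), and representing objects are unique.

  It remains to see that the category of modules is finite abelian.  The finite abelian
  categories are those with finite-dimensional hom spaces and a progenerator \<open>P\<close>, which is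
  characterized by two properties: linear maps \<open>Hom(P, X) \<rightarrow> Hom(P, Y)\<close> that commute with \<open>End(P)\<close> come
  from unique arrows \<open>X \<rightarrow> Y\<close>, and every finite-dimensional right \<open>End(P)\<close>-module is some \<open>Hom(P, X)\<close>.
  Since \<open>T\<close> has a right adjoint, both properties pass from \<open>P\<close> to the free module on \<open>P\<close>.
  They also yield copowers of modules, by which the families above become the coend.\<close>

section \<open>Finite-dimensional vector spaces\<close>

lemma linear_mapsI:
  assumes "\<And>x. x \<in> carrier V \<Longrightarrow> h x \<in> carrier W"
    and "\<And>x. x \<notin> carrier V \<Longrightarrow> h x = undefined"
    and "\<And>x y. x \<in> carrier V \<Longrightarrow> y \<in> carrier V \<Longrightarrow> h (x \<oplus>\<^bsub>V\<^esub> y) = h x \<oplus>\<^bsub>W\<^esub> h y"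
    and "\<And>c x. c \<in> carrier K \<Longrightarrow> x \<in> carrier V \<Longrightarrow> h (c \<odot>\<^bsub>V\<^esub> x) = c \<odot>\<^bsub>W\<^esub> h x"
  shows "h \<in> linear_maps K V W"
  using assms unfolding linear_maps_def by (auto simp: PiE_def extensional_def)

lemma
  assumes "h \<in> linear_maps K V W"
  shows linear_maps_closed: "x \<in> carrier V \<Longrightarrow> h x \<in> carrier W"
    and linear_maps_undefined: "x \<notin> carrier V \<Longrightarrow> h x = undefined"
    and linear_maps_add: "x \<in> carrier V \<Longrightarrow> y \<in> carrier V \<Longrightarrow> h (x \<oplus>\<^bsub>V\<^esub> y) = h x \<oplus>\<^bsub>W\<^esub> h y"
    and linear_maps_smult: "c \<in> carrier K \<Longrightarrow> x \<in> carrier V \<Longrightarrow> h (c \<odot>\<^bsub>V\<^esub> x) = c \<odot>\<^bsub>W\<^esub> h x"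
  using assms unfolding linear_maps_def by (auto simp: PiE_def extensional_def)

lemma linear_maps_eqI:
  assumes "h \<in> linear_maps K V W" "g \<in> linear_maps K V W'" "\<And>x. x \<in> carrier V \<Longrightarrow> h x = g x"
  shows "h = g"
proof
  fix x show "h x = g x"
    using assms(3) linear_maps_undefined[OF assms(1)] linear_maps_undefined[OF assms(2)]
    by (cases "x \<in> carrier V") auto
qed

text \<open>Extensional linear maps are obtained from maps that are linear on the carrier.\<close>

lemma restrict_linear_maps:
  assumes "module K V"
    and "\<And>x. x \<in> carrier V \<Longrightarrow> h x \<in> carrier W"
    and "\<And>x y. x \<in> carrier V \<Longrightarrow> y \<in> carrier V \<Longrightarrow> h (x \<oplus>\<^bsub>V\<^esub> y) = h x \<oplus>\<^bsub>W\<^esub> h y"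
    and "\<And>c x. c \<in> carrier K \<Longrightarrow> x \<in> carrier V \<Longrightarrow> h (c \<odot>\<^bsub>V\<^esub> x) = c \<odot>\<^bsub>W\<^esub> h x"
  shows "restrict h (carrier V) \<in> linear_maps K V W"
proof -
  interpret module K V by fact
  show ?thesis using assms by (intro linear_mapsI) auto
qed

lemma linear_maps_zero:
  assumes "module K V" "module K W" "h \<in> linear_maps K V W"
  shows "h \<zero>\<^bsub>V\<^esub> = \<zero>\<^bsub>W\<^esub>"
proof -
  interpret V: module K V by fact
  interpret W: module K W by fact
  have "h \<zero>\<^bsub>V\<^esub> = h (\<zero>\<^bsub>K\<^esub> \<odot>\<^bsub>V\<^esub> \<zero>\<^bsub>V\<^esub>)" by simp
  also have "\<dots> = \<zero>\<^bsub>K\<^esub> \<odot>\<^bsub>W\<^esub> h \<zero>\<^bsub>V\<^esub>" using assms by (intro linear_maps_smult) auto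
  also have "\<dots> = \<zero>\<^bsub>W\<^esub>" using linear_maps_closed[OF assms(3)] by simp
  finally show ?thesis .
qed

lemma linear_maps_minus:
  assumes "module K V" "module K W" "h \<in> linear_maps K V W" "x \<in> carrier V" "y \<in> carrier V"
  shows "h (x \<ominus>\<^bsub>V\<^esub> y) = h x \<ominus>\<^bsub>W\<^esub> h y"
proof -
  interpret V: module K V by fact
  interpret W: module K W by fact
  note c = linear_maps_closed[OF assms(3)]
  have "h (x \<ominus>\<^bsub>V\<^esub> y) = h (x \<oplus>\<^bsub>V\<^esub> (\<ominus>\<^bsub>K\<^esub> \<one>\<^bsub>K\<^esub>) \<odot>\<^bsub>V\<^esub> y)"
    using assms by (simp add: V.smult_l_minus a_minus_def)
  also have "\<dots> = h x \<oplus>\<^bsub>W\<^esub> (\<ominus>\<^bsub>K\<^esub> \<one>\<^bsub>K\<^esub>) \<odot>\<^bsub>W\<^esub> h y"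
    using assms by (simp add: linear_maps_add[OF assms(3)] linear_maps_smult[OF assms(3)])
  also have "\<dots> = h x \<ominus>\<^bsub>W\<^esub> h y" using assms c by (simp add: W.smult_l_minus a_minus_def)
  finally show ?thesis .
qed

lemma linear_maps_finsum:
  assumes "module K V" "module K W" "h \<in> linear_maps K V W" "finite S" "f \<in> S \<rightarrow> carrier V"
  shows "h (\<Oplus>\<^bsub>V\<^esub>s\<in>S. f s) = (\<Oplus>\<^bsub>W\<^esub>s\<in>S. h (f s))"
proof -
  interpret V: module K V by fact
  interpret W: module K W by fact
  note c = linear_maps_closed[OF assms(3)]
  show ?thesis using assms(4,5)
  proof (induction S)
    case empty
    then show ?case using linear_maps_zero[OF assms(1-3)] by simp
  next
    case (insert s S)
    have "(\<Oplus>\<^bsub>V\<^esub>s\<in>S. f s) \<in> carrier V" using insert by (intro V.finsum_closed) auto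
    then show ?case using insert c
      by (subst V.finsum_insert, simp, simp, force, simp, subst W.finsum_insert, simp, simp, force, force)
        (simp add: linear_maps_add[OF assms(3)] Pi_def)
  qed
qed

lemma linear_maps_comp:
  assumes "h \<in> linear_maps K U V" "g \<in> linear_maps K V W" "module K U"
  shows "(\<lambda>x\<in>carrier U. g (h x)) \<in> linear_maps K U W"
  using linear_maps_closed[OF assms(1)] linear_maps_add[OF assms(1)] linear_maps_smult[OF assms(1)]
    linear_maps_closed[OF assms(2)] linear_maps_add[OF assms(2)] linear_maps_smult[OF assms(2)]
  by (intro restrict_linear_maps assms(3)) auto

text \<open>Dual spaces, hom spaces and powers consist of families of vectors, with pointwise operations: the
  maps \<open>ev i\<close> are the evaluations.  The axioms are inherited from the target \<open>W\<close> of the evaluations,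
  the negative of \<open>x\<close> being \<open>(-1) x\<close>.\<close>

lemma module_pointwise:
  fixes V :: "('k, 'v) module" and W :: "'i \<Rightarrow> ('k, 'w) module"
  assumes W: "\<And>i. i \<in> I \<Longrightarrow> module K (W i)" and K: "cring K"
    and zero: "\<zero>\<^bsub>V\<^esub> \<in> carrier V"
    and add: "\<And>x y. x \<in> carrier V \<Longrightarrow> y \<in> carrier V \<Longrightarrow> x \<oplus>\<^bsub>V\<^esub> y \<in> carrier V"
    and smult: "\<And>c x. c \<in> carrier K \<Longrightarrow> x \<in> carrier V \<Longrightarrow> c \<odot>\<^bsub>V\<^esub> x \<in> carrier V"
    and ev: "\<And>i x. i \<in> I \<Longrightarrow> x \<in> carrier V \<Longrightarrow> ev i x \<in> carrier (W i)"
    and ev_zero: "\<And>i. i \<in> I \<Longrightarrow> ev i \<zero>\<^bsub>V\<^esub> = \<zero>\<^bsub>W i\<^esub>"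
    and ev_add: "\<And>i x y. i \<in> I \<Longrightarrow> x \<in> carrier V \<Longrightarrow> y \<in> carrier V \<Longrightarrow>
      ev i (x \<oplus>\<^bsub>V\<^esub> y) = ev i x \<oplus>\<^bsub>W i\<^esub> ev i y"
    and ev_smult: "\<And>i c x. i \<in> I \<Longrightarrow> c \<in> carrier K \<Longrightarrow> x \<in> carrier V \<Longrightarrow>
      ev i (c \<odot>\<^bsub>V\<^esub> x) = c \<odot>\<^bsub>W i\<^esub> ev i x"
    and inj: "\<And>x y. x \<in> carrier V \<Longrightarrow> y \<in> carrier V \<Longrightarrow> (\<And>i. i \<in> I \<Longrightarrow> ev i x = ev i y) \<Longrightarrow> x = y"
  shows "module K V"
proof -
  interpret K: cring K by fact
  have g: "abelian_group (W i)" "abelian_monoid (W i)" if "i \<in> I" for i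
    using W[OF that] by (simp_all add: module_def abelian_group_def)
  note [simp] = zero add smult ev ev_zero ev_add ev_smult
  note laws = abelian_monoid.a_assoc[OF g(2)] abelian_monoid.a_comm[OF g(2)] abelian_group.l_neg[OF g(1)]
    abelian_monoid.l_zero[OF g(2)] module.smult_l_minus[OF W] module.smult_one[OF W]
    module.smult_l_distr[OF W] module.smult_r_distr[OF W] module.smult_assoc1[OF W]
  have "abelian_group V"
  proof (rule abelian_groupI)
    fix x assume x: "x \<in> carrier V"
    have "(\<ominus>\<^bsub>K\<^esub> \<one>\<^bsub>K\<^esub>) \<odot>\<^bsub>V\<^esub> x \<oplus>\<^bsub>V\<^esub> x = \<zero>\<^bsub>V\<^esub>" by (rule inj) (use x in \<open>simp_all add: laws\<close>)
    then show "\<exists>y\<in>carrier V. y \<oplus>\<^bsub>V\<^esub> x = \<zero>\<^bsub>V\<^esub>"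
      using x by (intro bexI[of _ "(\<ominus>\<^bsub>K\<^esub> \<one>\<^bsub>K\<^esub>) \<odot>\<^bsub>V\<^esub> x"]) auto
    show "\<zero>\<^bsub>V\<^esub> \<oplus>\<^bsub>V\<^esub> x = x" by (rule inj) (use x in \<open>simp_all add: laws\<close>)
    fix y assume y: "y \<in> carrier V"
    show "x \<oplus>\<^bsub>V\<^esub> y = y \<oplus>\<^bsub>V\<^esub> x" by (rule inj) (use x y in \<open>simp_all add: laws(2)\<close>)
    fix z assume z: "z \<in> carrier V"
    show "x \<oplus>\<^bsub>V\<^esub> y \<oplus>\<^bsub>V\<^esub> z = x \<oplus>\<^bsub>V\<^esub> (y \<oplus>\<^bsub>V\<^esub> z)" by (rule inj) (use x y z in \<open>simp_all add: laws(1)\<close>)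
  qed auto
  then show ?thesis
  proof (rule moduleI[OF K])
    fix a b x assume h: "a \<in> carrier K" "b \<in> carrier K" "x \<in> carrier V"
    show "(a \<oplus>\<^bsub>K\<^esub> b) \<odot>\<^bsub>V\<^esub> x = a \<odot>\<^bsub>V\<^esub> x \<oplus>\<^bsub>V\<^esub> b \<odot>\<^bsub>V\<^esub> x"
      "(a \<otimes>\<^bsub>K\<^esub> b) \<odot>\<^bsub>V\<^esub> x = a \<odot>\<^bsub>V\<^esub> (b \<odot>\<^bsub>V\<^esub> x)"
      by (rule inj; use h in \<open>simp add: laws(5-)\<close>)+
  next
    fix a x y assume h: "a \<in> carrier K" "x \<in> carrier V" "y \<in> carrier V"
    show "a \<odot>\<^bsub>V\<^esub> (x \<oplus>\<^bsub>V\<^esub> y) = a \<odot>\<^bsub>V\<^esub> x \<oplus>\<^bsub>V\<^esub> a \<odot>\<^bsub>V\<^esub> y" by (rule inj) (use h in \<open>simp_all add: laws(5-)\<close>)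
  next
    fix x assume h: "x \<in> carrier V"
    show "\<one>\<^bsub>K\<^esub> \<odot>\<^bsub>V\<^esub> x = x" by (rule inj) (use h in \<open>simp_all add: laws(5-)\<close>)
  qed auto
qed

lemma scalars_simps [simp]:
  "carrier (scalars K) = carrier K" "zero (scalars K) = \<zero>\<^bsub>K\<^esub>" "add (scalars K) = add K"
  "smult (scalars K) = mult K"
  by (simp_all add: scalars_def)

lemma module_scalars:
  assumes "cring K" shows "module K (scalars K)"
proof -
  interpret cring K by fact
  have "abelian_group (scalars K)"
    by (rule abelian_groupI) (auto simp: a_assoc intro: a_comm)
  then show ?thesis
    by (rule moduleI[OF assms]) (auto simp: l_distr r_distr m_assoc)
qed

lemma carrier_dual [simp]: "carrier (dual K V) = linear_maps K V (scalars K)"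
  by (simp add: dual_def)

lemma module_dual:
  assumes "module K V" shows "module K (dual K V)"
proof -
  interpret module K V by fact
  have S: "module K (scalars K)" by (rule module_scalars) (use assms in \<open>simp add: module_def\<close>)
  show ?thesis
  proof (rule module_pointwise[where I = "carrier V" and W = "\<lambda>_. scalars K" and ev = "\<lambda>v \<xi>. \<xi> v"])
    show "cring K" using assms by (simp add: module_def)
    show "\<zero>\<^bsub>dual K V\<^esub> \<in> carrier (dual K V)"
      by (auto simp: dual_def intro!: linear_mapsI)
    fix x y assume x: "x \<in> carrier (dual K V)"
    then have x': "x \<in> linear_maps K V (scalars K)" by simp
    note X = linear_maps_closed[OF x', simplified] linear_maps_add[OF x', simplified]
      linear_maps_smult[OF x', simplified]
    show "c \<odot>\<^bsub>dual K V\<^esub> x \<in> carrier (dual K V)" if "c \<in> carrier K" for c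
      using that X by (auto simp: dual_def R.r_distr R.m_lcomm intro!: linear_mapsI)
    assume y: "y \<in> carrier (dual K V)"
    then have y': "y \<in> linear_maps K V (scalars K)" by simp
    note Y = linear_maps_closed[OF y', simplified] linear_maps_add[OF y', simplified]
      linear_maps_smult[OF y', simplified]
    show "x \<oplus>\<^bsub>dual K V\<^esub> y \<in> carrier (dual K V)"
      using X Y by (auto simp: dual_def R.r_distr R.a_ac intro!: linear_mapsI)
    show "x = y" if "\<And>v. v \<in> carrier V \<Longrightarrow> x v = y v"
      using linear_maps_eqI[OF x' y' that] .
  qed (use S in \<open>auto simp: dual_def dest: linear_maps_closed\<close>)
qed

lemma fd_space_module: "fd_space K V \<Longrightarrow> module K V"
  by (simp add: fd_space_def)

lemma (in abelian_group) minus_eq_zero_iff: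
  assumes "x \<in> carrier G" "y \<in> carrier G"
  shows "x \<ominus> y = \<zero> \<longleftrightarrow> x = y"
proof
  assume "x \<ominus> y = \<zero>"
  then have "\<ominus> (\<ominus> y) = x" using assms by (intro minus_equality) (auto simp: a_minus_def)
  then show "x = y" using assms by simp
qed (use assms in \<open>simp add: a_minus_def r_neg\<close>)

definition spans :: "'k ring \<Rightarrow> ('k, 'v) module \<Rightarrow> 'v set \<Rightarrow> bool" where
  "spans K V S \<longleftrightarrow> finite S \<and> S \<subseteq> carrier V \<and>
     (\<forall>v\<in>carrier V. \<exists>c\<in>S \<rightarrow> carrier K. v = (\<Oplus>\<^bsub>V\<^esub>s\<in>S. c s \<odot>\<^bsub>V\<^esub> s))"

lemma fd_space_spans: "fd_space K V \<longleftrightarrow> module K V \<and> (\<exists>S. spans K V S)"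
  by (simp add: fd_space_def spans_def)

text \<open>A spanning set of least size is independent: an element with a nonzero coefficient in a vanishing
  combination is a combination of the others and could be left out.\<close>

lemma fd_space_basis:
  assumes "field K" "fd_space K V"
  obtains S where "spans K V S"
    and "\<And>c d s. c \<in> S \<rightarrow> carrier K \<Longrightarrow> d \<in> S \<rightarrow> carrier K \<Longrightarrow>
      (\<Oplus>\<^bsub>V\<^esub>s\<in>S. c s \<odot>\<^bsub>V\<^esub> s) = (\<Oplus>\<^bsub>V\<^esub>s\<in>S. d s \<odot>\<^bsub>V\<^esub> s) \<Longrightarrow> s \<in> S \<Longrightarrow> c s = d s"
proof -
  interpret K: field K by fact
  interpret V: module K V using assms by (simp add: fd_space_def)
  obtain S where S: "spans K V S" and least: "\<And>S'. spans K V S' \<Longrightarrow> card S \<le> card S'"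
    using assms(2) ex_has_least_nat[of "spans K V" _ card] unfolding fd_space_spans by blast
  from S have fin: "finite S" and sub: "S \<subseteq> carrier V" by (auto simp: spans_def)
  have indep: "a s0 = \<zero>\<^bsub>K\<^esub>"
    if a: "a \<in> S \<rightarrow> carrier K" and z: "(\<Oplus>\<^bsub>V\<^esub>s\<in>S. a s \<odot>\<^bsub>V\<^esub> s) = \<zero>\<^bsub>V\<^esub>" and s0: "s0 \<in> S" for a s0
  proof (rule ccontr)
    assume ne: "a s0 \<noteq> \<zero>\<^bsub>K\<^esub>"
    define S' where "S' = S - {s0}"
    have S': "finite S'" "s0 \<notin> S'" "S = insert s0 S'" "S' \<subseteq> carrier V"
      using fin s0 sub by (auto simp: S'_def)
    have split: "(\<Oplus>\<^bsub>V\<^esub>s\<in>S. a s \<odot>\<^bsub>V\<^esub> s) = a s0 \<odot>\<^bsub>V\<^esub> s0 \<oplus>\<^bsub>V\<^esub> (\<Oplus>\<^bsub>V\<^esub>s\<in>S'. a s \<odot>\<^bsub>V\<^esub> s)"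
      if "a \<in> S \<rightarrow> carrier K" for a
      unfolding S'(3) using that S' sub s0 by (intro V.finsum_insert) (auto simp: Pi_def)
    have s0c: "s0 \<in> carrier V" "a s0 \<in> carrier K" using s0 sub a by auto
    have inv: "inv\<^bsub>K\<^esub> (a s0) \<in> carrier K" "inv\<^bsub>K\<^esub> (a s0) \<otimes>\<^bsub>K\<^esub> a s0 = \<one>\<^bsub>K\<^esub>"
      using ne s0c K.field_Units by (auto intro: K.Units_inv_closed K.Units_l_inv)
    define n where "n = \<ominus>\<^bsub>K\<^esub> (inv\<^bsub>K\<^esub> (a s0))"
    have n: "n \<in> carrier K" "n \<otimes>\<^bsub>K\<^esub> a s0 = \<ominus>\<^bsub>K\<^esub> \<one>\<^bsub>K\<^esub>" using inv s0c by (simp_all add: n_def K.l_minus)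
    define b where "b s = n \<otimes>\<^bsub>K\<^esub> a s" for s
    have a': "a \<in> S' \<rightarrow> carrier K" using a S' by auto
    then have b: "b \<in> S' \<rightarrow> carrier K" using n by (auto simp: b_def Pi_def)
    let ?a = "\<Oplus>\<^bsub>V\<^esub>s\<in>S'. a s \<odot>\<^bsub>V\<^esub> s"
    have cl: "?a \<in> carrier V" using a' S' by (intro V.finsum_closed) auto
    have "n \<odot>\<^bsub>V\<^esub> (a s0 \<odot>\<^bsub>V\<^esub> s0 \<oplus>\<^bsub>V\<^esub> ?a) = \<zero>\<^bsub>V\<^esub>" using z split[OF a] n by simp
    then have "n \<odot>\<^bsub>V\<^esub> ?a \<ominus>\<^bsub>V\<^esub> s0 = \<zero>\<^bsub>V\<^esub>"
      using s0c n cl by (simp add: V.smult_r_distr V.smult_assoc1[symmetric] V.smult_l_minus a_minus_def V.M.a_comm)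
    then have "s0 = n \<odot>\<^bsub>V\<^esub> ?a" using s0c n cl by (simp add: V.M.minus_eq_zero_iff)
    also have "\<dots> = (\<Oplus>\<^bsub>V\<^esub>s\<in>S'. n \<odot>\<^bsub>V\<^esub> (a s \<odot>\<^bsub>V\<^esub> s))"
      using S' a' n by (intro V.finsum_smult_ldistr) auto
    also have "\<dots> = (\<Oplus>\<^bsub>V\<^esub>s\<in>S'. b s \<odot>\<^bsub>V\<^esub> s)"
      using S' a' n by (intro V.finsum_cong') (auto simp: b_def V.smult_assoc1 Pi_def subset_iff)
    finally have s0b: "s0 = (\<Oplus>\<^bsub>V\<^esub>s\<in>S'. b s \<odot>\<^bsub>V\<^esub> s)" .
    have "spans K V S'"
      unfolding spans_def
    proof (intro conjI ballI)
      fix v assume "v \<in> carrier V"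
      then obtain a where a: "a \<in> S \<rightarrow> carrier K" and v: "v = (\<Oplus>\<^bsub>V\<^esub>s\<in>S. a s \<odot>\<^bsub>V\<^esub> s)"
        using S by (auto simp: spans_def)
      have a0: "a s0 \<in> carrier K" "a \<in> S' \<rightarrow> carrier K" using a s0 S' by auto
      have "v = a s0 \<odot>\<^bsub>V\<^esub> (\<Oplus>\<^bsub>V\<^esub>s\<in>S'. b s \<odot>\<^bsub>V\<^esub> s) \<oplus>\<^bsub>V\<^esub> (\<Oplus>\<^bsub>V\<^esub>s\<in>S'. a s \<odot>\<^bsub>V\<^esub> s)"
        unfolding s0b[symmetric] v by (rule split[OF a])
      also have "a s0 \<odot>\<^bsub>V\<^esub> (\<Oplus>\<^bsub>V\<^esub>s\<in>S'. b s \<odot>\<^bsub>V\<^esub> s) = (\<Oplus>\<^bsub>V\<^esub>s\<in>S'. a s0 \<odot>\<^bsub>V\<^esub> (b s \<odot>\<^bsub>V\<^esub> s))"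
        using S' a0 b by (intro V.finsum_smult_ldistr) (auto simp: Pi_def subset_iff)
      also have "(\<Oplus>\<^bsub>V\<^esub>s\<in>S'. a s0 \<odot>\<^bsub>V\<^esub> (b s \<odot>\<^bsub>V\<^esub> s)) \<oplus>\<^bsub>V\<^esub> (\<Oplus>\<^bsub>V\<^esub>s\<in>S'. a s \<odot>\<^bsub>V\<^esub> s) =
          (\<Oplus>\<^bsub>V\<^esub>s\<in>S'. a s0 \<odot>\<^bsub>V\<^esub> (b s \<odot>\<^bsub>V\<^esub> s) \<oplus>\<^bsub>V\<^esub> a s \<odot>\<^bsub>V\<^esub> s)"
        using S' a0 b by (subst V.finsum_addf) (auto simp: Pi_def subset_iff)
      also have "\<dots> = (\<Oplus>\<^bsub>V\<^esub>s\<in>S'. (a s0 \<otimes>\<^bsub>K\<^esub> b s \<oplus>\<^bsub>K\<^esub> a s) \<odot>\<^bsub>V\<^esub> s)"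
        using S' a0 b
        by (intro V.finsum_cong') (auto simp: V.smult_l_distr V.smult_assoc1 Pi_def subset_iff)
      finally show "\<exists>c\<in>S' \<rightarrow> carrier K. v = (\<Oplus>\<^bsub>V\<^esub>s\<in>S'. c s \<odot>\<^bsub>V\<^esub> s)"
        using a0 b by (intro bexI[of _ "\<lambda>s. a s0 \<otimes>\<^bsub>K\<^esub> b s \<oplus>\<^bsub>K\<^esub> a s"]) auto
    qed (use S' in auto)
    then have "card S \<le> card S'" by (rule least)
    then show False using S' by simp
  qed
  have "c s = d s" if c: "c \<in> S \<rightarrow> carrier K" and d: "d \<in> S \<rightarrow> carrier K"
    and eq: "(\<Oplus>\<^bsub>V\<^esub>s\<in>S. c s \<odot>\<^bsub>V\<^esub> s) = (\<Oplus>\<^bsub>V\<^esub>s\<in>S. d s \<odot>\<^bsub>V\<^esub> s)" and s: "s \<in> S" for c d s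
  proof -
    have cl: "(\<lambda>s. c s \<odot>\<^bsub>V\<^esub> s) \<in> S \<rightarrow> carrier V" "(\<lambda>s. d s \<odot>\<^bsub>V\<^esub> s) \<in> S \<rightarrow> carrier V"
      using c d sub by (auto simp: Pi_def subset_iff)
    let ?m = "\<ominus>\<^bsub>K\<^esub> \<one>\<^bsub>K\<^esub>"
    have "(\<Oplus>\<^bsub>V\<^esub>s\<in>S. (c s \<oplus>\<^bsub>K\<^esub> ?m \<otimes>\<^bsub>K\<^esub> d s) \<odot>\<^bsub>V\<^esub> s) = (\<Oplus>\<^bsub>V\<^esub>s\<in>S. c s \<odot>\<^bsub>V\<^esub> s \<oplus>\<^bsub>V\<^esub> ?m \<odot>\<^bsub>V\<^esub> (d s \<odot>\<^bsub>V\<^esub> s))"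
      using c d sub by (intro V.finsum_cong') (auto simp: V.smult_l_distr V.smult_assoc1 Pi_def subset_iff)
    also have "\<dots> = (\<Oplus>\<^bsub>V\<^esub>s\<in>S. c s \<odot>\<^bsub>V\<^esub> s) \<oplus>\<^bsub>V\<^esub> ?m \<odot>\<^bsub>V\<^esub> (\<Oplus>\<^bsub>V\<^esub>s\<in>S. d s \<odot>\<^bsub>V\<^esub> s)"
      using cl fin by (subst V.finsum_smult_ldistr, simp, simp, simp, subst V.finsum_addf) (auto simp: Pi_def)
    also have "\<dots> = \<zero>\<^bsub>V\<^esub>"
      unfolding eq using V.finsum_closed[OF cl(2)] by (simp add: V.smult_l_minus V.M.r_neg)
    finally have "c s \<oplus>\<^bsub>K\<^esub> ?m \<otimes>\<^bsub>K\<^esub> d s = \<zero>\<^bsub>K\<^esub>"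
      by (rule indep[rotated]) (use c d s in auto)
    then have "c s \<ominus>\<^bsub>K\<^esub> d s = \<zero>\<^bsub>K\<^esub>" using c d s by (auto simp: K.l_minus a_minus_def Pi_def)
    moreover have "c s \<in> carrier K" "d s \<in> carrier K" using c d s by auto
    ultimately show ?thesis by (simp add: K.minus_eq_zero_iff)
  qed
  then show thesis using that S by blast
qed

text \<open>The coefficients with respect to a basis are linear in the vector, as they are unique.\<close>

lemma fd_space_coordinates:
  assumes "field K" "fd_space K V"
  obtains S \<phi> where "spans K V S" "\<And>s. s \<in> S \<Longrightarrow> \<phi> s \<in> linear_maps K V (scalars K)"
    "\<And>v. v \<in> carrier V \<Longrightarrow> v = (\<Oplus>\<^bsub>V\<^esub>s\<in>S. \<phi> s v \<odot>\<^bsub>V\<^esub> s)"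
    "\<And>s t. s \<in> S \<Longrightarrow> t \<in> S \<Longrightarrow> \<phi> s t = (if t = s then \<one>\<^bsub>K\<^esub> else \<zero>\<^bsub>K\<^esub>)"
proof -
  interpret K: field K by fact
  interpret V: module K V using assms by (simp add: fd_space_def)
  obtain S where S: "spans K V S"
    and uniq: "\<And>c d s. c \<in> S \<rightarrow> carrier K \<Longrightarrow> d \<in> S \<rightarrow> carrier K \<Longrightarrow>
      (\<Oplus>\<^bsub>V\<^esub>s\<in>S. c s \<odot>\<^bsub>V\<^esub> s) = (\<Oplus>\<^bsub>V\<^esub>s\<in>S. d s \<odot>\<^bsub>V\<^esub> s) \<Longrightarrow> s \<in> S \<Longrightarrow> c s = d s"
    using fd_space_basis[OF assms] by blast
  have "\<forall>v\<in>carrier V. \<exists>c. c \<in> S \<rightarrow> carrier K \<and> v = (\<Oplus>\<^bsub>V\<^esub>s\<in>S. c s \<odot>\<^bsub>V\<^esub> s)"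
    using S unfolding spans_def by blast
  from bchoice[OF this] obtain c where c: "\<And>v. v \<in> carrier V \<Longrightarrow> c v \<in> S \<rightarrow> carrier K"
    "\<And>v. v \<in> carrier V \<Longrightarrow> v = (\<Oplus>\<^bsub>V\<^esub>s\<in>S. c v s \<odot>\<^bsub>V\<^esub> s)" by blast
  have fin: "finite S" and sub: "\<And>s. s \<in> S \<Longrightarrow> s \<in> carrier V" using S by (auto simp: spans_def)
  have cc: "c v s \<in> carrier K" if "v \<in> carrier V" "s \<in> S" for v s using c(1) that by auto
  have add: "c (v \<oplus>\<^bsub>V\<^esub> w) s = c v s \<oplus>\<^bsub>K\<^esub> c w s" if "v \<in> carrier V" "w \<in> carrier V" "s \<in> S" for v w s
  proof (rule uniq)
    have "(\<Oplus>\<^bsub>V\<^esub>s\<in>S. c (v \<oplus>\<^bsub>V\<^esub> w) s \<odot>\<^bsub>V\<^esub> s) = v \<oplus>\<^bsub>V\<^esub> w" using c(2)[symmetric] that by simp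
    also have "\<dots> = (\<Oplus>\<^bsub>V\<^esub>s\<in>S. c v s \<odot>\<^bsub>V\<^esub> s) \<oplus>\<^bsub>V\<^esub> (\<Oplus>\<^bsub>V\<^esub>s\<in>S. c w s \<odot>\<^bsub>V\<^esub> s)"
      using c(2)[OF that(1)] c(2)[OF that(2)] by metis
    also have "\<dots> = (\<Oplus>\<^bsub>V\<^esub>s\<in>S. c v s \<odot>\<^bsub>V\<^esub> s \<oplus>\<^bsub>V\<^esub> c w s \<odot>\<^bsub>V\<^esub> s)"
      using that fin sub cc by (subst V.finsum_addf) auto
    also have "\<dots> = (\<Oplus>\<^bsub>V\<^esub>s\<in>S. (c v s \<oplus>\<^bsub>K\<^esub> c w s) \<odot>\<^bsub>V\<^esub> s)"
      using that fin sub cc by (intro V.finsum_cong') (auto simp: V.smult_l_distr)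
    finally show "(\<Oplus>\<^bsub>V\<^esub>s\<in>S. c (v \<oplus>\<^bsub>V\<^esub> w) s \<odot>\<^bsub>V\<^esub> s) = (\<Oplus>\<^bsub>V\<^esub>s\<in>S. (c v s \<oplus>\<^bsub>K\<^esub> c w s) \<odot>\<^bsub>V\<^esub> s)" .
  qed (use that c in auto)
  have smult: "c (a \<odot>\<^bsub>V\<^esub> v) s = a \<otimes>\<^bsub>K\<^esub> c v s" if "v \<in> carrier V" "a \<in> carrier K" "s \<in> S" for v a s
  proof (rule uniq)
    have "(\<Oplus>\<^bsub>V\<^esub>s\<in>S. c (a \<odot>\<^bsub>V\<^esub> v) s \<odot>\<^bsub>V\<^esub> s) = a \<odot>\<^bsub>V\<^esub> v" using c(2)[symmetric] that by simp
    also have "\<dots> = a \<odot>\<^bsub>V\<^esub> (\<Oplus>\<^bsub>V\<^esub>s\<in>S. c v s \<odot>\<^bsub>V\<^esub> s)"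
      using c(2)[OF that(1)] by metis
    also have "\<dots> = (\<Oplus>\<^bsub>V\<^esub>s\<in>S. a \<odot>\<^bsub>V\<^esub> (c v s \<odot>\<^bsub>V\<^esub> s))"
      using that fin sub cc by (intro V.finsum_smult_ldistr) auto
    also have "\<dots> = (\<Oplus>\<^bsub>V\<^esub>s\<in>S. (a \<otimes>\<^bsub>K\<^esub> c v s) \<odot>\<^bsub>V\<^esub> s)"
      using that fin sub cc by (intro V.finsum_cong') (auto simp: V.smult_assoc1)
    finally show "(\<Oplus>\<^bsub>V\<^esub>s\<in>S. c (a \<odot>\<^bsub>V\<^esub> v) s \<odot>\<^bsub>V\<^esub> s) = (\<Oplus>\<^bsub>V\<^esub>s\<in>S. (a \<otimes>\<^bsub>K\<^esub> c v s) \<odot>\<^bsub>V\<^esub> s)" .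
  qed (use that c in auto)
  have "restrict (\<lambda>v. c v s) (carrier V) \<in> linear_maps K V (scalars K)" if "s \<in> S" for s
    by (rule restrict_linear_maps) (use that cc add smult V.module_axioms in auto)
  moreover have "v = (\<Oplus>\<^bsub>V\<^esub>s\<in>S. restrict (\<lambda>v. c v s) (carrier V) v \<odot>\<^bsub>V\<^esub> s)"
    if "v \<in> carrier V" for v
    unfolding restrict_apply' [OF that] by (rule c(2)[OF that])
  moreover have "restrict (\<lambda>v. c v s) (carrier V) t = (if t = s then \<one>\<^bsub>K\<^esub> else \<zero>\<^bsub>K\<^esub>)"
    if st: "s \<in> S" "t \<in> S" for s t
  proof -
    have "c t s = (if t = s then \<one>\<^bsub>K\<^esub> else \<zero>\<^bsub>K\<^esub>)"
    proof (rule uniq)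
      have "(\<Oplus>\<^bsub>V\<^esub>s\<in>S. c t s \<odot>\<^bsub>V\<^esub> s) = t" using c(2)[OF sub[OF st(2)]] by simp
      also have "\<dots> = (\<Oplus>\<^bsub>V\<^esub>s\<in>S. if t = s then s else \<zero>\<^bsub>V\<^esub>)"
        using st fin sub by (subst V.finsum_singleton) auto
      also have "\<dots> = (\<Oplus>\<^bsub>V\<^esub>s\<in>S. (if t = s then \<one>\<^bsub>K\<^esub> else \<zero>\<^bsub>K\<^esub>) \<odot>\<^bsub>V\<^esub> s)"
        using sub by (intro V.finsum_cong') auto
      finally show "(\<Oplus>\<^bsub>V\<^esub>s\<in>S. c t s \<odot>\<^bsub>V\<^esub> s) = (\<Oplus>\<^bsub>V\<^esub>s\<in>S. (if t = s then \<one>\<^bsub>K\<^esub> else \<zero>\<^bsub>K\<^esub>) \<odot>\<^bsub>V\<^esub> s)" .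
    qed (use st c(1)[OF sub[OF st(2)]] in auto)
    then show ?thesis using sub[OF st(2)] by simp
  qed
  ultimately show thesis using that[of S "\<lambda>s. restrict (\<lambda>v. c v s) (carrier V)"] S by blast
qed

lemma a_inv_scalars: "\<ominus>\<^bsub>scalars K\<^esub> x = \<ominus>\<^bsub>K\<^esub> x"
  by (simp add: a_inv_def m_inv_def)

text \<open>A space with finitely many jointly injective functionals is finite-dimensional, by induction on
  their number: either a functional vanishes, or \<open>v\<^sub>0\<close> with value \<open>1\<close> is added to a spanning set of
  its kernel.  In this form it yields at once that subspaces, hom spaces and duals are
  finite-dimensional.\<close>

lemma fd_spaceI:
  fixes V :: "('k, 'v) module" and I :: "'i set"
  assumes "field K" "module K V" "finite I"
    and "\<And>i. i \<in> I \<Longrightarrow> \<phi> i \<in> linear_maps K V (scalars K)"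
    and "\<And>v. v \<in> carrier V \<Longrightarrow> (\<And>i. i \<in> I \<Longrightarrow> \<phi> i v = \<zero>\<^bsub>K\<^esub>) \<Longrightarrow> v = \<zero>\<^bsub>V\<^esub>"
  shows "fd_space K V"
  using assms(3,2,4,5)
proof (induction I arbitrary: V \<phi> rule: finite_induct)
  case empty
  interpret V: module K V by fact
  have "carrier V = {\<zero>\<^bsub>V\<^esub>}" using empty by auto
  then have "spans K V {}" by (auto simp: spans_def)
  then show ?case using empty by (auto simp: fd_space_spans)
next
  case (insert i I)
  interpret K: field K by fact
  interpret V: module K V by fact
  have S: "module K (scalars K)" by (rule module_scalars) (rule K.is_cring)
  note lin = insert.prems(2)[of i, simplified]
  note \<phi>i = linear_maps_closed[OF lin, simplified] linear_maps_add[OF lin, simplified]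
    linear_maps_smult[OF lin, simplified] linear_maps_zero[OF V.module_axioms S lin, simplified]
    linear_maps_minus[OF V.module_axioms S lin]
  define V0 where "V0 = V\<lparr>carrier := {v \<in> carrier V. \<phi> i v = \<zero>\<^bsub>K\<^esub>}\<rparr>"
  have V0c: "carrier V0 = {v \<in> carrier V. \<phi> i v = \<zero>\<^bsub>K\<^esub>}"
    and V0s[simp]: "add V0 = add V" "zero V0 = zero V" "smult V0 = smult V"
    by (auto simp: V0_def)
  have V0: "module K V0"
    by (rule module_pointwise[where I = UNIV and W = "\<lambda>_::unit. V" and ev = "\<lambda>_ v. v"])
      (use \<phi>i V.module_axioms K.is_cring in \<open>auto simp: V0c\<close>)
  interpret V0: module K V0 by fact
  have "fd_space K V0"
  proof (rule insert.IH[OF V0, where \<phi> = "\<lambda>j. restrict (\<phi> j) (carrier V0)"])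
    fix j assume j: "j \<in> I"
    have l: "\<phi> j \<in> linear_maps K V (scalars K)" using insert j by auto
    show "restrict (\<phi> j) (carrier V0) \<in> linear_maps K V0 (scalars K)"
      using linear_maps_closed[OF l] linear_maps_add[OF l] linear_maps_smult[OF l]
      by (intro restrict_linear_maps V0) (auto simp: V0c)
  next
    fix v assume "v \<in> carrier V0" "\<And>j. j \<in> I \<Longrightarrow> restrict (\<phi> j) (carrier V0) v = \<zero>\<^bsub>K\<^esub>"
    then have "v = \<zero>\<^bsub>V\<^esub>" using insert.prems(3)[of v] by (auto simp: V0c)
    then show "v = \<zero>\<^bsub>V0\<^esub>" by simp
  qed
  then obtain S0 where S0: "spans K V0 S0" by (auto simp: fd_space_spans)
  then have fin: "finite S0" and sub0: "S0 \<subseteq> carrier V0" by (auto simp: spans_def)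
  then have sub: "S0 \<subseteq> carrier V" by (auto simp: V0c)
  have sums: "(\<Oplus>\<^bsub>V0\<^esub>s\<in>S. f s) = (\<Oplus>\<^bsub>V\<^esub>s\<in>S. f s)" if "finite S" "f \<in> S \<rightarrow> carrier V0" for f S
    using that
  proof (induction S rule: finite_induct)
    case (insert s S)
    then have "f s \<in> carrier V0" "f \<in> S \<rightarrow> carrier V0" by auto
    then show ?case using insert by (simp add: V0c Pi_def)
  qed simp
  have comb: "(\<Oplus>\<^bsub>V0\<^esub>s\<in>S0. c s \<odot>\<^bsub>V0\<^esub> s) = (\<Oplus>\<^bsub>V\<^esub>s\<in>S0. c s \<odot>\<^bsub>V\<^esub> s)" if "c \<in> S0 \<rightarrow> carrier K" for c
  proof -
    have "(\<lambda>s. c s \<odot>\<^bsub>V\<^esub> s) \<in> S0 \<rightarrow> carrier V0" using that sub0 V0.smult_closed by (auto simp: Pi_def subset_iff)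
    then show ?thesis using sums[OF fin] by simp
  qed
  have kern: "\<exists>c\<in>S0 \<rightarrow> carrier K. v = (\<Oplus>\<^bsub>V\<^esub>s\<in>S0. c s \<odot>\<^bsub>V\<^esub> s)"
    if v: "v \<in> carrier V" "\<phi> i v = \<zero>\<^bsub>K\<^esub>" for v
  proof -
    have "v \<in> carrier V0" using v by (simp add: V0c)
    then obtain c where "c \<in> S0 \<rightarrow> carrier K" "v = (\<Oplus>\<^bsub>V0\<^esub>s\<in>S0. c s \<odot>\<^bsub>V0\<^esub> s)"
      using S0 unfolding spans_def by blast
    then show ?thesis using comb by auto
  qed
  show ?case
  proof (cases "\<forall>v\<in>carrier V. \<phi> i v = \<zero>\<^bsub>K\<^esub>")
    case True
    then have "spans K V S0" using kern fin sub by (auto simp: spans_def)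
    then show ?thesis using V.module_axioms by (auto simp: fd_space_spans)
  next
    case False
    then obtain w where w: "w \<in> carrier V" "\<phi> i w \<noteq> \<zero>\<^bsub>K\<^esub>" by blast
    then have un: "\<phi> i w \<in> Units K" using \<phi>i K.field_Units by auto
    define v0 where "v0 = inv\<^bsub>K\<^esub> (\<phi> i w) \<odot>\<^bsub>V\<^esub> w"
    have v0: "v0 \<in> carrier V" "\<phi> i v0 = \<one>\<^bsub>K\<^esub>"
      using un w \<phi>i by (auto simp: v0_def)
    have v0S: "v0 \<notin> S0" using v0 sub0 by (auto simp: V0c)
    have "spans K V (insert v0 S0)"
      unfolding spans_def
    proof (intro conjI ballI)
      fix v assume v: "v \<in> carrier V"
      define a where "a = \<phi> i v"
      have a: "a \<in> carrier K" using v \<phi>i by (simp add: a_def)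
      have "\<phi> i (v \<ominus>\<^bsub>V\<^esub> a \<odot>\<^bsub>V\<^esub> v0) = a \<ominus>\<^bsub>K\<^esub> a"
        using \<phi>i v v0 a by (simp add: a_def a_minus_def a_inv_scalars)
      then have "\<phi> i (v \<ominus>\<^bsub>V\<^esub> a \<odot>\<^bsub>V\<^esub> v0) = \<zero>\<^bsub>K\<^esub>" using a by (simp add: K.minus_eq_zero_iff)
      then obtain c where c: "c \<in> S0 \<rightarrow> carrier K" "v \<ominus>\<^bsub>V\<^esub> a \<odot>\<^bsub>V\<^esub> v0 = (\<Oplus>\<^bsub>V\<^esub>s\<in>S0. c s \<odot>\<^bsub>V\<^esub> s)"
        using kern[of "v \<ominus>\<^bsub>V\<^esub> a \<odot>\<^bsub>V\<^esub> v0"] v v0 a by auto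
      have "v = a \<odot>\<^bsub>V\<^esub> v0 \<oplus>\<^bsub>V\<^esub> (v \<ominus>\<^bsub>V\<^esub> a \<odot>\<^bsub>V\<^esub> v0)"
        using v v0 a by (simp add: a_minus_def V.M.a_ac V.M.r_neg1 V.M.r_neg)
      also have "\<dots> = (\<Oplus>\<^bsub>V\<^esub>s\<in>insert v0 S0. (if s = v0 then a else c s) \<odot>\<^bsub>V\<^esub> s)"
      proof -
        have "(\<Oplus>\<^bsub>V\<^esub>s\<in>insert v0 S0. (if s = v0 then a else c s) \<odot>\<^bsub>V\<^esub> s) =
          (if v0 = v0 then a else c v0) \<odot>\<^bsub>V\<^esub> v0 \<oplus>\<^bsub>V\<^esub> (\<Oplus>\<^bsub>V\<^esub>s\<in>S0. (if s = v0 then a else c s) \<odot>\<^bsub>V\<^esub> s)"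
          using fin v0S sub v0 a c by (intro V.finsum_insert) (auto simp: Pi_def)
        also have "(\<Oplus>\<^bsub>V\<^esub>s\<in>S0. (if s = v0 then a else c s) \<odot>\<^bsub>V\<^esub> s) = (\<Oplus>\<^bsub>V\<^esub>s\<in>S0. c s \<odot>\<^bsub>V\<^esub> s)"
          using v0S sub c by (intro V.finsum_cong') (auto simp: Pi_def)
        finally show ?thesis using c(2) by simp
      qed
      finally show "\<exists>c\<in>insert v0 S0 \<rightarrow> carrier K. v = (\<Oplus>\<^bsub>V\<^esub>s\<in>insert v0 S0. c s \<odot>\<^bsub>V\<^esub> s)"
        using a c by (intro bexI[of _ "\<lambda>s. if s = v0 then a else c s"]) auto
    qed (use fin sub v0 in auto)
    then show ?thesis using V.module_axioms by (auto simp: fd_space_spans)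
  qed
qed

lemma fd_space_functionals:
  fixes V :: "('k, 'v) module"
  assumes "field K" "fd_space K V"
  obtains \<phi> :: "nat \<Rightarrow> 'v \<Rightarrow> 'k" and n where "\<And>i. i < n \<Longrightarrow> \<phi> i \<in> linear_maps K V (scalars K)"
    "\<And>v w. v \<in> carrier V \<Longrightarrow> w \<in> carrier V \<Longrightarrow> (\<And>i. i < n \<Longrightarrow> \<phi> i v = \<phi> i w) \<Longrightarrow> v = w"
proof -
  interpret V: module K V using assms by (simp add: fd_space_def)
  obtain S \<phi> where S: "spans K V S" "\<And>s. s \<in> S \<Longrightarrow> \<phi> s \<in> linear_maps K V (scalars K)"
    "\<And>v. v \<in> carrier V \<Longrightarrow> v = (\<Oplus>\<^bsub>V\<^esub>s\<in>S. \<phi> s v \<odot>\<^bsub>V\<^esub> s)"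
    by (rule fd_space_coordinates[OF assms]) blast
  have fin: "finite S" and sub: "S \<subseteq> carrier V" using S(1) by (auto simp: spans_def)
  obtain g where g: "bij_betw g {..<card S} S"
    using fin ex_bij_betw_nat_finite[of S] by (auto simp: atLeast0LessThan)
  show thesis
  proof (rule that[of "card S" "\<lambda>i. \<phi> (g i)"])
    fix i assume "i < card S"
    then show "\<phi> (g i) \<in> linear_maps K V (scalars K)" using g S(2) by (auto simp: bij_betw_def)
  next
    fix v w assume v: "v \<in> carrier V" and w: "w \<in> carrier V"
      and eq: "\<And>i. i < card S \<Longrightarrow> \<phi> (g i) v = \<phi> (g i) w"
    have "\<phi> s v = \<phi> s w" if s: "s \<in> S" for s
    proof -
      obtain i where "i < card S" "s = g i" using s g by (auto simp: bij_betw_def)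
      then show ?thesis using eq by simp
    qed
    then have "(\<Oplus>\<^bsub>V\<^esub>s\<in>S. \<phi> s v \<odot>\<^bsub>V\<^esub> s) = (\<Oplus>\<^bsub>V\<^esub>s\<in>S. \<phi> s w \<odot>\<^bsub>V\<^esub> s)"
      using sub linear_maps_closed[OF S(2)] w by (intro V.finsum_cong') (auto simp: Pi_def)
    then show "v = w" using S(3)[OF v, symmetric] S(3)[OF w, symmetric] by metis
  qed
qed

lemma fd_space_injective:
  assumes "field K" "module K V" "fd_space K W"
    and h: "h \<in> linear_maps K V W" and inj: "inj_on h (carrier V)"
  shows "fd_space K V"
proof -
  interpret V: module K V by fact
  interpret W: module K W using assms by (simp add: fd_space_def)
  obtain n \<phi> where \<phi>: "\<And>i. i < n \<Longrightarrow> \<phi> i \<in> linear_maps K W (scalars K)"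
    "\<And>v w. v \<in> carrier W \<Longrightarrow> w \<in> carrier W \<Longrightarrow> (\<And>i::nat. i < n \<Longrightarrow> \<phi> i v = \<phi> i w) \<Longrightarrow> v = w"
    by (rule fd_space_functionals[OF assms(1,3)]) blast
  have S: "module K (scalars K)" using V.module_axioms by (intro module_scalars) (simp add: module_def)
  show ?thesis
  proof (rule fd_spaceI[OF assms(1,2), where I = "{..<n}" and \<phi> = "\<lambda>i. \<lambda>v\<in>carrier V. \<phi> i (h v)"])
    fix i assume "i \<in> {..<n}"
    then show "(\<lambda>v\<in>carrier V. \<phi> i (h v)) \<in> linear_maps K V (scalars K)"
      using \<phi>(1) h by (intro linear_maps_comp[where V = W] assms) auto
  next
    fix v assume v: "v \<in> carrier V" and z: "\<And>i. i \<in> {..<n} \<Longrightarrow> (\<lambda>v\<in>carrier V. \<phi> i (h v)) v = \<zero>\<^bsub>K\<^esub>"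
    have "h v = h \<zero>\<^bsub>V\<^esub>"
      using z v linear_maps_closed[OF h] linear_maps_zero[OF assms(2) W.module_axioms h]
        linear_maps_zero[OF W.module_axioms S \<phi>(1)]
      by (intro \<phi>(2)) auto
    then show "v = \<zero>\<^bsub>V\<^esub>" using inj v by (auto dest: inj_onD)
  qed simp
qed

lemma fd_space_dual:
  assumes "field K" "fd_space K V"
  shows "fd_space K (dual K V)"
proof -
  interpret V: module K V using assms by (simp add: fd_space_def)
  obtain S where S: "spans K V S" using assms by (auto simp: fd_space_spans)
  have fin: "finite S" and sub: "S \<subseteq> carrier V" using S(1) by (auto simp: spans_def)
  have SK: "module K (scalars K)" using V.module_axioms by (intro module_scalars) (simp add: module_def)
  have D: "module K (dual K V)" by (rule module_dual) (rule V.module_axioms)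
  have ds: "add (dual K V) x y v = x v \<oplus>\<^bsub>K\<^esub> y v" "smult (dual K V) c x v = c \<otimes>\<^bsub>K\<^esub> x v"
    "zero (dual K V) v = \<zero>\<^bsub>K\<^esub>" if "v \<in> carrier V" for v x y c
    using that by (auto simp: dual_def)
  show ?thesis
  proof (rule fd_spaceI[OF assms(1) D fin, where \<phi> = "\<lambda>s. \<lambda>\<xi>\<in>carrier (dual K V). \<xi> s"])
    fix s assume "s \<in> S"
    then show "(\<lambda>\<xi>\<in>carrier (dual K V). \<xi> s) \<in> linear_maps K (dual K V) (scalars K)"
      using sub by (intro restrict_linear_maps D) (auto simp: ds subset_iff dest: linear_maps_closed)
  next
    fix \<xi> assume x: "\<xi> \<in> carrier (dual K V)"
      and z: "\<And>s. s \<in> S \<Longrightarrow> (\<lambda>\<xi>\<in>carrier (dual K V). \<xi> s) \<xi> = \<zero>\<^bsub>K\<^esub>"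
    interpret SK: module K "scalars K" by fact
    interpret D: module K "dual K V" by fact
    have x': "\<xi> \<in> linear_maps K V (scalars K)" "\<zero>\<^bsub>dual K V\<^esub> \<in> linear_maps K V (scalars K)"
      using x D.M.zero_closed by auto
    show "\<xi> = \<zero>\<^bsub>dual K V\<^esub>"
    proof (rule linear_maps_eqI[OF x'])
      fix v assume v: "v \<in> carrier V"
      then obtain c where c: "c \<in> S \<rightarrow> carrier K" "v = (\<Oplus>\<^bsub>V\<^esub>s\<in>S. c s \<odot>\<^bsub>V\<^esub> s)"
        using S by (auto simp: spans_def)
      have "\<xi> v = (\<Oplus>\<^bsub>scalars K\<^esub>s\<in>S. \<xi> (c s \<odot>\<^bsub>V\<^esub> s))"
        unfolding c(2) using c(1) sub fin
        by (intro linear_maps_finsum[OF V.module_axioms SK x'(1)]) auto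
      also have "\<dots> = (\<Oplus>\<^bsub>scalars K\<^esub>s\<in>S. \<zero>\<^bsub>scalars K\<^esub>)"
      proof (rule SK.finsum_cong')
        fix s assume s: "s \<in> S"
        have "\<xi> (c s \<odot>\<^bsub>V\<^esub> s) = c s \<otimes>\<^bsub>K\<^esub> \<xi> s"
          using s sub c by (subst linear_maps_smult[OF x'(1)]) auto
        then show "\<xi> (c s \<odot>\<^bsub>V\<^esub> s) = \<zero>\<^bsub>scalars K\<^esub>"
          using z[OF s] x s SK.smult_r_null[OF funcset_mem[OF c(1) s]] by auto
      qed auto
      also have "\<dots> = \<zero>\<^bsub>K\<^esub>" using SK.finsum_zero by simp
      finally show "\<xi> v = \<zero>\<^bsub>dual K V\<^esub> v" using v by (simp add: ds)
    qed
  qed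
qed

section \<open>Linear categories and equivalences\<close>

lemma Hom_simps [simp]:
  "carrier (Hom C X Y) = {f \<in> Arr C. Dom C f = X \<and> Cod C f = Y}"
  "zero (Hom C X Y) = HZero C X Y" "add (Hom C X Y) = HAdd C" "smult (Hom C X Y) = HSmult C"
  by (simp_all add: Hom_def)

locale cat =
  fixes C :: "('k, 'o, 'm) lincat" (structure)
  assumes category: "category C"
begin

lemma Dom_Obj [simp]: "f \<in> Arr C \<Longrightarrow> Dom C f \<in> Obj C"
  and Cod_Obj [simp]: "f \<in> Arr C \<Longrightarrow> Cod C f \<in> Obj C"
  and Id_Arr [simp]: "X \<in> Obj C \<Longrightarrow> Id C X \<in> Arr C"
  and Dom_Id [simp]: "X \<in> Obj C \<Longrightarrow> Dom C (Id C X) = X"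
  and Cod_Id [simp]: "X \<in> Obj C \<Longrightarrow> Cod C (Id C X) = X"
  and comp_Arr [simp]: "f \<in> Arr C \<Longrightarrow> g \<in> Arr C \<Longrightarrow> Cod C f = Dom C g \<Longrightarrow> g \<cdot> f \<in> Arr C"
  and Dom_comp [simp]: "f \<in> Arr C \<Longrightarrow> g \<in> Arr C \<Longrightarrow> Cod C f = Dom C g \<Longrightarrow> Dom C (g \<cdot> f) = Dom C f"
  and Cod_comp [simp]: "f \<in> Arr C \<Longrightarrow> g \<in> Arr C \<Longrightarrow> Cod C f = Dom C g \<Longrightarrow> Cod C (g \<cdot> f) = Cod C g"
  using category unfolding category_def by auto

lemma comp_Id [simp]: "f \<in> Arr C \<Longrightarrow> Dom C f = X \<Longrightarrow> f \<cdot> Id C X = f"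
  and Id_comp [simp]: "f \<in> Arr C \<Longrightarrow> Cod C f = X \<Longrightarrow> Id C X \<cdot> f = f"
  and assoc [simp]: "f \<in> Arr C \<Longrightarrow> g \<in> Arr C \<Longrightarrow> h \<in> Arr C \<Longrightarrow> Cod C f = Dom C g \<Longrightarrow>
    Cod C g = Dom C h \<Longrightarrow> (h \<cdot> g) \<cdot> f = h \<cdot> (g \<cdot> f)"
  using category unfolding category_def by auto

text \<open>Composites are kept associated to the right; this rule lets an equation be used inside a longer
  composite.\<close>

lemma reassoc:
  assumes "g \<cdot> f = k" "f \<in> Arr C" "g \<in> Arr C" "h \<in> Arr C" "Cod C f = Dom C g" "Cod C h = Dom C f"
  shows "g \<cdot> (f \<cdot> h) = k \<cdot> h"
  using assms assoc[of h f g] by simp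

lemma isoE:
  assumes "is_iso C f"
  obtains g where "g \<in> Arr C" "Dom C g = Cod C f" "Cod C g = Dom C f"
    "g \<cdot> f = Id C (Dom C f)" "f \<cdot> g = Id C (Cod C f)"
  using assms unfolding is_iso_def by auto

lemma iso_Arr: "is_iso C f \<Longrightarrow> f \<in> Arr C"
  by (simp add: is_iso_def)

lemma isoI:
  assumes "f \<in> Arr C" "g \<in> Arr C" "Dom C g = Cod C f" "Cod C g = Dom C f"
    "g \<cdot> f = Id C (Dom C f)" "f \<cdot> g = Id C (Cod C f)"
  shows "is_iso C f"
  using assms unfolding is_iso_def by auto

lemma iso_mono:
  assumes "is_iso C t" "f \<in> Arr C" "f' \<in> Arr C" "Cod C f = Dom C t" "Cod C f' = Dom C t"
    "t \<cdot> f = t \<cdot> f'"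
  shows "f = f'"
proof -
  obtain g where g: "g \<in> Arr C" "Dom C g = Cod C t" "Cod C g = Dom C t"
    "g \<cdot> t = Id C (Dom C t)" using isoE[OF assms(1)] by metis
  have t: "t \<in> Arr C" using assms(1) by (rule iso_Arr)
  have "(g \<cdot> t) \<cdot> f = (g \<cdot> t) \<cdot> f'" using assms g(1-3) t by simp
  then show ?thesis using assms g by simp
qed

lemma iso_epi:
  assumes "is_iso C t" "f \<in> Arr C" "f' \<in> Arr C" "Dom C f = Cod C t" "Dom C f' = Cod C t"
    "f \<cdot> t = f' \<cdot> t"
  shows "f = f'"
proof -
  obtain g where g: "g \<in> Arr C" "Dom C g = Cod C t" "Cod C g = Dom C t"
    "t \<cdot> g = Id C (Cod C t)" using isoE[OF assms(1)] by metis
  have t: "t \<in> Arr C" using assms(1) by (rule iso_Arr)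
  have "f \<cdot> (t \<cdot> g) = f' \<cdot> (t \<cdot> g)"
    using assms g(1-3) t assoc[of g t f] assoc[of g t f'] by metis
  then show ?thesis using assms g by simp
qed

end

locale lcat =
  fixes K :: "'k ring" and C :: "('k, 'o, 'm) lincat" (structure)
  assumes linear_category: "linear_category K C"
begin

sublocale cat C
  using linear_category by (simp add: linear_category_def cat_def)

lemma hom_module: "X \<in> Obj C \<Longrightarrow> Y \<in> Obj C \<Longrightarrow> module K (Hom C X Y)"
  using linear_category by (simp add: linear_category_def)

lemma HAdd_closed [simp]:
  assumes "f \<in> Arr C" "g \<in> Arr C" "Dom C f = Dom C g" "Cod C f = Cod C g"
  shows "HAdd C f g \<in> Arr C" "Dom C (HAdd C f g) = Dom C g" "Cod C (HAdd C f g) = Cod C g"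
proof -
  interpret module K "Hom C (Dom C g) (Cod C g)" using assms by (simp add: hom_module)
  show "HAdd C f g \<in> Arr C" "Dom C (HAdd C f g) = Dom C g" "Cod C (HAdd C f g) = Cod C g"
    using M.a_closed[of f g] assms by auto
qed

lemma HSmult_closed [simp]:
  assumes "f \<in> Arr C" "c \<in> carrier K"
  shows "HSmult C c f \<in> Arr C" "Dom C (HSmult C c f) = Dom C f" "Cod C (HSmult C c f) = Cod C f"
proof -
  interpret module K "Hom C (Dom C f) (Cod C f)" using assms by (simp add: hom_module)
  show "HSmult C c f \<in> Arr C" "Dom C (HSmult C c f) = Dom C f" "Cod C (HSmult C c f) = Cod C f"
    using smult_closed[of c f] assms by auto
qed

lemma HZero_closed [simp]:
  assumes "X \<in> Obj C" "Y \<in> Obj C"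
  shows "HZero C X Y \<in> Arr C" "Dom C (HZero C X Y) = X" "Cod C (HZero C X Y) = Y"
proof -
  interpret module K "Hom C X Y" using assms by (simp add: hom_module)
  show "HZero C X Y \<in> Arr C" "Dom C (HZero C X Y) = X" "Cod C (HZero C X Y) = Y"
    using M.zero_closed by auto
qed

lemma comp_HAdd:
  assumes "f \<in> Arr C" "f' \<in> Arr C" "g \<in> Arr C" "Dom C f = Dom C f'" "Cod C f = Dom C g" "Cod C f' = Dom C g"
  shows "g \<cdot> HAdd C f f' = HAdd C (g \<cdot> f) (g \<cdot> f')"
  using linear_category assms unfolding linear_category_def
  by (elim conjE) (drule bspec[of _ _ "Dom C f"], simp, drule bspec[of _ _ "Cod C f"], simp,
      drule bspec[of _ _ "Cod C g"], simp, drule bspec[of _ _ f], simp, drule bspec[of _ _ f'], simp,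
      drule bspec[of _ _ g], simp, drule bspec[of _ _ g], simp, simp)

lemma HAdd_comp:
  assumes "f \<in> Arr C" "g \<in> Arr C" "g' \<in> Arr C" "Cod C g = Cod C g'" "Cod C f = Dom C g" "Cod C f = Dom C g'"
  shows "HAdd C g g' \<cdot> f = HAdd C (g \<cdot> f) (g' \<cdot> f)"
  using linear_category assms unfolding linear_category_def
  by (elim conjE) (drule bspec[of _ _ "Dom C f"], simp, drule bspec[of _ _ "Cod C f"], simp,
      drule bspec[of _ _ "Cod C g"], simp, drule bspec[of _ _ f], simp, drule bspec[of _ _ f], simp,
      drule bspec[of _ _ g], simp, drule bspec[of _ _ g'], simp, simp)

lemma comp_HSmult:
  assumes "f \<in> Arr C" "g \<in> Arr C" "Cod C f = Dom C g" "c \<in> carrier K"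
  shows "g \<cdot> HSmult C c f = HSmult C c (g \<cdot> f)" "HSmult C c g \<cdot> f = HSmult C c (g \<cdot> f)"
proof -
  have "g \<cdot> HSmult C c f = HSmult C c (g \<cdot> f) \<and> HSmult C c g \<cdot> f = HSmult C c (g \<cdot> f)"
    using linear_category assms unfolding linear_category_def
    by (elim conjE) (drule bspec[of _ _ "Dom C f"], simp, drule bspec[of _ _ "Cod C f"], simp,
        drule bspec[of _ _ "Cod C g"], simp, drule bspec[of _ _ f], simp, drule bspec[of _ _ f], simp,
        drule bspec[of _ _ g], simp, drule bspec[of _ _ g], simp, simp)
  then show "g \<cdot> HSmult C c f = HSmult C c (g \<cdot> f)" "HSmult C c g \<cdot> f = HSmult C c (g \<cdot> f)"
    by auto
qed

lemma post_comp_linear: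
  assumes "X \<in> Obj C" "g \<in> hom_set C Y Z"
  shows "(\<lambda>f\<in>hom_set C X Y. g \<cdot> f) \<in> linear_maps K (Hom C X Y) (Hom C X Z)"
  using assms by (intro restrict_linear_maps) (auto simp: hom_module comp_HAdd comp_HSmult)

lemma pre_comp_linear:
  assumes "f \<in> hom_set C X Y" "Z \<in> Obj C"
  shows "(\<lambda>g\<in>hom_set C Y Z. g \<cdot> f) \<in> linear_maps K (Hom C Y Z) (Hom C X Z)"
  using assms by (intro restrict_linear_maps) (auto simp: hom_module HAdd_comp comp_HSmult)

end

locale fctr =
  fixes C :: "('k, 'o, 'm) lincat" and D :: "('k, 'p, 'n) lincat" and F :: "('o, 'm, 'p, 'n) ftr"
  assumes is_functor: "is_functor C D F"
begin

sublocale dom: cat C using is_functor by (simp add: is_functor_def cat_def)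
sublocale cod: cat D using is_functor by (simp add: is_functor_def cat_def)

lemma FO_Obj [simp]: "X \<in> Obj C \<Longrightarrow> FO F X \<in> Obj D"
  and FA_Id [simp]: "X \<in> Obj C \<Longrightarrow> FA F (Id C X) = Id D (FO F X)"
  and FA_Arr [simp]: "f \<in> Arr C \<Longrightarrow> FA F f \<in> Arr D"
  and Dom_FA [simp]: "f \<in> Arr C \<Longrightarrow> Dom D (FA F f) = FO F (Dom C f)"
  and Cod_FA [simp]: "f \<in> Arr C \<Longrightarrow> Cod D (FA F f) = FO F (Cod C f)"
  and FA_comp [simp]: "f \<in> Arr C \<Longrightarrow> g \<in> Arr C \<Longrightarrow> Cod C f = Dom C g \<Longrightarrow>
    FA F (g \<cdot>\<^bsub>C\<^esub> f) = FA F g \<cdot>\<^bsub>D\<^esub> FA F f"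
  using is_functor unfolding is_functor_def by auto

end

lemma is_functorI:
  assumes "category C" "category D"
    and "\<And>X. X \<in> Obj C \<Longrightarrow> FO F X \<in> Obj D" "\<And>X. X \<in> Obj C \<Longrightarrow> FA F (Id C X) = Id D (FO F X)"
    and "\<And>f. f \<in> Arr C \<Longrightarrow> FA F f \<in> Arr D \<and> Dom D (FA F f) = FO F (Dom C f) \<and> Cod D (FA F f) = FO F (Cod C f)"
    and "\<And>f g. f \<in> Arr C \<Longrightarrow> g \<in> Arr C \<Longrightarrow> Cod C f = Dom C g \<Longrightarrow>
      FA F (g \<cdot>\<^bsub>C\<^esub> f) = FA F g \<cdot>\<^bsub>D\<^esub> FA F f"
  shows "is_functor C D F"
  using assms unfolding is_functor_def by auto

lemma is_functor_id: "category C \<Longrightarrow> is_functor C C ftr_id"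
  by (rule is_functorI) (auto simp: ftr_id_def)

lemma is_functor_comp:
  assumes "is_functor C D F" "is_functor D E G"
  shows "is_functor C E (ftr_comp G F)"
proof -
  interpret F: fctr C D F using assms by (simp add: fctr_def)
  interpret G: fctr D E G using assms by (simp add: fctr_def)
  show ?thesis
    by (rule is_functorI) (auto simp: ftr_comp_def F.dom.category G.cod.category)
qed

lemma ftr_comp_simps [simp]:
  "FO (ftr_comp G F) X = FO G (FO F X)" "FA (ftr_comp G F) f = FA G (FA F f)"
  "FO ftr_id X = X" "FA ftr_id f = f"
  by (simp_all add: ftr_comp_def ftr_id_def)

lemma nat_transD:
  assumes "nat_trans C D F G t"
  shows "X \<in> Obj C \<Longrightarrow> t X \<in> Arr D" "X \<in> Obj C \<Longrightarrow> Dom D (t X) = FO F X" "X \<in> Obj C \<Longrightarrow> Cod D (t X) = FO G X"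
    and "f \<in> Arr C \<Longrightarrow> t (Cod C f) \<cdot>\<^bsub>D\<^esub> FA F f = FA G f \<cdot>\<^bsub>D\<^esub> t (Dom C f)"
  using assms unfolding nat_trans_def by auto

lemma nat_transI:
  assumes "is_functor C D F" "is_functor C D G"
    and "\<And>X. X \<in> Obj C \<Longrightarrow> t X \<in> Arr D \<and> Dom D (t X) = FO F X \<and> Cod D (t X) = FO G X"
    and "\<And>f. f \<in> Arr C \<Longrightarrow> t (Cod C f) \<cdot>\<^bsub>D\<^esub> FA F f = FA G f \<cdot>\<^bsub>D\<^esub> t (Dom C f)"
  shows "nat_trans C D F G t"
  using assms unfolding nat_trans_def by auto

lemma linear_functorD:
  assumes "linear_functor K C D F"
  shows "lcat K C" "lcat K D" "fctr C D F"
    and "f \<in> Arr C \<Longrightarrow> g \<in> Arr C \<Longrightarrow> Dom C f = Dom C g \<Longrightarrow> Cod C f = Cod C g \<Longrightarrow>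
      FA F (HAdd C f g) = HAdd D (FA F f) (FA F g)"
    and "f \<in> Arr C \<Longrightarrow> c \<in> carrier K \<Longrightarrow> FA F (HSmult C c f) = HSmult D c (FA F f)"
proof -
  show 1: "lcat K C" and "lcat K D" and "fctr C D F"
    using assms unfolding linear_functor_def lcat_def fctr_def by auto
  interpret lcat K C by fact
  have *: "\<forall>X\<in>Obj C. \<forall>Y\<in>Obj C. \<forall>f\<in>hom_set C X Y.
        (\<forall>g\<in>hom_set C X Y. FA F (HAdd C f g) = HAdd D (FA F f) (FA F g)) \<and>
        (\<forall>c\<in>carrier K. FA F (HSmult C c f) = HSmult D c (FA F f))"
    using assms by (simp add: linear_functor_def)
  show "FA F (HAdd C f g) = HAdd D (FA F f) (FA F g)"
    if "f \<in> Arr C" "g \<in> Arr C" "Dom C f = Dom C g" "Cod C f = Cod C g"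
    using *[rule_format, of "Dom C f" "Cod C f" f] that by simp
  show "FA F (HSmult C c f) = HSmult D c (FA F f)" if "f \<in> Arr C" "c \<in> carrier K"
    using *[rule_format, of "Dom C f" "Cod C f" f] that by simp
qed

lemma linear_functorI:
  assumes "lcat K C" "lcat K D" "fctr C D F"
    and "\<And>f g. f \<in> Arr C \<Longrightarrow> g \<in> Arr C \<Longrightarrow> Dom C f = Dom C g \<Longrightarrow> Cod C f = Cod C g \<Longrightarrow>
      FA F (HAdd C f g) = HAdd D (FA F f) (FA F g)"
    and "\<And>f c. f \<in> Arr C \<Longrightarrow> c \<in> carrier K \<Longrightarrow> FA F (HSmult C c f) = HSmult D c (FA F f)"
  shows "linear_functor K C D F"
  using assms unfolding linear_functor_def lcat_def fctr_def by simp

text \<open>An equivalence in the form in which it is constructed and used: fully faithful and essentially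
  surjective.\<close>

definition linear_equivalence ::
    "'k ring \<Rightarrow> ('k, 'o, 'm) lincat \<Rightarrow> ('k, 'p, 'n) lincat \<Rightarrow> ('o, 'm, 'p, 'n) ftr \<Rightarrow> bool" where
  "linear_equivalence K C D E \<longleftrightarrow> linear_functor K C D E \<and>
     (\<forall>X\<in>Obj C. \<forall>Y\<in>Obj C. bij_betw (FA E) (hom_set C X Y) (hom_set D (FO E X) (FO E Y))) \<and>
     (\<forall>Z\<in>Obj D. \<exists>X\<in>Obj C. \<exists>t\<in>hom_set D (FO E X) Z. is_iso D t)"

lemma naturally_isomorphicE:
  assumes "naturally_isomorphic C D F G"
  obtains t where "\<And>X. X \<in> Obj C \<Longrightarrow> t X \<in> Arr D" "\<And>X. X \<in> Obj C \<Longrightarrow> Dom D (t X) = FO F X"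
    "\<And>X. X \<in> Obj C \<Longrightarrow> Cod D (t X) = FO G X"
    "\<And>f. f \<in> Arr C \<Longrightarrow> t (Cod C f) \<cdot>\<^bsub>D\<^esub> FA F f = FA G f \<cdot>\<^bsub>D\<^esub> t (Dom C f)"
    "\<And>X. X \<in> Obj C \<Longrightarrow> is_iso D (t X)"
proof -
  obtain t where t: "nat_trans C D F G t" "\<And>X. X \<in> Obj C \<Longrightarrow> is_iso D (t X)"
    using assms unfolding naturally_isomorphic_def by blast
  show thesis by (rule that[of t]) (use t nat_transD[OF t(1)] in auto)
qed

text \<open>The natural isomorphism conjugates \<open>G(E(f))\<close> to \<open>f\<close>.\<close>

lemma faithful_if_retract:
  assumes E: "is_functor C D E" and G: "is_functor D C G" and iso: "naturally_isomorphic C C (ftr_comp G E) ftr_id"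
    and f: "f \<in> Arr C" "g \<in> Arr C" "Dom C f = Dom C g" "Cod C f = Cod C g" "FA E f = FA E g"
  shows "f = g"
proof -
  interpret E: fctr C D E using E by (simp add: fctr_def)
  interpret G: fctr D C G using G by (simp add: fctr_def)
  obtain s where s: "\<And>X. X \<in> Obj C \<Longrightarrow> s X \<in> Arr C" "\<And>X. X \<in> Obj C \<Longrightarrow> Dom C (s X) = FO G (FO E X)"
    "\<And>X. X \<in> Obj C \<Longrightarrow> Cod C (s X) = X"
    "\<And>f. f \<in> Arr C \<Longrightarrow> s (Cod C f) \<cdot>\<^bsub>C\<^esub> FA G (FA E f) = f \<cdot>\<^bsub>C\<^esub> s (Dom C f)"
    "\<And>X. X \<in> Obj C \<Longrightarrow> is_iso C (s X)"
    using naturally_isomorphicE[OF iso] by (auto simp only: ftr_comp_simps)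
  show ?thesis
  proof (rule E.dom.iso_epi[of "s (Dom C f)"])
    show "f \<cdot>\<^bsub>C\<^esub> s (Dom C f) = g \<cdot>\<^bsub>C\<^esub> s (Dom C f)" using s(4)[of f] s(4)[of g] f by simp
  qed (use f s in auto)
qed

lemma linearly_equivalent_imp_equivalence:
  assumes "linearly_equivalent K C D"
  obtains E where "linear_equivalence K C D E"
proof -
  obtain E G where E: "linear_functor K C D E" and G: "linear_functor K D C G"
    and i1: "naturally_isomorphic C C (ftr_comp G E) ftr_id"
    and i2: "naturally_isomorphic D D (ftr_comp E G) ftr_id"
    using assms unfolding linearly_equivalent_def by blast
  interpret E: fctr C D E using linear_functorD[OF E] by simp
  interpret G: fctr D C G using linear_functorD[OF G] by simp
  obtain s where s: "\<And>X. X \<in> Obj C \<Longrightarrow> s X \<in> Arr C" "\<And>X. X \<in> Obj C \<Longrightarrow> Dom C (s X) = FO G (FO E X)"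
    "\<And>X. X \<in> Obj C \<Longrightarrow> Cod C (s X) = X"
    "\<And>f. f \<in> Arr C \<Longrightarrow> s (Cod C f) \<cdot>\<^bsub>C\<^esub> FA G (FA E f) = f \<cdot>\<^bsub>C\<^esub> s (Dom C f)"
    "\<And>X. X \<in> Obj C \<Longrightarrow> is_iso C (s X)"
    using naturally_isomorphicE[OF i1] by (auto simp only: ftr_comp_simps)
  obtain t where t: "\<And>X. X \<in> Obj D \<Longrightarrow> t X \<in> Arr D" "\<And>X. X \<in> Obj D \<Longrightarrow> Dom D (t X) = FO E (FO G X)"
    "\<And>X. X \<in> Obj D \<Longrightarrow> Cod D (t X) = X"
    "\<And>f. f \<in> Arr D \<Longrightarrow> t (Cod D f) \<cdot>\<^bsub>D\<^esub> FA E (FA G f) = f \<cdot>\<^bsub>D\<^esub> t (Dom D f)"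
    "\<And>X. X \<in> Obj D \<Longrightarrow> is_iso D (t X)"
    using naturally_isomorphicE[OF i2] by (auto simp only: ftr_comp_simps)
  have full: "\<exists>f. f \<in> Arr C \<and> Dom C f = X \<and> Cod C f = Y \<and> FA E f = h"
    if X: "X \<in> Obj C" "Y \<in> Obj C" and h: "h \<in> Arr D" "Dom D h = FO E X" "Cod D h = FO E Y" for X Y h
  proof -
    obtain r where r: "r \<in> Arr C" "Dom C r = X" "Cod C r = FO G (FO E X)" "r \<cdot>\<^bsub>C\<^esub> s X = Id C (FO G (FO E X))"
      using E.dom.isoE[OF s(5)[OF X(1)]] s X by metis
    define f where "f = s Y \<cdot>\<^bsub>C\<^esub> (FA G h \<cdot>\<^bsub>C\<^esub> r)"
    have f: "f \<in> Arr C" "Dom C f = X" "Cod C f = Y" using X h r s by (auto simp: f_def)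
    have "s Y \<cdot>\<^bsub>C\<^esub> FA G (FA E f) = f \<cdot>\<^bsub>C\<^esub> s X" using s(4)[OF f(1)] f by simp
    also have "\<dots> = s Y \<cdot>\<^bsub>C\<^esub> (FA G h \<cdot>\<^bsub>C\<^esub> (r \<cdot>\<^bsub>C\<^esub> s X))" using X h r s by (simp add: f_def del: r)
    also have "\<dots> = s Y \<cdot>\<^bsub>C\<^esub> FA G h" using X h r s by simp
    finally have "FA G (FA E f) = FA G h"
      by (rule E.dom.iso_mono[OF s(5)[OF X(2)], rotated -1]) (use X h f s in auto)
    then have "FA E f = h"
      using f h X by (intro faithful_if_retract[OF G.is_functor E.is_functor i2]) auto
    then show ?thesis using f by blast
  qed
  have "bij_betw (FA E) (hom_set C X Y) (hom_set D (FO E X) (FO E Y))"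
    if "X \<in> Obj C" "Y \<in> Obj C" for X Y
    unfolding bij_betw_def
  proof
    show "inj_on (FA E) (hom_set C X Y)"
      by (rule inj_onI) (rule faithful_if_retract[OF E.is_functor G.is_functor i1], auto)
    show "FA E ` hom_set C X Y = hom_set D (FO E X) (FO E Y)"
      using full[OF that] by force
  qed
  moreover have "\<exists>X\<in>Obj C. \<exists>u\<in>hom_set D (FO E X) Z. is_iso D u" if "Z \<in> Obj D" for Z
    by (rule bexI[of _ "FO G Z"], rule bexI[of _ "t Z"]) (use that t in auto)
  ultimately show thesis using that E unfolding linear_equivalence_def by blast
qed

lemma linear_equivalence_full:
  assumes "linear_equivalence K C D E" "X \<in> Obj C" "Y \<in> Obj C" "h \<in> hom_set D (FO E X) (FO E Y)"
  obtains f where "f \<in> Arr C" "Dom C f = X" "Cod C f = Y" "FA E f = h"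
proof -
  have "FA E ` hom_set C X Y = hom_set D (FO E X) (FO E Y)"
    using assms unfolding linear_equivalence_def bij_betw_def by blast
  then have "h \<in> FA E ` hom_set C X Y" using assms(4) by simp
  then show thesis using that by auto
qed

lemma linear_equivalence_faithful:
  assumes "linear_equivalence K C D E" "f \<in> Arr C" "g \<in> Arr C" "Dom C f = Dom C g" "Cod C f = Cod C g"
    "FA E f = FA E g"
  shows "f = g"
proof -
  interpret fctr C D E using assms by (auto simp: linear_equivalence_def linear_functorD)
  have "inj_on (FA E) (hom_set C (Dom C g) (Cod C g))"
    using assms unfolding linear_equivalence_def bij_betw_def by auto
  then show ?thesis using assms by (auto dest: inj_onD)
qed

text \<open>The quasi-inverse is a choice of preimages up to isomorphism; as \<open>E\<close> is faithful, equations between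
  its arrows may be checked after applying \<open>E\<close>.\<close>

lemma linear_equivalence_imp_equivalent:
  assumes E: "linear_equivalence K C D E"
  shows "linearly_equivalent K C D"
proof -
  have lE: "linear_functor K C D E" using E by (simp add: linear_equivalence_def)
  interpret C: lcat K C using linear_functorD[OF lE] by simp
  interpret D: lcat K D using linear_functorD[OF lE] by simp
  interpret E: fctr C D E using linear_functorD[OF lE] by simp
  have "\<forall>Z\<in>Obj D. \<exists>p. fst p \<in> Obj C \<and> snd p \<in> hom_set D (FO E (fst p)) Z \<and> is_iso D (snd p)"
    using E unfolding linear_equivalence_def by (metis fst_conv snd_conv)
  from bchoice[OF this] obtain p where p: "\<forall>Z\<in>Obj D. fst (p Z) \<in> Obj C \<and>
    snd (p Z) \<in> hom_set D (FO E (fst (p Z))) Z \<and> is_iso D (snd (p Z))" by blast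
  define G0 where "G0 Z = fst (p Z)" for Z
  define t where "t Z = snd (p Z)" for Z
  have G0 [simp]: "G0 Z \<in> Obj C" and t [simp]: "t Z \<in> Arr D" "Dom D (t Z) = FO E (G0 Z)" "Cod D (t Z) = Z"
    and tiso: "is_iso D (t Z)" if "Z \<in> Obj D" for Z
    using p that by (auto simp: G0_def t_def)
  have "\<forall>Z\<in>Obj D. \<exists>r. r \<in> Arr D \<and> Dom D r = Z \<and> Cod D r = FO E (G0 Z) \<and>
    r \<cdot>\<^bsub>D\<^esub> t Z = Id D (FO E (G0 Z)) \<and> t Z \<cdot>\<^bsub>D\<^esub> r = Id D Z"
    using D.isoE[OF tiso] t by metis
  from bchoice[OF this] obtain r where r [simp]: "\<And>Z. Z \<in> Obj D \<Longrightarrow> r Z \<in> Arr D"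
    "\<And>Z. Z \<in> Obj D \<Longrightarrow> Dom D (r Z) = Z" "\<And>Z. Z \<in> Obj D \<Longrightarrow> Cod D (r Z) = FO E (G0 Z)"
    "\<And>Z. Z \<in> Obj D \<Longrightarrow> r Z \<cdot>\<^bsub>D\<^esub> t Z = Id D (FO E (G0 Z))" "\<And>Z. Z \<in> Obj D \<Longrightarrow> t Z \<cdot>\<^bsub>D\<^esub> r Z = Id D Z"
    by blast
  have "\<forall>h\<in>Arr D. \<exists>f. f \<in> Arr C \<and> Dom C f = G0 (Dom D h) \<and> Cod C f = G0 (Cod D h) \<and>
    FA E f = r (Cod D h) \<cdot>\<^bsub>D\<^esub> (h \<cdot>\<^bsub>D\<^esub> t (Dom D h))"
  proof
    fix h assume h: "h \<in> Arr D"
    have "r (Cod D h) \<cdot>\<^bsub>D\<^esub> (h \<cdot>\<^bsub>D\<^esub> t (Dom D h)) \<in> hom_set D (FO E (G0 (Dom D h))) (FO E (G0 (Cod D h)))"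
      using h by simp
    from linear_equivalence_full[OF E _ _ this]
    show "\<exists>f. f \<in> Arr C \<and> Dom C f = G0 (Dom D h) \<and> Cod C f = G0 (Cod D h) \<and>
      FA E f = r (Cod D h) \<cdot>\<^bsub>D\<^esub> (h \<cdot>\<^bsub>D\<^esub> t (Dom D h))" using h by (metis G0 D.Dom_Obj D.Cod_Obj)
  qed
  from bchoice[OF this] obtain Ga where Ga [simp]: "\<And>h. h \<in> Arr D \<Longrightarrow> Ga h \<in> Arr C"
    "\<And>h. h \<in> Arr D \<Longrightarrow> Dom C (Ga h) = G0 (Dom D h)" "\<And>h. h \<in> Arr D \<Longrightarrow> Cod C (Ga h) = G0 (Cod D h)"
    and EGa: "\<And>h. h \<in> Arr D \<Longrightarrow> FA E (Ga h) = r (Cod D h) \<cdot>\<^bsub>D\<^esub> (h \<cdot>\<^bsub>D\<^esub> t (Dom D h))" by blast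
  define G where "G = \<lparr>FO = G0, FA = Ga\<rparr>"
  have [simp]: "FO G = G0" "FA G = Ga" by (auto simp: G_def)
  have tr: "t Z \<cdot>\<^bsub>D\<^esub> (r Z \<cdot>\<^bsub>D\<^esub> h) = h" if "h \<in> Arr D" "Cod D h = Z" for Z h
    using that D.Cod_Obj[OF that(1)] by (simp add: D.reassoc[OF r(5)] del: D.Cod_Obj)
  have rt: "r Z \<cdot>\<^bsub>D\<^esub> (t Z \<cdot>\<^bsub>D\<^esub> h) = h" if "h \<in> Arr D" "Cod D h = FO E (G0 Z)" "Z \<in> Obj D" for Z h
    using that D.Cod_Obj[OF that(1)] by (simp add: D.reassoc[OF r(4)] del: D.Cod_Obj)
  have G: "is_functor D C G"
  proof (rule is_functorI)
    fix Z assume "Z \<in> Obj D"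
    then show "FA G (Id D Z) = Id C (FO G Z)"
      by (intro linear_equivalence_faithful[OF E]) (auto simp: EGa)
  next
    fix f g assume "f \<in> Arr D" "g \<in> Arr D" "Cod D f = Dom D g"
    then show "FA G (g \<cdot>\<^bsub>D\<^esub> f) = FA G g \<cdot>\<^bsub>C\<^esub> FA G f"
      by (intro linear_equivalence_faithful[OF E]) (auto simp: EGa tr)
  qed (auto simp: C.category D.category)
  have lG: "linear_functor K D C G"
  proof (rule linear_functorI)
    fix f g assume "f \<in> Arr D" "g \<in> Arr D" "Dom D f = Dom D g" "Cod D f = Cod D g"
    then show "FA G (HAdd D f g) = HAdd C (FA G f) (FA G g)"
      by (intro linear_equivalence_faithful[OF E])
        (auto simp: EGa linear_functorD(4)[OF lE] D.comp_HAdd D.HAdd_comp)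
  next
    fix f c assume "f \<in> Arr D" "c \<in> carrier K"
    then show "FA G (HSmult D c f) = HSmult C c (FA G f)"
      by (intro linear_equivalence_faithful[OF E])
        (auto simp: EGa linear_functorD(5)[OF lE] D.comp_HSmult)
  qed (simp_all add: C.lcat_axioms D.lcat_axioms fctr_def G)
  have "naturally_isomorphic D D (ftr_comp E G) ftr_id"
    unfolding naturally_isomorphic_def
  proof (intro exI[of _ t] conjI ballI nat_transI)
    fix h assume "h \<in> Arr D"
    then show "t (Cod D h) \<cdot>\<^bsub>D\<^esub> FA (ftr_comp E G) h = FA ftr_id h \<cdot>\<^bsub>D\<^esub> t (Dom D h)"
      by (simp add: EGa tr)
  qed (auto simp: is_functor_comp[OF G E.is_functor] is_functor_id D.category tiso)
  moreover have "naturally_isomorphic C C (ftr_comp G E) ftr_id"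
  proof -
    have "\<forall>X\<in>Obj C. \<exists>s. s \<in> Arr C \<and> Dom C s = G0 (FO E X) \<and> Cod C s = X \<and> FA E s = t (FO E X)"
    proof
      fix X assume X: "X \<in> Obj C"
      then have "t (FO E X) \<in> hom_set D (FO E (G0 (FO E X))) (FO E X)" by simp
      from linear_equivalence_full[OF E _ _ this] X
      show "\<exists>s. s \<in> Arr C \<and> Dom C s = G0 (FO E X) \<and> Cod C s = X \<and> FA E s = t (FO E X)"
        by (metis G0 E.FO_Obj)
    qed
    from bchoice[OF this] obtain s where s [simp]: "\<And>X. X \<in> Obj C \<Longrightarrow> s X \<in> Arr C"
      "\<And>X. X \<in> Obj C \<Longrightarrow> Dom C (s X) = G0 (FO E X)" "\<And>X. X \<in> Obj C \<Longrightarrow> Cod C (s X) = X"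
      "\<And>X. X \<in> Obj C \<Longrightarrow> FA E (s X) = t (FO E X)" by blast
    have "is_iso C (s X)" if X: "X \<in> Obj C" for X
    proof -
      have "r (FO E X) \<in> hom_set D (FO E X) (FO E (G0 (FO E X)))" using X by simp
      from linear_equivalence_full[OF E _ _ this] X obtain s' where s': "s' \<in> Arr C" "Dom C s' = X"
        "Cod C s' = G0 (FO E X)" "FA E s' = r (FO E X)" by (metis G0 E.FO_Obj)
      show ?thesis
      proof (rule C.isoI[of _ s'])
        show "s' \<cdot>\<^bsub>C\<^esub> s X = Id C (Dom C (s X))"
          using s' X by (intro linear_equivalence_faithful[OF E]) auto
        show "s X \<cdot>\<^bsub>C\<^esub> s' = Id C (Cod C (s X))"
          using s' X by (intro linear_equivalence_faithful[OF E]) auto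
      qed (use s' X in auto)
    qed
    then show ?thesis
      unfolding naturally_isomorphic_def
    proof (intro exI[of _ s] conjI ballI nat_transI)
      fix f assume f: "f \<in> Arr C"
      show "s (Cod C f) \<cdot>\<^bsub>C\<^esub> FA (ftr_comp G E) f = FA ftr_id f \<cdot>\<^bsub>C\<^esub> s (Dom C f)"
        using f by (intro linear_equivalence_faithful[OF E]) (auto simp: EGa tr)
    qed (auto simp: is_functor_comp[OF E.is_functor G] is_functor_id C.category)
  qed
  ultimately show ?thesis using lE lG unfolding linearly_equivalent_def by blast
qed

section \<open>Modules over a finite-dimensional algebra\<close>

lemma fd_mod_simps [simp]:
  "Obj (fd_mod K A) = {X. fd_left_module K A X}"
  "Dom (fd_mod K A) (X, h, Y) = X"
  "Cod (fd_mod K A) (X, h, Y) = Y"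
  "Id (fd_mod K A) X = (X, \<lambda>v\<in>carrier (fst X). v, X)"
  "Comp (fd_mod K A) (Y', g, Z) (X, h, Y) = (X, \<lambda>v\<in>carrier (fst X). g (h v), Z)"
  "HZero (fd_mod K A) X Y = (X, \<lambda>v\<in>carrier (fst X). \<zero>\<^bsub>fst Y\<^esub>, Y)"
  "HAdd (fd_mod K A) (X, h, Y) (X', g, Y') = (X, \<lambda>v\<in>carrier (fst X). h v \<oplus>\<^bsub>fst Y\<^esub> g v, Y)"
  "HSmult (fd_mod K A) c (X, h, Y) = (X, \<lambda>v\<in>carrier (fst X). c \<odot>\<^bsub>fst Y\<^esub> h v, Y)"
  by (simp_all add: fd_mod_def)

lemma fd_mod_Arr:
  "(X, h, Y) \<in> Arr (fd_mod K A) \<longleftrightarrow> fd_left_module K A X \<and> fd_left_module K A Y \<and>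
     h \<in> linear_maps K (fst X) (fst Y) \<and> (\<forall>a\<in>carrier A. \<forall>v\<in>carrier (fst X). h (snd X a v) = snd Y a (h v))"
  by (simp add: fd_mod_def)

lemma fd_mod_ArrE:
  assumes "f \<in> Arr (fd_mod K A)"
  obtains X h Y where "f = (X, h, Y)" "fd_left_module K A X" "fd_left_module K A Y"
    "h \<in> linear_maps K (fst X) (fst Y)"
    "\<And>a v. a \<in> carrier A \<Longrightarrow> v \<in> carrier (fst X) \<Longrightarrow> h (snd X a v) = snd Y a (h v)"
    "\<And>v. v \<in> carrier (fst X) \<Longrightarrow> h v \<in> carrier (fst Y)"
    "\<And>v. v \<notin> carrier (fst X) \<Longrightarrow> h v = undefined"
proof -
  obtain X h Y where f: "f = (X, h, Y)" by (cases f) auto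
  then show thesis using assms that[OF f] linear_maps_closed[of h K "fst X" "fst Y"]
    linear_maps_undefined[of h K "fst X" "fst Y"]
    by (auto simp: fd_mod_Arr)
qed

lemma fd_mod_homE:
  assumes "f \<in> hom_set (fd_mod K A) X Y"
  obtains h where "f = (X, h, Y)" "h \<in> linear_maps K (fst X) (fst Y)"
    "\<And>a v. a \<in> carrier A \<Longrightarrow> v \<in> carrier (fst X) \<Longrightarrow> h (snd X a v) = snd Y a (h v)"
    "\<And>v. v \<in> carrier (fst X) \<Longrightarrow> h v \<in> carrier (fst Y)"
proof -
  obtain h where f: "f = (X, h, Y)" using assms by (cases f) auto
  then have "(X, h, Y) \<in> Arr (fd_mod K A)" using assms by simp
  then have h: "h \<in> linear_maps K (fst X) (fst Y)"
    "\<forall>a\<in>carrier A. \<forall>v\<in>carrier (fst X). h (snd X a v) = snd Y a (h v)" by (simp_all add: fd_mod_Arr)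
  show thesis by (rule that[OF f h(1)]) (use h linear_maps_closed[OF h(1)] in auto)
qed

lemma fd_left_moduleD:
  assumes "fd_left_module K A X"
  shows "fd_space K (fst X)" "module K (fst X)"
    and "a \<in> carrier A \<Longrightarrow> v \<in> carrier (fst X) \<Longrightarrow> snd X a v \<in> carrier (fst X)"
    and "a \<in> carrier A \<Longrightarrow> v \<in> carrier (fst X) \<Longrightarrow> w \<in> carrier (fst X) \<Longrightarrow>
      snd X a (v \<oplus>\<^bsub>fst X\<^esub> w) = snd X a v \<oplus>\<^bsub>fst X\<^esub> snd X a w"
    and "a \<in> carrier A \<Longrightarrow> b \<in> carrier A \<Longrightarrow> v \<in> carrier (fst X) \<Longrightarrow>
      snd X (a \<oplus>\<^bsub>A\<^esub> b) v = snd X a v \<oplus>\<^bsub>fst X\<^esub> snd X b v"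
    and "c \<in> carrier K \<Longrightarrow> a \<in> carrier A \<Longrightarrow> v \<in> carrier (fst X) \<Longrightarrow>
      snd X (c \<odot>\<^bsub>A\<^esub> a) v = c \<odot>\<^bsub>fst X\<^esub> snd X a v"
    and "c \<in> carrier K \<Longrightarrow> a \<in> carrier A \<Longrightarrow> v \<in> carrier (fst X) \<Longrightarrow>
      snd X a (c \<odot>\<^bsub>fst X\<^esub> v) = c \<odot>\<^bsub>fst X\<^esub> snd X a v"
    and "a \<in> carrier A \<Longrightarrow> b \<in> carrier A \<Longrightarrow> v \<in> carrier (fst X) \<Longrightarrow>
      snd X (a \<otimes>\<^bsub>A\<^esub> b) v = snd X a (snd X b v)"
    and "v \<in> carrier (fst X) \<Longrightarrow> snd X \<one>\<^bsub>A\<^esub> v = v"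
  using assms unfolding fd_left_module_def by (auto simp: fd_space_def split: prod.splits)

lemma fd_left_moduleI:
  assumes "fd_space K V"
    and "\<And>a v. a \<in> carrier A \<Longrightarrow> v \<in> carrier V \<Longrightarrow> r a v \<in> carrier V"
    and "\<And>a v w. a \<in> carrier A \<Longrightarrow> v \<in> carrier V \<Longrightarrow> w \<in> carrier V \<Longrightarrow>
      r a (v \<oplus>\<^bsub>V\<^esub> w) = r a v \<oplus>\<^bsub>V\<^esub> r a w"
    and "\<And>a b v. a \<in> carrier A \<Longrightarrow> b \<in> carrier A \<Longrightarrow> v \<in> carrier V \<Longrightarrow>
      r (a \<oplus>\<^bsub>A\<^esub> b) v = r a v \<oplus>\<^bsub>V\<^esub> r b v"
    and "\<And>c a v. c \<in> carrier K \<Longrightarrow> a \<in> carrier A \<Longrightarrow> v \<in> carrier V \<Longrightarrow>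
      r (c \<odot>\<^bsub>A\<^esub> a) v = c \<odot>\<^bsub>V\<^esub> r a v"
    and "\<And>c a v. c \<in> carrier K \<Longrightarrow> a \<in> carrier A \<Longrightarrow> v \<in> carrier V \<Longrightarrow>
      r a (c \<odot>\<^bsub>V\<^esub> v) = c \<odot>\<^bsub>V\<^esub> r a v"
    and "\<And>a b v. a \<in> carrier A \<Longrightarrow> b \<in> carrier A \<Longrightarrow> v \<in> carrier V \<Longrightarrow>
      r (a \<otimes>\<^bsub>A\<^esub> b) v = r a (r b v)"
    and "\<And>v. v \<in> carrier V \<Longrightarrow> r \<one>\<^bsub>A\<^esub> v = v"
  shows "fd_left_module K A (V, r)"
  using assms unfolding fd_left_module_def by auto

lemma fd_mod_smult_left:
  assumes "fd_left_module K A Y" "c \<in> carrier K" "d \<in> carrier K" "v \<in> carrier (fst Y)"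
  shows "c \<odot>\<^bsub>fst Y\<^esub> (d \<odot>\<^bsub>fst Y\<^esub> v) = d \<odot>\<^bsub>fst Y\<^esub> (c \<odot>\<^bsub>fst Y\<^esub> v)"
proof -
  interpret Y: module K "fst Y" using fd_left_moduleD[OF assms(1)] by simp
  show ?thesis using assms by (simp add: Y.smult_assoc1[symmetric] Y.R.m_comm)
qed

lemma fd_mod_linear_category:
  fixes K :: "'k ring" and A :: "('k, 'a) module"
  assumes K: "cring K"
  shows "linear_category K (fd_mod K A :: ('k, ('k, 'a, 'v) lmod, _) lincat)"
  unfolding linear_category_def
proof (intro conjI ballI)
  let ?M = "fd_mod K A :: ('k, ('k, 'a, 'v) lmod, _) lincat"
  show "category ?M"
    unfolding category_def
  proof (intro conjI ballI impI)
    fix X assume "X \<in> Obj ?M"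
    then show "Id ?M X \<in> hom_set ?M X X"
      by (auto simp: fd_mod_Arr fd_left_moduleD intro!: restrict_linear_maps)
  next
    fix f g assume "f \<in> Arr ?M" "g \<in> Arr ?M" "Cod ?M f = Dom ?M g"
    then show "g \<cdot>\<^bsub>?M\<^esub> f \<in> hom_set ?M (Dom ?M f) (Cod ?M g)"
      by (elim fd_mod_ArrE)
        (auto simp: fd_mod_Arr fd_left_moduleD intro: linear_maps_comp dest: fd_left_moduleD(2))
  next
    fix f g h assume "f \<in> Arr ?M" "g \<in> Arr ?M" "h \<in> Arr ?M" "Cod ?M f = Dom ?M g \<and> Cod ?M g = Dom ?M h"
    then show "h \<cdot>\<^bsub>?M\<^esub> (g \<cdot>\<^bsub>?M\<^esub> f) = (h \<cdot>\<^bsub>?M\<^esub> g) \<cdot>\<^bsub>?M\<^esub> f"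
      by (elim fd_mod_ArrE) (auto intro!: restrict_ext)
  next
    fix f assume "f \<in> Arr ?M"
    then show "f \<cdot>\<^bsub>?M\<^esub> Id ?M (Dom ?M f) = f" "Id ?M (Cod ?M f) \<cdot>\<^bsub>?M\<^esub> f = f"
      by (elim fd_mod_ArrE; auto intro!: ext)+
  qed (auto elim: fd_mod_ArrE)
next
  let ?M = "fd_mod K A :: ('k, ('k, 'a, 'v) lmod, _) lincat"
  fix X Y assume X: "X \<in> Obj ?M" and Y: "Y \<in> Obj ?M"
  have MX: "module K (fst X)" and MY: "module K (fst Y)" using X Y by (auto simp: fd_left_moduleD)
  interpret X: module K "fst X" by fact
  interpret Y: module K "fst Y" by fact
  show "module K (Hom ?M X Y)"
  proof (rule module_pointwise[where I = "carrier (fst X)" and W = "\<lambda>_. fst Y" and ev = "\<lambda>v f. fst (snd f) v"])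
    have "snd Y a \<zero>\<^bsub>fst Y\<^esub> = \<zero>\<^bsub>fst Y\<^esub>" if "a \<in> carrier A" for a
    proof -
      have "snd Y a \<zero>\<^bsub>fst Y\<^esub> = snd Y a (\<zero>\<^bsub>K\<^esub> \<odot>\<^bsub>fst Y\<^esub> \<zero>\<^bsub>fst Y\<^esub>)" by simp
      also have "\<dots> = \<zero>\<^bsub>fst Y\<^esub>"
        using that Y by (subst fd_left_moduleD(7)) (auto simp: fd_left_moduleD(3))
      finally show ?thesis .
    qed
    then show "\<zero>\<^bsub>Hom ?M X Y\<^esub> \<in> carrier (Hom ?M X Y)"
      using X Y by (auto simp: fd_mod_Arr fd_left_moduleD(3) intro!: restrict_linear_maps MX)
  next
    fix f g assume "f \<in> carrier (Hom ?M X Y)"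
    then obtain h where h: "f = (X, h, Y)" "h \<in> linear_maps K (fst X) (fst Y)"
      "\<And>a v. a \<in> carrier A \<Longrightarrow> v \<in> carrier (fst X) \<Longrightarrow> h (snd X a v) = snd Y a (h v)"
      "\<And>v. v \<in> carrier (fst X) \<Longrightarrow> h v \<in> carrier (fst Y)" by (rule fd_mod_homE) blast
    note [simp] = h(4) linear_maps_add[OF h(2)] linear_maps_smult[OF h(2)] h(3)
      fd_left_moduleD(3,4,7)[OF X[simplified]] fd_left_moduleD(3,4,7)[OF Y[simplified]]
    have "(\<lambda>v\<in>carrier (fst X). c \<odot>\<^bsub>fst Y\<^esub> h v) \<in> linear_maps K (fst X) (fst Y)"
      if "c \<in> carrier K" for c
      by (rule restrict_linear_maps)
        (use that MX Y in \<open>auto simp: Y.smult_r_distr fd_mod_smult_left\<close>)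
    then show "c \<odot>\<^bsub>Hom ?M X Y\<^esub> f \<in> carrier (Hom ?M X Y)" if "c \<in> carrier K" for c
      using that X Y h(1) by (simp add: fd_mod_Arr)
    assume "g \<in> carrier (Hom ?M X Y)"
    then obtain k where k: "g = (X, k, Y)" "k \<in> linear_maps K (fst X) (fst Y)"
      "\<And>a v. a \<in> carrier A \<Longrightarrow> v \<in> carrier (fst X) \<Longrightarrow> k (snd X a v) = snd Y a (k v)"
      "\<And>v. v \<in> carrier (fst X) \<Longrightarrow> k v \<in> carrier (fst Y)" by (rule fd_mod_homE) blast
    note [simp] = k(4) linear_maps_add[OF k(2)] linear_maps_smult[OF k(2)] k(3)
    have "(\<lambda>v\<in>carrier (fst X). h v \<oplus>\<^bsub>fst Y\<^esub> k v) \<in> linear_maps K (fst X) (fst Y)"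
      by (rule restrict_linear_maps) (use MX in \<open>auto simp: Y.smult_r_distr Y.M.a_ac\<close>)
    then show "f \<oplus>\<^bsub>Hom ?M X Y\<^esub> g \<in> carrier (Hom ?M X Y)"
      using X Y h(1) k(1) by (simp add: fd_mod_Arr)
    show "f = g" if "\<And>v. v \<in> carrier (fst X) \<Longrightarrow> fst (snd f) v = fst (snd g) v"
      using linear_maps_eqI[OF h(2) k(2)] that by (simp add: h(1) k(1))
  qed (use K MY in \<open>auto elim!: fd_mod_ArrE\<close>)
next
  let ?M = "fd_mod K A :: ('k, ('k, 'a, 'v) lmod, _) lincat"
  fix X Y Z f f' g g'
  assume "f \<in> hom_set ?M X Y" "f' \<in> hom_set ?M X Y" "g \<in> hom_set ?M Y Z" "g' \<in> hom_set ?M Y Z"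
  then show "g \<cdot>\<^bsub>?M\<^esub> HAdd ?M f f' = HAdd ?M (g \<cdot>\<^bsub>?M\<^esub> f) (g \<cdot>\<^bsub>?M\<^esub> f')"
    "HAdd ?M g g' \<cdot>\<^bsub>?M\<^esub> f = HAdd ?M (g \<cdot>\<^bsub>?M\<^esub> f) (g' \<cdot>\<^bsub>?M\<^esub> f)"
    by (auto elim!: fd_mod_ArrE intro!: restrict_ext simp: linear_maps_add)
  fix c assume "c \<in> carrier K"
  with \<open>f \<in> hom_set ?M X Y\<close> \<open>g \<in> hom_set ?M Y Z\<close>
  show "g \<cdot>\<^bsub>?M\<^esub> HSmult ?M c f = HSmult ?M c (g \<cdot>\<^bsub>?M\<^esub> f)"
    "HSmult ?M c g \<cdot>\<^bsub>?M\<^esub> f = HSmult ?M c (g \<cdot>\<^bsub>?M\<^esub> f)"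
    by (auto elim!: fd_mod_ArrE intro!: restrict_ext simp: linear_maps_smult)
qed

text \<open>A module map is determined by the finitely many coordinates of its values on a spanning set.\<close>

lemma fd_mod_hom_fd:
  assumes K: "field K" and X: "fd_left_module K A X" and Y: "fd_left_module K A Y"
  shows "fd_space K (Hom (fd_mod K A) X Y)"
proof -
  let ?M = "fd_mod K A"
  interpret K: field K by fact
  interpret M: lcat K ?M by unfold_locales (rule fd_mod_linear_category, rule K.is_cring)
  interpret X: module K "fst X" using X by (simp add: fd_left_moduleD)
  interpret Y: module K "fst Y" using Y by (simp add: fd_left_moduleD)
  obtain S where S: "spans K (fst X) S" using fd_left_moduleD(1)[OF X] by (auto simp: fd_space_spans)
  then have fin: "finite S" and sub: "S \<subseteq> carrier (fst X)" by (auto simp: spans_def)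
  obtain n :: nat and \<phi> where \<phi>: "\<And>i. i < n \<Longrightarrow> \<phi> i \<in> linear_maps K (fst Y) (scalars K)"
    "\<And>v w. v \<in> carrier (fst Y) \<Longrightarrow> w \<in> carrier (fst Y) \<Longrightarrow> (\<And>i. i < n \<Longrightarrow> \<phi> i v = \<phi> i w) \<Longrightarrow> v = w"
    by (rule fd_space_functionals[OF K fd_left_moduleD(1)[OF Y]]) blast
  have H: "module K (Hom ?M X Y)" using X Y by (simp add: M.hom_module)
  interpret H: module K "Hom ?M X Y" by fact
  have SK: "module K (scalars K)" by (rule module_scalars) (rule K.is_cring)
  show ?thesis
  proof (rule fd_spaceI[OF K H, where I = "S \<times> {..<n}" and \<phi> = "\<lambda>(s, i). \<lambda>f\<in>hom_set ?M X Y. \<phi> i (fst (snd f) s)"])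
    fix p assume "p \<in> S \<times> {..<n}"
    then obtain s i where p: "p = (s, i)" "s \<in> carrier (fst X)" "i < n" using sub by auto
    note l = \<phi>(1)[OF p(3)]
    have "(\<lambda>f\<in>hom_set ?M X Y. \<phi> i (fst (snd f) s)) \<in> linear_maps K (Hom ?M X Y) (scalars K)"
      using p linear_maps_closed[OF l] linear_maps_add[OF l] linear_maps_smult[OF l]
      by (intro restrict_linear_maps H) (auto elim!: fd_mod_ArrE)
    then show "(case p of (s, i) \<Rightarrow> \<lambda>f\<in>hom_set ?M X Y. \<phi> i (fst (snd f) s)) \<in> linear_maps K (Hom ?M X Y) (scalars K)"
      using p by simp
  next
    fix f assume f: "f \<in> carrier (Hom ?M X Y)"
      and z: "\<And>p. p \<in> S \<times> {..<n} \<Longrightarrow> (case p of (s, i) \<Rightarrow> \<lambda>f\<in>hom_set ?M X Y. \<phi> i (fst (snd f) s)) f = \<zero>\<^bsub>K\<^esub>"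
    obtain h where h: "f = (X, h, Y)" "h \<in> linear_maps K (fst X) (fst Y)"
      using f by (auto elim!: fd_mod_ArrE)
    have hs: "h s = \<zero>\<^bsub>fst Y\<^esub>" if s: "s \<in> S" for s
    proof (rule \<phi>(2))
      fix i assume i: "i < n"
      show "\<phi> i (h s) = \<phi> i \<zero>\<^bsub>fst Y\<^esub>"
        using z[of "(s, i)"] s i f h linear_maps_zero[OF Y.module_axioms SK \<phi>(1)[OF i]] by simp
    qed (use s sub linear_maps_closed[OF h(2)] in auto)
    have "h v = \<zero>\<^bsub>fst Y\<^esub>" if v: "v \<in> carrier (fst X)" for v
    proof -
      obtain c where c: "c \<in> S \<rightarrow> carrier K" "v = (\<Oplus>\<^bsub>fst X\<^esub>s\<in>S. c s \<odot>\<^bsub>fst X\<^esub> s)"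
        using v S by (auto simp: spans_def)
      have "h v = (\<Oplus>\<^bsub>fst Y\<^esub>s\<in>S. h (c s \<odot>\<^bsub>fst X\<^esub> s))"
        unfolding c(2) using c(1) sub fin
        by (intro linear_maps_finsum[OF X.module_axioms Y.module_axioms h(2)]) auto
      also have "\<dots> = (\<Oplus>\<^bsub>fst Y\<^esub>s\<in>S. \<zero>\<^bsub>fst Y\<^esub>)"
        using sub c(1) hs by (intro Y.finsum_cong') (auto simp: linear_maps_smult[OF h(2)] Pi_def subset_iff)
      also have "\<dots> = \<zero>\<^bsub>fst Y\<^esub>" by (rule Y.finsum_zero)
      finally show ?thesis .
    qed
    moreover have "h v = undefined" if "v \<notin> carrier (fst X)" for v
      using that linear_maps_undefined[OF h(2)] by simp
    ultimately show "f = \<zero>\<^bsub>Hom ?M X Y\<^esub>" using h by (auto simp: restrict_def)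
  qed (simp add: fin)
qed

text \<open>Algebras and modules on arbitrary types are moved to the type \<open>nat \<Rightarrow> 'k\<close> in this way; for vector
  spaces the multiplication is a dummy.\<close>

definition transport :: "('k, 'v) module \<Rightarrow> ('v \<Rightarrow> 'w) \<Rightarrow> ('k, 'w) module" where
  "transport V \<phi> = (let \<psi> = the_inv_into (carrier V) \<phi> in
     \<lparr>carrier = \<phi> ` carrier V, mult = (\<lambda>x y. \<phi> (\<psi> x \<otimes>\<^bsub>V\<^esub> \<psi> y)), one = \<phi> \<one>\<^bsub>V\<^esub>, zero = \<phi> \<zero>\<^bsub>V\<^esub>,
      add = (\<lambda>x y. \<phi> (\<psi> x \<oplus>\<^bsub>V\<^esub> \<psi> y)), smult = (\<lambda>c x. \<phi> (c \<odot>\<^bsub>V\<^esub> \<psi> x))\<rparr>)"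

lemma transport_simps:
  assumes "inj_on \<phi> (carrier V)"
  shows "carrier (transport V \<phi>) = \<phi> ` carrier V"
    "\<one>\<^bsub>transport V \<phi>\<^esub> = \<phi> \<one>\<^bsub>V\<^esub>" "\<zero>\<^bsub>transport V \<phi>\<^esub> = \<phi> \<zero>\<^bsub>V\<^esub>"
    "x \<in> carrier V \<Longrightarrow> y \<in> carrier V \<Longrightarrow> \<phi> x \<otimes>\<^bsub>transport V \<phi>\<^esub> \<phi> y = \<phi> (x \<otimes>\<^bsub>V\<^esub> y)"
    "x \<in> carrier V \<Longrightarrow> y \<in> carrier V \<Longrightarrow> \<phi> x \<oplus>\<^bsub>transport V \<phi>\<^esub> \<phi> y = \<phi> (x \<oplus>\<^bsub>V\<^esub> y)"
    "x \<in> carrier V \<Longrightarrow> c \<odot>\<^bsub>transport V \<phi>\<^esub> \<phi> x = \<phi> (c \<odot>\<^bsub>V\<^esub> x)"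
  using assms by (simp_all add: transport_def Let_def the_inv_into_f_f)

lemma transport_fd:
  assumes K: "field K" and V: "fd_space K V" and inj: "inj_on \<phi> (carrier V)"
  shows "fd_space K (transport V \<phi>)" "restrict \<phi> (carrier V) \<in> linear_maps K V (transport V \<phi>)"
proof -
  let ?W = "transport V \<phi>" and ?\<psi> = "the_inv_into (carrier V) \<phi>"
  interpret V: module K V using V by (simp add: fd_space_def)
  note [simp] = transport_simps[OF inj] the_inv_into_f_f[OF inj]
  have W: "module K ?W"
    by (rule module_pointwise[where I = UNIV and W = "\<lambda>_::unit. V" and ev = "\<lambda>_. ?\<psi>"])
      (use V.module_axioms in \<open>auto simp: module_def\<close>)
  have "restrict ?\<psi> (carrier ?W) \<in> linear_maps K ?W V"
    by (intro restrict_linear_maps W) auto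
  moreover have "inj_on (restrict ?\<psi> (carrier ?W)) (carrier ?W)"
    by (auto intro!: inj_onI)
  ultimately show "fd_space K ?W" by (rule fd_space_injective[OF K W V])
  show "restrict \<phi> (carrier V) \<in> linear_maps K V ?W"
    by (intro restrict_linear_maps V.module_axioms) auto
qed

lemma fd_space_inj_nat:
  fixes V :: "('k, 'v) module"
  assumes K: "field K" and V: "fd_space K V"
  obtains \<phi> :: "'v \<Rightarrow> nat \<Rightarrow> 'k" where "inj_on \<phi> (carrier V)"
proof -
  obtain n :: nat and \<phi> where \<phi>: "\<And>i. i < n \<Longrightarrow> \<phi> i \<in> linear_maps K V (scalars K)"
    "\<And>v w. v \<in> carrier V \<Longrightarrow> w \<in> carrier V \<Longrightarrow> (\<And>i. i < n \<Longrightarrow> \<phi> i v = \<phi> i w) \<Longrightarrow> v = w"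
    by (rule fd_space_functionals[OF K V]) blast
  have "inj_on (\<lambda>v i. \<phi> i v) (carrier V)"
  proof (rule inj_onI)
    fix v w assume "v \<in> carrier V" "w \<in> carrier V" "(\<lambda>i. \<phi> i v) = (\<lambda>i. \<phi> i w)"
    then show "v = w" by (intro \<phi>(2)) (auto dest: fun_cong)
  qed
  then show thesis by (rule that)
qed

lemma fd_algebra_transport:
  assumes K: "field K" and A: "fd_algebra K A" and inj: "inj_on \<phi> (carrier A)"
  shows "fd_algebra K (transport A \<phi>)"
proof -
  interpret A: ring A using A by (simp add: fd_algebra_def)
  have fdA: "fd_space K A" using A by (simp add: fd_algebra_def)
  then interpret AM: module K A by (simp add: fd_space_def)
  note [simp] = transport_simps[OF inj] the_inv_into_f_f[OF inj]
  have fd: "fd_space K (transport A \<phi>)" using transport_fd[OF K fdA inj] by simp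
  then interpret T: module K "transport A \<phi>" by (simp add: fd_space_def)
  have "ring (transport A \<phi>)"
    by (rule ringI[OF T.abelian_group_axioms])
      (auto simp: A.m_assoc A.l_distr A.r_distr intro!: monoidI)
  then show ?thesis
    using A fd unfolding fd_algebra_def by auto
qed

lemma fd_left_module_transport:
  fixes V :: "('k, 'v) module" and \<phi> :: "'v \<Rightarrow> 'w"
  assumes K: "field K" and M: "fd_left_module K A (V, r)" and inj: "inj_on \<phi> (carrier V)"
  shows "fd_left_module K A (transport V \<phi>, \<lambda>a x. \<phi> (r a (the_inv_into (carrier V) \<phi> x)))"
proof -
  have fd: "fd_space K V" using fd_left_moduleD(1)[OF M] by simp
  interpret V: module K V using fd by (simp add: fd_space_def)
  note [simp] = transport_simps[OF inj] the_inv_into_f_f[OF inj] fd_left_moduleD(3-)[OF M, simplified]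
  show ?thesis
    by (rule fd_left_moduleI) (auto simp: transport_fd[OF K fd inj])
qed

lemma fd_left_module_restrict:
  assumes M: "fd_left_module K B (W, r)"
    and "\<And>a. a \<in> carrier A \<Longrightarrow> f a \<in> carrier B"
    and "\<And>a b. a \<in> carrier A \<Longrightarrow> b \<in> carrier A \<Longrightarrow> f (a \<oplus>\<^bsub>A\<^esub> b) = f a \<oplus>\<^bsub>B\<^esub> f b"
    and "\<And>c a. c \<in> carrier K \<Longrightarrow> a \<in> carrier A \<Longrightarrow> f (c \<odot>\<^bsub>A\<^esub> a) = c \<odot>\<^bsub>B\<^esub> f a"
    and "\<And>a b. a \<in> carrier A \<Longrightarrow> b \<in> carrier A \<Longrightarrow> f (a \<otimes>\<^bsub>A\<^esub> b) = f a \<otimes>\<^bsub>B\<^esub> f b"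
    and "f \<one>\<^bsub>A\<^esub> = \<one>\<^bsub>B\<^esub>"
  shows "fd_left_module K A (W, \<lambda>a. r (f a))"
  using fd_left_moduleD[OF M, simplified] by (intro fd_left_moduleI) (simp_all add: assms(2-))

lemma regular_module:
  assumes "fd_algebra K A" shows "fd_left_module K A (A, mult A)"
proof -
  interpret A: ring A using assms by (simp add: fd_algebra_def)
  show ?thesis
    using assms by (intro fd_left_moduleI) (auto simp: fd_algebra_def A.l_distr A.r_distr A.m_assoc)
qed

subsection \<open>Powers of modules\<close>

definition power_module :: "('k, 'a, 'v) lmod \<Rightarrow> 's set \<Rightarrow> ('k, 'a, 's \<Rightarrow> 'v) lmod" where
  "power_module X S = (\<lparr>carrier = S \<rightarrow>\<^sub>E carrier (fst X), mult = undefined, one = undefined,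
     zero = (\<lambda>s\<in>S. \<zero>\<^bsub>fst X\<^esub>), add = (\<lambda>v w. \<lambda>s\<in>S. v s \<oplus>\<^bsub>fst X\<^esub> w s),
     smult = (\<lambda>c v. \<lambda>s\<in>S. c \<odot>\<^bsub>fst X\<^esub> v s)\<rparr>, \<lambda>a v. \<lambda>s\<in>S. snd X a (v s))"

lemma power_module_simps [simp]:
  "carrier (fst (power_module X S)) = S \<rightarrow>\<^sub>E carrier (fst X)"
  "zero (fst (power_module X S)) = (\<lambda>s\<in>S. \<zero>\<^bsub>fst X\<^esub>)"
  "add (fst (power_module X S)) v w = (\<lambda>s\<in>S. v s \<oplus>\<^bsub>fst X\<^esub> w s)"
  "smult (fst (power_module X S)) c v = (\<lambda>s\<in>S. c \<odot>\<^bsub>fst X\<^esub> v s)"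
  "snd (power_module X S) a v = (\<lambda>s\<in>S. snd X a (v s))"
  by (simp_all add: power_module_def)

lemma fd_left_module_power:
  assumes K: "field K" and S: "finite S" and X: "fd_left_module K A X"
  shows "fd_left_module K A (power_module X S)"
proof -
  interpret K: field K by fact
  interpret X: module K "fst X" using X by (simp add: fd_left_moduleD)
  let ?W = "fst (power_module X S)"
  note [simp] = fd_left_moduleD(3-)[OF X]
  have wS [simp]: "w s \<in> carrier (fst X)" if "w \<in> S \<rightarrow>\<^sub>E carrier (fst X)" "s \<in> S" for w s
    using that by auto
  have ext: "v = w" if "v \<in> S \<rightarrow>\<^sub>E carrier (fst X)" "w \<in> S \<rightarrow>\<^sub>E carrier (fst X)" "\<And>s. s \<in> S \<Longrightarrow> v s = w s" for v w
    using that by (rule PiE_ext)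
  have restr: "restrict w S = w" if "w \<in> S \<rightarrow>\<^sub>E carrier (fst X)" for w
    using that by (simp add: PiE_restrict)
  have SK: "module K (scalars K)" by (rule module_scalars) (rule K.is_cring)
  have W: "module K ?W"
    by (rule module_pointwise[where I = S and W = "\<lambda>_. fst X" and ev = "\<lambda>s w. w s"])
      (use K.is_cring X.module_axioms in \<open>auto intro: ext\<close>)
  obtain n :: nat and \<phi> where \<phi>: "\<And>i. i < n \<Longrightarrow> \<phi> i \<in> linear_maps K (fst X) (scalars K)"
    "\<And>v w. v \<in> carrier (fst X) \<Longrightarrow> w \<in> carrier (fst X) \<Longrightarrow> (\<And>i. i < n \<Longrightarrow> \<phi> i v = \<phi> i w) \<Longrightarrow> v = w"
    by (rule fd_space_functionals[OF K fd_left_moduleD(1)[OF X]]) blast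
  have fd: "fd_space K ?W"
  proof (rule fd_spaceI[OF K W, where I = "S \<times> {..<n}" and \<phi> = "\<lambda>(s, i). \<lambda>w\<in>carrier ?W. \<phi> i (w s)"])
    fix p assume "p \<in> S \<times> {..<n}"
    then obtain s i where p: "p = (s, i)" "s \<in> S" "i < n" by auto
    note l = \<phi>(1)[OF p(3)]
    have "(\<lambda>w\<in>carrier ?W. \<phi> i (w s)) \<in> linear_maps K ?W (scalars K)"
      using p linear_maps_closed[OF l] linear_maps_add[OF l] linear_maps_smult[OF l]
      by (intro restrict_linear_maps W) auto
    then show "(case p of (s, i) \<Rightarrow> \<lambda>w\<in>carrier ?W. \<phi> i (w s)) \<in> linear_maps K ?W (scalars K)"
      using p by simp
  next
    fix w assume w: "w \<in> carrier ?W"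
      and z: "\<And>p. p \<in> S \<times> {..<n} \<Longrightarrow> (case p of (s, i) \<Rightarrow> \<lambda>w\<in>carrier ?W. \<phi> i (w s)) w = \<zero>\<^bsub>K\<^esub>"
    have "w s = \<zero>\<^bsub>fst X\<^esub>" if s: "s \<in> S" for s
    proof (rule \<phi>(2))
      fix i assume i: "i < n"
      show "\<phi> i (w s) = \<phi> i \<zero>\<^bsub>fst X\<^esub>"
        using z[of "(s, i)"] s i w linear_maps_zero[OF X.module_axioms SK \<phi>(1)[OF i]] by simp
    qed (use s w in auto)
    then show "w = \<zero>\<^bsub>?W\<^esub>" using w by (intro ext) auto
  qed (use S in auto)
  have "fd_left_module K A (?W, snd (power_module X S))"
    by (rule fd_left_moduleI) (use fd in \<open>auto simp: restr intro!: restrict_ext cong: restrict_cong\<close>)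
  then show ?thesis by simp
qed

subsection \<open>Progenerators\<close>

lemma (in cat) iso_homE:
  assumes "is_iso C t" "t \<in> hom_set C X Y"
  obtains s where "s \<in> Arr C" "Dom C s = Y" "Cod C s = X" "s \<cdot> t = Id C X" "t \<cdot> s = Id C Y"
  by (rule isoE[OF assms(1)]) (use assms(2) that in auto)

abbreviation app :: "('k, 'a, 'v) lmod \<times> ('v \<Rightarrow> 'v) \<times> ('k, 'a, 'v) lmod \<Rightarrow> 'v \<Rightarrow> 'v" where
  "app f \<equiv> fst (snd f)"

lemma
  assumes "f \<in> hom_set (fd_mod K A) X Y"
  shows app_closed: "x \<in> carrier (fst X) \<Longrightarrow> app f x \<in> carrier (fst Y)"
    and app_linear: "app f \<in> linear_maps K (fst X) (fst Y)"
    and app_add: "x \<in> carrier (fst X) \<Longrightarrow> y \<in> carrier (fst X) \<Longrightarrow>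
      app f (x \<oplus>\<^bsub>fst X\<^esub> y) = app f x \<oplus>\<^bsub>fst Y\<^esub> app f y"
    and app_smult: "c \<in> carrier K \<Longrightarrow> x \<in> carrier (fst X) \<Longrightarrow> app f (c \<odot>\<^bsub>fst X\<^esub> x) = c \<odot>\<^bsub>fst Y\<^esub> app f x"
    and app_act: "a \<in> carrier A \<Longrightarrow> x \<in> carrier (fst X) \<Longrightarrow> app f (snd X a x) = snd Y a (app f x)"
proof -
  obtain h where h: "f = (X, h, Y)" "h \<in> linear_maps K (fst X) (fst Y)"
    "\<And>a v. a \<in> carrier A \<Longrightarrow> v \<in> carrier (fst X) \<Longrightarrow> h (snd X a v) = snd Y a (h v)"
    "\<And>v. v \<in> carrier (fst X) \<Longrightarrow> h v \<in> carrier (fst Y)" using assms by (rule fd_mod_homE) blast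
  then show "x \<in> carrier (fst X) \<Longrightarrow> app f x \<in> carrier (fst Y)"
    "app f \<in> linear_maps K (fst X) (fst Y)"
    "x \<in> carrier (fst X) \<Longrightarrow> y \<in> carrier (fst X) \<Longrightarrow>
      app f (x \<oplus>\<^bsub>fst X\<^esub> y) = app f x \<oplus>\<^bsub>fst Y\<^esub> app f y"
    "c \<in> carrier K \<Longrightarrow> x \<in> carrier (fst X) \<Longrightarrow> app f (c \<odot>\<^bsub>fst X\<^esub> x) = c \<odot>\<^bsub>fst Y\<^esub> app f x"
    "a \<in> carrier A \<Longrightarrow> x \<in> carrier (fst X) \<Longrightarrow> app f (snd X a x) = snd Y a (app f x)"
    using linear_maps_add[OF h(2)] linear_maps_smult[OF h(2)] by simp_all
qed

lemma app_comp:
  assumes "f \<in> hom_set (fd_mod K A) X Y" "g \<in> hom_set (fd_mod K A) Y Z" "x \<in> carrier (fst X)"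
  shows "app (g \<cdot>\<^bsub>fd_mod K A\<^esub> f) x = app g (app f x)"
  by (rule fd_mod_homE[OF assms(1)], rule fd_mod_homE[OF assms(2)]) (use assms(3) in simp)

lemma app_eqI:
  assumes "f \<in> hom_set (fd_mod K A) X Y" "g \<in> hom_set (fd_mod K A) X Y"
    "\<And>x. x \<in> carrier (fst X) \<Longrightarrow> app f x = app g x"
  shows "f = g"
proof -
  obtain h where h: "f = (X, h, Y)" "h \<in> linear_maps K (fst X) (fst Y)"
    using assms(1) by (rule fd_mod_homE)
  obtain k where k: "g = (X, k, Y)" "k \<in> linear_maps K (fst X) (fst Y)"
    using assms(2) by (rule fd_mod_homE)
  show ?thesis using linear_maps_eqI[OF h(2) k(2)] assms(3) h(1) k(1) by simp
qed

lemma fd_mod_homI: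
  assumes X: "fd_left_module K A X" and Y: "fd_left_module K A Y"
    and "\<And>x. x \<in> carrier (fst X) \<Longrightarrow> h x \<in> carrier (fst Y)"
    and "\<And>x y. x \<in> carrier (fst X) \<Longrightarrow> y \<in> carrier (fst X) \<Longrightarrow> h (x \<oplus>\<^bsub>fst X\<^esub> y) = h x \<oplus>\<^bsub>fst Y\<^esub> h y"
    and "\<And>c x. c \<in> carrier K \<Longrightarrow> x \<in> carrier (fst X) \<Longrightarrow> h (c \<odot>\<^bsub>fst X\<^esub> x) = c \<odot>\<^bsub>fst Y\<^esub> h x"
    and "\<And>a x. a \<in> carrier A \<Longrightarrow> x \<in> carrier (fst X) \<Longrightarrow> h (snd X a x) = snd Y a (h x)"
  shows "(X, restrict h (carrier (fst X)), Y) \<in> hom_set (fd_mod K A) X Y"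
proof -
  have "restrict h (carrier (fst X)) \<in> linear_maps K (fst X) (fst Y)"
    using assms fd_left_moduleD(2)[OF X] by (intro restrict_linear_maps) auto
  then show ?thesis using assms fd_left_moduleD(3)[OF X] by (simp add: fd_mod_Arr)
qed

lemma fd_mod_iso_bij:
  assumes K: "cring K" and f: "is_iso (fd_mod K A) f" "f \<in> hom_set (fd_mod K A) X Y"
  shows "bij_betw (app f) (carrier (fst X)) (carrier (fst Y))"
proof -
  interpret M: lcat K "fd_mod K A" by unfold_locales (rule fd_mod_linear_category[OF K])
  obtain g where g': "g \<in> Arr (fd_mod K A)" "Dom (fd_mod K A) g = Y" "Cod (fd_mod K A) g = X"
    "g \<cdot>\<^bsub>fd_mod K A\<^esub> f = Id (fd_mod K A) X" "f \<cdot>\<^bsub>fd_mod K A\<^esub> g = Id (fd_mod K A) Y"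
    by (rule M.iso_homE[OF f])
  then have g: "g \<in> hom_set (fd_mod K A) Y X" "g \<cdot>\<^bsub>fd_mod K A\<^esub> f = Id (fd_mod K A) X"
    "f \<cdot>\<^bsub>fd_mod K A\<^esub> g = Id (fd_mod K A) Y" by auto
  show ?thesis
  proof (rule bij_betwI[of _ _ _ "app g"])
    show "app g (app f x) = x" if "x \<in> carrier (fst X)" for x
      using app_comp[OF f(2) g(1) that] g(2) that by simp
    show "app f (app g y) = y" if "y \<in> carrier (fst Y)" for y
      using app_comp[OF g(1) f(2) that] g(3) that by simp
  qed (use app_closed[OF f(2)] app_closed[OF g(1)] in auto)
qed

lemma fd_mod_bij_iso:
  assumes K: "cring K" and f: "f \<in> hom_set (fd_mod K A) X Y"
    and bij: "bij_betw (app f) (carrier (fst X)) (carrier (fst Y))"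
  shows "is_iso (fd_mod K A) f"
proof -
  interpret M: lcat K "fd_mod K A" by unfold_locales (rule fd_mod_linear_category[OF K])
  have XY: "fd_left_module K A X" "fd_left_module K A Y"
    using f M.Dom_Obj[of f] M.Cod_Obj[of f] by auto
  interpret X: module K "fst X" using XY by (simp add: fd_left_moduleD)
  let ?g = "the_inv_into (carrier (fst X)) (app f)"
  have inj: "inj_on (app f) (carrier (fst X))" and im: "app f ` carrier (fst X) = carrier (fst Y)"
    using bij by (auto simp: bij_betw_def)
  have gf: "?g (app f x) = x" if "x \<in> carrier (fst X)" for x
    using that inj by (simp add: the_inv_into_f_f)
  have yE: "\<exists>x\<in>carrier (fst X). y = app f x" if "y \<in> carrier (fst Y)" for y using that im by blast
  let ?G = "(Y, restrict ?g (carrier (fst Y)), X)"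
  have G: "?G \<in> hom_set (fd_mod K A) Y X"
  proof (rule fd_mod_homI[OF XY(2,1)])
    show "?g y \<in> carrier (fst X)" if "y \<in> carrier (fst Y)" for y
      using yE[OF that] gf by auto
    show "?g (y \<oplus>\<^bsub>fst Y\<^esub> z) = ?g y \<oplus>\<^bsub>fst X\<^esub> ?g z" if "y \<in> carrier (fst Y)" "z \<in> carrier (fst Y)" for y z
      using yE[OF that(1)] yE[OF that(2)] gf by (auto simp: app_add[OF f, symmetric])
    show "?g (c \<odot>\<^bsub>fst Y\<^esub> y) = c \<odot>\<^bsub>fst X\<^esub> ?g y" if "c \<in> carrier K" "y \<in> carrier (fst Y)" for y c
      using yE[OF that(2)] that(1) gf by (auto simp: app_smult[OF f, symmetric])
    show "?g (snd Y a y) = snd X a (?g y)" if "a \<in> carrier A" "y \<in> carrier (fst Y)" for y a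
      using yE[OF that(2)] that(1) gf fd_left_moduleD(3)[OF XY(1)] by (auto simp: app_act[OF f, symmetric])
  qed
  show ?thesis
  proof (rule M.isoI[of f ?G])
    have "?G \<cdot>\<^bsub>fd_mod K A\<^esub> f = Id (fd_mod K A) X"
    proof (rule app_eqI)
      fix x assume x: "x \<in> carrier (fst X)"
      show "app (?G \<cdot>\<^bsub>fd_mod K A\<^esub> f) x = app (Id (fd_mod K A) X) x"
        unfolding app_comp[OF f G x] using x app_closed[OF f x] gf by simp
    qed (use f G XY M.Id_Arr[of X] M.Dom_Id[of X] M.Cod_Id[of X] in auto)
    then show "?G \<cdot>\<^bsub>fd_mod K A\<^esub> f = Id (fd_mod K A) (Dom (fd_mod K A) f)" using f by simp
    have "f \<cdot>\<^bsub>fd_mod K A\<^esub> ?G = Id (fd_mod K A) Y"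
    proof (rule app_eqI)
      fix y assume y: "y \<in> carrier (fst Y)"
      show "app (f \<cdot>\<^bsub>fd_mod K A\<^esub> ?G) y = app (Id (fd_mod K A) Y) y"
        unfolding app_comp[OF G f y] using y f_the_inv_into_f[OF inj] im by simp
    qed (use f G XY M.Id_Arr[of Y] M.Dom_Id[of Y] M.Cod_Id[of Y] in auto)
    then show "f \<cdot>\<^bsub>fd_mod K A\<^esub> ?G = Id (fd_mod K A) (Cod (fd_mod K A) f)" using f by simp
  qed (use f G in auto)
qed

text \<open>The opposite of the endomorphism algebra, so that \<open>Hom(P, X)\<close> is a left module by
  precomposition.\<close>

definition end_alg :: "('k, 'o, 'm) lincat \<Rightarrow> 'o \<Rightarrow> ('k, 'm) module" where
  "end_alg C P = (Hom C P P)\<lparr>mult := (\<lambda>a b. b \<cdot>\<^bsub>C\<^esub> a), one := Id C P\<rparr>"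

lemma end_alg_simps [simp]:
  "carrier (end_alg C P) = hom_set C P P" "mult (end_alg C P) a b = b \<cdot>\<^bsub>C\<^esub> a" "one (end_alg C P) = Id C P"
  "zero (end_alg C P) = HZero C P P" "add (end_alg C P) = HAdd C" "smult (end_alg C P) = HSmult C"
  by (simp_all add: end_alg_def)

definition hom_finite :: "'k ring \<Rightarrow> ('k, 'o, 'm) lincat \<Rightarrow> bool" where
  "hom_finite K C \<longleftrightarrow> (\<forall>X\<in>Obj C. \<forall>Y\<in>Obj C. fd_space K (Hom C X Y))"

text \<open>The functor \<open>Hom(P, -)\<close> is an equivalence onto the finite-dimensional \<open>End(P)\<close>-modules.  Its
  full faithfulness (second clause) says that \<open>P\<close> is dense: every \<open>X\<close> is the colimit of the arrows
  \<open>P \<rightarrow> X\<close>, linearly indexed.  In this form the property passes through left adjoint functors.\<close>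

definition progenerator :: "'k ring \<Rightarrow> ('k, 'o, 'm) lincat \<Rightarrow> 'o \<Rightarrow> bool" where
  "progenerator K C P \<longleftrightarrow> P \<in> Obj C \<and>
     (\<forall>X\<in>Obj C. \<forall>Y\<in>Obj C. \<forall>\<psi>\<in>linear_maps K (Hom C P X) (Hom C P Y).
        (\<forall>p\<in>hom_set C P X. \<forall>a\<in>hom_set C P P. \<psi> (p \<cdot>\<^bsub>C\<^esub> a) = \<psi> p \<cdot>\<^bsub>C\<^esub> a) \<longrightarrow>
        (\<exists>!f. f \<in> hom_set C X Y \<and> (\<forall>p\<in>hom_set C P X. \<psi> p = f \<cdot>\<^bsub>C\<^esub> p))) \<and>
     (\<forall>(W :: ('k, nat \<Rightarrow> 'k) module) r. fd_left_module K (end_alg C P) (W, r) \<longrightarrow>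
        (\<exists>X\<in>Obj C. \<exists>\<theta>\<in>linear_maps K (Hom C P X) W. bij_betw \<theta> (hom_set C P X) (carrier W) \<and>
           (\<forall>p\<in>hom_set C P X. \<forall>a\<in>hom_set C P P. \<theta> (p \<cdot>\<^bsub>C\<^esub> a) = r a (\<theta> p))))"

lemma progenerator_realize:
  fixes W :: "('k, nat \<Rightarrow> 'k) module"
  assumes "progenerator K C P" "fd_left_module K (end_alg C P) (W, r)"
  obtains X \<theta> where "X \<in> Obj C" "\<theta> \<in> linear_maps K (Hom C P X) W"
    "bij_betw \<theta> (hom_set C P X) (carrier W)"
    "\<And>p a. p \<in> hom_set C P X \<Longrightarrow> a \<in> hom_set C P P \<Longrightarrow> \<theta> (p \<cdot>\<^bsub>C\<^esub> a) = r a (\<theta> p)"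
proof -
  have "\<exists>X\<in>Obj C. \<exists>\<theta>\<in>linear_maps K (Hom C P X) W. bij_betw \<theta> (hom_set C P X) (carrier W) \<and>
    (\<forall>p\<in>hom_set C P X. \<forall>a\<in>hom_set C P P. \<theta> (p \<cdot>\<^bsub>C\<^esub> a) = r a (\<theta> p))"
    using assms unfolding progenerator_def by blast
  then show thesis using that by blast
qed

lemma progenerator_unique:
  assumes P: "progenerator K C P" and C: "lcat K C" and X: "X \<in> Obj C" "Y \<in> Obj C"
    and f: "f \<in> hom_set C X Y" "g \<in> hom_set C X Y" and eq: "\<And>p. p \<in> hom_set C P X \<Longrightarrow> f \<cdot>\<^bsub>C\<^esub> p = g \<cdot>\<^bsub>C\<^esub> p"
  shows "f = g"
proof -
  interpret lcat K C by fact
  have PO: "P \<in> Obj C" using P by (simp add: progenerator_def)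
  let ?\<psi> = "\<lambda>p\<in>hom_set C P X. f \<cdot>\<^bsub>C\<^esub> p"
  have "?\<psi> \<in> linear_maps K (Hom C P X) (Hom C P Y)"
    using f PO by (intro post_comp_linear)
  moreover have "\<forall>p\<in>hom_set C P X. \<forall>a\<in>hom_set C P P. ?\<psi> (p \<cdot>\<^bsub>C\<^esub> a) = ?\<psi> p \<cdot>\<^bsub>C\<^esub> a"
    using f by auto
  ultimately have "\<exists>!h. h \<in> hom_set C X Y \<and> (\<forall>p\<in>hom_set C P X. ?\<psi> p = h \<cdot>\<^bsub>C\<^esub> p)"
    using P X unfolding progenerator_def by blast
  moreover have "\<forall>p\<in>hom_set C P X. ?\<psi> p = f \<cdot>\<^bsub>C\<^esub> p" "\<forall>p\<in>hom_set C P X. ?\<psi> p = g \<cdot>\<^bsub>C\<^esub> p"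
    using eq by auto
  ultimately show ?thesis using f by blast
qed

lemma progenerator_extend:
  assumes P: "progenerator K C P" and C: "lcat K C" and X: "X \<in> Obj C" "Y \<in> Obj C"
    and cl: "\<And>p. p \<in> hom_set C P X \<Longrightarrow> \<psi> p \<in> hom_set C P Y"
    and add: "\<And>p p'. p \<in> hom_set C P X \<Longrightarrow> p' \<in> hom_set C P X \<Longrightarrow> \<psi> (HAdd C p p') = HAdd C (\<psi> p) (\<psi> p')"
    and smult: "\<And>c p. c \<in> carrier K \<Longrightarrow> p \<in> hom_set C P X \<Longrightarrow> \<psi> (HSmult C c p) = HSmult C c (\<psi> p)"
    and act: "\<And>p a. p \<in> hom_set C P X \<Longrightarrow> a \<in> hom_set C P P \<Longrightarrow> \<psi> (p \<cdot>\<^bsub>C\<^esub> a) = \<psi> p \<cdot>\<^bsub>C\<^esub> a"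
  obtains f where "f \<in> hom_set C X Y" "\<And>p. p \<in> hom_set C P X \<Longrightarrow> f \<cdot>\<^bsub>C\<^esub> p = \<psi> p"
proof -
  interpret lcat K C by fact
  have PO: "P \<in> Obj C" using P by (simp add: progenerator_def)
  have lin: "restrict \<psi> (hom_set C P X) \<in> linear_maps K (Hom C P X) (Hom C P Y)"
    by (rule restrict_linear_maps[OF hom_module[OF PO X(1)]])
      (simp_all only: Hom_simps(3,4) cl add smult)
  have act': "\<forall>p\<in>hom_set C P X. \<forall>a\<in>hom_set C P P.
    restrict \<psi> (hom_set C P X) (p \<cdot>\<^bsub>C\<^esub> a) = restrict \<psi> (hom_set C P X) p \<cdot>\<^bsub>C\<^esub> a"
    using act by simp
  have *: "\<forall>\<psi>\<in>linear_maps K (Hom C P X) (Hom C P Y).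
        (\<forall>p\<in>hom_set C P X. \<forall>a\<in>hom_set C P P. \<psi> (p \<cdot>\<^bsub>C\<^esub> a) = \<psi> p \<cdot>\<^bsub>C\<^esub> a) \<longrightarrow>
        (\<exists>!f. f \<in> hom_set C X Y \<and> (\<forall>p\<in>hom_set C P X. \<psi> p = f \<cdot>\<^bsub>C\<^esub> p))"
    using P X unfolding progenerator_def by blast
  obtain f where "f \<in> hom_set C X Y" "\<forall>p\<in>hom_set C P X. restrict \<psi> (hom_set C P X) p = f \<cdot>\<^bsub>C\<^esub> p"
    using *[rule_format, OF lin act'[rule_format]] by blast
  then show thesis using that by simp
qed

text \<open>Identities of modules are not unfolded below, so that the laws of a category apply to them.\<close>

declare fd_mod_simps(4) [simp del]

lemma finite_abelian_hom_finite:
  fixes K :: "'k ring" and C :: "('k, 'o, 'm) lincat"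
  assumes K: "field K" and C: "finite_abelian K C"
  shows "hom_finite K C"
proof -
  obtain A :: "('k, nat \<Rightarrow> 'k) module" where A: "fd_algebra K A"
    and eq: "linearly_equivalent K C (fd_mod K A :: ('k, ('k, nat \<Rightarrow> 'k, nat \<Rightarrow> 'k) lmod, _) lincat)"
    using C by (auto simp: finite_abelian_def)
  let ?M = "fd_mod K A :: ('k, ('k, nat \<Rightarrow> 'k, nat \<Rightarrow> 'k) lmod, _) lincat"
  obtain E where E: "linear_equivalence K C ?M E"
    by (rule linearly_equivalent_imp_equivalence[OF eq])
  then have lE: "linear_functor K C ?M E" by (simp add: linear_equivalence_def)
  interpret C: lcat K C using linear_functorD[OF lE] by simp
  interpret E: fctr C ?M E using linear_functorD[OF lE] by simp
  show ?thesis
    unfolding hom_finite_def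
  proof (intro ballI)
    fix X Y assume X: "X \<in> Obj C" and Y: "Y \<in> Obj C"
    have fd: "fd_space K (Hom ?M (FO E X) (FO E Y))"
      using E.FO_Obj[OF X] E.FO_Obj[OF Y] by (intro fd_mod_hom_fd[OF K]) auto
    let ?h = "restrict (FA E) (hom_set C X Y)"
    have "?h \<in> linear_maps K (Hom C X Y) (Hom ?M (FO E X) (FO E Y))"
      using X Y by (intro restrict_linear_maps C.hom_module) (auto simp: linear_functorD(4,5)[OF lE])
    moreover have "inj_on ?h (hom_set C X Y)"
      by (intro inj_onI linear_equivalence_faithful[OF E]) auto
    ultimately show "fd_space K (Hom C X Y)"
      by (rule fd_space_injective[OF K C.hom_module[OF X Y] fd])
  qed
qed

text \<open>The regular module is free on its unit; so an object \<open>E\<close> isomorphic to it has a free generator, the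
  image \<open>x\<close> of the unit.\<close>

lemma fd_mod_free_generator:
  fixes A :: "('k, 'a) module" and E :: "('k, 'a, 'a) lmod"
  assumes K: "cring K" and A: "fd_algebra K A" and t: "t \<in> hom_set (fd_mod K A) E (A, mult A)" "is_iso (fd_mod K A) t"
  obtains x where "x \<in> carrier (fst E)" "\<And>y. y \<in> carrier (fst E) \<Longrightarrow> \<exists>a\<in>carrier A. y = snd E a x"
    "\<And>Z z. fd_left_module K A Z \<Longrightarrow> z \<in> carrier (fst Z) \<Longrightarrow> \<exists>f\<in>hom_set (fd_mod K A) E Z. app f x = z"
proof -
  let ?M = "fd_mod K A" and ?R = "(A, mult A)"
  interpret A: ring A using A by (simp add: fd_algebra_def)
  interpret M: lcat K ?M by unfold_locales (rule fd_mod_linear_category[OF K])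
  have R: "fd_left_module K A ?R" by (rule regular_module[OF A])
  obtain s where s': "s \<in> Arr ?M" "Dom ?M s = ?R" "Cod ?M s = E"
    "s \<cdot>\<^bsub>?M\<^esub> t = Id ?M E" "t \<cdot>\<^bsub>?M\<^esub> s = Id ?M ?R"
    by (rule M.iso_homE[OF t(2,1)])
  then have s: "s \<in> hom_set ?M ?R E" by simp
  let ?x = "app s \<one>\<^bsub>A\<^esub>"
  show thesis
  proof (rule that[of ?x])
    show "?x \<in> carrier (fst E)" using app_closed[OF s] by simp
    fix y assume y: "y \<in> carrier (fst E)"
    have a: "app t y \<in> carrier A" using app_closed[OF t(1) y] by simp
    have "y = app s (app t y)" using app_comp[OF t(1) s y] y by (simp add: s'(4) fd_mod_simps(4))
    also have "\<dots> = app s (snd ?R (app t y) \<one>\<^bsub>A\<^esub>)" using a by simp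
    also have "\<dots> = snd E (app t y) ?x" by (rule app_act[OF s a]) simp
    finally show "\<exists>a\<in>carrier A. y = snd E a ?x" using a by blast
  next
    fix Z :: "('k, 'a, 'a) lmod" and z assume Z: "fd_left_module K A Z" and z: "z \<in> carrier (fst Z)"
    let ?f = "(?R, restrict (\<lambda>x. snd Z x z) (carrier (fst ?R)), Z)"
    have f: "?f \<in> hom_set ?M ?R Z"
      by (rule fd_mod_homI[OF R Z]) (use z fd_left_moduleD(3-)[OF Z] in auto)
    have ts: "app t ?x = \<one>\<^bsub>A\<^esub>" using app_comp[OF s t(1), of "\<one>\<^bsub>A\<^esub>"] by (simp add: s'(5) fd_mod_simps(4))
    have "app (?f \<cdot>\<^bsub>?M\<^esub> t) ?x = app ?f (app t ?x)" by (rule app_comp[OF t(1) f]) (use app_closed[OF s] in simp)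
    also have "\<dots> = z" unfolding ts using fd_left_moduleD(9)[OF Z z] by simp
    finally have "app (?f \<cdot>\<^bsub>?M\<^esub> t) ?x = z" .
    moreover have "?f \<cdot>\<^bsub>?M\<^esub> t \<in> hom_set ?M E Z" using M.comp_Arr[of t ?f] f t(1) by simp
    ultimately show "\<exists>f\<in>hom_set ?M E Z. app f ?x = z" by blast
  qed
qed

text \<open>Under an equivalence \<open>E\<close> with the modules over \<open>A\<close>, the object \<open>P\<close> with \<open>E(P) \<cong> A\<close> is a
  progenerator: the value at the free generator identifies \<open>Hom(P, X)\<close> with \<open>E(X)\<close>, and the action of
  \<open>A\<close> with the composition with endomorphisms of \<open>P\<close>.\<close>

lemma finite_abelian_progenerator:
  fixes K :: "'k ring" and C :: "('k, 'o, 'm) lincat"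
  assumes K: "field K" and C: "finite_abelian K C"
  obtains P where "progenerator K C P"
proof -
  obtain A :: "('k, nat \<Rightarrow> 'k) module" where A: "fd_algebra K A"
    and eq: "linearly_equivalent K C (fd_mod K A :: ('k, ('k, nat \<Rightarrow> 'k, nat \<Rightarrow> 'k) lmod, _) lincat)"
    using C by (auto simp: finite_abelian_def)
  let ?M = "fd_mod K A :: ('k, ('k, nat \<Rightarrow> 'k, nat \<Rightarrow> 'k) lmod, _) lincat"
  obtain E where E: "linear_equivalence K C ?M E"
    by (rule linearly_equivalent_imp_equivalence[OF eq])
  then have lE: "linear_functor K C ?M E" by (simp add: linear_equivalence_def)
  interpret C: lcat K C using linear_functorD[OF lE] by simp
  interpret M: lcat K ?M using linear_functorD[OF lE] by simp
  interpret E: fctr C ?M E using linear_functorD[OF lE] by simp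
  interpret A: ring A using A by (simp add: fd_algebra_def)
  interpret AM: module K A using A by (simp add: fd_algebra_def fd_space_def)
  have Kc: "cring K" using K by (simp add: field_def domain_def)
  have "(A, mult A) \<in> Obj ?M" using regular_module[OF A] by simp
  then obtain P t where P: "P \<in> Obj C" and t: "t \<in> hom_set ?M (FO E P) (A, mult A)" "is_iso ?M t"
    using E unfolding linear_equivalence_def by blast
  have EX: "fd_left_module K A (FO E X)" if "X \<in> Obj C" for X using E.FO_Obj[OF that] by simp
  note EP = fd_left_moduleD[OF EX[OF P]]
  obtain x where x: "x \<in> carrier (fst (FO E P))"
    and gen: "\<And>y. y \<in> carrier (fst (FO E P)) \<Longrightarrow> \<exists>a\<in>carrier A. y = snd (FO E P) a x"
    and free: "\<And>Z z. fd_left_module K A Z \<Longrightarrow> z \<in> carrier (fst Z) \<Longrightarrow> \<exists>f\<in>hom_set ?M (FO E P) Z. app f x = z"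
    by (rule fd_mod_free_generator[OF Kc A t]) blast
  define pt where "pt p = app (FA E p) x" for p
  have Ep: "FA E p \<in> hom_set ?M (FO E X) (FO E Y)" if "p \<in> hom_set C X Y" for p X Y using that by auto
  have pt: "pt p \<in> carrier (fst (FO E X))" if "p \<in> hom_set C P X" for p X
    unfolding pt_def by (rule app_closed[OF Ep[OF that] x])
  have pt_inj: "p = p'" if p: "p \<in> hom_set C P X" "p' \<in> hom_set C P X" and eq: "pt p = pt p'" for p p' X
  proof (rule linear_equivalence_faithful[OF E])
    show "FA E p = FA E p'"
    proof (rule app_eqI[OF Ep[OF p(1)] Ep[OF p(2)]])
      fix y assume "y \<in> carrier (fst (FO E P))"
      then obtain a where "a \<in> carrier A" "y = snd (FO E P) a x" using gen by blast
      then show "app (FA E p) y = app (FA E p') y"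
        using app_act[OF Ep[OF p(1)] _ x] app_act[OF Ep[OF p(2)] _ x] eq by (simp add: pt_def)
    qed
  qed (use p in auto)
  have pt_surj: "\<exists>p\<in>hom_set C P X. pt p = z" if X: "X \<in> Obj C" and z: "z \<in> carrier (fst (FO E X))" for X z
  proof -
    obtain f where f: "f \<in> hom_set ?M (FO E P) (FO E X)" "app f x = z" using free[OF EX[OF X] z] by blast
    obtain p where "p \<in> Arr C" "Dom C p = P" "Cod C p = X" "FA E p = f"
      by (rule linear_equivalence_full[OF E P X f(1)])
    then show ?thesis using f(2) by (intro bexI[of _ p]) (auto simp: pt_def)
  qed
  have pt_add: "pt (HAdd C p p') = pt p \<oplus>\<^bsub>fst (FO E X)\<^esub> pt p'"
    if p: "p \<in> hom_set C P X" "p' \<in> hom_set C P X" for p p' X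
  proof -
    obtain h where h: "FA E p = (FO E P, h, FO E X)" by (rule fd_mod_homE[OF Ep[OF p(1)]])
    obtain h' where h': "FA E p' = (FO E P, h', FO E X)" by (rule fd_mod_homE[OF Ep[OF p(2)]])
    have "FA E (HAdd C p p') = HAdd ?M (FA E p) (FA E p')" using p by (auto simp: linear_functorD(4)[OF lE])
    then show ?thesis using x by (simp add: pt_def h h')
  qed
  have pt_smult: "pt (HSmult C c p) = c \<odot>\<^bsub>fst (FO E X)\<^esub> pt p"
    if p: "c \<in> carrier K" "p \<in> hom_set C P X" for p c X
  proof -
    obtain h where h: "FA E p = (FO E P, h, FO E X)" by (rule fd_mod_homE[OF Ep[OF p(2)]])
    have "FA E (HSmult C c p) = HSmult ?M c (FA E p)" using p by (auto simp: linear_functorD(5)[OF lE])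
    then show ?thesis using x by (simp add: pt_def h)
  qed
  have pt_comp: "pt (f \<cdot>\<^bsub>C\<^esub> p) = app (FA E f) (pt p)" if p: "p \<in> hom_set C P X" and f: "f \<in> hom_set C X Y" for p f X Y
    using app_comp[OF Ep[OF p] Ep[OF f] x] p f by (auto simp: pt_def)
  \<comment> \<open>the endomorphism of \<open>P\<close> that corresponds to the right multiplication with \<open>a\<close>\<close>
  have "\<forall>a\<in>carrier A. \<exists>f. f \<in> hom_set C P P \<and> pt f = snd (FO E P) a x"
    using pt_surj[OF P] EP(3)[OF _ x] by blast
  from bchoice[OF this] obtain e where e: "\<And>a. a \<in> carrier A \<Longrightarrow> e a \<in> hom_set C P P"
    and pt_of_e: "\<And>a. a \<in> carrier A \<Longrightarrow> pt (e a) = snd (FO E P) a x" by blast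
  have e': "e a \<in> Arr C" "Dom C (e a) = P" "Cod C (e a) = P" if "a \<in> carrier A" for a
    using e[OF that] by auto
  have pt_e: "pt (p \<cdot>\<^bsub>C\<^esub> e a) = snd (FO E X) a (pt p)" if p: "p \<in> hom_set C P X" and a: "a \<in> carrier A" for p a X
    by (simp only: pt_comp[OF e[OF a] p] pt_of_e[OF a] app_act[OF Ep[OF p] a x]) (simp only: pt_def)
  have e_surj: "\<exists>a\<in>carrier A. f = e a" if f: "f \<in> hom_set C P P" for f
  proof -
    obtain a where a: "a \<in> carrier A" "pt f = snd (FO E P) a x" using gen[OF pt[OF f]] by blast
    have "f = e a" by (rule pt_inj[OF f e[OF a(1)]]) (use a pt_of_e in simp)
    then show ?thesis using a(1) by blast
  qed
  have "progenerator K C P"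
    unfolding progenerator_def
  proof (intro conjI ballI allI impI P)
    fix X Y \<psi> assume X: "X \<in> Obj C" and Y: "Y \<in> Obj C" and psi: "\<psi> \<in> linear_maps K (Hom C P X) (Hom C P Y)"
      and act: "\<forall>p\<in>hom_set C P X. \<forall>a\<in>hom_set C P P. \<psi> (p \<cdot>\<^bsub>C\<^esub> a) = \<psi> p \<cdot>\<^bsub>C\<^esub> a"
    have psic: "\<psi> p \<in> hom_set C P Y" if "p \<in> hom_set C P X" for p using linear_maps_closed[OF psi that] .
    define qq where "qq = the_inv_into (hom_set C P X) pt"
    have inj: "inj_on pt (hom_set C P X)" by (rule inj_onI) (rule pt_inj)
    have qq: "qq (pt p) = p" if "p \<in> hom_set C P X" for p
      unfolding qq_def by (rule the_inv_into_f_f[OF inj that])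
    let ?k = "\<lambda>z. pt (\<psi> (qq z))"
    have k: "(FO E X, restrict ?k (carrier (fst (FO E X))), FO E Y) \<in> hom_set ?M (FO E X) (FO E Y)"
    proof (rule fd_mod_homI[OF EX[OF X] EX[OF Y]])
      fix z assume "z \<in> carrier (fst (FO E X))"
      then obtain p where p: "p \<in> hom_set C P X" "z = pt p" using pt_surj[OF X] by metis
      show "?k z \<in> carrier (fst (FO E Y))" unfolding p(2) qq[OF p(1)] by (rule pt[OF psic[OF p(1)]])
      show "?k (c \<odot>\<^bsub>fst (FO E X)\<^esub> z) = c \<odot>\<^bsub>fst (FO E Y)\<^esub> ?k z" if c: "c \<in> carrier K" for c
      proof -
        have m: "HSmult C c p \<in> hom_set C P X" using p c by auto
        show ?thesis
          unfolding p(2) pt_smult[OF c p(1), symmetric] qq[OF p(1)] qq[OF m]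
          using linear_maps_smult[OF psi c p(1)] pt_smult[OF c psic[OF p(1)]] by simp
      qed
      show "?k (snd (FO E X) a z) = snd (FO E Y) a (?k z)" if a: "a \<in> carrier A" for a
      proof -
        have m: "p \<cdot>\<^bsub>C\<^esub> e a \<in> hom_set C P X" using p e'[OF a] by auto
        show ?thesis
          unfolding p(2) pt_e[OF p(1) a, symmetric] qq[OF p(1)] qq[OF m]
          using act p(1) e[OF a] pt_e[OF psic[OF p(1)] a] by simp
      qed
      fix z' assume "z' \<in> carrier (fst (FO E X))"
      then obtain p' where p': "p' \<in> hom_set C P X" "z' = pt p'" using pt_surj[OF X] by metis
      have m: "HAdd C p p' \<in> hom_set C P X" using p p' by auto
      show "?k (z \<oplus>\<^bsub>fst (FO E X)\<^esub> z') = ?k z \<oplus>\<^bsub>fst (FO E Y)\<^esub> ?k z'"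
        unfolding p(2) p'(2) pt_add[OF p(1) p'(1), symmetric] qq[OF p(1)] qq[OF p'(1)] qq[OF m]
        using linear_maps_add[OF psi p(1) p'(1)] pt_add[OF psic[OF p(1)] psic[OF p'(1)]] by simp
    qed
    obtain f where f: "f \<in> Arr C" "Dom C f = X" "Cod C f = Y"
      "FA E f = (FO E X, restrict ?k (carrier (fst (FO E X))), FO E Y)"
      by (rule linear_equivalence_full[OF E X Y k])
    have f': "f \<in> hom_set C X Y" using f by simp
    have fp: "\<psi> p = f \<cdot>\<^bsub>C\<^esub> p" if p: "p \<in> hom_set C P X" for p
    proof (rule pt_inj[OF psic[OF p]])
      show "f \<cdot>\<^bsub>C\<^esub> p \<in> hom_set C P Y" using p f by auto
      show "pt (\<psi> p) = pt (f \<cdot>\<^bsub>C\<^esub> p)"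
        using pt_comp[OF p f'] pt[OF p] qq[OF p] by (simp add: f(4))
    qed
    show "\<exists>!f. f \<in> hom_set C X Y \<and> (\<forall>p\<in>hom_set C P X. \<psi> p = f \<cdot>\<^bsub>C\<^esub> p)"
    proof (rule ex1I[of _ f])
      show "f \<in> hom_set C X Y \<and> (\<forall>p\<in>hom_set C P X. \<psi> p = f \<cdot>\<^bsub>C\<^esub> p)" using f' fp by blast
      fix g assume g: "g \<in> hom_set C X Y \<and> (\<forall>p\<in>hom_set C P X. \<psi> p = g \<cdot>\<^bsub>C\<^esub> p)"
      have "FA E g = FA E f"
      proof (rule app_eqI[where K = K and A = A])
        fix z assume "z \<in> carrier (fst (FO E X))"
        then obtain p where p: "p \<in> hom_set C P X" "pt p = z" using pt_surj[OF X] by metis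
        have "g \<cdot>\<^bsub>C\<^esub> p = f \<cdot>\<^bsub>C\<^esub> p" using g fp p(1) by metis
        then show "app (FA E g) z = app (FA E f) z"
          using pt_comp[OF p(1) f'] pt_comp[OF p(1), of g Y] g p(2) by simp
      qed (use f(1-3) g in auto)
      then show "g = f" using f g by (intro linear_equivalence_faithful[OF E]) auto
    qed
  next
    fix W :: "('k, nat \<Rightarrow> 'k) module" and r
    assume W: "fd_left_module K (end_alg C P) (W, r)"
    note Wr = fd_left_moduleD[OF W, simplified]
    have e_add: "e (a \<oplus>\<^bsub>A\<^esub> b) = HAdd C (e a) (e b)" if ab: "a \<in> carrier A" "b \<in> carrier A" for a b
      by (rule pt_inj[of _ P]) (use ab e' EP(5)[OF ab x] pt_add[OF e e, OF ab] in \<open>simp_all add: pt_of_e\<close>)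
    have e_smult: "e (c \<odot>\<^bsub>A\<^esub> a) = HSmult C c (e a)" if ac: "a \<in> carrier A" "c \<in> carrier K" for a c
      by (rule pt_inj[of _ P])
        (use ac e' EP(6)[OF ac(2,1) x] pt_smult[OF ac(2) e[OF ac(1)]] in \<open>simp_all add: pt_of_e\<close>)
    have e_mult: "e (a \<otimes>\<^bsub>A\<^esub> b) = e b \<cdot>\<^bsub>C\<^esub> e a" if ab: "a \<in> carrier A" "b \<in> carrier A" for a b
      by (rule pt_inj[of _ P]) (use ab e' EP(8)[OF ab x] pt_e[OF e, OF ab(2,1)] in \<open>simp_all add: pt_of_e\<close>)
    have e_one: "e \<one>\<^bsub>A\<^esub> = Id C P"
    proof (rule pt_inj[of _ P])
      have "pt (Id C P) = x" using P x by (simp add: pt_def fd_mod_simps(4))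
      then show "pt (e \<one>\<^bsub>A\<^esub>) = pt (Id C P)" using pt_of_e[of "\<one>\<^bsub>A\<^esub>"] EP(9)[OF x] by simp
    qed (use P e' in auto)
    let ?W = "(W, \<lambda>a. r (e a))"
    have "fd_left_module K A ?W"
      by (rule fd_left_module_restrict[OF W]) (use e' in \<open>auto simp: e_add e_smult e_mult e_one\<close>)
    then have "?W \<in> Obj ?M" by simp
    then obtain X \<tau> where X: "X \<in> Obj C" and tau: "\<tau> \<in> hom_set ?M (FO E X) ?W" "is_iso ?M \<tau>"
      using E unfolding linear_equivalence_def by blast
    have tb: "bij_betw (app \<tau>) (carrier (fst (FO E X))) (carrier W)"
      using fd_mod_iso_bij[OF Kc tau(2,1)] by simp
    let ?\<theta> = "\<lambda>p. app \<tau> (pt p)"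
    have cl: "?\<theta> p \<in> carrier W" if "p \<in> hom_set C P X" for p
      using app_closed[OF tau(1) pt[OF that]] by simp
    have lin: "restrict ?\<theta> (hom_set C P X) \<in> linear_maps K (Hom C P X) W"
    proof (rule restrict_linear_maps[OF C.hom_module[OF P X]])
      fix p p' assume p: "p \<in> hom_set C P X" "p' \<in> hom_set C P X"
      show "?\<theta> (p \<oplus>\<^bsub>Hom C P X\<^esub> p') = ?\<theta> p \<oplus>\<^bsub>W\<^esub> ?\<theta> p'"
        using pt_add[OF p] app_add[OF tau(1) pt[OF p(1)] pt[OF p(2)]] by simp
    next
      fix c p assume p: "c \<in> carrier K" "p \<in> hom_set C P X"
      show "?\<theta> (c \<odot>\<^bsub>Hom C P X\<^esub> p) = c \<odot>\<^bsub>W\<^esub> ?\<theta> p"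
        using pt_smult[OF p] app_smult[OF tau(1) p(1) pt[OF p(2)]] by simp
    qed (rule cl)
    have ptb: "bij_betw pt (hom_set C P X) (carrier (fst (FO E X)))"
      unfolding bij_betw_def
    proof
      show "inj_on pt (hom_set C P X)" by (rule inj_onI) (rule pt_inj)
      show "pt ` hom_set C P X = carrier (fst (FO E X))" using pt pt_surj[OF X] by blast
    qed
    have "bij_betw (restrict ?\<theta> (hom_set C P X)) (hom_set C P X) (carrier W)"
      using bij_betw_trans[OF ptb tb] by (rule bij_betw_cong[THEN iffD1, rotated]) auto
    moreover have "restrict ?\<theta> (hom_set C P X) (p \<cdot>\<^bsub>C\<^esub> a) = r a (restrict ?\<theta> (hom_set C P X) p)"
      if p: "p \<in> hom_set C P X" and a: "a \<in> hom_set C P P" for p a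
    proof -
      obtain b where b: "b \<in> carrier A" "a = e b" using e_surj[OF a] by blast
      have "p \<cdot>\<^bsub>C\<^esub> a \<in> hom_set C P X" using p a by auto
      then show ?thesis
        using p b pt_e[OF p b(1)] app_act[OF tau(1) b(1) pt[OF p]] by simp
    qed
    ultimately show "\<exists>X\<in>Obj C. \<exists>\<theta>\<in>linear_maps K (Hom C P X) W. bij_betw \<theta> (hom_set C P X) (carrier W) \<and>
           (\<forall>p\<in>hom_set C P X. \<forall>a\<in>hom_set C P P. \<theta> (p \<cdot>\<^bsub>C\<^esub> a) = r a (\<theta> p))"
      using X lin by blast
  qed
  then show thesis by (rule that)
qed

lemma fd_left_module_hom:
  assumes C: "lcat K C" and P: "P \<in> Obj C" "X \<in> Obj C" and fd: "fd_space K (Hom C P X)"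
  shows "fd_left_module K (end_alg C P) (Hom C P X, \<lambda>a p. p \<cdot>\<^bsub>C\<^esub> a)"
proof -
  interpret lcat K C by fact
  show ?thesis by (rule fd_left_moduleI[OF fd]) (use P in \<open>auto simp: comp_HAdd HAdd_comp comp_HSmult\<close>)
qed

lemma end_alg_fd_algebra:
  assumes C: "lcat K C" and P: "P \<in> Obj C" and fd: "fd_space K (Hom C P P)" and K: "field K"
  shows "fd_algebra K (end_alg C P)"
proof -
  interpret lcat K C by fact
  interpret H: module K "Hom C P P" using P by (simp add: hom_module)
  have m: "fd_space K (end_alg C P)"
  proof -
    have M: "module K (end_alg C P)"
      by (rule module_pointwise[where I = UNIV and W = "\<lambda>_::unit. Hom C P P" and ev = "\<lambda>_ f. f"])
        (use H.module_axioms P K in \<open>auto simp: field_def domain_def\<close>)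
    have "restrict (\<lambda>f. f) (carrier (end_alg C P)) \<in> linear_maps K (end_alg C P) (Hom C P P)"
      by (rule restrict_linear_maps[OF M]) auto
    then show ?thesis by (rule fd_space_injective[OF K M fd]) (auto intro: inj_onI)
  qed
  interpret E: module K "end_alg C P" using m by (simp add: fd_space_def)
  have "ring (end_alg C P)"
    by (rule ringI[OF E.abelian_group_axioms])
      (use P in \<open>auto intro!: monoidI simp: HAdd_comp comp_HAdd\<close>)
  then show ?thesis using m unfolding fd_algebra_def by (auto simp: comp_HSmult)
qed

text \<open>Conversely the functor \<open>Hom(P, -)\<close> of a progenerator is an equivalence with the modules over
  \<open>End(P)\<^sup>o\<^sup>p\<close>.  The hom spaces and this algebra are transported to the type \<open>nat \<Rightarrow> 'k\<close> along
  arbitrary injections.\<close>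

lemma progenerator_finite_abelian:
  fixes K :: "'k ring" and C :: "('k, 'o, 'm) lincat"
  assumes K: "field K" and C: "linear_category K C" and fin: "hom_finite K C" and P: "progenerator K C P"
  shows "finite_abelian K C"
proof -
  interpret C: lcat K C by unfold_locales fact
  have Kc: "cring K" using K by (simp add: field_def domain_def)
  have PO: "P \<in> Obj C" using P by (simp add: progenerator_def)
  have fd: "fd_space K (Hom C P X)" if "X \<in> Obj C" for X using fin PO that by (simp add: hom_finite_def)
  let ?B0 = "end_alg C P"
  have B0: "fd_algebra K ?B0" by (rule end_alg_fd_algebra[OF C.lcat_axioms PO fd[OF PO] K])
  obtain e :: "'m \<Rightarrow> nat \<Rightarrow> 'k" where e: "inj_on e (carrier ?B0)"
    using fd_space_inj_nat[OF K fd[OF PO]] by auto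
  define B where "B = transport ?B0 e"
  have B: "fd_algebra K B" unfolding B_def by (rule fd_algebra_transport[OF K B0 e])
  let ?M = "fd_mod K B :: ('k, ('k, nat \<Rightarrow> 'k, nat \<Rightarrow> 'k) lmod, _) lincat"
  interpret M: lcat K ?M by unfold_locales (rule fd_mod_linear_category[OF Kc])
  have Bs: "carrier B = e ` hom_set C P P" "\<one>\<^bsub>B\<^esub> = e (Id C P)"
    "\<And>a b. a \<in> hom_set C P P \<Longrightarrow> b \<in> hom_set C P P \<Longrightarrow> e a \<otimes>\<^bsub>B\<^esub> e b = e (b \<cdot>\<^bsub>C\<^esub> a)"
    "\<And>a b. a \<in> hom_set C P P \<Longrightarrow> b \<in> hom_set C P P \<Longrightarrow> e a \<oplus>\<^bsub>B\<^esub> e b = e (HAdd C a b)"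
    "\<And>a c. a \<in> hom_set C P P \<Longrightarrow> c \<odot>\<^bsub>B\<^esub> e a = e (HSmult C c a)"
    using e by (auto simp: B_def transport_simps)
  define ei where "ei = the_inv_into (carrier ?B0) e"
  have ei: "ei (e a) = a" if "a \<in> hom_set C P P" for a
    using the_inv_into_f_f[OF e] that by (simp add: ei_def)
  have "\<forall>X\<in>Obj C. \<exists>\<phi> :: 'm \<Rightarrow> nat \<Rightarrow> 'k. inj_on \<phi> (hom_set C P X)"
    using fd_space_inj_nat[OF K fd] by metis
  from bchoice[OF this] obtain \<phi> :: "'o \<Rightarrow> 'm \<Rightarrow> nat \<Rightarrow> 'k"
    where phi: "\<And>X. X \<in> Obj C \<Longrightarrow> inj_on (\<phi> X) (hom_set C P X)" by blast
  define \<phi>i where "\<phi>i X = the_inv_into (hom_set C P X) (\<phi> X)" for X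
  have phii: "\<phi>i X (\<phi> X p) = p" if "X \<in> Obj C" "p \<in> hom_set C P X" for X p
    unfolding \<phi>i_def by (rule the_inv_into_f_f[OF phi[OF that(1)] that(2)])
  \<comment> \<open>the functor \<open>Hom(P, -)\<close>, with values on the type \<open>nat \<Rightarrow> 'k\<close>\<close>
  define F0 where "F0 X = (transport (Hom C P X) (\<phi> X), \<lambda>b x. \<phi> X (\<phi>i X x \<cdot>\<^bsub>C\<^esub> ei b))" for X
  have F0s: "carrier (fst (F0 X)) = \<phi> X ` hom_set C P X"
    "\<And>p q. p \<in> hom_set C P X \<Longrightarrow> q \<in> hom_set C P X \<Longrightarrow> \<phi> X p \<oplus>\<^bsub>fst (F0 X)\<^esub> \<phi> X q = \<phi> X (HAdd C p q)"
    "\<And>p c. p \<in> hom_set C P X \<Longrightarrow> c \<odot>\<^bsub>fst (F0 X)\<^esub> \<phi> X p = \<phi> X (HSmult C c p)"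
    "\<And>p a. p \<in> hom_set C P X \<Longrightarrow> a \<in> hom_set C P P \<Longrightarrow> snd (F0 X) (e a) (\<phi> X p) = \<phi> X (p \<cdot>\<^bsub>C\<^esub> a)"
    if X: "X \<in> Obj C" for X
    using transport_simps[OF phi[OF X]] phii[OF X] ei by (simp_all add: F0_def)
  have F0: "fd_left_module K B (F0 X)" if X: "X \<in> Obj C" for X
  proof -
    have "fd_left_module K B (fst (F0 X), \<lambda>b x. \<phi> X (\<phi>i X x \<cdot>\<^bsub>C\<^esub> ei b))"
      unfolding F0_def \<phi>i_def fst_conv
      by (rule fd_left_module_restrict[OF fd_left_module_transport[OF K
            fd_left_module_hom[OF C.lcat_axioms PO X fd[OF X]] phi[OF X]]])
        (use PO in \<open>auto simp: Bs ei\<close>)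
    then show ?thesis by (simp add: F0_def)
  qed
  let ?h = "\<lambda>f x. \<phi> (Cod C f) (f \<cdot>\<^bsub>C\<^esub> \<phi>i (Dom C f) x)"
  define F1 where "F1 f = (F0 (Dom C f), restrict (?h f) (carrier (fst (F0 (Dom C f)))), F0 (Cod C f))" for f
  define F where "F = \<lparr>FO = F0, FA = F1\<rparr>"
  have Fs [simp]: "FO F = F0" "FA F = F1" by (auto simp: F_def)
  have F1p: "app (F1 f) (\<phi> X p) = \<phi> Y (f \<cdot>\<^bsub>C\<^esub> p)"
    if "f \<in> hom_set C X Y" "p \<in> hom_set C P X" for f X Y p
  proof -
    have X: "X \<in> Obj C" using that(1) by auto
    show ?thesis using that F0s(1)[OF X] phii[OF X that(2)] by (auto simp: F1_def)
  qed
  have F1: "F1 f \<in> hom_set ?M (F0 X) (F0 Y)" if f: "f \<in> hom_set C X Y" for f X Y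
  proof -
    have X: "X \<in> Obj C" and Y: "Y \<in> Obj C" and d: "Dom C f = X" "Cod C f = Y" using f by auto
    have fp: "f \<cdot>\<^bsub>C\<^esub> p \<in> hom_set C P Y" if "p \<in> hom_set C P X" for p using that f by auto
    show ?thesis
      unfolding F1_def d
    proof (rule fd_mod_homI[OF F0[OF X] F0[OF Y]])
      fix v assume "v \<in> carrier (fst (F0 X))"
      then obtain p where p: "v = \<phi> X p" "p \<in> hom_set C P X" unfolding F0s(1)[OF X] by blast
      show "\<phi> Y (f \<cdot>\<^bsub>C\<^esub> \<phi>i X v) \<in> carrier (fst (F0 Y))"
        unfolding p(1) phii[OF X p(2)] F0s(1)[OF Y] using fp[OF p(2)] by (rule imageI)
      show "\<phi> Y (f \<cdot>\<^bsub>C\<^esub> \<phi>i X (c \<odot>\<^bsub>fst (F0 X)\<^esub> v)) = c \<odot>\<^bsub>fst (F0 Y)\<^esub> \<phi> Y (f \<cdot>\<^bsub>C\<^esub> \<phi>i X v)"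
        if c: "c \<in> carrier K" for c
        using phii[OF X p(2)] phii[OF X, of "HSmult C c p"] p f c F0s(3)[OF X p(2)] F0s(3)[OF Y fp[OF p(2)], of c]
        by (auto simp: C.comp_HSmult)
      show "\<phi> Y (f \<cdot>\<^bsub>C\<^esub> \<phi>i X (snd (F0 X) b v)) = snd (F0 Y) b (\<phi> Y (f \<cdot>\<^bsub>C\<^esub> \<phi>i X v))"
        if b: "b \<in> carrier B" for b
      proof -
        obtain a where a: "b = e a" "a \<in> hom_set C P P" using b unfolding Bs(1) by blast
        show ?thesis
          using phii[OF X p(2)] phii[OF X, of "p \<cdot>\<^bsub>C\<^esub> a"] p f a F0s(4)[OF X p(2) a(2)] F0s(4)[OF Y fp[OF p(2)] a(2)]
          by auto
      qed
      fix w assume "w \<in> carrier (fst (F0 X))"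
      then obtain q where q: "w = \<phi> X q" "q \<in> hom_set C P X" unfolding F0s(1)[OF X] by blast
      show "\<phi> Y (f \<cdot>\<^bsub>C\<^esub> \<phi>i X (v \<oplus>\<^bsub>fst (F0 X)\<^esub> w)) = \<phi> Y (f \<cdot>\<^bsub>C\<^esub> \<phi>i X v) \<oplus>\<^bsub>fst (F0 Y)\<^esub> \<phi> Y (f \<cdot>\<^bsub>C\<^esub> \<phi>i X w)"
        using phii[OF X p(2)] phii[OF X q(2)] phii[OF X, of "HAdd C p q"] p q f F0s(2)[OF X p(2) q(2)]
          F0s(2)[OF Y fp[OF p(2)] fp[OF q(2)]]
        by (auto simp: C.comp_HAdd)
    qed
  qed
  have F1_eqI: "F1 f = g" if f: "f \<in> hom_set C X Y" and g: "g \<in> hom_set ?M (F0 X) (F0 Y)"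
    and eq: "\<And>p. p \<in> hom_set C P X \<Longrightarrow> app g (\<phi> X p) = \<phi> Y (f \<cdot>\<^bsub>C\<^esub> p)" for f g X Y
  proof (rule app_eqI[OF F1[OF f] g])
    fix v assume "v \<in> carrier (fst (F0 X))"
    moreover have X: "X \<in> Obj C" using f by auto
    ultimately obtain p where p: "v = \<phi> X p" "p \<in> hom_set C P X" unfolding F0s(1)[OF X] by blast
    then show "app (F1 f) v = app g v" using F1p[OF f p(2)] eq[OF p(2)] by simp
  qed
  have F: "is_functor C ?M F"
  proof (rule is_functorI)
    fix X assume X: "X \<in> Obj C"
    then show "FO F X \<in> Obj ?M" using F0 by simp
    have "F1 (Id C X) = Id ?M (F0 X)"
    proof (rule F1_eqI)
      fix p assume p: "p \<in> hom_set C P X"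
      then have "\<phi> X p \<in> carrier (fst (F0 X))" using F0s(1)[OF X] by simp
      then show "app (Id ?M (F0 X)) (\<phi> X p) = \<phi> X (Id C X \<cdot>\<^bsub>C\<^esub> p)" using p by (auto simp: fd_mod_simps(4))
    qed (use X F0[OF X] in auto)
    then show "FA F (Id C X) = Id ?M (FO F X)" by simp
  next
    fix f assume "f \<in> Arr C"
    then show "FA F f \<in> Arr ?M \<and> Dom ?M (FA F f) = FO F (Dom C f) \<and> Cod ?M (FA F f) = FO F (Cod C f)"
      using F1[of f "Dom C f" "Cod C f"] by simp
  next
    fix f g assume f: "f \<in> Arr C" "g \<in> Arr C" "Cod C f = Dom C g"
    have f': "f \<in> hom_set C (Dom C f) (Dom C g)" "g \<in> hom_set C (Dom C g) (Cod C g)" using f by auto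
    have "F1 (g \<cdot>\<^bsub>C\<^esub> f) = F1 g \<cdot>\<^bsub>?M\<^esub> F1 f"
    proof (rule F1_eqI)
      show "F1 g \<cdot>\<^bsub>?M\<^esub> F1 f \<in> hom_set ?M (F0 (Dom C f)) (F0 (Cod C g))"
        using F1[OF f'(1)] F1[OF f'(2)] by simp
      fix p assume p: "p \<in> hom_set C P (Dom C f)"
      have fp: "f \<cdot>\<^bsub>C\<^esub> p \<in> hom_set C P (Dom C g)" using p f by auto
      have v: "\<phi> (Dom C f) p \<in> carrier (fst (F0 (Dom C f)))" using p f F0s(1)[of "Dom C f"] by simp
      show "app (F1 g \<cdot>\<^bsub>?M\<^esub> F1 f) (\<phi> (Dom C f) p) = \<phi> (Cod C g) ((g \<cdot>\<^bsub>C\<^esub> f) \<cdot>\<^bsub>C\<^esub> p)"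
        unfolding app_comp[OF F1[OF f'(1)] F1[OF f'(2)] v] F1p[OF f'(1) p] F1p[OF f'(2) fp]
        using f p by auto
    qed (use f in auto)
    then show "FA F (g \<cdot>\<^bsub>C\<^esub> f) = FA F g \<cdot>\<^bsub>?M\<^esub> FA F f" by simp
  qed (auto simp: C.category M.category)
  have lF: "linear_functor K C ?M F"
  proof (rule linear_functorI)
    fix f g assume f: "f \<in> Arr C" "g \<in> Arr C" "Dom C f = Dom C g" "Cod C f = Cod C g"
    let ?X = "Dom C g" and ?Y = "Cod C g"
    have f': "f \<in> hom_set C ?X ?Y" "g \<in> hom_set C ?X ?Y" using f by auto
    have X: "?X \<in> Obj C" "?Y \<in> Obj C" using f by auto
    have "F1 (HAdd C f g) = HAdd ?M (F1 f) (F1 g)"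
    proof (rule F1_eqI)
      fix p assume p: "p \<in> hom_set C P ?X"
      have v: "\<phi> ?X p \<in> carrier (fst (F0 ?X))" using p F0s(1)[OF X(1)] by simp
      obtain h where h: "F1 f = (F0 ?X, h, F0 ?Y)" by (rule fd_mod_homE[OF F1[OF f'(1)]])
      obtain k where k: "F1 g = (F0 ?X, k, F0 ?Y)" by (rule fd_mod_homE[OF F1[OF f'(2)]])
      have "app (HAdd ?M (F1 f) (F1 g)) (\<phi> ?X p) = app (F1 f) (\<phi> ?X p) \<oplus>\<^bsub>fst (F0 ?Y)\<^esub> app (F1 g) (\<phi> ?X p)"
        using v by (simp add: h k)
      also have "\<dots> = \<phi> ?Y (f \<cdot>\<^bsub>C\<^esub> p) \<oplus>\<^bsub>fst (F0 ?Y)\<^esub> \<phi> ?Y (g \<cdot>\<^bsub>C\<^esub> p)"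
        unfolding F1p[OF f'(1) p] F1p[OF f'(2) p] by simp
      also have "\<dots> = \<phi> ?Y (HAdd C (f \<cdot>\<^bsub>C\<^esub> p) (g \<cdot>\<^bsub>C\<^esub> p))" using f p by (intro F0s(2)[OF X(2)]) auto
      also have "HAdd C (f \<cdot>\<^bsub>C\<^esub> p) (g \<cdot>\<^bsub>C\<^esub> p) = HAdd C f g \<cdot>\<^bsub>C\<^esub> p" using f p by (simp add: C.HAdd_comp)
      finally show "app (HAdd ?M (F1 f) (F1 g)) (\<phi> ?X p) = \<phi> ?Y (HAdd C f g \<cdot>\<^bsub>C\<^esub> p)" .
    qed (use f F1[OF f'(1)] F1[OF f'(2)] in auto)
    then show "FA F (HAdd C f g) = HAdd ?M (FA F f) (FA F g)" by simp
  next
    fix f c assume f: "f \<in> Arr C" and c: "c \<in> carrier K"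
    let ?X = "Dom C f" and ?Y = "Cod C f"
    have f': "f \<in> hom_set C ?X ?Y" using f by auto
    have X: "?X \<in> Obj C" "?Y \<in> Obj C" using f by auto
    have "F1 (HSmult C c f) = HSmult ?M c (F1 f)"
    proof (rule F1_eqI)
      fix p assume p: "p \<in> hom_set C P ?X"
      have v: "\<phi> ?X p \<in> carrier (fst (F0 ?X))" using p F0s(1)[OF X(1)] by simp
      obtain h where h: "F1 f = (F0 ?X, h, F0 ?Y)" by (rule fd_mod_homE[OF F1[OF f']])
      have "app (HSmult ?M c (F1 f)) (\<phi> ?X p) = c \<odot>\<^bsub>fst (F0 ?Y)\<^esub> app (F1 f) (\<phi> ?X p)"
        using v by (simp add: h)
      also have "\<dots> = c \<odot>\<^bsub>fst (F0 ?Y)\<^esub> \<phi> ?Y (f \<cdot>\<^bsub>C\<^esub> p)" unfolding F1p[OF f' p] by simp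
      also have "\<dots> = \<phi> ?Y (HSmult C c (f \<cdot>\<^bsub>C\<^esub> p))" using f p by (intro F0s(3)[OF X(2)]) auto
      also have "HSmult C c (f \<cdot>\<^bsub>C\<^esub> p) = HSmult C c f \<cdot>\<^bsub>C\<^esub> p" using f p c by (simp add: C.comp_HSmult)
      finally show "app (HSmult ?M c (F1 f)) (\<phi> ?X p) = \<phi> ?Y (HSmult C c f \<cdot>\<^bsub>C\<^esub> p)" .
    qed (use f c F1[OF f'] in auto)
    then show "FA F (HSmult C c f) = HSmult ?M c (FA F f)" by simp
  qed (simp_all add: C.lcat_axioms M.lcat_axioms fctr_def F)
  have "bij_betw (FA F) (hom_set C X Y) (hom_set ?M (FO F X) (FO F Y))" if X: "X \<in> Obj C" "Y \<in> Obj C" for X Y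
    unfolding bij_betw_def Fs
  proof
    show "inj_on F1 (hom_set C X Y)"
    proof (rule inj_onI)
      fix f g assume f: "f \<in> hom_set C X Y" and g: "g \<in> hom_set C X Y" and eq: "F1 f = F1 g"
      show "f = g"
      proof (rule progenerator_unique[OF P C.lcat_axioms X f g])
        fix p assume p: "p \<in> hom_set C P X"
        have "\<phi> Y (f \<cdot>\<^bsub>C\<^esub> p) = \<phi> Y (g \<cdot>\<^bsub>C\<^esub> p)" using F1p[OF f p] F1p[OF g p] eq by simp
        then show "f \<cdot>\<^bsub>C\<^esub> p = g \<cdot>\<^bsub>C\<^esub> p"
          by (rule inj_onD[OF phi[OF X(2)]]) (use f g p in auto)
      qed
    qed
    show "F1 ` hom_set C X Y = hom_set ?M (F0 X) (F0 Y)"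
    proof
      show "F1 ` hom_set C X Y \<subseteq> hom_set ?M (F0 X) (F0 Y)" using F1 by blast
      show "hom_set ?M (F0 X) (F0 Y) \<subseteq> F1 ` hom_set C X Y"
      proof
        fix g assume g: "g \<in> hom_set ?M (F0 X) (F0 Y)"
        \<comment> \<open>a module map is an \<open>End(P)\<close>-linear map on \<open>Hom(P, X)\<close>, which comes from an arrow by density\<close>
        define \<psi> where "\<psi> p = \<phi>i Y (app g (\<phi> X p))" for p
        have psi: "\<psi> p \<in> hom_set C P Y \<and> \<phi> Y (\<psi> p) = app g (\<phi> X p)" if p: "p \<in> hom_set C P X" for p
        proof -
          have "app g (\<phi> X p) \<in> carrier (fst (F0 Y))"
            by (rule app_closed[OF g]) (use p F0s(1)[OF X(1)] in simp)
          then obtain q where q: "app g (\<phi> X p) = \<phi> Y q" "q \<in> hom_set C P Y" unfolding F0s(1)[OF X(2)] by blast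
          then show ?thesis using phii[OF X(2) q(2)] by (simp add: \<psi>_def)
        qed
        have v: "\<phi> X p \<in> carrier (fst (F0 X))" if "p \<in> hom_set C P X" for p using that F0s(1)[OF X(1)] by simp
        have eqI: "a = b" if "a \<in> hom_set C P Y" "b \<in> hom_set C P Y" "\<phi> Y a = \<phi> Y b" for a b
          using inj_onD[OF phi[OF X(2)] that(3,1,2)] .
        obtain f where f: "f \<in> hom_set C X Y" "\<And>p. p \<in> hom_set C P X \<Longrightarrow> f \<cdot>\<^bsub>C\<^esub> p = \<psi> p"
        proof (rule progenerator_extend[OF P C.lcat_axioms X, of \<psi>])
          fix p p' assume p: "p \<in> hom_set C P X" "p' \<in> hom_set C P X"
          have m: "HAdd C p p' \<in> hom_set C P X" "HAdd C (\<psi> p) (\<psi> p') \<in> hom_set C P Y" using p psi by auto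
          show "\<psi> (HAdd C p p') = HAdd C (\<psi> p) (\<psi> p')"
            using eqI[OF conjunct1[OF psi[OF m(1)]] m(2)] psi[OF m(1)] psi[OF p(1)] psi[OF p(2)]
              F0s(2)[OF X(1) p] F0s(2)[OF X(2), of "\<psi> p" "\<psi> p'"] app_add[OF g v[OF p(1)] v[OF p(2)]] by simp
        next
          fix c p assume p: "c \<in> carrier K" "p \<in> hom_set C P X"
          have m: "HSmult C c p \<in> hom_set C P X" "HSmult C c (\<psi> p) \<in> hom_set C P Y" using p psi by auto
          show "\<psi> (HSmult C c p) = HSmult C c (\<psi> p)"
            using eqI[OF conjunct1[OF psi[OF m(1)]] m(2)] psi[OF m(1)] psi[OF p(2)]
              F0s(3)[OF X(1) p(2)] F0s(3)[OF X(2), of "\<psi> p"] app_smult[OF g p(1) v[OF p(2)]] by simp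
        next
          fix p a assume p: "p \<in> hom_set C P X" "a \<in> hom_set C P P"
          have m: "p \<cdot>\<^bsub>C\<^esub> a \<in> hom_set C P X" "\<psi> p \<cdot>\<^bsub>C\<^esub> a \<in> hom_set C P Y" using p psi[OF p(1)] by auto
          have "e a \<in> carrier B" using p by (simp add: Bs(1))
          then show "\<psi> (p \<cdot>\<^bsub>C\<^esub> a) = \<psi> p \<cdot>\<^bsub>C\<^esub> a"
            using eqI[OF conjunct1[OF psi[OF m(1)]] m(2)] psi[OF m(1)] psi[OF p(1)]
              F0s(4)[OF X(1) p] F0s(4)[OF X(2), of "\<psi> p" a] app_act[OF g _ v[OF p(1)], of "e a"] p(2) by simp
        qed (use psi in blast)+
        have "F1 f = g" by (rule F1_eqI[OF f(1) g]) (use f(2) psi in simp)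
        then show "g \<in> F1 ` hom_set C X Y" using f(1) by blast
      qed
    qed
  qed
  \<comment> \<open>every module, with the action restricted along \<open>e\<close>, is realized by an object\<close>
  moreover have "\<exists>X\<in>Obj C. \<exists>t\<in>hom_set ?M (FO F X) Z. is_iso ?M t" if Z: "Z \<in> Obj ?M" for Z
  proof -
    have Z': "fd_left_module K B Z" using Z by simp
    note Zd = fd_left_moduleD[OF Z']
    have eB: "e a \<in> carrier B" if "a \<in> hom_set C P P" for a using that by (simp add: Bs(1))
    have "fd_left_module K ?B0 (fst Z, \<lambda>a. snd Z (e a))"
      by (rule fd_left_module_restrict[where B = B]) (use Z' eB Bs in simp_all)
    from progenerator_realize[OF P this] obtain X \<theta> where X: "X \<in> Obj C" and th: "\<theta> \<in> linear_maps K (Hom C P X) (fst Z)"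
      and bij: "bij_betw \<theta> (hom_set C P X) (carrier (fst Z))"
      and act: "\<And>p a. p \<in> hom_set C P X \<Longrightarrow> a \<in> hom_set C P P \<Longrightarrow> \<theta> (p \<cdot>\<^bsub>C\<^esub> a) = snd Z (e a) (\<theta> p)"
      by blast
    let ?t = "(F0 X, restrict (\<lambda>x. \<theta> (\<phi>i X x)) (carrier (fst (F0 X))), Z)"
    have t: "?t \<in> hom_set ?M (F0 X) Z"
    proof (rule fd_mod_homI[OF F0[OF X] Z'])
      fix v assume "v \<in> carrier (fst (F0 X))"
      then obtain p where p: "v = \<phi> X p" "p \<in> hom_set C P X" unfolding F0s(1)[OF X] by blast
      show "\<theta> (\<phi>i X v) \<in> carrier (fst Z)" using p phii[OF X p(2)] linear_maps_closed[OF th p(2)] by simp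
      show "\<theta> (\<phi>i X (c \<odot>\<^bsub>fst (F0 X)\<^esub> v)) = c \<odot>\<^bsub>fst Z\<^esub> \<theta> (\<phi>i X v)" if c: "c \<in> carrier K" for c
        using phii[OF X p(2)] phii[OF X, of "HSmult C c p"] p c F0s(3)[OF X p(2)] linear_maps_smult[OF th c p(2)] by auto
      show "\<theta> (\<phi>i X (snd (F0 X) b v)) = snd Z b (\<theta> (\<phi>i X v))" if b: "b \<in> carrier B" for b
      proof -
        obtain a where a: "b = e a" "a \<in> hom_set C P P" using b unfolding Bs(1) by blast
        show ?thesis
          using phii[OF X p(2)] phii[OF X, of "p \<cdot>\<^bsub>C\<^esub> a"] p a F0s(4)[OF X p(2) a(2)] act[OF p(2) a(2)] by auto
      qed
      fix w assume "w \<in> carrier (fst (F0 X))"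
      then obtain q where q: "w = \<phi> X q" "q \<in> hom_set C P X" unfolding F0s(1)[OF X] by blast
      show "\<theta> (\<phi>i X (v \<oplus>\<^bsub>fst (F0 X)\<^esub> w)) = \<theta> (\<phi>i X v) \<oplus>\<^bsub>fst Z\<^esub> \<theta> (\<phi>i X w)"
        using phii[OF X p(2)] phii[OF X q(2)] phii[OF X, of "HAdd C p q"] p q F0s(2)[OF X p(2) q(2)]
          linear_maps_add[OF th p(2) q(2)] by auto
    qed
    have phib: "bij_betw (\<phi>i X) (carrier (fst (F0 X))) (hom_set C P X)"
      unfolding \<phi>i_def F0s(1)[OF X]
      using phi[OF X] by (intro bij_betw_the_inv_into) (simp add: bij_betw_def)
    have "bij_betw (\<theta> \<circ> \<phi>i X) (carrier (fst (F0 X))) (carrier (fst Z))"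
      by (rule bij_betw_trans[OF phib bij])
    then have "bij_betw (app ?t) (carrier (fst (F0 X))) (carrier (fst Z))"
      by (rule bij_betw_cong[THEN iffD1, rotated]) auto
    then have "is_iso ?M ?t" by (rule fd_mod_bij_iso[OF Kc t])
    then show ?thesis using X t by (intro bexI[of _ X] bexI[of _ ?t]) simp_all
  qed
  ultimately have "linear_equivalence K C ?M F" unfolding linear_equivalence_def using lF by blast
  then have "linearly_equivalent K C ?M" by (rule linear_equivalence_imp_equivalent)
  then show ?thesis using B C.linear_category by (auto simp: finite_abelian_def)
qed

subsection \<open>Copowers\<close>

text \<open>Every finite-dimensional module is isomorphic to one on the type \<open>nat \<Rightarrow> 'k\<close>, so modules on
  other types are realized by objects as well.\<close>

lemma progenerator_realize_any:
  fixes W :: "('k, 'w) module"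
  assumes K: "field K" and P: "progenerator K C P" and W: "fd_left_module K (end_alg C P) (W, r)"
  obtains X \<theta> where "X \<in> Obj C" "\<And>p. p \<in> hom_set C P X \<Longrightarrow> \<theta> p \<in> carrier W"
    "\<And>p q. p \<in> hom_set C P X \<Longrightarrow> q \<in> hom_set C P X \<Longrightarrow> \<theta> (HAdd C p q) = \<theta> p \<oplus>\<^bsub>W\<^esub> \<theta> q"
    "\<And>c p. c \<in> carrier K \<Longrightarrow> p \<in> hom_set C P X \<Longrightarrow> \<theta> (HSmult C c p) = c \<odot>\<^bsub>W\<^esub> \<theta> p"
    "\<And>p a. p \<in> hom_set C P X \<Longrightarrow> a \<in> hom_set C P P \<Longrightarrow> \<theta> (p \<cdot>\<^bsub>C\<^esub> a) = r a (\<theta> p)"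
    "bij_betw \<theta> (hom_set C P X) (carrier W)"
proof -
  have fd: "fd_space K W" using fd_left_moduleD(1)[OF W] by simp
  then interpret W: module K W by (simp add: fd_space_def)
  obtain e :: "'w \<Rightarrow> nat \<Rightarrow> 'k" where e: "inj_on e (carrier W)" by (rule fd_space_inj_nat[OF K fd])
  let ?d = "the_inv_into (carrier W) e"
  note d [simp] = the_inv_into_f_f[OF e] and [simp] = transport_simps[OF e] fd_left_moduleD(3)[OF W, simplified]
  obtain X \<theta> where X: "X \<in> Obj C" and th: "\<theta> \<in> linear_maps K (Hom C P X) (transport W e)"
    and bij: "bij_betw \<theta> (hom_set C P X) (carrier (transport W e))"
    and act: "\<And>p a. p \<in> hom_set C P X \<Longrightarrow> a \<in> hom_set C P P \<Longrightarrow> \<theta> (p \<cdot>\<^bsub>C\<^esub> a) = e (r a (?d (\<theta> p)))"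
    by (rule progenerator_realize[OF P fd_left_module_transport[OF K W e]]) blast
  have w: "\<exists>w\<in>carrier W. \<theta> p = e w" if "p \<in> hom_set C P X" for p
    using linear_maps_closed[OF th that] by auto
  have db: "bij_betw ?d (carrier (transport W e)) (carrier W)"
    using bij_betw_the_inv_into[of e "carrier W"] e by (simp add: bij_betw_def)
  show thesis
  proof (rule that[OF X, of "\<lambda>p. ?d (\<theta> p)"])
    fix p assume p: "p \<in> hom_set C P X"
    show "?d (\<theta> p) \<in> carrier W" using w[OF p] by auto
    show "?d (\<theta> (HSmult C c p)) = c \<odot>\<^bsub>W\<^esub> ?d (\<theta> p)" if "c \<in> carrier K" for c
      using w[OF p] linear_maps_smult[OF th that p] that by auto
    show "?d (\<theta> (p \<cdot>\<^bsub>C\<^esub> a)) = r a (?d (\<theta> p))" if "a \<in> hom_set C P P" for a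
      using w[OF p] act[OF p that] that by auto
    show "?d (\<theta> (HAdd C p q)) = ?d (\<theta> p) \<oplus>\<^bsub>W\<^esub> ?d (\<theta> q)" if "q \<in> hom_set C P X" for q
      using w[OF p] w[OF that] linear_maps_add[OF th p that] by auto
  qed (use bij_betw_trans[OF bij db] in \<open>simp add: comp_def\<close>)
qed

context lcat
begin

lemma comp_finsum:
  assumes g: "g \<in> hom_set C Y Z" and X: "X \<in> Obj C" and S: "finite S" and f: "f \<in> S \<rightarrow> hom_set C X Y"
  shows "g \<cdot> (\<Oplus>\<^bsub>Hom C X Y\<^esub>s\<in>S. f s) = (\<Oplus>\<^bsub>Hom C X Z\<^esub>s\<in>S. g \<cdot> f s)"
proof -
  have M: "module K (Hom C X Y)" "module K (Hom C X Z)" using g X by (auto simp: hom_module)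
  interpret Y: module K "Hom C X Y" by fact
  interpret Z: module K "Hom C X Z" by fact
  have gf: "(\<lambda>s. g \<cdot> f s) \<in> S \<rightarrow> hom_set C X Z" using g f by (auto simp: Pi_def)
  have "g \<cdot> (\<Oplus>\<^bsub>Hom C X Y\<^esub>s\<in>S. f s) = (\<Oplus>\<^bsub>Hom C X Z\<^esub>s\<in>S. (\<lambda>f\<in>hom_set C X Y. g \<cdot> f) (f s))"
    using linear_maps_finsum[OF M post_comp_linear[OF X g] S f] Y.finsum_closed[OF f] by simp
  also have "\<dots> = (\<Oplus>\<^bsub>Hom C X Z\<^esub>s\<in>S. g \<cdot> f s)"
    using f by (intro Z.finsum_cong' gf) (auto simp: Pi_def)
  finally show ?thesis .
qed

lemma finsum_comp:
  assumes g: "g \<in> hom_set C X Y" and Z: "Z \<in> Obj C" and S: "finite S" and f: "f \<in> S \<rightarrow> hom_set C Y Z"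
  shows "(\<Oplus>\<^bsub>Hom C Y Z\<^esub>s\<in>S. f s) \<cdot> g = (\<Oplus>\<^bsub>Hom C X Z\<^esub>s\<in>S. f s \<cdot> g)"
proof -
  have M: "module K (Hom C Y Z)" "module K (Hom C X Z)" using g Z by (auto simp: hom_module)
  interpret Y: module K "Hom C Y Z" by fact
  interpret X: module K "Hom C X Z" by fact
  have fg: "(\<lambda>s. f s \<cdot> g) \<in> S \<rightarrow> hom_set C X Z" using g f by (auto simp: Pi_def)
  have "(\<Oplus>\<^bsub>Hom C Y Z\<^esub>s\<in>S. f s) \<cdot> g = (\<Oplus>\<^bsub>Hom C X Z\<^esub>s\<in>S. (\<lambda>f\<in>hom_set C Y Z. f \<cdot> g) (f s))"
    using linear_maps_finsum[OF M pre_comp_linear[OF g Z] S f] Y.finsum_closed[OF f] by simp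
  also have "\<dots> = (\<Oplus>\<^bsub>Hom C X Z\<^esub>s\<in>S. f s \<cdot> g)"
    using f by (intro X.finsum_cong' fg) (auto simp: Pi_def)
  finally show ?thesis .
qed

text \<open>If \<open>S\<close> is a finite basis of \<open>V\<close>, then the object that realizes the module \<open>Hom(P, X)\<^sup>S\<close> is the
  copower \<open>V \<otimes> X\<close>: the arrow \<open>j v\<close> multiplies with the coordinates of \<open>v\<close>, and every \<open>q : P \<rightarrow> Q\<close> is
  the sum of the \<open>j s \<cdot> \<theta> q s\<close>.\<close>

lemma progenerator_copower:
  fixes V :: "('k, 'v) module"
  assumes K: "field K" and P: "progenerator K C P" and V: "fd_space K V" and X: "X \<in> Obj C"
    and fd: "fd_space K (Hom C P X)"
  obtains Q j where "is_copower K C V X Q j"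
proof -
  note lc = lcat_axioms
  interpret K: field K by fact
  interpret V: module K V using V by (simp add: fd_space_def)
  have PO: "P \<in> Obj C" using P by (simp add: progenerator_def)
  interpret H: module K "Hom C P X" using fd by (simp add: fd_space_def)
  obtain S \<phi> where S: "spans K V S" "\<And>s. s \<in> S \<Longrightarrow> \<phi> s \<in> linear_maps K V (scalars K)"
    "\<And>v. v \<in> carrier V \<Longrightarrow> v = (\<Oplus>\<^bsub>V\<^esub>s\<in>S. \<phi> s v \<odot>\<^bsub>V\<^esub> s)"
    "\<And>s t. s \<in> S \<Longrightarrow> t \<in> S \<Longrightarrow> \<phi> s t = (if t = s then \<one>\<^bsub>K\<^esub> else \<zero>\<^bsub>K\<^esub>)"
    by (rule fd_space_coordinates[OF K V]) blast
  have fin: "finite S" and sub: "\<And>s. s \<in> S \<Longrightarrow> s \<in> carrier V" using S(1) by (auto simp: spans_def)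
  note \<phi> = linear_maps_closed[OF S(2), simplified] linear_maps_add[OF S(2), simplified]
    linear_maps_smult[OF S(2), simplified]
  let ?W = "power_module (Hom C P X, \<lambda>a p. p \<cdot> a) S"
  have W: "fd_left_module K (end_alg C P) (fst ?W, snd ?W)"
    using fd_left_module_power[OF K fin fd_left_module_hom[OF lc PO X fd]] by simp
  obtain Q \<theta> where Q: "Q \<in> Obj C" and th: "\<And>p. p \<in> hom_set C P Q \<Longrightarrow> \<theta> p \<in> carrier (fst ?W)"
    "\<And>p q. p \<in> hom_set C P Q \<Longrightarrow> q \<in> hom_set C P Q \<Longrightarrow> \<theta> (HAdd C p q) = \<theta> p \<oplus>\<^bsub>fst ?W\<^esub> \<theta> q"
    "\<And>c p. c \<in> carrier K \<Longrightarrow> p \<in> hom_set C P Q \<Longrightarrow> \<theta> (HSmult C c p) = c \<odot>\<^bsub>fst ?W\<^esub> \<theta> p"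
    "\<And>p a. p \<in> hom_set C P Q \<Longrightarrow> a \<in> hom_set C P P \<Longrightarrow> \<theta> (p \<cdot> a) = snd ?W a (\<theta> p)"
    and bij: "bij_betw \<theta> (hom_set C P Q) (carrier (fst ?W))"
    by (rule progenerator_realize_any[OF K P W]) blast
  interpret PQ: module K "Hom C P Q" using PO Q by (rule hom_module)
  have thS: "\<theta> q s \<in> Arr C" "Dom C (\<theta> q s) = P" "Cod C (\<theta> q s) = X" if "q \<in> hom_set C P Q" "s \<in> S" for q s
    using th(1)[OF that(1)] that(2) by auto
  have eqI: "p = q" if p: "p \<in> hom_set C P Q" "q \<in> hom_set C P Q" and "\<And>s. s \<in> S \<Longrightarrow> \<theta> p s = \<theta> q s" for p q
  proof -
    have "\<theta> p = \<theta> q"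
      by (rule PiE_ext[of _ S "\<lambda>_. hom_set C P X"]) (use th(1)[OF p(1)] th(1)[OF p(2)] that(3) in auto)
    then show ?thesis using bij p unfolding bij_betw_def by (auto dest: inj_onD)
  qed
  have "\<exists>J. J \<in> hom_set C X Q \<and> (\<forall>p\<in>hom_set C P X. \<forall>s\<in>S. \<theta> (J \<cdot> p) s = HSmult C (\<phi> s v) p)" if v: "v \<in> carrier V" for v
  proof -
    have "\<exists>q. q \<in> hom_set C P Q \<and> (\<forall>s\<in>S. \<theta> q s = HSmult C (\<phi> s v) p)" if p: "p \<in> hom_set C P X" for p
    proof -
      have "(\<lambda>s\<in>S. HSmult C (\<phi> s v) p) \<in> \<theta> ` hom_set C P Q"
        using bij \<phi>(1)[OF _ v] p unfolding bij_betw_def by auto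
      then obtain q where "q \<in> hom_set C P Q" "\<theta> q = (\<lambda>s\<in>S. HSmult C (\<phi> s v) p)" by (metis imageE)
      then show ?thesis by (intro exI[of _ q]) simp
    qed
    then obtain \<psi> where psi: "\<And>p. p \<in> hom_set C P X \<Longrightarrow> \<psi> p \<in> hom_set C P Q"
      and psi_th: "\<And>p s. p \<in> hom_set C P X \<Longrightarrow> s \<in> S \<Longrightarrow> \<theta> (\<psi> p) s = HSmult C (\<phi> s v) p"
      using bchoice[of "hom_set C P X" "\<lambda>p q. q \<in> hom_set C P Q \<and> (\<forall>s\<in>S. \<theta> q s = HSmult C (\<phi> s v) p)"] by blast
    obtain J where "J \<in> hom_set C X Q" "\<And>p. p \<in> hom_set C P X \<Longrightarrow> J \<cdot> p = \<psi> p"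
    proof (rule progenerator_extend[OF P lc X Q, of \<psi>])
      fix p assume p: "p \<in> hom_set C P X"
      show "\<psi> p \<in> hom_set C P Q" by (rule psi[OF p])
      show "\<psi> (HAdd C p p') = HAdd C (\<psi> p) (\<psi> p')" if p': "p' \<in> hom_set C P X"  for p'
        by (rule eqI) (use p p' psi[of p] psi[of p'] psi[of "HAdd C p p'"] \<phi>(1)[OF _ v] H.smult_r_distr[of _ p p'] in
          \<open>auto simp: th(2)[OF psi[OF p] psi[OF p']] psi_th\<close>)
      show "\<psi> (HSmult C c p) = HSmult C c (\<psi> p)" if c: "c \<in> carrier K" for c
        by (rule eqI) (use p c psi[of p] psi[of "HSmult C c p"] \<phi>(1)[OF _ v] H.smult_assoc1[of _ _ p, symmetric] in
          \<open>auto simp: th(3)[OF c psi[OF p]] psi_th K.m_comm\<close>)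
      show "\<psi> (p \<cdot> a) = \<psi> p \<cdot> a" if a: "a \<in> hom_set C P P" for a
        by (rule eqI) (use p a psi[of p] psi[of "p \<cdot> a"] \<phi>(1)[OF _ v] in
          \<open>auto simp: th(4)[OF psi[OF p] a] psi_th comp_HSmult\<close>)
    qed blast
    then show ?thesis using psi_th by (intro exI[of _ J]) auto
  qed
  \<comment> \<open>the arrow \<open>j0 v\<close> has the multiples of the identity by the coordinates of \<open>v\<close> as components\<close>
  then obtain j0 where j0: "\<And>v. v \<in> carrier V \<Longrightarrow> j0 v \<in> hom_set C X Q"
    and j0_th: "\<And>v p s. v \<in> carrier V \<Longrightarrow> p \<in> hom_set C P X \<Longrightarrow> s \<in> S \<Longrightarrow> \<theta> (j0 v \<cdot> p) s = HSmult C (\<phi> s v) p"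
    using bchoice[of "carrier V" "\<lambda>v J. J \<in> hom_set C X Q \<and> (\<forall>p\<in>hom_set C P X. \<forall>s\<in>S. \<theta> (J \<cdot> p) s = HSmult C (\<phi> s v) p)"]
    by blast
  have j0': "j0 v \<in> Arr C" "Dom C (j0 v) = X" "Cod C (j0 v) = Q" if "v \<in> carrier V" for v using j0[OF that] by auto
  have jp: "j0 v \<cdot> p \<in> hom_set C P Q" if "v \<in> carrier V" "p \<in> hom_set C P X" for v p using j0'[OF that(1)] that(2) by simp
  have jlin: "restrict j0 (carrier V) \<in> linear_maps K V (Hom C X Q)"
  proof (rule restrict_linear_maps[OF V.module_axioms j0])
    fix v w assume v: "v \<in> carrier V" "w \<in> carrier V"
    have vw: "v \<oplus>\<^bsub>V\<^esub> w \<in> carrier V" using v by simp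
    show "j0 (v \<oplus>\<^bsub>V\<^esub> w) = j0 v \<oplus>\<^bsub>Hom C X Q\<^esub> j0 w"
    proof (rule progenerator_unique[OF P lc X Q j0[OF vw]])
      fix p assume p: "p \<in> hom_set C P X"
      have "j0 (v \<oplus>\<^bsub>V\<^esub> w) \<cdot> p = HAdd C (j0 v \<cdot> p) (j0 w \<cdot> p)"
        by (rule eqI[OF jp[OF vw p]])
          (use v p jp[OF v(1) p] jp[OF v(2) p] th(2)[OF jp[OF v(1) p] jp[OF v(2) p]] \<phi> H.smult_l_distr[of _ _ p] in
            \<open>auto simp: j0_th[OF vw p] j0_th[OF v(1) p] j0_th[OF v(2) p]\<close>)
      then show "j0 (v \<oplus>\<^bsub>V\<^esub> w) \<cdot> p = (j0 v \<oplus>\<^bsub>Hom C X Q\<^esub> j0 w) \<cdot> p" using j0' v p by (auto simp: HAdd_comp)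
    qed (use j0' v in auto)
  next
    fix c v assume v: "c \<in> carrier K" "v \<in> carrier V"
    have cv: "c \<odot>\<^bsub>V\<^esub> v \<in> carrier V" using v by simp
    show "j0 (c \<odot>\<^bsub>V\<^esub> v) = c \<odot>\<^bsub>Hom C X Q\<^esub> j0 v"
    proof (rule progenerator_unique[OF P lc X Q j0[OF cv]])
      fix p assume p: "p \<in> hom_set C P X"
      have "j0 (c \<odot>\<^bsub>V\<^esub> v) \<cdot> p = HSmult C c (j0 v \<cdot> p)"
        by (rule eqI[OF jp[OF cv p]])
          (use v p jp[OF v(2) p] th(3)[OF v(1) jp[OF v(2) p]] \<phi> H.smult_assoc1[of _ _ p] in
            \<open>auto simp: j0_th[OF cv p] j0_th[OF v(2) p]\<close>)
      then show "j0 (c \<odot>\<^bsub>V\<^esub> v) \<cdot> p = (c \<odot>\<^bsub>Hom C X Q\<^esub> j0 v) \<cdot> p" using j0' v p by (auto simp: comp_HSmult)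
    qed (use j0' v in auto)
  qed
  have sum: "q = (\<Oplus>\<^bsub>Hom C P Q\<^esub>s\<in>S. j0 s \<cdot> \<theta> q s)" if q: "q \<in> hom_set C P Q" for q
  proof -
    have c: "(\<lambda>s. j0 s \<cdot> \<theta> q s) \<in> S \<rightarrow> hom_set C P Q" using thS[OF q] j0' sub by (auto simp: Pi_def)
    note cl = PQ.finsum_closed[OF c]
    show ?thesis
    proof (rule eqI[OF q cl])
      fix t assume t: "t \<in> S"
      let ?ev = "\<lambda>q\<in>hom_set C P Q. \<theta> q t"
      have ev: "?ev \<in> linear_maps K (Hom C P Q) (Hom C P X)"
        by (rule restrict_linear_maps[OF PQ.module_axioms]) (use thS t th(2,3) in auto)
      have "\<theta> (\<Oplus>\<^bsub>Hom C P Q\<^esub>s\<in>S. j0 s \<cdot> \<theta> q s) t = (\<Oplus>\<^bsub>Hom C P X\<^esub>s\<in>S. ?ev (j0 s \<cdot> \<theta> q s))"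
        using linear_maps_finsum[OF PQ.module_axioms H.module_axioms ev fin c] cl by simp
      also have "\<dots> = (\<Oplus>\<^bsub>Hom C P X\<^esub>s\<in>S. if t = s then \<theta> q s else \<zero>\<^bsub>Hom C P X\<^esub>)"
      proof (rule H.finsum_cong')
        fix s assume s: "s \<in> S"
        have m: "\<theta> q s \<in> hom_set C P X" using thS[OF q s] by simp
        show "?ev (j0 s \<cdot> \<theta> q s) = (if t = s then \<theta> q s else \<zero>\<^bsub>Hom C P X\<^esub>)"
          using jp[OF sub[OF s] m] j0_th[OF sub[OF s] m t] S(4)[OF t s] H.smult_one[OF m] H.smult_l_null[OF m] by simp
      qed (use thS[OF q] PO X in auto)
      also have "\<dots> = \<theta> q t" by (rule H.finsum_singleton[OF t fin]) (use thS[OF q] in auto)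
      finally show "\<theta> q t = \<theta> (\<Oplus>\<^bsub>Hom C P Q\<^esub>s\<in>S. j0 s \<cdot> \<theta> q s) t" by simp
    qed
  qed
  have "is_copower K C V X Q (restrict j0 (carrier V))"
    unfolding is_copower_def
  proof (intro conjI ballI Q jlin)
    fix Y h assume Y: "Y \<in> Obj C" and h: "h \<in> linear_maps K V (Hom C X Y)"
    interpret XY: module K "Hom C X Y" using X Y by (rule hom_module)
    interpret PY: module K "Hom C P Y" using PO Y by (rule hom_module)
    have hv: "h v \<in> Arr C" "Dom C (h v) = X" "Cod C (h v) = Y" if "v \<in> carrier V" for v
      using linear_maps_closed[OF h that] by auto
    have c: "(\<lambda>s. h s \<cdot> \<theta> q s) \<in> S \<rightarrow> hom_set C P Y" if "q \<in> hom_set C P Q" for q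
      using thS[OF that] hv sub by (auto simp: Pi_def)
    let ?f = "\<lambda>q. \<Oplus>\<^bsub>Hom C P Y\<^esub>s\<in>S. h s \<cdot> \<theta> q s"
    obtain f where f: "f \<in> hom_set C Q Y" "\<And>q. q \<in> hom_set C P Q \<Longrightarrow> f \<cdot> q = ?f q"
    proof (rule progenerator_extend[OF P lc Q Y, of ?f])
      fix q assume q: "q \<in> hom_set C P Q"
      show "?f q \<in> hom_set C P Y" by (rule PY.finsum_closed[OF c[OF q]])
      show "?f (HAdd C q q') = HAdd C (?f q) (?f q')" if q': "q' \<in> hom_set C P Q" for q'
      proof -
        have "?f (HAdd C q q') = (\<Oplus>\<^bsub>Hom C P Y\<^esub>s\<in>S. h s \<cdot> \<theta> q s \<oplus>\<^bsub>Hom C P Y\<^esub> h s \<cdot> \<theta> q' s)"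
          using th(2)[OF q q'] thS[OF q] thS[OF q'] hv sub
          by (intro PY.finsum_cong') (auto simp: comp_HAdd)
        then show ?thesis using PY.finsum_addf[OF c[OF q] c[OF q']] by simp
      qed
      show "?f (HSmult C r q) = HSmult C r (?f q)" if r: "r \<in> carrier K" for r
      proof -
        have "?f (HSmult C r q) = (\<Oplus>\<^bsub>Hom C P Y\<^esub>s\<in>S. r \<odot>\<^bsub>Hom C P Y\<^esub> (h s \<cdot> \<theta> q s))"
          using th(3)[OF r q] thS[OF q] hv sub r by (intro PY.finsum_cong') (auto simp: comp_HSmult)
        then show ?thesis using PY.finsum_smult_ldistr[OF fin r c[OF q]] by simp
      qed
      show "?f (q \<cdot> a) = ?f q \<cdot> a" if a: "a \<in> hom_set C P P" for a
        unfolding finsum_comp[OF a Y fin c[OF q]]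
        using th(4)[OF q a] thS[OF q] hv sub a by (intro PY.finsum_cong') auto
    qed blast
    show "\<exists>!f. f \<in> hom_set C Q Y \<and> (\<forall>v\<in>carrier V. f \<cdot> restrict j0 (carrier V) v = h v)"
    proof (rule ex1I[of _ f], intro conjI ballI)
      show "f \<in> hom_set C Q Y" by (rule f(1))
      fix v assume v: "v \<in> carrier V"
      have c': "(\<lambda>s. \<phi> s v \<odot>\<^bsub>V\<^esub> s) \<in> S \<rightarrow> carrier V" "(\<lambda>s. h (\<phi> s v \<odot>\<^bsub>V\<^esub> s)) \<in> S \<rightarrow> hom_set C X Y"
        using \<phi> sub v linear_maps_closed[OF h] by (simp_all add: Pi_def)
      have "f \<cdot> j0 v = h v"
      proof (rule progenerator_unique[OF P lc X Y])
        fix p assume p: "p \<in> hom_set C P X"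
        have "(f \<cdot> j0 v) \<cdot> p = ?f (j0 v \<cdot> p)" using f(2)[OF jp[OF v p]] f(1) j0'[OF v] p by simp
        also have "\<dots> = (\<Oplus>\<^bsub>Hom C P Y\<^esub>s\<in>S. h (\<phi> s v \<odot>\<^bsub>V\<^esub> s) \<cdot> p)"
          using j0_th[OF v p] linear_maps_smult[OF h] \<phi> sub hv v p
          by (intro PY.finsum_cong') (auto simp: comp_HSmult)
        also have "\<dots> = h (\<Oplus>\<^bsub>V\<^esub>s\<in>S. \<phi> s v \<odot>\<^bsub>V\<^esub> s) \<cdot> p"
          unfolding linear_maps_finsum[OF V.module_axioms XY.module_axioms h fin c'(1)] finsum_comp[OF p Y fin c'(2)] ..
        finally show "(f \<cdot> j0 v) \<cdot> p = h v \<cdot> p" using S(3)[OF v] by simp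
      qed (use f(1) j0'[OF v] hv[OF v] in auto)
      then show "f \<cdot> restrict j0 (carrier V) v = h v" using v by simp
    next
      fix g assume g: "g \<in> hom_set C Q Y \<and> (\<forall>v\<in>carrier V. g \<cdot> restrict j0 (carrier V) v = h v)"
      then have g1: "g \<in> hom_set C Q Y" and gj: "\<And>v. v \<in> carrier V \<Longrightarrow> g \<cdot> j0 v = h v" by simp_all
      show "g = f"
      proof (rule progenerator_unique[OF P lc Q Y g1 f(1)])
        fix q assume q: "q \<in> hom_set C P Q"
        have c': "(\<lambda>s. j0 s \<cdot> \<theta> q s) \<in> S \<rightarrow> hom_set C P Q" using thS[OF q] j0' sub by (auto simp: Pi_def)
        have "g \<cdot> q = (\<Oplus>\<^bsub>Hom C P Y\<^esub>s\<in>S. g \<cdot> (j0 s \<cdot> \<theta> q s))"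
          by (subst sum[OF q]) (rule comp_finsum[OF g1 PO fin c'])
        also have "\<dots> = ?f q"
        proof (rule PY.finsum_cong'[OF refl c[OF q]])
          fix s assume s: "s \<in> S"
          have "g \<cdot> (j0 s \<cdot> \<theta> q s) = (g \<cdot> j0 s) \<cdot> \<theta> q s" using g1 j0'[OF sub[OF s]] thS[OF q s] by simp
          then show "g \<cdot> (j0 s \<cdot> \<theta> q s) = h s \<cdot> \<theta> q s" by (simp only: gj[OF sub[OF s]])
        qed
        finally show "g \<cdot> q = f \<cdot> q" unfolding f(2)[OF q] .
      qed
    qed
  qed
  then show thesis by (rule that)
qed

end

lemma finite_abelian_copower:
  fixes K :: "'k ring" and C :: "('k, 'o, 'm) lincat" and V :: "('k, 'v) module"
  assumes K: "field K" and C: "finite_abelian K C" and V: "fd_space K V" and X: "X \<in> Obj C"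
  obtains Q j where "is_copower K C V X Q j"
proof -
  obtain P where P: "progenerator K C P" by (rule finite_abelian_progenerator[OF K C])
  interpret lcat K C using C by (simp add: finite_abelian_def lcat_def)
  have "fd_space K (Hom C P X)"
    using finite_abelian_hom_finite[OF K C] P X by (simp add: hom_finite_def progenerator_def)
  then show thesis by (rule progenerator_copower[OF K P V X]) (rule that)
qed

section \<open>Adjunctions\<close>

definition jointly_epic :: "('k, 'o, 'm) lincat \<Rightarrow> 'o \<Rightarrow> 'm set \<Rightarrow> bool" where
  "jointly_epic C X S \<longleftrightarrow> X \<in> Obj C \<and> (\<forall>s\<in>S. s \<in> Arr C \<and> Cod C s = X) \<and>
     (\<forall>f\<in>Arr C. \<forall>g\<in>Arr C. Dom C f = X \<and> Dom C g = X \<and> Cod C f = Cod C g \<and>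
        (\<forall>s\<in>S. f \<cdot>\<^bsub>C\<^esub> s = g \<cdot>\<^bsub>C\<^esub> s) \<longrightarrow> f = g)"

lemma jointly_epicD:
  assumes "jointly_epic C X S" "f \<in> Arr C" "g \<in> Arr C" "Dom C f = X" "Dom C g = X" "Cod C f = Cod C g"
    "\<And>s. s \<in> S \<Longrightarrow> f \<cdot>\<^bsub>C\<^esub> s = g \<cdot>\<^bsub>C\<^esub> s"
  shows "f = g"
  using assms unfolding jointly_epic_def by blast

locale adj =
  fixes C :: "('k, 'o, 'm) lincat" (structure) and F G :: "('o, 'm, 'o, 'm) ftr" and u e :: "'o \<Rightarrow> 'm"
  assumes adjunction: "adjunction C C F G u e"
begin

sublocale cat C
  using adjunction by (simp add: adjunction_def is_functor_def cat_def)
sublocale F: fctr C C F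
  using adjunction by (simp add: adjunction_def fctr_def)
sublocale G: fctr C C G
  using adjunction by (simp add: adjunction_def fctr_def)

lemma unit_nt: "nat_trans C C ftr_id (ftr_comp G F) u"
  and counit_nt: "nat_trans C C (ftr_comp F G) ftr_id e"
  using adjunction by (simp_all add: adjunction_def)

lemma unit_simps [simp]:
  "X \<in> Obj C \<Longrightarrow> u X \<in> Arr C" "X \<in> Obj C \<Longrightarrow> Dom C (u X) = X"
  "X \<in> Obj C \<Longrightarrow> Cod C (u X) = FO G (FO F X)"
  using nat_transD(1-3)[OF unit_nt] by simp_all

lemma counit_simps [simp]:
  "X \<in> Obj C \<Longrightarrow> e X \<in> Arr C" "X \<in> Obj C \<Longrightarrow> Dom C (e X) = FO F (FO G X)"
  "X \<in> Obj C \<Longrightarrow> Cod C (e X) = X"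
  using nat_transD(1-3)[OF counit_nt] by simp_all

lemma unit_natural: "f \<in> Arr C \<Longrightarrow> Dom C f = X \<Longrightarrow> FA G (FA F f) \<cdot> u X = u (Cod C f) \<cdot> f"
  using nat_transD(4)[OF unit_nt] by simp

lemma counit_natural: "f \<in> Arr C \<Longrightarrow> Cod C f = Y \<Longrightarrow> e Y \<cdot> FA F (FA G f) = f \<cdot> e (Dom C f)"
  using nat_transD(4)[OF counit_nt] by auto

lemma triangle_F: "X \<in> Obj C \<Longrightarrow> e (FO F X) \<cdot> FA F (u X) = Id C (FO F X)"
  and triangle_G: "Y \<in> Obj C \<Longrightarrow> FA G (e Y) \<cdot> u (FO G Y) = Id C (FO G Y)"
  using adjunction by (simp_all add: adjunction_def)

lemma transpose_inverse:
  assumes "f \<in> Arr C" "X \<in> Obj C" "Dom C f = FO F X"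
  shows "e (Cod C f) \<cdot> FA F (FA G f \<cdot> u X) = f"
proof -
  have "e (Cod C f) \<cdot> FA F (FA G f \<cdot> u X) = (e (Cod C f) \<cdot> FA F (FA G f)) \<cdot> FA F (u X)"
    using assms by simp
  also have "\<dots> = f \<cdot> (e (FO F X) \<cdot> FA F (u X))" using assms by (subst counit_natural) auto
  also have "\<dots> = f" using assms by (simp add: triangle_F)
  finally show ?thesis .
qed

lemma inverse_transpose:
  assumes "g \<in> Arr C" "Y \<in> Obj C" "Cod C g = FO G Y"
  shows "FA G (e Y \<cdot> FA F g) \<cdot> u (Dom C g) = g"
proof -
  have "FA G (e Y \<cdot> FA F g) \<cdot> u (Dom C g) = FA G (e Y) \<cdot> (FA G (FA F g) \<cdot> u (Dom C g))"
    using assms by simp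
  also have "\<dots> = (FA G (e Y) \<cdot> u (FO G Y)) \<cdot> g" using assms by (subst unit_natural) auto
  also have "\<dots> = g" using assms by (subst triangle_G) auto
  finally show ?thesis .
qed

lemma transpose_inj:
  assumes "f \<in> Arr C" "f' \<in> Arr C" "X \<in> Obj C" "Dom C f = FO F X" "Dom C f' = FO F X" "Cod C f = Cod C f'"
    "FA G f \<cdot> u X = FA G f' \<cdot> u X"
  shows "f = f'"
  using transpose_inverse[of f X] transpose_inverse[of f' X] assms by metis

lemma inverse_transpose_inj:
  assumes "g \<in> Arr C" "g' \<in> Arr C" "Y \<in> Obj C" "Cod C g = FO G Y" "Cod C g' = FO G Y" "Dom C g = Dom C g'"
    "e Y \<cdot> FA F g = e Y \<cdot> FA F g'"
  shows "g = g'"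
  using inverse_transpose[of g Y] inverse_transpose[of g' Y] assms by metis

text \<open>The transposes of two arrows that agree on \<open>F(S)\<close> agree on \<open>S\<close>.\<close>

lemma jointly_epic_F:
  assumes S: "jointly_epic C X S"
  shows "jointly_epic C (FO F X) (FA F ` S)"
  unfolding jointly_epic_def
proof (intro conjI ballI impI)
  have X: "X \<in> Obj C" and s: "\<And>s. s \<in> S \<Longrightarrow> s \<in> Arr C" "\<And>s. s \<in> S \<Longrightarrow> Cod C s = X"
    using S by (auto simp: jointly_epic_def)
  show "FO F X \<in> Obj C" using X by simp
  show "t \<in> Arr C" "Cod C t = FO F X" if "t \<in> FA F ` S" for t using that s by auto
  fix f g assume f: "f \<in> Arr C" and g: "g \<in> Arr C"
    and *: "Dom C f = FO F X \<and> Dom C g = FO F X \<and> Cod C f = Cod C g \<and> (\<forall>s\<in>FA F ` S. f \<cdot> s = g \<cdot> s)"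
  then have fg: "Dom C f = FO F X" "Dom C g = FO F X" "Cod C f = Cod C g" by simp_all
  have "FA G f \<cdot> u X = FA G g \<cdot> u X"
  proof (rule jointly_epicD[OF S])
    fix t assume t: "t \<in> S"
    have "(FA G f \<cdot> u X) \<cdot> t = FA G f \<cdot> (FA G (FA F t) \<cdot> u (Dom C t))"
      using f fg X s[OF t] unit_natural[of t] by simp
    also have "\<dots> = FA G (f \<cdot> FA F t) \<cdot> u (Dom C t)" using f fg X s[OF t] by simp
    also have "f \<cdot> FA F t = g \<cdot> FA F t" using * t by blast
    also have "FA G (g \<cdot> FA F t) \<cdot> u (Dom C t) = FA G g \<cdot> (FA G (FA F t) \<cdot> u (Dom C t))"
      using g fg X s[OF t] by simp
    also have "\<dots> = (FA G g \<cdot> u X) \<cdot> t" using g fg X s[OF t] unit_natural[of t] by simp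
    finally show "(FA G f \<cdot> u X) \<cdot> t = (FA G g \<cdot> u X) \<cdot> t" .
  qed (use f g fg X in simp_all)
  then show "f = g" by (rule transpose_inj[OF f g X fg])
qed

lemma linear_F:
  assumes G: "linear_functor K C C G"
  shows "linear_functor K C C F"
proof -
  interpret L: lcat K C using linear_functorD[OF G] by simp
  show ?thesis
  proof (rule linear_functorI)
    fix f g assume f: "f \<in> Arr C" "g \<in> Arr C" "Dom C f = Dom C g" "Cod C f = Cod C g"
    show "FA F (HAdd C f g) = HAdd C (FA F f) (FA F g)"
    proof (rule transpose_inj[of _ _ "Dom C g"])
      have "FA G (FA F (HAdd C f g)) \<cdot> u (Dom C g) = u (Cod C g) \<cdot> HAdd C f g"
        using f by (simp add: unit_natural)
      also have "\<dots> = HAdd C (u (Cod C g) \<cdot> f) (u (Cod C g) \<cdot> g)" using f by (simp add: L.comp_HAdd)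
      also have "\<dots> = HAdd C (FA G (FA F f) \<cdot> u (Dom C g)) (FA G (FA F g) \<cdot> u (Dom C g))"
        using f by (simp add: unit_natural)
      also have "\<dots> = FA G (HAdd C (FA F f) (FA F g)) \<cdot> u (Dom C g)"
        using f by (simp add: L.HAdd_comp linear_functorD(4)[OF G])
      finally show "FA G (FA F (HAdd C f g)) \<cdot> u (Dom C g) = FA G (HAdd C (FA F f) (FA F g)) \<cdot> u (Dom C g)" .
    qed (use f in auto)
  next
    fix f c assume f: "f \<in> Arr C" "c \<in> carrier K"
    show "FA F (HSmult C c f) = HSmult C c (FA F f)"
    proof (rule transpose_inj[of _ _ "Dom C f"])
      have "FA G (FA F (HSmult C c f)) \<cdot> u (Dom C f) = u (Cod C f) \<cdot> HSmult C c f"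
        using f by (simp add: unit_natural)
      also have "\<dots> = HSmult C c (u (Cod C f) \<cdot> f)" using f by (simp add: L.comp_HSmult)
      also have "\<dots> = HSmult C c (FA G (FA F f) \<cdot> u (Dom C f))" using f by (simp add: unit_natural)
      also have "\<dots> = FA G (HSmult C c (FA F f)) \<cdot> u (Dom C f)"
        using f by (simp add: L.comp_HSmult linear_functorD(5)[OF G])
      finally show "FA G (FA F (HSmult C c f)) \<cdot> u (Dom C f) = FA G (HSmult C c (FA F f)) \<cdot> u (Dom C f)" .
    qed (use f in auto)
  qed (simp_all add: L.lcat_axioms F.fctr_axioms)
qed

lemma linear_G:
  assumes F: "linear_functor K C C F"
  shows "linear_functor K C C G"
proof -
  interpret L: lcat K C using linear_functorD[OF F] by simp
  show ?thesis
  proof (rule linear_functorI)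
    fix f g assume f: "f \<in> Arr C" "g \<in> Arr C" "Dom C f = Dom C g" "Cod C f = Cod C g"
    show "FA G (HAdd C f g) = HAdd C (FA G f) (FA G g)"
    proof (rule inverse_transpose_inj[of _ _ "Cod C g"])
      have "e (Cod C g) \<cdot> FA F (FA G (HAdd C f g)) = HAdd C f g \<cdot> e (Dom C g)"
        using f by (simp add: counit_natural)
      also have "\<dots> = HAdd C (f \<cdot> e (Dom C g)) (g \<cdot> e (Dom C g))" using f by (simp add: L.HAdd_comp)
      also have "\<dots> = HAdd C (e (Cod C g) \<cdot> FA F (FA G f)) (e (Cod C g) \<cdot> FA F (FA G g))"
        using f by (simp add: counit_natural)
      also have "\<dots> = e (Cod C g) \<cdot> FA F (HAdd C (FA G f) (FA G g))"
        using f by (simp add: L.comp_HAdd linear_functorD(4)[OF F])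
      finally show "e (Cod C g) \<cdot> FA F (FA G (HAdd C f g)) = e (Cod C g) \<cdot> FA F (HAdd C (FA G f) (FA G g))" .
    qed (use f in auto)
  next
    fix f c assume f: "f \<in> Arr C" "c \<in> carrier K"
    show "FA G (HSmult C c f) = HSmult C c (FA G f)"
    proof (rule inverse_transpose_inj[of _ _ "Cod C f"])
      have "e (Cod C f) \<cdot> FA F (FA G (HSmult C c f)) = HSmult C c f \<cdot> e (Dom C f)"
        using f by (simp add: counit_natural)
      also have "\<dots> = HSmult C c (f \<cdot> e (Dom C f))" using f by (simp add: L.comp_HSmult)
      also have "\<dots> = HSmult C c (e (Cod C f) \<cdot> FA F (FA G f))" using f by (simp add: counit_natural)
      also have "\<dots> = e (Cod C f) \<cdot> FA F (HSmult C c (FA G f))"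
        using f by (simp add: L.comp_HSmult linear_functorD(5)[OF F])
      finally show "e (Cod C f) \<cdot> FA F (FA G (HSmult C c f)) = e (Cod C f) \<cdot> FA F (HSmult C c (FA G f))" .
    qed (use f in auto)
  qed (simp_all add: L.lcat_axioms G.fctr_axioms)
qed

end

section \<open>Modules over a monad\<close>

lemma tmod_simps [simp]:
  "Obj (tmod C T \<mu> \<eta>) = monad_modules C T \<mu> \<eta>"
  "Dom (tmod C T \<mu> \<eta>) (x, f, y) = x"
  "Cod (tmod C T \<mu> \<eta>) (x, f, y) = y"
  "Id (tmod C T \<mu> \<eta>) x = (x, Id C (fst x), x)"
  "Comp (tmod C T \<mu> \<eta>) (y', g, z) (x, f, y) = (x, g \<cdot>\<^bsub>C\<^esub> f, z)"
  "HZero (tmod C T \<mu> \<eta>) x y = (x, HZero C (fst x) (fst y), y)"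
  "HAdd (tmod C T \<mu> \<eta>) (x, f, y) (x', g, y') = (x, HAdd C f g, y)"
  "HSmult (tmod C T \<mu> \<eta>) c (x, f, y) = (x, HSmult C c f, y)"
  by (simp_all add: tmod_def)

lemma tmod_Arr: "(x, f, y) \<in> Arr (tmod C T \<mu> \<eta>) \<longleftrightarrow>
    x \<in> monad_modules C T \<mu> \<eta> \<and> y \<in> monad_modules C T \<mu> \<eta> \<and>
    f \<in> Arr C \<and> Dom C f = fst x \<and> Cod C f = fst y \<and> f \<cdot>\<^bsub>C\<^esub> snd x = snd y \<cdot>\<^bsub>C\<^esub> FA T f"
  by (simp add: tmod_def)

lemma monad_modules_iff: "x \<in> monad_modules C T \<mu> \<eta> \<longleftrightarrow> fst x \<in> Obj C \<and>
    snd x \<in> Arr C \<and> Dom C (snd x) = FO T (fst x) \<and> Cod C (snd x) = fst x \<and>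
    snd x \<cdot>\<^bsub>C\<^esub> \<mu> (fst x) = snd x \<cdot>\<^bsub>C\<^esub> FA T (snd x) \<and> snd x \<cdot>\<^bsub>C\<^esub> \<eta> (fst x) = Id C (fst x)"
  by (cases x) (simp add: monad_modules_def)

lemma tmod_homE:
  assumes "\<phi> \<in> hom_set (tmod C T \<mu> \<eta>) x y"
  obtains f where "\<phi> = (x, f, y)" "f \<in> Arr C" "Dom C f = fst x" "Cod C f = fst y"
    "f \<cdot>\<^bsub>C\<^esub> snd x = snd y \<cdot>\<^bsub>C\<^esub> FA T f" "x \<in> monad_modules C T \<mu> \<eta>" "y \<in> monad_modules C T \<mu> \<eta>"
proof -
  obtain f where f: "\<phi> = (x, f, y)" using assms by (cases \<phi>) auto
  then show thesis using assms that[OF f] by (simp add: tmod_Arr)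
qed

lemma tmod_ArrE:
  assumes "\<phi> \<in> Arr (tmod C T \<mu> \<eta>)"
  obtains x f y where "\<phi> = (x, f, y)" "f \<in> Arr C" "Dom C f = fst x" "Cod C f = fst y"
    "f \<cdot>\<^bsub>C\<^esub> snd x = snd y \<cdot>\<^bsub>C\<^esub> FA T f" "x \<in> monad_modules C T \<mu> \<eta>" "y \<in> monad_modules C T \<mu> \<eta>"
proof -
  obtain x f y where f: "\<phi> = (x, f, y)" by (cases \<phi>) auto
  then show thesis using assms that[OF f] by (simp add: tmod_Arr)
qed

lemma tmod_category:
  assumes T: "is_functor C C T"
  shows "category (tmod C T \<mu> \<eta>)"
proof -
  interpret cat C using T by (simp add: cat_def is_functor_def)
  interpret T: fctr C C T using T by (simp add: fctr_def)
  show ?thesis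
    unfolding category_def
  proof (intro conjI ballI impI)
    let ?M = "tmod C T \<mu> \<eta>"
    show "Dom ?M \<phi> \<in> Obj ?M" "Cod ?M \<phi> \<in> Obj ?M"
      "\<phi> \<cdot>\<^bsub>?M\<^esub> Id ?M (Dom ?M \<phi>) = \<phi>" "Id ?M (Cod ?M \<phi>) \<cdot>\<^bsub>?M\<^esub> \<phi> = \<phi>" if "\<phi> \<in> Arr ?M" for \<phi>
      using that by (auto elim!: tmod_ArrE)
    show "Id ?M x \<in> hom_set ?M x x" if "x \<in> Obj ?M" for x
      using that by (simp add: tmod_Arr monad_modules_iff)
    show "\<psi> \<cdot>\<^bsub>?M\<^esub> \<phi> \<in> hom_set ?M (Dom ?M \<phi>) (Cod ?M \<psi>)"
      if h: "\<phi> \<in> Arr ?M" "\<psi> \<in> Arr ?M" "Cod ?M \<phi> = Dom ?M \<psi>" for \<phi> \<psi>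
    proof -
      obtain x f y where f: "\<phi> = (x, f, y)" "f \<in> Arr C" "Dom C f = fst x" "Cod C f = fst y"
        "f \<cdot>\<^bsub>C\<^esub> snd x = snd y \<cdot>\<^bsub>C\<^esub> FA T f" "x \<in> monad_modules C T \<mu> \<eta>" "y \<in> monad_modules C T \<mu> \<eta>"
        using h(1) by (rule tmod_ArrE)
      obtain y' g z where g: "\<psi> = (y', g, z)" "g \<in> Arr C" "Dom C g = fst y'" "Cod C g = fst z"
        "g \<cdot>\<^bsub>C\<^esub> snd y' = snd z \<cdot>\<^bsub>C\<^esub> FA T g" "y' \<in> monad_modules C T \<mu> \<eta>" "z \<in> monad_modules C T \<mu> \<eta>"
        using h(2) by (rule tmod_ArrE)
      have y: "y' = y" using h(3) f(1) g(1) by simp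
      have m: "snd x \<in> Arr C" "Dom C (snd x) = FO T (fst x)" "Cod C (snd x) = fst x"
        "snd y \<in> Arr C" "Dom C (snd y) = FO T (fst y)" "Cod C (snd y) = fst y"
        "snd z \<in> Arr C" "Dom C (snd z) = FO T (fst z)" "Cod C (snd z) = fst z"
        using f(6,7) g(7) by (simp_all add: monad_modules_iff)
      have "(g \<cdot>\<^bsub>C\<^esub> f) \<cdot>\<^bsub>C\<^esub> snd x = (g \<cdot>\<^bsub>C\<^esub> snd y) \<cdot>\<^bsub>C\<^esub> FA T f"
        using f(2-5) g(2-3) m y by simp
      also have "\<dots> = snd z \<cdot>\<^bsub>C\<^esub> FA T (g \<cdot>\<^bsub>C\<^esub> f)"
        using f(2-4) g(2-5) m y by simp
      finally show ?thesis using f g y by (simp add: tmod_Arr)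
    qed
    show "\<chi> \<cdot>\<^bsub>?M\<^esub> (\<psi> \<cdot>\<^bsub>?M\<^esub> \<phi>) = (\<chi> \<cdot>\<^bsub>?M\<^esub> \<psi>) \<cdot>\<^bsub>?M\<^esub> \<phi>"
      if h: "\<phi> \<in> Arr ?M" "\<psi> \<in> Arr ?M" "\<chi> \<in> Arr ?M" "Cod ?M \<phi> = Dom ?M \<psi> \<and> Cod ?M \<psi> = Dom ?M \<chi>" for \<phi> \<psi> \<chi>
      using h by (auto elim!: tmod_ArrE)
  qed
qed

lemma tmod_linear_category:
  assumes T: "linear_functor K C C T"
  shows "linear_category K (tmod C T \<mu> \<eta>)"
proof -
  interpret lcat K C using linear_functorD[OF T] by simp
  interpret T: fctr C C T using linear_functorD[OF T] by simp
  let ?M = "tmod C T \<mu> \<eta>"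
  have zero: "FA T (HZero C X Y) = HZero C (FO T X) (FO T Y)" and zero': "g \<cdot>\<^bsub>C\<^esub> HZero C X Y = HZero C X (Cod C g)"
    and zero'': "HZero C Y Z \<cdot>\<^bsub>C\<^esub> f = HZero C (Dom C f) Z"
    if "X \<in> Obj C" "Y \<in> Obj C" "Z \<in> Obj C" "g \<in> Arr C" "Dom C g = Y" "f \<in> Arr C" "Cod C f = Y" for X Y Z f g
  proof -
    interpret XY: module K "Hom C X Y" using that by (simp add: hom_module)
    interpret T: module K "Hom C (FO T X) (FO T Y)" using that by (simp add: hom_module)
    interpret XZ: module K "Hom C X (Cod C g)" using that by (simp add: hom_module)
    interpret YZ: module K "Hom C Y Z" using that by (simp add: hom_module)
    interpret WZ: module K "Hom C (Dom C f) Z" using that by (simp add: hom_module)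
    have z: "HZero C X Y = HSmult C \<zero>\<^bsub>K\<^esub> (HZero C X Y)" "HZero C Y Z = HSmult C \<zero>\<^bsub>K\<^esub> (HZero C Y Z)"
      using XY.smult_l_null[OF XY.M.zero_closed] YZ.smult_l_null[OF YZ.M.zero_closed] by simp_all
    have "FA T (HZero C X Y) = HSmult C \<zero>\<^bsub>K\<^esub> (FA T (HZero C X Y))"
      by (subst z(1), subst linear_functorD(5)[OF T]) (use that in auto)
    also have "\<dots> = HZero C (FO T X) (FO T Y)"
      using T.smult_l_null[of "FA T (HZero C X Y)"] that by simp
    finally show "FA T (HZero C X Y) = HZero C (FO T X) (FO T Y)" .
    have "g \<cdot>\<^bsub>C\<^esub> HZero C X Y = HSmult C \<zero>\<^bsub>K\<^esub> (g \<cdot>\<^bsub>C\<^esub> HZero C X Y)"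
      by (subst z(1), subst comp_HSmult) (use that in auto)
    also have "\<dots> = HZero C X (Cod C g)" using XZ.smult_l_null[of "g \<cdot>\<^bsub>C\<^esub> HZero C X Y"] that by simp
    finally show "g \<cdot>\<^bsub>C\<^esub> HZero C X Y = HZero C X (Cod C g)" .
    have "HZero C Y Z \<cdot>\<^bsub>C\<^esub> f = HSmult C \<zero>\<^bsub>K\<^esub> (HZero C Y Z \<cdot>\<^bsub>C\<^esub> f)"
      by (subst z(2), subst comp_HSmult) (use that in auto)
    also have "\<dots> = HZero C (Dom C f) Z" using WZ.smult_l_null[of "HZero C Y Z \<cdot>\<^bsub>C\<^esub> f"] that by simp
    finally show "HZero C Y Z \<cdot>\<^bsub>C\<^esub> f = HZero C (Dom C f) Z" .
  qed
  have "module K (Hom ?M x y)" if x: "x \<in> Obj ?M" and y: "y \<in> Obj ?M" for x y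
  proof (rule module_pointwise[where I = UNIV and W = "\<lambda>_::unit. Hom C (fst x) (fst y)" and ev = "\<lambda>_ \<phi>. fst (snd \<phi>)"])
    have X: "fst x \<in> Obj C" "snd x \<in> Arr C" "Dom C (snd x) = FO T (fst x)" "Cod C (snd x) = fst x"
      and Y: "fst y \<in> Obj C" "snd y \<in> Arr C" "Dom C (snd y) = FO T (fst y)" "Cod C (snd y) = fst y"
      using x y by (auto simp: monad_modules_iff)
    show "module K (Hom C (fst x) (fst y))" using X Y by (simp add: hom_module)
    then show "cring K" by (simp add: module_def)
    show "\<zero>\<^bsub>Hom ?M x y\<^esub> \<in> carrier (Hom ?M x y)"
      using x y X Y zero[of "fst x" "fst y" "fst y" "Id C (fst y)" "Id C (fst y)"]
        zero'[of "FO T (fst x)" "FO T (fst y)" "fst y" "snd y" "Id C (FO T (fst y))"]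
        zero''[of "fst x" "fst x" "fst y" "Id C (fst x)" "snd x"] by (simp add: tmod_Arr)
    show "\<phi> \<oplus>\<^bsub>Hom ?M x y\<^esub> \<psi> \<in> carrier (Hom ?M x y)"
      if p: "\<phi> \<in> carrier (Hom ?M x y)" and q: "\<psi> \<in> carrier (Hom ?M x y)" for \<phi> \<psi>
    proof -
      obtain f where f: "\<phi> = (x, f, y)" "f \<in> Arr C" "Dom C f = fst x" "Cod C f = fst y"
        "f \<cdot>\<^bsub>C\<^esub> snd x = snd y \<cdot>\<^bsub>C\<^esub> FA T f" using p by (rule tmod_homE)
      obtain g where g: "\<psi> = (x, g, y)" "g \<in> Arr C" "Dom C g = fst x" "Cod C g = fst y"
        "g \<cdot>\<^bsub>C\<^esub> snd x = snd y \<cdot>\<^bsub>C\<^esub> FA T g" using q by (rule tmod_homE)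
      show ?thesis using f g x y X Y by (simp add: tmod_Arr HAdd_comp comp_HAdd linear_functorD(4)[OF T])
    qed
    show "c \<odot>\<^bsub>Hom ?M x y\<^esub> \<phi> \<in> carrier (Hom ?M x y)"
      if c: "c \<in> carrier K" and p: "\<phi> \<in> carrier (Hom ?M x y)" for c \<phi>
    proof -
      obtain f where f: "\<phi> = (x, f, y)" "f \<in> Arr C" "Dom C f = fst x" "Cod C f = fst y"
        "f \<cdot>\<^bsub>C\<^esub> snd x = snd y \<cdot>\<^bsub>C\<^esub> FA T f" using p by (rule tmod_homE)
      show ?thesis using f c x y X Y by (simp add: tmod_Arr comp_HSmult linear_functorD(5)[OF T])
    qed
  qed (auto elim!: tmod_ArrE)
  moreover have "\<psi> \<cdot>\<^bsub>?M\<^esub> HAdd ?M \<phi> \<phi>' = HAdd ?M (\<psi> \<cdot>\<^bsub>?M\<^esub> \<phi>) (\<psi> \<cdot>\<^bsub>?M\<^esub> \<phi>') \<and>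
      HAdd ?M \<psi> \<psi>' \<cdot>\<^bsub>?M\<^esub> \<phi> = HAdd ?M (\<psi> \<cdot>\<^bsub>?M\<^esub> \<phi>) (\<psi>' \<cdot>\<^bsub>?M\<^esub> \<phi>) \<and>
      (\<forall>c\<in>carrier K. \<psi> \<cdot>\<^bsub>?M\<^esub> HSmult ?M c \<phi> = HSmult ?M c (\<psi> \<cdot>\<^bsub>?M\<^esub> \<phi>) \<and>
        HSmult ?M c \<psi> \<cdot>\<^bsub>?M\<^esub> \<phi> = HSmult ?M c (\<psi> \<cdot>\<^bsub>?M\<^esub> \<phi>))"
    if "\<phi> \<in> hom_set ?M x y" "\<phi>' \<in> hom_set ?M x y" "\<psi> \<in> hom_set ?M y z" "\<psi>' \<in> hom_set ?M y z" for x y z \<phi> \<phi>' \<psi> \<psi>'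
    using that by (auto elim!: tmod_ArrE simp: comp_HAdd HAdd_comp comp_HSmult)
  ultimately show ?thesis
    using tmod_category[OF T.is_functor, of \<mu> \<eta>] unfolding linear_category_def by blast
qed

locale lmonad =
  fixes K :: "'k ring" and C :: "('k, 'o, 'm) lincat" (structure) and T :: "('o, 'm, 'o, 'm) ftr"
    and \<mu> \<eta> :: "'o \<Rightarrow> 'm"
  assumes T_linear: "linear_functor K C C T" and monad: "monad C T \<mu> \<eta>"
begin

sublocale lcat K C
  using linear_functorD[OF T_linear] by simp
sublocale T: fctr C C T
  using linear_functorD[OF T_linear] by simp

abbreviation TMod where "TMod \<equiv> tmod C T \<mu> \<eta>"
abbreviation Mods where "Mods \<equiv> monad_modules C T \<mu> \<eta>"

lemma mu_nt: "nat_trans C C (ftr_comp T T) T \<mu>" and eta_nt: "nat_trans C C ftr_id T \<eta>"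
  using monad by (simp_all add: monad_def)

lemma mu_simps [simp]:
  "X \<in> Obj C \<Longrightarrow> \<mu> X \<in> Arr C" "X \<in> Obj C \<Longrightarrow> Dom C (\<mu> X) = FO T (FO T X)"
  "X \<in> Obj C \<Longrightarrow> Cod C (\<mu> X) = FO T X"
  using nat_transD(1-3)[OF mu_nt] by simp_all

lemma eta_simps [simp]:
  "X \<in> Obj C \<Longrightarrow> \<eta> X \<in> Arr C" "X \<in> Obj C \<Longrightarrow> Dom C (\<eta> X) = X"
  "X \<in> Obj C \<Longrightarrow> Cod C (\<eta> X) = FO T X"
  using nat_transD(1-3)[OF eta_nt] by simp_all

lemma mu_natural: "f \<in> Arr C \<Longrightarrow> Cod C f = Y \<Longrightarrow> \<mu> Y \<cdot> FA T (FA T f) = FA T f \<cdot> \<mu> (Dom C f)"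
  and eta_natural: "f \<in> Arr C \<Longrightarrow> Cod C f = Y \<Longrightarrow> \<eta> Y \<cdot> f = FA T f \<cdot> \<eta> (Dom C f)"
  using nat_transD(4)[OF mu_nt] nat_transD(4)[OF eta_nt] by auto

lemma mu_assoc: "X \<in> Obj C \<Longrightarrow> \<mu> X \<cdot> FA T (\<mu> X) = \<mu> X \<cdot> \<mu> (FO T X)"
  and mu_eta: "X \<in> Obj C \<Longrightarrow> \<mu> X \<cdot> \<eta> (FO T X) = Id C (FO T X)"
  and mu_T_eta: "X \<in> Obj C \<Longrightarrow> \<mu> X \<cdot> FA T (\<eta> X) = Id C (FO T X)"
  using monad by (simp_all add: monad_def)

sublocale TMod: lcat K TMod
  by unfold_locales (rule tmod_linear_category[OF T_linear])

lemma act_simps [simp]: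
  assumes "x \<in> Mods"
  shows "fst x \<in> Obj C" "snd x \<in> Arr C" "Dom C (snd x) = FO T (fst x)" "Cod C (snd x) = fst x"
  using assms by (simp_all add: monad_modules_iff)

lemma act_assoc: "x \<in> Mods \<Longrightarrow> snd x \<cdot> FA T (snd x) = snd x \<cdot> \<mu> (fst x)"
  and act_unit: "x \<in> Mods \<Longrightarrow> snd x \<cdot> \<eta> (fst x) = Id C (fst x)"
  unfolding monad_modules_iff by auto

definition free :: "'o \<Rightarrow> 'o \<times> 'm" where
  "free X = (FO T X, \<mu> X)"

lemma fst_free [simp]: "fst (free X) = FO T X" and snd_free [simp]: "snd (free X) = \<mu> X"
  by (simp_all add: free_def)

lemma free_module [simp]: "X \<in> Obj C \<Longrightarrow> free X \<in> Mods"
  by (simp add: monad_modules_iff mu_assoc mu_eta)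

lemma free_map:
  "f \<in> Arr C \<Longrightarrow> (free (Dom C f), FA T f, free (Cod C f)) \<in> Arr TMod"
  by (simp add: tmod_Arr mu_natural)

text \<open>The extension of an arrow \<open>p : X \<rightarrow> x\<close> to a module map from the free module on \<open>X\<close>.\<close>

definition lift :: "'o \<times> 'm \<Rightarrow> 'm \<Rightarrow> 'm" where
  "lift x p = snd x \<cdot> FA T p"

lemma lift_simps [simp]:
  assumes "x \<in> Mods" "p \<in> Arr C" "Cod C p = fst x"
  shows "lift x p \<in> Arr C" "Dom C (lift x p) = FO T (Dom C p)" "Cod C (lift x p) = fst x"
  using assms by (simp_all add: lift_def)

lemma lift_linear:
  assumes "x \<in> Mods" "p \<in> Arr C" "Cod C p = fst x"
  shows "lift x p \<cdot> \<mu> (Dom C p) = snd x \<cdot> FA T (lift x p)"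
proof -
  have "lift x p \<cdot> \<mu> (Dom C p) = snd x \<cdot> (\<mu> (fst x) \<cdot> FA T (FA T p))"
    using assms by (simp add: lift_def mu_natural)
  also have "\<dots> = (snd x \<cdot> FA T (snd x)) \<cdot> FA T (FA T p)" using assms by (simp add: act_assoc)
  finally show ?thesis using assms by (simp add: lift_def)
qed

lemma lift_hom:
  assumes "x \<in> Mods" "p \<in> Arr C" "Cod C p = fst x"
  shows "(free (Dom C p), lift x p, x) \<in> Arr TMod"
  using assms lift_linear[OF assms] by (simp add: tmod_Arr)

lemma lift_eta:
  assumes "x \<in> Mods" "p \<in> Arr C" "Cod C p = fst x"
  shows "lift x p \<cdot> \<eta> (Dom C p) = p"
proof -
  have "lift x p \<cdot> \<eta> (Dom C p) = (snd x \<cdot> \<eta> (fst x)) \<cdot> p"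
    using assms by (simp add: lift_def eta_natural)
  then show ?thesis using assms by (simp add: act_unit)
qed

lemma lift_unique:
  assumes "x \<in> Mods" "f \<in> Arr C" "Cod C f = fst x" "Dom C f = FO T X" "X \<in> Obj C"
    "f \<cdot> \<mu> X = snd x \<cdot> FA T f"
  shows "lift x (f \<cdot> \<eta> X) = f"
proof -
  have "lift x (f \<cdot> \<eta> X) = (f \<cdot> \<mu> X) \<cdot> FA T (\<eta> X)"
    unfolding assms(6) using assms(1-5) by (simp add: lift_def)
  also have "\<dots> = f \<cdot> (\<mu> X \<cdot> FA T (\<eta> X))" using assms(1-5) by simp
  also have "\<dots> = f" using assms(2-5) by (simp add: mu_T_eta)
  finally show ?thesis .
qed

lemma lift_comp:
  assumes "x \<in> Mods" "p \<in> Arr C" "Cod C p = fst x" "g \<in> Arr C" "Cod C g = Dom C p"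
  shows "lift x (p \<cdot> g) = lift x p \<cdot> FA T g"
  using assms by (simp add: lift_def)

lemma module_map_lift:
  assumes "x \<in> Mods" "y \<in> Mods" "p \<in> Arr C" "Cod C p = fst x"
    "f \<in> Arr C" "Dom C f = fst x" "Cod C f = fst y" "f \<cdot> snd x = snd y \<cdot> FA T f"
  shows "f \<cdot> lift x p = lift y (f \<cdot> p)"
proof -
  have "f \<cdot> lift x p = (f \<cdot> snd x) \<cdot> FA T p" using assms(1-7) by (simp add: lift_def)
  then show ?thesis using assms by (simp add: lift_def)
qed

end

text \<open>The free module on a progenerator is a progenerator of the category of modules, if \<open>T\<close> has a
  right adjoint \<open>R\<close>: a family of arrows \<open>T(P) \<rightarrow> Z\<close>, indexed by the arrows \<open>p : P \<rightarrow> X\<close>, comes from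
  an arrow \<open>T(X) \<rightarrow> Z\<close>, since its transpose \<open>P \<rightarrow> R(Z)\<close> comes from \<open>X \<rightarrow> R(Z)\<close>.  So module maps and
  module structures may be defined on \<open>P\<close> alone.\<close>

locale lmonad_adj = lmonad + R: adj C T R v w for R v w +
  fixes P
  assumes P: "progenerator K C P"
begin

lemma P_Obj [simp]: "P \<in> Obj C"
  using P by (simp add: progenerator_def)

lemma P_epic: "X \<in> Obj C \<Longrightarrow> jointly_epic C X (hom_set C P X)"
  unfolding jointly_epic_def
proof (intro conjI ballI impI)
  fix f g assume "X \<in> Obj C" "f \<in> Arr C" "g \<in> Arr C"
    "Dom C f = X \<and> Dom C g = X \<and> Cod C f = Cod C g \<and> (\<forall>s\<in>hom_set C P X. f \<cdot> s = g \<cdot> s)"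
  then show "f = g" by - (rule progenerator_unique[OF P lcat_axioms, of X "Cod C g"], auto)
qed auto

lemma P_eqI:
  assumes "f \<in> Arr C" "g \<in> Arr C" "Dom C f = Dom C g" "Cod C f = Cod C g"
    "\<And>p. p \<in> Arr C \<Longrightarrow> Dom C p = P \<Longrightarrow> Cod C p = Dom C g \<Longrightarrow> f \<cdot> p = g \<cdot> p"
  shows "f = g"
  by (rule jointly_epicD[OF P_epic[of "Dom C g"]]) (use assms in auto)

lemma TP_eqI:
  assumes "f \<in> Arr C" "g \<in> Arr C" "X \<in> Obj C" "Dom C f = FO T X" "Dom C g = FO T X" "Cod C f = Cod C g"
    "\<And>p. p \<in> Arr C \<Longrightarrow> Dom C p = P \<Longrightarrow> Cod C p = X \<Longrightarrow> f \<cdot> FA T p = g \<cdot> FA T p"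
  shows "f = g"
  by (rule jointly_epicD[OF R.jointly_epic_F[OF P_epic[of X]]]) (use assms in auto)

lemma TTP_eqI:
  assumes "f \<in> Arr C" "g \<in> Arr C" "X \<in> Obj C" "Dom C f = FO T (FO T X)" "Dom C g = FO T (FO T X)" "Cod C f = Cod C g"
    "\<And>p. p \<in> Arr C \<Longrightarrow> Dom C p = P \<Longrightarrow> Cod C p = X \<Longrightarrow> f \<cdot> FA T (FA T p) = g \<cdot> FA T (FA T p)"
  shows "f = g"
  by (rule jointly_epicD[OF R.jointly_epic_F[OF R.jointly_epic_F[OF P_epic[of X]]]]) (use assms in auto)

text \<open>Density of \<open>P\<close>, transposed along \<open>T \<stileturn> R\<close>.\<close>

lemma extend_from_TP:
  assumes X: "X \<in> Obj C" and Z: "Z \<in> Obj C"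
    and cl: "\<And>p. p \<in> hom_set C P X \<Longrightarrow> \<psi> p \<in> hom_set C (FO T P) Z"
    and add: "\<And>p p'. p \<in> hom_set C P X \<Longrightarrow> p' \<in> hom_set C P X \<Longrightarrow> \<psi> (HAdd C p p') = HAdd C (\<psi> p) (\<psi> p')"
    and smult: "\<And>c p. c \<in> carrier K \<Longrightarrow> p \<in> hom_set C P X \<Longrightarrow> \<psi> (HSmult C c p) = HSmult C c (\<psi> p)"
    and act: "\<And>p a. p \<in> hom_set C P X \<Longrightarrow> a \<in> hom_set C P P \<Longrightarrow> \<psi> (p \<cdot> a) = \<psi> p \<cdot> FA T a"
  obtains f where "f \<in> hom_set C (FO T X) Z" "\<And>p. p \<in> hom_set C P X \<Longrightarrow> f \<cdot> FA T p = \<psi> p"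
proof -
  note lR = R.linear_G[OF T_linear]
  have cl': "\<psi> p \<in> Arr C" "Dom C (\<psi> p) = FO T P" "Cod C (\<psi> p) = Z" if "p \<in> hom_set C P X" for p
    using cl[OF that] by auto
  obtain k where k: "k \<in> hom_set C X (FO R Z)" "\<And>p. p \<in> hom_set C P X \<Longrightarrow> k \<cdot> p = FA R (\<psi> p) \<cdot> v P"
  proof (rule progenerator_extend[OF P lcat_axioms X, of "FO R Z" "\<lambda>p. FA R (\<psi> p) \<cdot> v P"])
    show "FO R Z \<in> Obj C" using Z by simp
    fix p p' assume p: "p \<in> hom_set C P X"
    show "FA R (\<psi> p) \<cdot> v P \<in> hom_set C P (FO R Z)" using cl'[OF p] by simp
    show "FA R (\<psi> (HAdd C p p')) \<cdot> v P = HAdd C (FA R (\<psi> p) \<cdot> v P) (FA R (\<psi> p') \<cdot> v P)"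
      if p': "p' \<in> hom_set C P X"
      using cl'[OF p] cl'[OF p'] by (simp add: add[OF p p'] linear_functorD(4)[OF lR] HAdd_comp)
    show "FA R (\<psi> (HSmult C c p)) \<cdot> v P = HSmult C c (FA R (\<psi> p) \<cdot> v P)" if c: "c \<in> carrier K" for c
      using cl'[OF p] c by (simp add: smult[OF c p] linear_functorD(5)[OF lR] comp_HSmult)
    show "FA R (\<psi> (p \<cdot> a)) \<cdot> v P = (FA R (\<psi> p) \<cdot> v P) \<cdot> a" if a: "a \<in> hom_set C P P" for a
      using cl'[OF p] a by (simp add: act[OF p a] R.unit_natural)
  qed blast
  have "(w Z \<cdot> FA T k) \<cdot> FA T p = \<psi> p" if p: "p \<in> hom_set C P X" for p
  proof -
    have "(w Z \<cdot> FA T k) \<cdot> FA T p = w Z \<cdot> FA T (k \<cdot> p)" using k(1) p Z by auto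
    also have "\<dots> = \<psi> p" unfolding k(2)[OF p] using R.transpose_inverse[of "\<psi> p" P] cl'[OF p] by simp
    finally show ?thesis .
  qed
  then show thesis using k(1) Z by (intro that[of "w Z \<cdot> FA T k"]) auto
qed

text \<open>Module maps \<open>T(P) \<rightarrow> x\<close> are the arrows \<open>p : P \<rightarrow> x\<close>, so \<open>\<psi>\<close> yields a map from \<open>Hom(P, x)\<close> to \<open>Hom(P, y)\<close>
  and by density an arrow \<open>f\<close> from \<open>x\<close> to \<open>y\<close>.  It is linear because \<open>\<psi>\<close> commutes with all endomorphisms
  of the free module and not only with the \<open>T(a)\<close>.\<close>

lemma free_dense:
  assumes x: "x \<in> Obj TMod" and y: "y \<in> Obj TMod"
    and psi: "\<psi> \<in> linear_maps K (Hom TMod (free P) x) (Hom TMod (free P) y)"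
    and act: "\<forall>p\<in>hom_set TMod (free P) x. \<forall>a\<in>hom_set TMod (free P) (free P). \<psi> (p \<cdot>\<^bsub>TMod\<^esub> a) = \<psi> p \<cdot>\<^bsub>TMod\<^esub> a"
  shows "\<exists>!\<phi>. \<phi> \<in> hom_set TMod x y \<and> (\<forall>p\<in>hom_set TMod (free P) x. \<psi> p = \<phi> \<cdot>\<^bsub>TMod\<^esub> p)"
proof -
  have x' [simp]: "x \<in> Mods" and y' [simp]: "y \<in> Mods" using x y by auto
  \<comment> \<open>the map on \<open>Hom(P, -)\<close> that corresponds to \<open>\<psi>\<close>\<close>
  define \<psi>1 where "\<psi>1 p = fst (snd (\<psi> (free P, lift x p, x)))" for p
  have lh: "(free P, lift x p, x) \<in> hom_set TMod (free P) x" if "p \<in> hom_set C P (fst x)" for p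
    using lift_hom[of x p] that by auto
  have psi1: "\<psi> (free P, lift x p, x) = (free P, \<psi>1 p, y)" "\<psi>1 p \<in> Arr C" "Dom C (\<psi>1 p) = FO T P"
    "Cod C (\<psi>1 p) = fst y" "\<psi>1 p \<cdot> \<mu> P = snd y \<cdot> FA T (\<psi>1 p)" if p: "p \<in> hom_set C P (fst x)" for p
  proof -
    have h: "\<psi> (free P, lift x p, x) \<in> hom_set TMod (free P) y" by (rule linear_maps_closed[OF psi lh[OF p]])
    obtain f where "\<psi> (free P, lift x p, x) = (free P, f, y)" "f \<in> Arr C" "Dom C f = FO T P"
      "Cod C f = fst y" "f \<cdot> \<mu> P = snd y \<cdot> FA T f"
      by (rule tmod_homE[OF h]) auto
    then show "\<psi> (free P, lift x p, x) = (free P, \<psi>1 p, y)" "\<psi>1 p \<in> Arr C" "Dom C (\<psi>1 p) = FO T P"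
      "Cod C (\<psi>1 p) = fst y" "\<psi>1 p \<cdot> \<mu> P = snd y \<cdot> FA T (\<psi>1 p)" by (simp_all add: \<psi>1_def)
  qed
  have act1: "\<psi>1 (lift x p \<cdot> (g \<cdot> \<eta> P)) = \<psi>1 p \<cdot> g"
    if p: "p \<in> hom_set C P (fst x)" and g: "g \<in> Arr C" "Dom C g = FO T P" "Cod C g = FO T P" "g \<cdot> \<mu> P = \<mu> P \<cdot> FA T g" for p g
  proof -
    have gh: "(free P, g, free P) \<in> hom_set TMod (free P) (free P)" using g by (simp add: tmod_Arr)
    have pg: "lift x p \<cdot> (g \<cdot> \<eta> P) \<in> hom_set C P (fst x)" using p g by auto
    have ll: "(lift x p \<cdot> g) \<cdot> \<mu> P = snd x \<cdot> FA T (lift x p \<cdot> g)"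
    proof -
      have "(lift x p \<cdot> g) \<cdot> \<mu> P = (lift x p \<cdot> \<mu> P) \<cdot> FA T g" using p g by auto
      also have "\<dots> = (snd x \<cdot> FA T (lift x p)) \<cdot> FA T g" using lift_linear[of x p] p by auto
      finally show ?thesis using p g by auto
    qed
    have "lift x (lift x p \<cdot> (g \<cdot> \<eta> P)) = lift x p \<cdot> g"
      using lift_unique[of x "lift x p \<cdot> g" P] ll p g by auto
    then have "(free P, \<psi>1 (lift x p \<cdot> (g \<cdot> \<eta> P)), y) = \<psi> (free P, lift x p \<cdot> g, x)"
      using psi1(1)[OF pg] by simp
    also have "\<dots> = \<psi> ((free P, lift x p, x) \<cdot>\<^bsub>TMod\<^esub> (free P, g, free P))" by simp
    also have "\<dots> = \<psi> (free P, lift x p, x) \<cdot>\<^bsub>TMod\<^esub> (free P, g, free P)"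
      using act lh[OF p] gh by blast
    also have "\<dots> = (free P, \<psi>1 p \<cdot> g, y)" using psi1(1)[OF p] by simp
    finally show ?thesis by simp
  qed
  obtain f where f: "f \<in> hom_set C (fst x) (fst y)" "\<And>p. p \<in> hom_set C P (fst x) \<Longrightarrow> f \<cdot> p = \<psi>1 p \<cdot> \<eta> P"
  proof (rule progenerator_extend[OF P lcat_axioms, of "fst x" "fst y" "\<lambda>p. \<psi>1 p \<cdot> \<eta> P"])
    fix p p' a c assume p: "p \<in> hom_set C P (fst x)"
    show "\<psi>1 p \<cdot> \<eta> P \<in> hom_set C P (fst y)" using psi1[OF p] by simp
    show "\<psi>1 (HAdd C p p') \<cdot> \<eta> P = HAdd C (\<psi>1 p \<cdot> \<eta> P) (\<psi>1 p' \<cdot> \<eta> P)" if p': "p' \<in> hom_set C P (fst x)"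
    proof -
      have pp: "HAdd C p p' \<in> hom_set C P (fst x)" using p p' by auto
      have "lift x (HAdd C p p') = HAdd C (lift x p) (lift x p')"
        using p p' by (auto simp: lift_def linear_functorD(4)[OF T_linear] comp_HAdd)
      then have "(free P, \<psi>1 (HAdd C p p'), y) = \<psi> ((free P, lift x p, x) \<oplus>\<^bsub>Hom TMod (free P) x\<^esub> (free P, lift x p', x))"
        using psi1(1)[OF pp] by simp
      also have "\<dots> = (free P, HAdd C (\<psi>1 p) (\<psi>1 p'), y)"
        using linear_maps_add[OF psi lh[OF p] lh[OF p']] psi1(1)[OF p] psi1(1)[OF p'] by simp
      finally show ?thesis using psi1[OF p] psi1[OF p'] by (simp add: HAdd_comp)
    qed
    show "\<psi>1 (HSmult C c p) \<cdot> \<eta> P = HSmult C c (\<psi>1 p \<cdot> \<eta> P)" if c: "c \<in> carrier K"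
    proof -
      have pp: "HSmult C c p \<in> hom_set C P (fst x)" using p c by auto
      have "lift x (HSmult C c p) = HSmult C c (lift x p)"
        using p c by (auto simp: lift_def linear_functorD(5)[OF T_linear] comp_HSmult)
      then have "(free P, \<psi>1 (HSmult C c p), y) = \<psi> (c \<odot>\<^bsub>Hom TMod (free P) x\<^esub> (free P, lift x p, x))"
        using psi1(1)[OF pp] by simp
      also have "\<dots> = (free P, HSmult C c (\<psi>1 p), y)"
        using linear_maps_smult[OF psi c lh[OF p]] psi1(1)[OF p] by simp
      finally show ?thesis using psi1[OF p] c by (simp add: comp_HSmult)
    qed
    show "\<psi>1 (p \<cdot> a) \<cdot> \<eta> P = (\<psi>1 p \<cdot> \<eta> P) \<cdot> a" if a: "a \<in> hom_set C P P"
    proof -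
      have "lift x p \<cdot> (FA T a \<cdot> \<eta> P) = (lift x p \<cdot> \<eta> P) \<cdot> a" using p a by (auto simp: eta_natural)
      also have "\<dots> = p \<cdot> a" using lift_eta[of x p] p by auto
      finally have "\<psi>1 (p \<cdot> a) = \<psi>1 p \<cdot> FA T a"
        using act1[OF p, of "FA T a"] a by (auto simp: mu_natural)
      then show ?thesis using psi1[OF p] a by (auto simp: eta_natural)
    qed
  qed auto
  have f' [simp]: "f \<in> Arr C" "Dom C f = fst x" "Cod C f = fst y" using f(1) by auto
  have psi1_lift: "\<psi>1 p = lift y (f \<cdot> p)" if p: "p \<in> hom_set C P (fst x)" for p
    using lift_unique[of y "\<psi>1 p" P] psi1[OF p] f(2)[OF p] by simp
  have f_lin: "f \<cdot> snd x = snd y \<cdot> FA T f"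
  proof (rule TP_eqI[of _ _ "fst x"])
    fix p assume p: "p \<in> Arr C" "Dom C p = P" "Cod C p = fst x"
    then have p': "p \<in> hom_set C P (fst x)" by simp
    have "f \<cdot> lift x p = lift y (f \<cdot> p)"
    proof (rule P_eqI)
      fix b assume "b \<in> Arr C" "Dom C b = P" "Cod C b = Dom C (lift y (f \<cdot> p))"
      then have b: "b \<in> Arr C" "Dom C b = P" "Cod C b = FO T P" using p by simp_all
      have bl: "lift (free P) b \<cdot> \<mu> P = \<mu> P \<cdot> FA T (lift (free P) b)" "lift (free P) b \<cdot> \<eta> P = b"
        using lift_linear[of "free P" b] lift_eta[of "free P" b] b by simp_all
      have pb: "lift x p \<cdot> b \<in> hom_set C P (fst x)" using p b by simp
      have "(f \<cdot> lift x p) \<cdot> b = f \<cdot> (lift x p \<cdot> b)" using p b by simp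
      also have "\<dots> = \<psi>1 (lift x p \<cdot> b) \<cdot> \<eta> P" by (rule f(2)[OF pb])
      also have "\<psi>1 (lift x p \<cdot> b) = \<psi>1 p \<cdot> lift (free P) b"
        using act1[OF p', of "lift (free P) b"] b bl by simp
      also have "(\<psi>1 p \<cdot> lift (free P) b) \<cdot> \<eta> P = \<psi>1 p \<cdot> b"
        using psi1[OF p'] b bl by simp
      finally show "(f \<cdot> lift x p) \<cdot> b = lift y (f \<cdot> p) \<cdot> b" unfolding psi1_lift[OF p'] .
    qed (use p in auto)
    then show "(f \<cdot> snd x) \<cdot> FA T p = (snd y \<cdot> FA T f) \<cdot> FA T p" using p by (simp add: lift_def)
  qed auto
  show ?thesis
  proof (rule ex1I[of _ "(x, f, y)"], intro conjI ballI)
    show "(x, f, y) \<in> hom_set TMod x y" using f_lin by (simp add: tmod_Arr)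
    fix \<alpha> assume "\<alpha> \<in> hom_set TMod (free P) x"
    then obtain g where g: "\<alpha> = (free P, g, x)" "g \<in> Arr C" "Dom C g = FO T P" "Cod C g = fst x"
      "g \<cdot> \<mu> P = snd x \<cdot> FA T g" by (rule tmod_homE) auto
    have p: "g \<cdot> \<eta> P \<in> hom_set C P (fst x)" using g by simp
    have l: "lift x (g \<cdot> \<eta> P) = g" using lift_unique[of x g P] g by simp
    show "\<psi> \<alpha> = (x, f, y) \<cdot>\<^bsub>TMod\<^esub> \<alpha>"
      using psi1(1)[OF p] psi1_lift[OF p] module_map_lift[of x y "g \<cdot> \<eta> P" f] g f_lin by (simp add: l)
  next
    fix \<beta> assume \<beta>: "\<beta> \<in> hom_set TMod x y \<and> (\<forall>p\<in>hom_set TMod (free P) x. \<psi> p = \<beta> \<cdot>\<^bsub>TMod\<^esub> p)"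
    then obtain h where h: "\<beta> = (x, h, y)" "h \<in> Arr C" "Dom C h = fst x" "Cod C h = fst y"
      by (auto elim!: tmod_ArrE)
    have "h = f"
    proof (rule P_eqI)
      fix p assume p: "p \<in> Arr C" "Dom C p = P" "Cod C p = Dom C f"
      then have p': "p \<in> hom_set C P (fst x)" by simp
      have "\<psi> (free P, lift x p, x) = \<beta> \<cdot>\<^bsub>TMod\<^esub> (free P, lift x p, x)" using \<beta> lh[OF p'] by blast
      then have "h \<cdot> lift x p = \<psi>1 p" using psi1(1)[OF p'] h(1) by simp
      then have "(h \<cdot> lift x p) \<cdot> \<eta> P = f \<cdot> p" using f(2)[OF p'] by simp
      then show "h \<cdot> p = f \<cdot> p" using lift_eta[of x p] p h by simp
    qed (use h in auto)
    then show "\<beta> = (x, f, y)" using h by simp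
  qed
qed

text \<open>The endomorphisms of the free module on \<open>P\<close> are the arrows \<open>b : P \<rightarrow> T(P)\<close>.  Through \<open>a \<mapsto> \<eta> a\<close> the space
  \<open>W\<close> is a module over \<open>End(P)\<close>, so it is \<open>Hom(P, X)\<close> for some \<open>X\<close>.  The action of all \<open>b\<close> on \<open>W\<close> then assigns
  to \<open>p : P \<rightarrow> X\<close> an arrow \<open>T(P) \<rightarrow> X\<close>, and these come from an arrow \<open>T(X) \<rightarrow> X\<close>.  It satisfies the laws of
  an action because \<open>W\<close> does, as arrows out of \<open>T(X)\<close> and \<open>T(T(X))\<close> can be tested on \<open>P\<close>.\<close>

lemma free_realizes:
  fixes W :: "('a, nat \<Rightarrow> 'a) module"
  assumes W: "fd_left_module K (end_alg TMod (free P)) (W, r)"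
  shows "\<exists>x\<in>Obj TMod. \<exists>\<theta>\<in>linear_maps K (Hom TMod (free P) x) W.
      bij_betw \<theta> (hom_set TMod (free P) x) (carrier W) \<and>
      (\<forall>p\<in>hom_set TMod (free P) x. \<forall>a\<in>hom_set TMod (free P) (free P). \<theta> (p \<cdot>\<^bsub>TMod\<^esub> a) = r a (\<theta> p))"
proof -
  note Wr = fd_left_moduleD[OF W, simplified fst_conv snd_conv]
  \<comment> \<open>\<open>E\<close> is the Kleisli description of the endomorphisms of the free module\<close>
  define E where "E b = (free P, lift (free P) b, free P)" for b
  have lift_mu: "lift (free P) b = \<mu> P \<cdot> FA T b" for b by (simp add: lift_def)
  have E_in: "E b \<in> carrier (end_alg TMod (free P))" if "b \<in> hom_set C P (FO T P)" for b
    using lift_hom[of "free P" b] that by (auto simp: E_def)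
  have Eh: "h = E (fst (snd h) \<cdot> \<eta> P)" "fst (snd h) \<cdot> \<eta> P \<in> hom_set C P (FO T P)"
    if h: "h \<in> hom_set TMod (free P) (free P)" for h
  proof -
    obtain g where g: "h = (free P, g, free P)" "g \<in> Arr C" "Dom C g = FO T P" "Cod C g = FO T P"
      "g \<cdot> \<mu> P = \<mu> P \<cdot> FA T g" using h by (rule tmod_homE) auto
    show "h = E (fst (snd h) \<cdot> \<eta> P)" "fst (snd h) \<cdot> \<eta> P \<in> hom_set C P (FO T P)"
      using g lift_unique[of "free P" g P] by (simp_all add: E_def)
  qed
  have E_comp: "E (lift (free P) b \<cdot> b') = E b \<cdot>\<^bsub>TMod\<^esub> E b'"
    if b: "b \<in> hom_set C P (FO T P)" "b' \<in> hom_set C P (FO T P)" for b b'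
  proof -
    have bl: "lift (free P) b \<cdot> \<mu> P = \<mu> P \<cdot> FA T (lift (free P) b)" using lift_linear[of "free P" b] b by auto
    have "lift (free P) b \<cdot> lift (free P) b' = lift (free P) (lift (free P) b \<cdot> b')"
      using b bl by (intro module_map_lift) auto
    then show ?thesis by (simp add: E_def)
  qed
  define r0 where "r0 a = r (E (\<eta> P \<cdot> a))" for a
  have E_eta: "E (\<eta> P \<cdot> a) = (free P, FA T a, free P)" if "a \<in> hom_set C P P" for a
    using that by (auto simp: E_def lift_mu reassoc[OF mu_T_eta])
  have E_add: "E (HAdd C b b') = HAdd TMod (E b) (E b')" if "b \<in> hom_set C P (FO T P)" "b' \<in> hom_set C P (FO T P)" for b b'
    using that by (auto simp: E_def lift_def linear_functorD(4)[OF T_linear] comp_HAdd)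
  have E_smult: "E (HSmult C c b) = HSmult TMod c (E b)" if "b \<in> hom_set C P (FO T P)" "c \<in> carrier K" for b c
    using that by (auto simp: E_def lift_def linear_functorD(5)[OF T_linear] comp_HSmult)
  have r_mult: "r (E (lift (free P) b \<cdot> b')) v = r (E b') (r (E b) v)"
    if b: "b \<in> hom_set C P (FO T P)" "b' \<in> hom_set C P (FO T P)" "v \<in> carrier W" for b b' v
    using Wr(8)[OF E_in[OF b(2)] E_in[OF b(1)] b(3)] E_comp[OF b(1,2)] by simp
  have r_one: "r (E (\<eta> P)) v = v" if "v \<in> carrier W" for v
    using Wr(9)[OF that] by (simp add: E_def lift_mu mu_T_eta)
  have ea: "\<eta> P \<cdot> a \<in> hom_set C P (FO T P)" if "a \<in> hom_set C P P" for a using that by auto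
  have "fd_left_module K (end_alg C P) (W, r0)"
    unfolding r0_def
    by (rule fd_left_module_restrict[OF W])
      (use E_eta[of "Id C P"] in \<open>auto simp: E_eta tmod_Arr mu_natural linear_functorD(4,5)[OF T_linear]\<close>)
  then obtain X \<theta> where X [simp]: "X \<in> Obj C" and th: "\<theta> \<in> linear_maps K (Hom C P X) W"
    and bij: "bij_betw \<theta> (hom_set C P X) (carrier W)"
    and th_act: "\<And>p a. p \<in> hom_set C P X \<Longrightarrow> a \<in> hom_set C P P \<Longrightarrow> \<theta> (p \<cdot> a) = r0 a (\<theta> p)"
    by (rule progenerator_realize[OF P]) blast
  have inj: "inj_on \<theta> (hom_set C P X)" and im: "\<theta> ` hom_set C P X = carrier W"
    using bij by (auto simp: bij_betw_def)
  note thc = linear_maps_closed[OF th]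
  have eqI: "p = q" if "p \<in> hom_set C P X" "q \<in> hom_set C P X" "\<theta> p = \<theta> q" for p q
    using inj_onD[OF inj that(3,1,2)] .
  \<comment> \<open>the right action of \<open>Hom(P, T P)\<close> on \<open>Hom(P, X)\<close>\<close>
  define ra where "ra p b = the_inv_into (hom_set C P X) \<theta> (r (E b) (\<theta> p))" for p b
  have ra: "ra p b \<in> hom_set C P X" "\<theta> (ra p b) = r (E b) (\<theta> p)"
    if p: "p \<in> hom_set C P X" and b: "b \<in> hom_set C P (FO T P)" for p b
  proof -
    have m: "r (E b) (\<theta> p) \<in> \<theta> ` hom_set C P X" unfolding im using Wr(3)[OF E_in[OF b] thc[OF p]] .
    show "ra p b \<in> hom_set C P X" unfolding ra_def by (rule the_inv_into_into[OF inj m]) simp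
    show "\<theta> (ra p b) = r (E b) (\<theta> p)" unfolding ra_def by (rule f_the_inv_into_f[OF inj m])
  qed
  have "\<exists>s. s \<in> hom_set C (FO T P) X \<and> (\<forall>b\<in>hom_set C P (FO T P). s \<cdot> b = ra p b)"
    if p: "p \<in> hom_set C P X" for p
  proof -
    obtain s where "s \<in> hom_set C (FO T P) X" "\<And>b. b \<in> hom_set C P (FO T P) \<Longrightarrow> s \<cdot> b = ra p b"
    proof (rule progenerator_extend[OF P lcat_axioms, of "FO T P" X "ra p"])
      fix b assume b: "b \<in> hom_set C P (FO T P)"
      show "ra p b \<in> hom_set C P X" by (rule ra(1)[OF p b])
      show "ra p (HAdd C b b') = HAdd C (ra p b) (ra p b')" if b': "b' \<in> hom_set C P (FO T P)" for b'
      proof -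
        have m: "HAdd C b b' \<in> hom_set C P (FO T P)" "HAdd C (ra p b) (ra p b') \<in> hom_set C P X"
          using b b' ra(1)[OF p b] ra(1)[OF p b'] by auto
        show ?thesis
          by (rule eqI[OF ra(1)[OF p m(1)] m(2)])
            (use Wr(5)[OF E_in[OF b] E_in[OF b'] thc[OF p]] linear_maps_add[OF th ra(1)[OF p b] ra(1)[OF p b']]
              in \<open>simp add: ra(2)[OF p m(1)] E_add[OF b b'] ra(2)[OF p b] ra(2)[OF p b']\<close>)
      qed
      show "ra p (HSmult C c b) = HSmult C c (ra p b)" if c: "c \<in> carrier K" for c
      proof -
        have m: "HSmult C c b \<in> hom_set C P (FO T P)" "HSmult C c (ra p b) \<in> hom_set C P X"
          using b c ra(1)[OF p b] by auto
        show ?thesis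
          by (rule eqI[OF ra(1)[OF p m(1)] m(2)])
            (use Wr(6)[OF c E_in[OF b] thc[OF p]] linear_maps_smult[OF th c ra(1)[OF p b]]
              in \<open>simp add: ra(2)[OF p m(1)] E_smult[OF b c] ra(2)[OF p b]\<close>)
      qed
      show "ra p (b \<cdot> a) = ra p b \<cdot> a" if a: "a \<in> hom_set C P P" for a
      proof -
        have m: "b \<cdot> a \<in> hom_set C P (FO T P)" "ra p b \<cdot> a \<in> hom_set C P X"
          using a b ra(1)[OF p b] by auto
        have "lift (free P) b \<cdot> (\<eta> P \<cdot> a) = b \<cdot> a"
          using b a reassoc[OF lift_eta[of "free P" b], of a] by auto
        then have "r (E (b \<cdot> a)) (\<theta> p) = r0 a (r (E b) (\<theta> p))"
          using r_mult[OF b ea[OF a] thc[OF p]] by (simp add: r0_def)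
        then show ?thesis
          by (intro eqI[OF ra(1)[OF p m(1)] m(2)]) (simp add: ra(2)[OF p m(1)] th_act[OF ra(1)[OF p b] a] ra(2)[OF p b])
      qed
    qed auto
    then show ?thesis by blast
  qed
  then have "\<forall>p\<in>hom_set C P X. \<exists>s. s \<in> hom_set C (FO T P) X \<and> (\<forall>b\<in>hom_set C P (FO T P). s \<cdot> b = ra p b)"
    by blast
  from bchoice[OF this] obtain sh where sh: "\<And>p. p \<in> hom_set C P X \<Longrightarrow> sh p \<in> hom_set C (FO T P) X"
    and sh_ra: "\<And>p b. p \<in> hom_set C P X \<Longrightarrow> b \<in> hom_set C P (FO T P) \<Longrightarrow> sh p \<cdot> b = ra p b" by blast
  have sh' : "sh p \<in> Arr C" "Dom C (sh p) = FO T P" "Cod C (sh p) = X" if "p \<in> hom_set C P X" for p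
    using sh[OF that] by auto
  have shI: "sh p = f" if p: "p \<in> hom_set C P X" and f: "f \<in> hom_set C (FO T P) X"
    and eq: "\<And>b. b \<in> hom_set C P (FO T P) \<Longrightarrow> \<theta> (f \<cdot> b) = r (E b) (\<theta> p)" for p f
  proof (rule P_eqI)
    fix b assume "b \<in> Arr C" "Dom C b = P" "Cod C b = Dom C f"
    then have b: "b \<in> hom_set C P (FO T P)" using f by simp
    show "sh p \<cdot> b = f \<cdot> b"
      unfolding sh_ra[OF p b] using f b by (intro eqI[OF ra(1)[OF p b]]) (auto simp: ra(2)[OF p b] eq)
  qed (use f sh'[OF p] in auto)
  \<comment> \<open>\<open>sh p\<close> is the arrow \<open>T(P) \<rightarrow> X\<close> with \<open>sh p \<cdot> b = ra p b\<close>; the action \<open>a0\<close> has to satisfy \<open>a0 \<cdot> T(p) = sh p\<close>\<close>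
  obtain a0 where a0: "a0 \<in> hom_set C (FO T X) X" "\<And>p. p \<in> hom_set C P X \<Longrightarrow> a0 \<cdot> FA T p = sh p"
  proof (rule extend_from_TP[of X X sh])
    fix p assume p: "p \<in> hom_set C P X"
    show "sh p \<in> hom_set C (FO T P) X" by (rule sh[OF p])
    show "sh (HAdd C p p') = HAdd C (sh p) (sh p')" if p': "p' \<in> hom_set C P X" for p'
    proof (rule shI)
      fix b assume b: "b \<in> hom_set C P (FO T P)"
      have "HAdd C (sh p) (sh p') \<cdot> b = HAdd C (ra p b) (ra p' b)"
        using sh'[OF p] sh'[OF p'] b by (auto simp: HAdd_comp sh_ra[OF p b, symmetric] sh_ra[OF p' b, symmetric])
      then show "\<theta> (HAdd C (sh p) (sh p') \<cdot> b) = r (E b) (\<theta> (HAdd C p p'))"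
        using linear_maps_add[OF th ra(1)[OF p b] ra(1)[OF p' b]] linear_maps_add[OF th p p']
          Wr(4)[OF E_in[OF b] thc[OF p] thc[OF p']] by (simp add: ra(2)[OF p b] ra(2)[OF p' b])
    qed (use p p' sh'[OF p] sh'[OF p'] in auto)
    show "sh (HSmult C c p) = HSmult C c (sh p)" if c: "c \<in> carrier K" for c
    proof (rule shI)
      fix b assume b: "b \<in> hom_set C P (FO T P)"
      have "HSmult C c (sh p) \<cdot> b = HSmult C c (ra p b)"
        using sh'[OF p] b c by (auto simp: comp_HSmult sh_ra[OF p b, symmetric])
      then show "\<theta> (HSmult C c (sh p) \<cdot> b) = r (E b) (\<theta> (HSmult C c p))"
        using linear_maps_smult[OF th c ra(1)[OF p b]] linear_maps_smult[OF th c p]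
          Wr(7)[OF c E_in[OF b] thc[OF p]] by (simp add: ra(2)[OF p b])
    qed (use p c sh'[OF p] in auto)
    show "sh (p \<cdot> a) = sh p \<cdot> FA T a" if a: "a \<in> hom_set C P P" for a
    proof (rule shI)
      fix b assume b: "b \<in> hom_set C P (FO T P)"
      have Tb: "FA T a \<cdot> b \<in> hom_set C P (FO T P)" using a b by auto
      have "lift (free P) (\<eta> P \<cdot> a) \<cdot> b = FA T a \<cdot> b" using E_eta[OF a] by (simp add: E_def)
      then have "r (E (FA T a \<cdot> b)) (\<theta> p) = r (E b) (r0 a (\<theta> p))"
        using r_mult[OF ea[OF a] b thc[OF p]] by (simp add: r0_def)
      moreover have "(sh p \<cdot> FA T a) \<cdot> b = sh p \<cdot> (FA T a \<cdot> b)" using sh'[OF p] a b by auto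
      ultimately show "\<theta> ((sh p \<cdot> FA T a) \<cdot> b) = r (E b) (\<theta> (p \<cdot> a))"
        using sh_ra[OF p Tb] ra(2)[OF p Tb] th_act[OF p a] by simp
    qed (use p a sh'[OF p] in auto)
  qed auto
  have a0' [simp]: "a0 \<in> Arr C" "Dom C a0 = FO T X" "Cod C a0 = X" using a0(1) by auto
  have sh_eta: "sh p \<cdot> \<eta> P = p" if p: "p \<in> hom_set C P X" for p
  proof -
    have e: "\<eta> P \<in> hom_set C P (FO T P)" by simp
    show ?thesis unfolding sh_ra[OF p e]
      by (rule eqI[OF ra(1)[OF p e] p]) (simp add: ra(2)[OF p e] r_one[OF thc[OF p]])
  qed
  have unit: "a0 \<cdot> \<eta> X = Id C X"
  proof (rule P_eqI)
    fix p assume "p \<in> Arr C" "Dom C p = P" "Cod C p = Dom C (Id C X)"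
    then have p: "p \<in> hom_set C P X" by simp
    have "(a0 \<cdot> \<eta> X) \<cdot> p = (a0 \<cdot> FA T p) \<cdot> \<eta> P" using p by (auto simp: eta_natural)
    then show "(a0 \<cdot> \<eta> X) \<cdot> p = Id C X \<cdot> p" using p by (auto simp: a0(2) sh_eta)
  qed auto
  have sh_lift: "sh p \<cdot> lift (free P) b = sh (sh p \<cdot> b)"
    if p: "p \<in> hom_set C P X" and b: "b \<in> hom_set C P (FO T P)" for p b
  proof (rule shI[symmetric])
    have m: "sh p \<cdot> b \<in> hom_set C P X" using sh'[OF p] b by auto
    fix b' assume b': "b' \<in> hom_set C P (FO T P)"
    have lb: "lift (free P) b \<cdot> b' \<in> hom_set C P (FO T P)" using b b' by auto
    have "(sh p \<cdot> lift (free P) b) \<cdot> b' = ra p (lift (free P) b \<cdot> b')"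
      using sh'[OF p] b b' sh_ra[OF p lb] by auto
    then show "\<theta> ((sh p \<cdot> lift (free P) b) \<cdot> b') = r (E b') (\<theta> (sh p \<cdot> b))"
      using ra(2)[OF p lb] r_mult[OF b b' thc[OF p]] by (simp add: sh_ra[OF p b] ra(2)[OF p b])
  qed (use sh'[OF p] b in auto)
  have assoc_law: "a0 \<cdot> \<mu> X = a0 \<cdot> FA T a0"
  proof (rule TTP_eqI[of _ _ X])
    fix p assume "p \<in> Arr C" "Dom C p = P" "Cod C p = X"
    then have p: "p \<in> hom_set C P X" by simp
    have "(a0 \<cdot> \<mu> X) \<cdot> FA T (FA T p) = (a0 \<cdot> FA T p) \<cdot> \<mu> P" using p by (auto simp: mu_natural)
    also have "\<dots> = sh p \<cdot> \<mu> P" by (simp add: a0(2)[OF p])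
    also have "\<dots> = a0 \<cdot> FA T (sh p)"
    proof (rule TP_eqI[of _ _ "FO T P"])
      fix b assume "b \<in> Arr C" "Dom C b = P" "Cod C b = FO T P"
      then have b: "b \<in> hom_set C P (FO T P)" by simp
      have m: "sh p \<cdot> b \<in> hom_set C P X" using sh'[OF p] b by auto
      have "(a0 \<cdot> FA T (sh p)) \<cdot> FA T b = a0 \<cdot> FA T (sh p \<cdot> b)" using sh'[OF p] b by auto
      also have "\<dots> = sh p \<cdot> lift (free P) b" unfolding a0(2)[OF m] sh_lift[OF p b] by simp
      also have "\<dots> = (sh p \<cdot> \<mu> P) \<cdot> FA T b" using sh'[OF p] b by (auto simp: lift_mu)
      finally show "(sh p \<cdot> \<mu> P) \<cdot> FA T b = (a0 \<cdot> FA T (sh p)) \<cdot> FA T b" by simp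
    qed (use sh'[OF p] in auto)
    also have "FA T (sh p) = FA T (a0 \<cdot> FA T p)" by (simp add: a0(2)[OF p])
    also have "a0 \<cdot> \<dots> = (a0 \<cdot> FA T a0) \<cdot> FA T (FA T p)" using p by auto
    finally show "(a0 \<cdot> \<mu> X) \<cdot> FA T (FA T p) = (a0 \<cdot> FA T a0) \<cdot> FA T (FA T p)" .
  qed auto
  define x where "x = (X, a0)"
  have x: "x \<in> Mods" using unit assoc_law by (simp add: x_def monad_modules_iff)
  have xs [simp]: "fst x = X" "snd x = a0" by (simp_all add: x_def)
  have lift_sh: "lift x p = sh p" if "p \<in> hom_set C P X" for p using a0(2)[OF that] by (simp add: lift_def)
  let ?th = "\<lambda>\<alpha>. \<theta> (fst (snd \<alpha>) \<cdot> \<eta> P)"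
  have al: "\<alpha> = (free P, sh (fst (snd \<alpha>) \<cdot> \<eta> P), x)" "fst (snd \<alpha>) \<cdot> \<eta> P \<in> hom_set C P X"
    if "\<alpha> \<in> hom_set TMod (free P) x" for \<alpha>
  proof -
    obtain g where g: "\<alpha> = (free P, g, x)" "g \<in> Arr C" "Dom C g = FO T P" "Cod C g = X"
      "g \<cdot> \<mu> P = a0 \<cdot> FA T g" using \<open>\<alpha> \<in> _\<close> by (rule tmod_homE) auto
    show m: "fst (snd \<alpha>) \<cdot> \<eta> P \<in> hom_set C P X" using g by simp
    show "\<alpha> = (free P, sh (fst (snd \<alpha>) \<cdot> \<eta> P), x)"
      using lift_sh[OF m] lift_unique[OF x, of g P] g by simp
  qed
  have lin: "restrict ?th (hom_set TMod (free P) x) \<in> linear_maps K (Hom TMod (free P) x) W"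
  proof (rule restrict_linear_maps)
    show "module K (Hom TMod (free P) x)" using x by (intro TMod.hom_module) auto
    fix \<alpha> assume \<alpha>: "\<alpha> \<in> hom_set TMod (free P) x"
    show "?th \<alpha> \<in> carrier W" using thc[OF al(2)[OF \<alpha>]] .
    obtain g where g: "\<alpha> = (free P, g, x)" "g \<in> Arr C" "Dom C g = FO T P" "Cod C g = X"
      using \<alpha> by (rule tmod_homE) auto
    show "?th (c \<odot>\<^bsub>Hom TMod (free P) x\<^esub> \<alpha>) = c \<odot>\<^bsub>W\<^esub> ?th \<alpha>" if c: "c \<in> carrier K" for c
      using linear_maps_smult[OF th c al(2)[OF \<alpha>]] g c by (simp add: comp_HSmult)
    fix \<beta> assume \<beta>: "\<beta> \<in> hom_set TMod (free P) x"
    obtain h where h: "\<beta> = (free P, h, x)" "h \<in> Arr C" "Dom C h = FO T P" "Cod C h = X"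
      using \<beta> by (rule tmod_homE) auto
    show "?th (\<alpha> \<oplus>\<^bsub>Hom TMod (free P) x\<^esub> \<beta>) = ?th \<alpha> \<oplus>\<^bsub>W\<^esub> ?th \<beta>"
      using linear_maps_add[OF th al(2)[OF \<alpha>] al(2)[OF \<beta>]] g h by (simp add: HAdd_comp)
  qed
  have "bij_betw (restrict ?th (hom_set TMod (free P) x)) (hom_set TMod (free P) x) (carrier W)"
    unfolding bij_betw_def
  proof
    show "inj_on (restrict ?th (hom_set TMod (free P) x)) (hom_set TMod (free P) x)"
    proof (rule inj_onI)
      fix \<alpha> \<beta> assume a: "\<alpha> \<in> hom_set TMod (free P) x" and b: "\<beta> \<in> hom_set TMod (free P) x"
        and "restrict ?th (hom_set TMod (free P) x) \<alpha> = restrict ?th (hom_set TMod (free P) x) \<beta>"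
      then have "?th \<alpha> = ?th \<beta>" by (simp only: restrict_apply')
      then show "\<alpha> = \<beta>" using al(1)[OF a] al(1)[OF b] eqI[OF al(2)[OF a] al(2)[OF b]] by metis
    qed
    have "\<exists>\<alpha>\<in>hom_set TMod (free P) x. ?th \<alpha> = z" if "z \<in> carrier W" for z
    proof -
      have "z \<in> \<theta> ` hom_set C P X" unfolding im by fact
      then obtain p where p: "p \<in> hom_set C P X" "\<theta> p = z" by (rule imageE) simp
      have "(free P, lift x p, x) \<in> hom_set TMod (free P) x" using lift_hom[OF x, of p] p(1) by auto
      moreover have "?th (free P, lift x p, x) = z" using lift_sh[OF p(1)] sh_eta[OF p(1)] p(2) by simp
      ultimately show ?thesis by blast
    qed
    then have "carrier W \<subseteq> ?th ` hom_set TMod (free P) x" by blast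
    moreover have "?th ` hom_set TMod (free P) x \<subseteq> carrier W" using thc[OF al(2)] by blast
    ultimately show "restrict ?th (hom_set TMod (free P) x) ` hom_set TMod (free P) x = carrier W"
      by (simp only: image_restrict_eq subset_antisym)
  qed
  moreover have "restrict ?th (hom_set TMod (free P) x) (\<alpha> \<cdot>\<^bsub>TMod\<^esub> h) = r h (restrict ?th (hom_set TMod (free P) x) \<alpha>)"
    if a: "\<alpha> \<in> hom_set TMod (free P) x" and h: "h \<in> hom_set TMod (free P) (free P)" for \<alpha> h
  proof -
    let ?p = "fst (snd \<alpha>) \<cdot> \<eta> P" and ?b = "fst (snd h) \<cdot> \<eta> P"
    have m: "\<alpha> \<cdot>\<^bsub>TMod\<^esub> h \<in> hom_set TMod (free P) x" using a h by simp
    have "\<alpha> \<cdot>\<^bsub>TMod\<^esub> h = (free P, sh ?p \<cdot> lift (free P) ?b, x)"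
      by (subst al(1)[OF a], subst Eh(1)[OF h]) (simp add: E_def)
    then have "fst (snd (\<alpha> \<cdot>\<^bsub>TMod\<^esub> h)) \<cdot> \<eta> P = sh ?p \<cdot> (lift (free P) ?b \<cdot> \<eta> P)"
      using sh'[OF al(2)[OF a]] Eh(2)[OF h] by simp
    also have "\<dots> = sh ?p \<cdot> ?b" using lift_eta[of "free P" ?b] Eh(2)[OF h] by simp
    finally have "?th (\<alpha> \<cdot>\<^bsub>TMod\<^esub> h) = r (E ?b) (\<theta> ?p)"
      using sh_ra[OF al(2)[OF a] Eh(2)[OF h]] ra(2)[OF al(2)[OF a] Eh(2)[OF h]] by simp
    then show ?thesis using m a Eh(1)[OF h] by simp
  qed
  ultimately show ?thesis
    using x lin by (intro bexI[of _ x] bexI[of _ "restrict ?th (hom_set TMod (free P) x)"] conjI ballI) auto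
qed

lemma free_progenerator: "progenerator K TMod (free P)"
  unfolding progenerator_def using free_dense free_realizes by (intro conjI ballI allI impI) auto

text \<open>The hom spaces of modules are subspaces of hom spaces of \<open>C\<close>.\<close>

lemma tmod_finite_abelian:
  assumes K: "field K" and fin: "hom_finite K C"
  shows "finite_abelian K TMod"
proof (rule progenerator_finite_abelian[OF K TMod.linear_category _ free_progenerator])
  show "hom_finite K TMod"
    unfolding hom_finite_def
  proof (intro ballI)
    fix x y assume x: "x \<in> Obj TMod" and y: "y \<in> Obj TMod"
    let ?h = "\<lambda>\<phi>\<in>hom_set TMod x y. fst (snd \<phi>)"
    have h: "?h \<in> linear_maps K (Hom TMod x y) (Hom C (fst x) (fst y))"
      using x y by (intro restrict_linear_maps TMod.hom_module) (auto elim!: tmod_ArrE)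
    have inj: "inj_on ?h (hom_set TMod x y)"
      by (rule inj_onI) (auto elim!: tmod_ArrE)
    have "fd_space K (Hom C (fst x) (fst y))" using fin x y by (simp add: hom_finite_def)
    then show "fd_space K (Hom TMod x y)"
      by (rule fd_space_injective[OF K TMod.hom_module[OF x y] _ h inj])
  qed
qed

end

section \<open>Nakayama functors without copowers\<close>

lemma dual_map_dual:
  assumes "module K V" "\<xi> \<in> carrier (dual K W)" "\<And>v. v \<in> carrier V \<Longrightarrow> h v \<in> carrier W"
    "\<And>x y. x \<in> carrier V \<Longrightarrow> y \<in> carrier V \<Longrightarrow> h (x \<oplus>\<^bsub>V\<^esub> y) = h x \<oplus>\<^bsub>W\<^esub> h y"
    "\<And>c x. c \<in> carrier K \<Longrightarrow> x \<in> carrier V \<Longrightarrow> h (c \<odot>\<^bsub>V\<^esub> x) = c \<odot>\<^bsub>W\<^esub> h x"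
  shows "dual_map V h \<xi> \<in> carrier (dual K V)"
proof -
  have x: "\<xi> \<in> linear_maps K W (scalars K)" using assms(2) by simp
  have "restrict (\<lambda>v. \<xi> (h v)) (carrier V) \<in> linear_maps K V (scalars K)"
    by (rule restrict_linear_maps[OF assms(1)])
      (simp_all only: assms(3-5) linear_maps_closed[OF x] linear_maps_add[OF x] linear_maps_smult[OF x])
  then show ?thesis by (simp add: dual_map_def)
qed

lemma dual_map_comp:
  "(\<And>v. v \<in> carrier V \<Longrightarrow> h v \<in> carrier W) \<Longrightarrow> dual_map V h (dual_map W k \<xi>) = dual_map V (\<lambda>v. k (h v)) \<xi>"
  by (auto simp: dual_map_def)

lemma dual_map_cong:
  "(\<And>v. v \<in> carrier V \<Longrightarrow> h v = h' v) \<Longrightarrow> dual_map V h \<xi> = dual_map V h' \<xi>"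
  by (auto simp: dual_map_def)

lemma dual_map_id:
  assumes "\<xi> \<in> carrier (dual K V)" "\<And>v. v \<in> carrier V \<Longrightarrow> h v = v"
  shows "dual_map V h \<xi> = \<xi>"
  using assms linear_maps_undefined[of \<xi> K V "scalars K"] by (auto simp: dual_map_def)

lemma dual_map_add:
  assumes "\<And>v. v \<in> carrier V \<Longrightarrow> h v \<in> carrier W"
  shows "dual_map V h (\<xi> \<oplus>\<^bsub>dual K W\<^esub> \<zeta>) = dual_map V h \<xi> \<oplus>\<^bsub>dual K V\<^esub> dual_map V h \<zeta>"
    "dual_map V h (c \<odot>\<^bsub>dual K W\<^esub> \<xi>) = c \<odot>\<^bsub>dual K V\<^esub> dual_map V h \<xi>"
  using assms by (auto simp: dual_map_def dual_def)

text \<open>By the universal property of copowers, a dinatural family \<open>Hom(M, X)\<^sup>* \<otimes> X \<rightarrow> Z\<close> amounts to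
  linear maps \<open>Hom(M, X)\<^sup>* \<rightarrow> Hom(X, Z)\<close>, natural in \<open>X\<close>; so the value \<open>N(M)\<close> of a Nakayama functor
  represents the functor of such families.\<close>

abbreviation hom_dual :: "'k ring \<Rightarrow> ('k, 'o, 'm) lincat \<Rightarrow> 'o \<Rightarrow> 'o \<Rightarrow> ('m \<Rightarrow> 'k) set" where
  "hom_dual K C M X \<equiv> carrier (dual K (Hom C M X))"

definition nak_cone ::
    "'k ring \<Rightarrow> ('k, 'o, 'm) lincat \<Rightarrow> 'o \<Rightarrow> 'o \<Rightarrow> ('o \<Rightarrow> ('m \<Rightarrow> 'k) \<Rightarrow> 'm) \<Rightarrow> bool" where
  "nak_cone K C M Z \<kappa> \<longleftrightarrow> Z \<in> Obj C \<and>
     (\<forall>X\<in>Obj C. \<kappa> X \<in> linear_maps K (dual K (Hom C M X)) (Hom C X Z)) \<and>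
     (\<forall>f\<in>Arr C. \<forall>\<xi>\<in>hom_dual K C M (Cod C f).
        \<kappa> (Dom C f) (dual_map (Hom C M (Dom C f)) (\<lambda>h. f \<cdot>\<^bsub>C\<^esub> h) \<xi>) = \<kappa> (Cod C f) \<xi> \<cdot>\<^bsub>C\<^esub> f)"

definition nak_rep ::
    "'k ring \<Rightarrow> ('k, 'o, 'm) lincat \<Rightarrow> 'o \<Rightarrow> 'o \<Rightarrow> ('o \<Rightarrow> ('m \<Rightarrow> 'k) \<Rightarrow> 'm) \<Rightarrow> bool" where
  "nak_rep K C M Z \<iota> \<longleftrightarrow> nak_cone K C M Z \<iota> \<and>
     (\<forall>Z' \<kappa>. nak_cone K C M Z' \<kappa> \<longrightarrow>
        (\<exists>!h. h \<in> hom_set C Z Z' \<and> (\<forall>X\<in>Obj C. \<forall>\<xi>\<in>hom_dual K C M X. h \<cdot>\<^bsub>C\<^esub> \<iota> X \<xi> = \<kappa> X \<xi>)))"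

definition nak_functor ::
    "'k ring \<Rightarrow> ('k, 'o, 'm) lincat \<Rightarrow> ('o, 'm, 'o, 'm) ftr \<Rightarrow>
     ('o \<Rightarrow> 'o \<Rightarrow> ('m \<Rightarrow> 'k) \<Rightarrow> 'm) \<Rightarrow> bool" where
  "nak_functor K C N \<iota> \<longleftrightarrow> is_functor C C N \<and>
     (\<forall>M\<in>Obj C. nak_rep K C M (FO N M) (\<iota> M)) \<and>
     (\<forall>f\<in>Arr C. \<forall>X\<in>Obj C. \<forall>\<xi>\<in>hom_dual K C (Dom C f) X.
        FA N f \<cdot>\<^bsub>C\<^esub> \<iota> (Dom C f) X \<xi> = \<iota> (Cod C f) X (dual_map (Hom C (Cod C f) X) (\<lambda>h. h \<cdot>\<^bsub>C\<^esub> f) \<xi>))"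

lemma nak_coneI:
  assumes "lcat K C" "M \<in> Obj C" "Z \<in> Obj C"
    and "\<And>X \<xi>. X \<in> Obj C \<Longrightarrow> \<xi> \<in> hom_dual K C M X \<Longrightarrow> \<kappa> X \<xi> \<in> hom_set C X Z"
    and "\<And>X \<xi> \<zeta>. X \<in> Obj C \<Longrightarrow> \<xi> \<in> hom_dual K C M X \<Longrightarrow> \<zeta> \<in> hom_dual K C M X \<Longrightarrow>
      \<kappa> X (\<xi> \<oplus>\<^bsub>dual K (Hom C M X)\<^esub> \<zeta>) = HAdd C (\<kappa> X \<xi>) (\<kappa> X \<zeta>)"
    and "\<And>X \<xi> c. X \<in> Obj C \<Longrightarrow> \<xi> \<in> hom_dual K C M X \<Longrightarrow> c \<in> carrier K \<Longrightarrow>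
      \<kappa> X (c \<odot>\<^bsub>dual K (Hom C M X)\<^esub> \<xi>) = HSmult C c (\<kappa> X \<xi>)"
    and "\<And>f \<xi>. f \<in> Arr C \<Longrightarrow> \<xi> \<in> hom_dual K C M (Cod C f) \<Longrightarrow>
      \<kappa> (Dom C f) (dual_map (Hom C M (Dom C f)) (\<lambda>h. f \<cdot>\<^bsub>C\<^esub> h) \<xi>) = \<kappa> (Cod C f) \<xi> \<cdot>\<^bsub>C\<^esub> f"
  shows "nak_cone K C M Z (\<lambda>X. restrict (\<kappa> X) (hom_dual K C M X))"
proof -
  interpret lcat K C by fact
  have d: "dual_map (Hom C M (Dom C f)) (\<lambda>h. f \<cdot>\<^bsub>C\<^esub> h) \<xi> \<in> hom_dual K C M (Dom C f)"
    if "f \<in> Arr C" "\<xi> \<in> hom_dual K C M (Cod C f)" for f \<xi>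
    using that assms(2)
    by (intro dual_map_dual[of K _ \<xi> "Hom C M (Cod C f)"] hom_module) (auto simp: comp_HAdd comp_HSmult)
  show ?thesis
    unfolding nak_cone_def
  proof (intro conjI ballI)
    fix X assume X: "X \<in> Obj C"
    show "restrict (\<kappa> X) (hom_dual K C M X) \<in> linear_maps K (dual K (Hom C M X)) (Hom C X Z)"
      by (rule restrict_linear_maps[OF module_dual[OF hom_module[OF assms(2) X]]])
        (simp_all only: assms(4-6) X Hom_simps(3,4))
  next
    fix f \<xi> assume f: "f \<in> Arr C" and x: "\<xi> \<in> hom_dual K C M (Cod C f)"
    show "restrict (\<kappa> (Dom C f)) (hom_dual K C M (Dom C f)) (dual_map (Hom C M (Dom C f)) (\<lambda>h. f \<cdot>\<^bsub>C\<^esub> h) \<xi>) =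
      restrict (\<kappa> (Cod C f)) (hom_dual K C M (Cod C f)) \<xi> \<cdot>\<^bsub>C\<^esub> f"
      unfolding restrict_apply'[OF d[OF f x]] restrict_apply'[OF x] by (rule assms(7)[OF f x])
  qed fact
qed

context lcat
begin

abbreviation dpost where "dpost M f \<equiv> dual_map (Hom C M (Dom C f)) (\<lambda>h. f \<cdot> h)"
abbreviation dpre where "dpre f X \<equiv> dual_map (Hom C (Cod C f) X) (\<lambda>h. h \<cdot> f)"

lemma dual_post:
  assumes "M \<in> Obj C" "f \<in> Arr C" "\<xi> \<in> hom_dual K C M (Cod C f)"
  shows "dpost M f \<xi> \<in> hom_dual K C M (Dom C f)"
  using assms
  by (intro dual_map_dual[of K _ \<xi> "Hom C M (Cod C f)"] hom_module) (auto simp: comp_HAdd comp_HSmult)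

lemma dual_pre:
  assumes "X \<in> Obj C" "f \<in> Arr C" "\<xi> \<in> hom_dual K C (Dom C f) X"
  shows "dpre f X \<xi> \<in> hom_dual K C (Cod C f) X"
  using assms
  by (intro dual_map_dual[of K _ \<xi> "Hom C (Dom C f) X"] hom_module) (auto simp: HAdd_comp comp_HSmult)

lemma nak_coneD:
  assumes "nak_cone K C M Z \<kappa>"
  shows "Z \<in> Obj C"
    and "X \<in> Obj C \<Longrightarrow> \<xi> \<in> hom_dual K C M X \<Longrightarrow> \<kappa> X \<xi> \<in> Arr C"
    and "X \<in> Obj C \<Longrightarrow> \<xi> \<in> hom_dual K C M X \<Longrightarrow> Dom C (\<kappa> X \<xi>) = X"
    and "X \<in> Obj C \<Longrightarrow> \<xi> \<in> hom_dual K C M X \<Longrightarrow> Cod C (\<kappa> X \<xi>) = Z"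
    and "X \<in> Obj C \<Longrightarrow> \<xi> \<in> hom_dual K C M X \<Longrightarrow> \<zeta> \<in> hom_dual K C M X \<Longrightarrow>
      \<kappa> X (\<xi> \<oplus>\<^bsub>dual K (Hom C M X)\<^esub> \<zeta>) = HAdd C (\<kappa> X \<xi>) (\<kappa> X \<zeta>)"
    and "X \<in> Obj C \<Longrightarrow> \<xi> \<in> hom_dual K C M X \<Longrightarrow> c \<in> carrier K \<Longrightarrow>
      \<kappa> X (c \<odot>\<^bsub>dual K (Hom C M X)\<^esub> \<xi>) = HSmult C c (\<kappa> X \<xi>)"
    and "f \<in> Arr C \<Longrightarrow> \<xi> \<in> hom_dual K C M (Cod C f) \<Longrightarrow>
      \<kappa> (Dom C f) (dpost M f \<xi>) = \<kappa> (Cod C f) \<xi> \<cdot> f"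
proof -
  have l: "\<kappa> X \<in> linear_maps K (dual K (Hom C M X)) (Hom C X Z)" if "X \<in> Obj C" for X
    using assms that unfolding nak_cone_def by blast
  show "Z \<in> Obj C" using assms unfolding nak_cone_def by blast
  show "\<kappa> X \<xi> \<in> Arr C" "Dom C (\<kappa> X \<xi>) = X" "Cod C (\<kappa> X \<xi>) = Z" if "X \<in> Obj C" "\<xi> \<in> hom_dual K C M X"
    using linear_maps_closed[OF l[OF that(1)] that(2)] by auto
  show "\<kappa> X (\<xi> \<oplus>\<^bsub>dual K (Hom C M X)\<^esub> \<zeta>) = HAdd C (\<kappa> X \<xi>) (\<kappa> X \<zeta>)"
    if "X \<in> Obj C" "\<xi> \<in> hom_dual K C M X" "\<zeta> \<in> hom_dual K C M X"
    using linear_maps_add[OF l[OF that(1)] that(2,3)] by simp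
  show "\<kappa> X (c \<odot>\<^bsub>dual K (Hom C M X)\<^esub> \<xi>) = HSmult C c (\<kappa> X \<xi>)"
    if "X \<in> Obj C" "\<xi> \<in> hom_dual K C M X" "c \<in> carrier K"
    using linear_maps_smult[OF l[OF that(1)] that(3,2)] by simp
  show "\<kappa> (Dom C f) (dpost M f \<xi>) = \<kappa> (Cod C f) \<xi> \<cdot> f"
    if "f \<in> Arr C" "\<xi> \<in> hom_dual K C M (Cod C f)"
    using assms that unfolding nak_cone_def by blast
qed

lemma nak_rep_cone: "nak_rep K C M Z \<iota> \<Longrightarrow> nak_cone K C M Z \<iota>"
  by (simp add: nak_rep_def)

lemma nak_rep_ex1:
  "nak_rep K C M Z \<iota> \<Longrightarrow> nak_cone K C M Z' \<kappa> \<Longrightarrow>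
    \<exists>!h. h \<in> hom_set C Z Z' \<and> (\<forall>X\<in>Obj C. \<forall>\<xi>\<in>hom_dual K C M X. h \<cdot> \<iota> X \<xi> = \<kappa> X \<xi>)"
  unfolding nak_rep_def by blast

lemma nak_repE:
  assumes "nak_rep K C M Z \<iota>" "nak_cone K C M Z' \<kappa>"
  obtains h where "h \<in> Arr C" "Dom C h = Z" "Cod C h = Z'"
    "\<And>X \<xi>. X \<in> Obj C \<Longrightarrow> \<xi> \<in> hom_dual K C M X \<Longrightarrow> h \<cdot> \<iota> X \<xi> = \<kappa> X \<xi>"
proof -
  obtain h where "h \<in> hom_set C Z Z'" "\<forall>X\<in>Obj C. \<forall>\<xi>\<in>hom_dual K C M X. h \<cdot> \<iota> X \<xi> = \<kappa> X \<xi>"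
    using nak_rep_ex1[OF assms] by blast
  then show thesis by (intro that[of h]) auto
qed

definition nak_arrows :: "'o \<Rightarrow> ('o \<Rightarrow> ('m \<Rightarrow> 'k) \<Rightarrow> 'm) \<Rightarrow> 'm set" where
  "nak_arrows M \<iota> = {\<iota> X \<xi> | X \<xi>. X \<in> Obj C \<and> \<xi> \<in> hom_dual K C M X}"

lemma nak_rep_jointly_epic:
  assumes M: "M \<in> Obj C" and rep: "nak_rep K C M Z \<iota>"
  shows "jointly_epic C Z (nak_arrows M \<iota>)"
  unfolding jointly_epic_def
proof (intro conjI ballI impI)
  note cone = nak_coneD[OF nak_rep_cone[OF rep]]
  show "Z \<in> Obj C" by (rule cone(1))
  show "s \<in> Arr C" "Cod C s = Z" if "s \<in> nak_arrows M \<iota>" for s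
    using that cone(2,4) unfolding nak_arrows_def by blast+
  fix f g assume f: "f \<in> Arr C" and g: "g \<in> Arr C"
    and *: "Dom C f = Z \<and> Dom C g = Z \<and> Cod C f = Cod C g \<and> (\<forall>s\<in>nak_arrows M \<iota>. f \<cdot> s = g \<cdot> s)"
  then have d: "Dom C f = Z" "Dom C g = Z" "Cod C f = Cod C g" by simp_all
  have eq: "f \<cdot> \<iota> X \<xi> = g \<cdot> \<iota> X \<xi>" if "X \<in> Obj C" "\<xi> \<in> hom_dual K C M X" for X \<xi>
  proof -
    have "\<iota> X \<xi> \<in> nak_arrows M \<iota>" using that unfolding nak_arrows_def by blast
    then show ?thesis using * by blast
  qed
  let ?\<kappa> = "\<lambda>X. restrict (\<lambda>\<xi>. g \<cdot> \<iota> X \<xi>) (hom_dual K C M X)"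
  have k: "nak_cone K C M (Cod C g) ?\<kappa>"
  proof (rule nak_coneI[OF lcat_axioms M])
    show "Cod C g \<in> Obj C" using g by simp
    fix X \<xi> assume X: "X \<in> Obj C" "\<xi> \<in> hom_dual K C M X"
    show "g \<cdot> \<iota> X \<xi> \<in> hom_set C X (Cod C g)" using cone(2-4)[OF X] g d by simp
    show "g \<cdot> \<iota> X (\<xi> \<oplus>\<^bsub>dual K (Hom C M X)\<^esub> \<zeta>) = HAdd C (g \<cdot> \<iota> X \<xi>) (g \<cdot> \<iota> X \<zeta>)"
      if "\<zeta> \<in> hom_dual K C M X" for \<zeta>
      unfolding cone(5)[OF X that] using cone(2-4)[OF X] cone(2-4)[OF X(1) that] g d by (simp add: comp_HAdd)
    show "g \<cdot> \<iota> X (c \<odot>\<^bsub>dual K (Hom C M X)\<^esub> \<xi>) = HSmult C c (g \<cdot> \<iota> X \<xi>)" if "c \<in> carrier K" for c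
      unfolding cone(6)[OF X that] using cone(2-4)[OF X] that g d by (simp add: comp_HSmult)
  next
    fix h \<xi> assume h: "h \<in> Arr C" "\<xi> \<in> hom_dual K C M (Cod C h)"
    show "g \<cdot> \<iota> (Dom C h) (dual_map (Hom C M (Dom C h)) (\<lambda>k. h \<cdot> k) \<xi>) = (g \<cdot> \<iota> (Cod C h) \<xi>) \<cdot> h"
      unfolding cone(7)[OF h] using cone(2-4)[OF Cod_Obj[OF h(1)] h(2)] g d h(1) by simp
  qed
  have "f \<in> hom_set C Z (Cod C g)" "g \<in> hom_set C Z (Cod C g)" using f g d by auto
  moreover have "\<forall>X\<in>Obj C. \<forall>\<xi>\<in>hom_dual K C M X. f \<cdot> \<iota> X \<xi> = ?\<kappa> X \<xi>"
    "\<forall>X\<in>Obj C. \<forall>\<xi>\<in>hom_dual K C M X. g \<cdot> \<iota> X \<xi> = ?\<kappa> X \<xi>"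
    using eq by simp_all
  ultimately show "f = g" using nak_rep_ex1[OF rep k] by blast
qed

lemma nak_rep_eqI:
  assumes "M \<in> Obj C" "nak_rep K C M Z \<iota>" "f \<in> Arr C" "g \<in> Arr C" "Dom C f = Z" "Dom C g = Z" "Cod C f = Cod C g"
    "\<And>X \<xi>. X \<in> Obj C \<Longrightarrow> \<xi> \<in> hom_dual K C M X \<Longrightarrow> f \<cdot> \<iota> X \<xi> = g \<cdot> \<iota> X \<xi>"
  shows "f = g"
proof (rule jointly_epicD[OF nak_rep_jointly_epic[OF assms(1,2)] assms(3-7)])
  fix s assume "s \<in> nak_arrows M \<iota>"
  then obtain X \<xi> where "s = \<iota> X \<xi>" "X \<in> Obj C" "\<xi> \<in> hom_dual K C M X" unfolding nak_arrows_def by blast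
  then show "f \<cdot> s = g \<cdot> s" using assms(8) by blast
qed

lemma nak_functorD:
  assumes "nak_functor K C N \<iota>"
  shows "is_functor C C N" "M \<in> Obj C \<Longrightarrow> nak_rep K C M (FO N M) (\<iota> M)"
    "f \<in> Arr C \<Longrightarrow> X \<in> Obj C \<Longrightarrow> \<xi> \<in> hom_dual K C (Dom C f) X \<Longrightarrow>
      FA N f \<cdot> \<iota> (Dom C f) X \<xi> = \<iota> (Cod C f) X (dpre f X \<xi>)"
  using assms unfolding nak_functor_def by blast+

text \<open>The values of both functors represent the same families, which gives mutually inverse arrows.\<close>

lemma nak_functor_unique:
  assumes N: "nak_functor K C N \<iota>" and N': "nak_functor K C N' \<iota>'"
  shows "naturally_isomorphic C C N N'"
proof -
  interpret N: fctr C C N using nak_functorD(1)[OF N] by (simp add: fctr_def)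
  interpret N': fctr C C N' using nak_functorD(1)[OF N'] by (simp add: fctr_def)
  note rep = nak_functorD(2)[OF N] and rep' = nak_functorD(2)[OF N']
  note cone = nak_coneD[OF nak_rep_cone[OF rep]] and cone' = nak_coneD[OF nak_rep_cone[OF rep']]
  have "\<forall>M\<in>Obj C. \<exists>h. h \<in> hom_set C (FO N M) (FO N' M) \<and> is_iso C h \<and>
    (\<forall>X\<in>Obj C. \<forall>\<xi>\<in>hom_dual K C M X. h \<cdot> \<iota> M X \<xi> = \<iota>' M X \<xi>)"
  proof
    fix M assume M: "M \<in> Obj C"
    obtain h where h: "h \<in> Arr C" "Dom C h = FO N M" "Cod C h = FO N' M"
      "\<And>X \<xi>. X \<in> Obj C \<Longrightarrow> \<xi> \<in> hom_dual K C M X \<Longrightarrow> h \<cdot> \<iota> M X \<xi> = \<iota>' M X \<xi>"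
      by (rule nak_repE[OF rep[OF M] nak_rep_cone[OF rep'[OF M]]]) blast
    obtain k where k: "k \<in> Arr C" "Dom C k = FO N' M" "Cod C k = FO N M"
      "\<And>X \<xi>. X \<in> Obj C \<Longrightarrow> \<xi> \<in> hom_dual K C M X \<Longrightarrow> k \<cdot> \<iota>' M X \<xi> = \<iota> M X \<xi>"
      by (rule nak_repE[OF rep'[OF M] nak_rep_cone[OF rep[OF M]]]) blast
    have "k \<cdot> h = Id C (FO N M)"
    proof (rule nak_rep_eqI[OF M rep[OF M]])
      fix X \<xi> assume X: "X \<in> Obj C" "\<xi> \<in> hom_dual K C M X"
      show "(k \<cdot> h) \<cdot> \<iota> M X \<xi> = Id C (FO N M) \<cdot> \<iota> M X \<xi>"
        using h(1-3) k(1-3) h(4)[OF X] k(4)[OF X] cone(2-4)[OF M X] by simp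
    qed (use h k M in auto)
    moreover have "h \<cdot> k = Id C (FO N' M)"
    proof (rule nak_rep_eqI[OF M rep'[OF M]])
      fix X \<xi> assume X: "X \<in> Obj C" "\<xi> \<in> hom_dual K C M X"
      show "(h \<cdot> k) \<cdot> \<iota>' M X \<xi> = Id C (FO N' M) \<cdot> \<iota>' M X \<xi>"
        using h(1-3) k(1-3) h(4)[OF X] k(4)[OF X] cone'(2-4)[OF M X] by simp
    qed (use h k M in auto)
    ultimately have "is_iso C h" using h k by (intro isoI[of h k]) auto
    then show "\<exists>h. h \<in> hom_set C (FO N M) (FO N' M) \<and> is_iso C h \<and>
      (\<forall>X\<in>Obj C. \<forall>\<xi>\<in>hom_dual K C M X. h \<cdot> \<iota> M X \<xi> = \<iota>' M X \<xi>)" using h by (intro exI[of _ h]) auto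
  qed
  from bchoice[OF this] obtain t where t: "\<forall>M\<in>Obj C. t M \<in> hom_set C (FO N M) (FO N' M) \<and> is_iso C (t M) \<and>
    (\<forall>X\<in>Obj C. \<forall>\<xi>\<in>hom_dual K C M X. t M \<cdot> \<iota> M X \<xi> = \<iota>' M X \<xi>)" by blast
  have t': "t M \<in> Arr C" "Dom C (t M) = FO N M" "Cod C (t M) = FO N' M" "is_iso C (t M)"
    if "M \<in> Obj C" for M using t that by auto
  have ti: "t M \<cdot> \<iota> M X \<xi> = \<iota>' M X \<xi>" if "M \<in> Obj C" "X \<in> Obj C" "\<xi> \<in> hom_dual K C M X" for M X \<xi>
    using t that by blast
  have "t (Cod C f) \<cdot> FA N f = FA N' f \<cdot> t (Dom C f)" if f: "f \<in> Arr C" for f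
  proof (rule nak_rep_eqI[OF Dom_Obj[OF f] rep[OF Dom_Obj[OF f]]])
    fix X \<xi> assume X: "X \<in> Obj C" "\<xi> \<in> hom_dual K C (Dom C f) X"
    have d: "dpre f X \<xi> \<in> hom_dual K C (Cod C f) X"
      by (rule dual_pre[OF X(1) f X(2)])
    have "(t (Cod C f) \<cdot> FA N f) \<cdot> \<iota> (Dom C f) X \<xi> = t (Cod C f) \<cdot> (FA N f \<cdot> \<iota> (Dom C f) X \<xi>)"
      using f t' cone(2-4)[OF Dom_Obj[OF f] X] by simp
    also have "\<dots> = \<iota>' (Cod C f) X (dpre f X \<xi>)"
      unfolding nak_functorD(3)[OF N f X] by (rule ti[OF Cod_Obj[OF f] X(1) d])
    also have "\<dots> = FA N' f \<cdot> (t (Dom C f) \<cdot> \<iota> (Dom C f) X \<xi>)"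
      unfolding ti[OF Dom_Obj[OF f] X] by (rule nak_functorD(3)[OF N' f X, symmetric])
    also have "\<dots> = (FA N' f \<cdot> t (Dom C f)) \<cdot> \<iota> (Dom C f) X \<xi>"
      using f t' cone(2-4)[OF Dom_Obj[OF f] X] by simp
    finally show "(t (Cod C f) \<cdot> FA N f) \<cdot> \<iota> (Dom C f) X \<xi> = (FA N' f \<cdot> t (Dom C f)) \<cdot> \<iota> (Dom C f) X \<xi>" .
  qed (use f t' in auto)
  then show ?thesis
    unfolding naturally_isomorphic_def
    by (intro exI[of _ t] conjI nat_transI ballI) (use t' in \<open>auto simp: N.is_functor N'.is_functor\<close>)
qed

end

subsection \<open>Comparison with the coend\<close>

locale lcat_copowers = lcat K C for K :: "'k ring" and C :: "('k, 'o, 'm) lincat" (structure) +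
  fixes ten :: "('k, 'm \<Rightarrow> 'k) module \<Rightarrow> 'o \<Rightarrow> 'o" and tj :: "('k, 'm \<Rightarrow> 'k) module \<Rightarrow> 'o \<Rightarrow> ('m \<Rightarrow> 'k) \<Rightarrow> 'm"
  assumes copowers: "copowers K C ten tj"
    and fd_dual: "\<And>M X. M \<in> Obj C \<Longrightarrow> X \<in> Obj C \<Longrightarrow> fd_space K (dual K (Hom C M X))"
begin

lemma copower: "fd_space K V \<Longrightarrow> X \<in> Obj C \<Longrightarrow> is_copower K C V X (ten V X) (tj V X)"
  using copowers by (simp add: copowers_def)

lemma ten_Obj [simp]: "fd_space K V \<Longrightarrow> X \<in> Obj C \<Longrightarrow> ten V X \<in> Obj C"
  using copower by (simp add: is_copower_def)

lemma tj_linear: "fd_space K V \<Longrightarrow> X \<in> Obj C \<Longrightarrow> tj V X \<in> linear_maps K V (Hom C X (ten V X))"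
  using copower by (simp add: is_copower_def)

lemma tj_simps [simp]:
  assumes "fd_space K V" "X \<in> Obj C" "v \<in> carrier V"
  shows "tj V X v \<in> Arr C" "Dom C (tj V X v) = X" "Cod C (tj V X v) = ten V X"
  using linear_maps_closed[OF tj_linear[OF assms(1,2)] assms(3)] by simp_all

lemma tj_ex1:
  assumes "fd_space K V" "X \<in> Obj C" "Y \<in> Obj C" "h \<in> linear_maps K V (Hom C X Y)"
  shows "\<exists>!f. f \<in> hom_set C (ten V X) Y \<and> (\<forall>v\<in>carrier V. f \<cdot> tj V X v = h v)"
  using copower[OF assms(1,2)] assms(3,4) unfolding is_copower_def by blast

lemma tj_eqI:
  assumes V: "fd_space K V" and X: "X \<in> Obj C" and f: "f \<in> Arr C" "g \<in> Arr C"
    "Dom C f = ten V X" "Dom C g = ten V X" "Cod C f = Cod C g"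
    and eq: "\<And>v. v \<in> carrier V \<Longrightarrow> f \<cdot> tj V X v = g \<cdot> tj V X v"
  shows "f = g"
proof -
  note l = tj_linear[OF V X]
  have "(\<lambda>v\<in>carrier V. g \<cdot> tj V X v) \<in> linear_maps K V (Hom C X (Cod C g))"
    using V X f fd_space_module[OF V]
    by (intro restrict_linear_maps) (auto simp: linear_maps_add[OF l] linear_maps_smult[OF l] comp_HAdd comp_HSmult)
  from tj_ex1[OF V X _ this] f have "\<exists>!h. h \<in> hom_set C (ten V X) (Cod C g) \<and>
    (\<forall>v\<in>carrier V. h \<cdot> tj V X v = (\<lambda>v\<in>carrier V. g \<cdot> tj V X v) v)" by simp
  moreover have "f \<in> hom_set C (ten V X) (Cod C g)" "g \<in> hom_set C (ten V X) (Cod C g)" using f by simp_all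
  moreover have "\<forall>v\<in>carrier V. f \<cdot> tj V X v = (\<lambda>v\<in>carrier V. g \<cdot> tj V X v) v"
    "\<forall>v\<in>carrier V. g \<cdot> tj V X v = (\<lambda>v\<in>carrier V. g \<cdot> tj V X v) v" using eq by simp_all
  ultimately show ?thesis by blast
qed

lemma the_copower_map:
  assumes V: "fd_space K V" and X: "X \<in> Obj C" "Y \<in> Obj C"
    and h: "\<And>v. v \<in> carrier V \<Longrightarrow> h v \<in> hom_set C X Y"
    "\<And>v w. v \<in> carrier V \<Longrightarrow> w \<in> carrier V \<Longrightarrow> h (v \<oplus>\<^bsub>V\<^esub> w) = HAdd C (h v) (h w)"
    "\<And>c v. c \<in> carrier K \<Longrightarrow> v \<in> carrier V \<Longrightarrow> h (c \<odot>\<^bsub>V\<^esub> v) = HSmult C c (h v)"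
  defines "p \<equiv> (THE p. p \<in> hom_set C (ten V X) Y \<and> (\<forall>v\<in>carrier V. p \<cdot> tj V X v = h v))"
  shows "p \<in> Arr C" "Dom C p = ten V X" "Cod C p = Y" "\<And>v. v \<in> carrier V \<Longrightarrow> p \<cdot> tj V X v = h v"
proof -
  have "restrict h (carrier V) \<in> linear_maps K V (Hom C X Y)"
    using h fd_space_module[OF V] by (intro restrict_linear_maps) auto
  from tj_ex1[OF V X this]
  have "\<exists>!p. p \<in> hom_set C (ten V X) Y \<and> (\<forall>v\<in>carrier V. p \<cdot> tj V X v = h v)"
    by (simp cong: ball_cong)
  from theI'[OF this, folded p_def]
  show "p \<in> Arr C" "Dom C p = ten V X" "Cod C p = Y" "\<And>v. v \<in> carrier V \<Longrightarrow> p \<cdot> tj V X v = h v" by auto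
qed

lemma ten_map:
  assumes V: "fd_space K V" and W: "fd_space K W" and f: "f \<in> Arr C"
    and g: "\<And>v. v \<in> carrier V \<Longrightarrow> g v \<in> carrier W"
    "\<And>v w. v \<in> carrier V \<Longrightarrow> w \<in> carrier V \<Longrightarrow> g (v \<oplus>\<^bsub>V\<^esub> w) = g v \<oplus>\<^bsub>W\<^esub> g w"
    "\<And>c v. c \<in> carrier K \<Longrightarrow> v \<in> carrier V \<Longrightarrow> g (c \<odot>\<^bsub>V\<^esub> v) = c \<odot>\<^bsub>W\<^esub> g v"
  shows "ten_map C ten tj V W g f \<in> Arr C" "Dom C (ten_map C ten tj V W g f) = ten V (Dom C f)"
    "Cod C (ten_map C ten tj V W g f) = ten W (Cod C f)"
    "\<And>v. v \<in> carrier V \<Longrightarrow> ten_map C ten tj V W g f \<cdot> tj V (Dom C f) v = tj W (Cod C f) (g v) \<cdot> f"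
proof -
  note l = tj_linear[OF W Cod_Obj[OF f]]
  have h: "tj W (Cod C f) (g v) \<cdot> f \<in> hom_set C (Dom C f) (ten W (Cod C f))" if "v \<in> carrier V" for v
    using that g W f by simp
  have h2: "tj W (Cod C f) (g (v \<oplus>\<^bsub>V\<^esub> w)) \<cdot> f = HAdd C (tj W (Cod C f) (g v) \<cdot> f) (tj W (Cod C f) (g w) \<cdot> f)"
    if "v \<in> carrier V" "w \<in> carrier V" for v w
    using that g W f by (simp add: linear_maps_add[OF l] HAdd_comp)
  have h3: "tj W (Cod C f) (g (c \<odot>\<^bsub>V\<^esub> v)) \<cdot> f = HSmult C c (tj W (Cod C f) (g v) \<cdot> f)"
    if "c \<in> carrier K" "v \<in> carrier V" for v c
    using that g W f by (simp add: linear_maps_smult[OF l] comp_HSmult)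
  show "ten_map C ten tj V W g f \<in> Arr C" "Dom C (ten_map C ten tj V W g f) = ten V (Dom C f)"
    "Cod C (ten_map C ten tj V W g f) = ten W (Cod C f)"
    "\<And>v. v \<in> carrier V \<Longrightarrow> ten_map C ten tj V W g f \<cdot> tj V (Dom C f) v = tj W (Cod C f) (g v) \<cdot> f"
    using the_copower_map[OF V Dom_Obj[OF f] ten_Obj[OF W Cod_Obj[OF f]] h h2 h3] f
    unfolding ten_map_def by auto
qed

abbreviation dual_hom where "dual_hom M X \<equiv> dual K (Hom C M X)"
abbreviation ten_hom where "ten_hom M X \<equiv> ten (dual_hom M X) X"
abbreviation tj_hom where "tj_hom M X \<equiv> tj (dual_hom M X) X"

lemma nak_arr:
  assumes M: "M \<in> Obj C" and f: "f \<in> Arr C" and g: "g \<in> Arr C"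
  defines "s \<equiv> nak_arr K C ten tj M f g"
  shows "s \<in> Arr C" "Dom C s = ten (dual_hom M (Cod C f)) (Dom C g)" "Cod C s = ten (dual_hom M (Dom C f)) (Cod C g)"
    "\<And>\<xi>. \<xi> \<in> hom_dual K C M (Cod C f) \<Longrightarrow>
      s \<cdot> tj (dual_hom M (Cod C f)) (Dom C g) \<xi> = tj (dual_hom M (Dom C f)) (Cod C g) (dpost M f \<xi>) \<cdot> g"
proof -
  have c: "\<And>v. v \<in> hom_set C M (Dom C f) \<Longrightarrow> f \<cdot> v \<in> hom_set C M (Cod C f)" using f by auto
  note d = ten_map[OF fd_dual[OF M Cod_Obj[OF f]] fd_dual[OF M Dom_Obj[OF f]] g,
      of "dpost M f", OF dual_post[OF M f] dual_map_add(1)[OF c] dual_map_add(2)[OF c]]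
  show "s \<in> Arr C" "Dom C s = ten (dual_hom M (Cod C f)) (Dom C g)" "Cod C s = ten (dual_hom M (Dom C f)) (Cod C g)"
    "\<And>\<xi>. \<xi> \<in> hom_dual K C M (Cod C f) \<Longrightarrow>
      s \<cdot> tj (dual_hom M (Cod C f)) (Dom C g) \<xi> = tj (dual_hom M (Dom C f)) (Cod C g) (dpost M f \<xi>) \<cdot> g"
    using d unfolding s_def nak_arr_def by auto
qed

definition cone_of :: "'o \<Rightarrow> ('o \<Rightarrow> 'm) \<Rightarrow> 'o \<Rightarrow> ('m \<Rightarrow> 'k) \<Rightarrow> 'm" where
  "cone_of M i X = (\<lambda>\<xi>\<in>hom_dual K C M X. i X \<cdot> tj_hom M X \<xi>)"

abbreviation dinat where "dinat M Z i \<equiv> dinatural C C (nak_obj K C ten M) (nak_arr K C ten tj M) Z i"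

text \<open>The arrows out of a copower are determined by their composites with the universal linear map; so
  dinatural families out of the copowers are the natural families of linear maps.\<close>

lemma dinatural_cone:
  assumes M: "M \<in> Obj C"
  shows "dinat M Z i \<longleftrightarrow> Z \<in> Obj C \<and> (\<forall>X\<in>Obj C. i X \<in> hom_set C (ten_hom M X) Z) \<and>
    nak_cone K C M Z (cone_of M i)" (is "_ \<longleftrightarrow> ?R")
proof -
  note fd = fd_dual[OF M]
  have eq: "i (Dom C f) \<cdot> nak_arr K C ten tj M f (Id C (Dom C f)) = i (Cod C f) \<cdot> nak_arr K C ten tj M (Id C (Cod C f)) f \<longleftrightarrow>
    (\<forall>\<xi>\<in>hom_dual K C M (Cod C f). i (Dom C f) \<cdot> tj_hom M (Dom C f) (dpost M f \<xi>) =
       (i (Cod C f) \<cdot> tj_hom M (Cod C f) \<xi>) \<cdot> f)" (is "?l = ?r \<longleftrightarrow> _")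
    if i: "\<And>X. X \<in> Obj C \<Longrightarrow> i X \<in> hom_set C (ten_hom M X) Z" and f: "f \<in> Arr C" for f
  proof -
    have i1: "i (Dom C f) \<in> Arr C" "Dom C (i (Dom C f)) = ten_hom M (Dom C f)" "Cod C (i (Dom C f)) = Z"
      using i[OF Dom_Obj[OF f]] by auto
    have i2: "i (Cod C f) \<in> Arr C" "Dom C (i (Cod C f)) = ten_hom M (Cod C f)" "Cod C (i (Cod C f)) = Z"
      using i[OF Cod_Obj[OF f]] by auto
    note n1 = nak_arr[OF M f Id_Arr[OF Dom_Obj[OF f]]] and n2 = nak_arr[OF M Id_Arr[OF Cod_Obj[OF f]] f]
    have l: "?l \<cdot> tj (dual_hom M (Cod C f)) (Dom C f) \<xi> =
        i (Dom C f) \<cdot> tj_hom M (Dom C f) (dpost M f \<xi>)"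
      and r: "?r \<cdot> tj (dual_hom M (Cod C f)) (Dom C f) \<xi> = (i (Cod C f) \<cdot> tj_hom M (Cod C f) \<xi>) \<cdot> f"
      if x: "\<xi> \<in> hom_dual K C M (Cod C f)" for \<xi>
    proof -
      note d = dual_post[OF M f x]
      have "?l \<cdot> tj (dual_hom M (Cod C f)) (Dom C f) \<xi> =
        i (Dom C f) \<cdot> (nak_arr K C ten tj M f (Id C (Dom C f)) \<cdot> tj (dual_hom M (Cod C f)) (Dom C f) \<xi>)"
        using f x i1 n1(1-3) fd by simp
      also have "nak_arr K C ten tj M f (Id C (Dom C f)) \<cdot> tj (dual_hom M (Cod C f)) (Dom C f) \<xi> =
        tj_hom M (Dom C f) (dpost M f \<xi>)"
        using n1(4)[OF x] tj_simps[OF fd Dom_Obj[OF f] d] f by simp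
      finally show "?l \<cdot> tj (dual_hom M (Cod C f)) (Dom C f) \<xi> =
        i (Dom C f) \<cdot> tj_hom M (Dom C f) (dpost M f \<xi>)" .
      have "dual_map (Hom C M (Cod C f)) (\<lambda>h. Id C (Cod C f) \<cdot> h) \<xi> = \<xi>"
        by (rule dual_map_id[OF x]) auto
      then have "nak_arr K C ten tj M (Id C (Cod C f)) f \<cdot> tj (dual_hom M (Cod C f)) (Dom C f) \<xi> =
        tj_hom M (Cod C f) \<xi> \<cdot> f"
        using n2(4)[of \<xi>] x f by simp
      then show "?r \<cdot> tj (dual_hom M (Cod C f)) (Dom C f) \<xi> = (i (Cod C f) \<cdot> tj_hom M (Cod C f) \<xi>) \<cdot> f"
        using f x i2 n2(1-3) fd by simp
    qed
    show ?thesis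
    proof
      assume "?l = ?r"
      then show "\<forall>\<xi>\<in>hom_dual K C M (Cod C f). i (Dom C f) \<cdot> tj_hom M (Dom C f) (dpost M f \<xi>) =
       (i (Cod C f) \<cdot> tj_hom M (Cod C f) \<xi>) \<cdot> f" using l r by metis
    next
      assume *: "\<forall>\<xi>\<in>hom_dual K C M (Cod C f). i (Dom C f) \<cdot> tj_hom M (Dom C f) (dpost M f \<xi>) =
       (i (Cod C f) \<cdot> tj_hom M (Cod C f) \<xi>) \<cdot> f"
      show "?l = ?r"
        by (rule tj_eqI[OF fd[OF Cod_Obj[OF f]] Dom_Obj[OF f]]) (use f i1 i2 n1(1-3) n2(1-3) l r * in simp_all)
    qed
  qed
  have lin: "cone_of M i X \<in> linear_maps K (dual_hom M X) (Hom C X Z)"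
    if i: "i X \<in> hom_set C (ten_hom M X) Z" and X: "X \<in> Obj C" for X
    unfolding cone_of_def
    using fd_space_module[OF fd[OF X]] i X fd[OF X] linear_maps_add[OF tj_linear[OF fd[OF X] X]]
      linear_maps_smult[OF tj_linear[OF fd[OF X] X]]
    by (intro restrict_linear_maps) (auto simp: comp_HAdd comp_HSmult)
  have cn: "nak_cone K C M Z (cone_of M i) \<longleftrightarrow>
    (\<forall>f\<in>Arr C. i (Dom C f) \<cdot> nak_arr K C ten tj M f (Id C (Dom C f)) = i (Cod C f) \<cdot> nak_arr K C ten tj M (Id C (Cod C f)) f)"
    if Z: "Z \<in> Obj C" and i: "\<And>X. X \<in> Obj C \<Longrightarrow> i X \<in> hom_set C (ten_hom M X) Z"
  proof -
    have "cone_of M i (Dom C f) (dpost M f \<xi>) = cone_of M i (Cod C f) \<xi> \<cdot> f \<longleftrightarrow>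
      i (Dom C f) \<cdot> tj_hom M (Dom C f) (dpost M f \<xi>) =
       (i (Cod C f) \<cdot> tj_hom M (Cod C f) \<xi>) \<cdot> f"
      if "f \<in> Arr C" "\<xi> \<in> hom_dual K C M (Cod C f)" for f \<xi>
      unfolding cone_of_def restrict_apply'[OF that(2)] restrict_apply'[OF dual_post[OF M that]] ..
    then show ?thesis unfolding nak_cone_def using Z lin[OF i] eq[OF i] by (simp only: ball_simps cong: ball_cong) blast
  qed
  show ?thesis
    unfolding dinatural_def nak_obj_def using cn by blast
qed

lemma cone_dinatural:
  assumes M: "M \<in> Obj C" and \<kappa>: "nak_cone K C M Z \<kappa>"
  obtains i where "dinat M Z i" "\<And>X. X \<in> Obj C \<Longrightarrow> cone_of M i X = \<kappa> X"
    "\<And>X \<xi>. X \<in> Obj C \<Longrightarrow> \<xi> \<in> hom_dual K C M X \<Longrightarrow> i X \<cdot> tj_hom M X \<xi> = \<kappa> X \<xi>"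
proof -
  note Z = nak_coneD(1)[OF \<kappa>]
  have l: "\<kappa> X \<in> linear_maps K (dual_hom M X) (Hom C X Z)" if "X \<in> Obj C" for X
    using \<kappa> that unfolding nak_cone_def by blast
  have "\<forall>X\<in>Obj C. \<exists>p. p \<in> hom_set C (ten_hom M X) Z \<and> (\<forall>\<xi>\<in>hom_dual K C M X. p \<cdot> tj_hom M X \<xi> = \<kappa> X \<xi>)"
    using tj_ex1[OF fd_dual[OF M] _ Z l] by blast
  from bchoice[OF this] obtain i where i: "\<And>X. X \<in> Obj C \<Longrightarrow> i X \<in> hom_set C (ten_hom M X) Z"
    "\<And>X \<xi>. X \<in> Obj C \<Longrightarrow> \<xi> \<in> hom_dual K C M X \<Longrightarrow> i X \<cdot> tj_hom M X \<xi> = \<kappa> X \<xi>" by blast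
  have c: "cone_of M i X = \<kappa> X" if X: "X \<in> Obj C" for X
  proof
    fix \<xi> show "cone_of M i X \<xi> = \<kappa> X \<xi>"
      using i(2)[OF X] linear_maps_undefined[OF l[OF X]] unfolding cone_of_def by (cases "\<xi> \<in> hom_dual K C M X") auto
  qed
  have "nak_cone K C M Z (cone_of M i)" using \<kappa> c unfolding nak_cone_def by (simp cong: ball_cong)
  then have "dinat M Z i" using Z i(1) by (simp add: dinatural_cone[OF M])
  then show thesis using that c i(2) by blast
qed

lemma coend_iff_rep:
  assumes M: "M \<in> Obj C" and d: "dinat M Z i"
  shows "is_coend C C (nak_obj K C ten M) (nak_arr K C ten tj M) Z i \<longleftrightarrow> nak_rep K C M Z (cone_of M i)"
proof -
  have i: "i X \<in> Arr C" "Dom C (i X) = ten_hom M X" "Cod C (i X) = Z" if "X \<in> Obj C" for X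
    using d that unfolding dinatural_cone[OF M] by auto
  have eq: "h \<cdot> i X = i' X \<longleftrightarrow> (\<forall>\<xi>\<in>hom_dual K C M X. h \<cdot> cone_of M i X \<xi> = cone_of M i' X \<xi>)"
    if h: "h \<in> hom_set C Z Z'" and d': "dinat M Z' i'" and X: "X \<in> Obj C" for h Z' i' X
  proof -
    have i': "i' X \<in> Arr C" "Dom C (i' X) = ten_hom M X" "Cod C (i' X) = Z'"
      using d' X unfolding dinatural_cone[OF M] by auto
    have "h \<cdot> cone_of M i X \<xi> = (h \<cdot> i X) \<cdot> tj_hom M X \<xi>" "cone_of M i' X \<xi> = i' X \<cdot> tj_hom M X \<xi>"
      if "\<xi> \<in> hom_dual K C M X" for \<xi>
      using that h i[OF X] X fd_dual[OF M X] by (auto simp: cone_of_def)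
    then show ?thesis
      using tj_eqI[OF fd_dual[OF M X] X, of "h \<cdot> i X" "i' X"] h i[OF X] i' by auto
  qed
  have cone: "nak_cone K C M Z (cone_of M i)" using d unfolding dinatural_cone[OF M] by blast
  show ?thesis
  proof
    assume co: "is_coend C C (nak_obj K C ten M) (nak_arr K C ten tj M) Z i"
    show "nak_rep K C M Z (cone_of M i)"
      unfolding nak_rep_def
    proof (intro conjI cone allI impI)
      fix Z' \<kappa> assume k: "nak_cone K C M Z' \<kappa>"
      obtain i' where i': "dinat M Z' i'" "\<And>X. X \<in> Obj C \<Longrightarrow> cone_of M i' X = \<kappa> X"
        by (rule cone_dinatural[OF M k]) blast
      have "\<exists>!h. h \<in> hom_set C Z Z' \<and> (\<forall>X\<in>Obj C. h \<cdot> i X = i' X)"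
        using co i'(1) unfolding is_coend_def by blast
      moreover have iff: "h \<in> hom_set C Z Z' \<and> (\<forall>X\<in>Obj C. h \<cdot> i X = i' X) \<longleftrightarrow>
          h \<in> hom_set C Z Z' \<and> (\<forall>X\<in>Obj C. \<forall>\<xi>\<in>hom_dual K C M X. h \<cdot> cone_of M i X \<xi> = \<kappa> X \<xi>)" for h
        using eq[OF _ i'(1)] i'(2) by metis
      ultimately show "\<exists>!h. h \<in> hom_set C Z Z' \<and> (\<forall>X\<in>Obj C. \<forall>\<xi>\<in>hom_dual K C M X. h \<cdot> cone_of M i X \<xi> = \<kappa> X \<xi>)"
        by (simp only: iff)
    qed
  next
    assume rep: "nak_rep K C M Z (cone_of M i)"
    show "is_coend C C (nak_obj K C ten M) (nak_arr K C ten tj M) Z i"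
      unfolding is_coend_def
    proof (intro conjI d allI impI)
      fix Z' i' assume i': "dinat M Z' i'"
      then have "nak_cone K C M Z' (cone_of M i')" unfolding dinatural_cone[OF M] by blast
      from nak_rep_ex1[OF rep this]
      have "\<exists>!h. h \<in> hom_set C Z Z' \<and> (\<forall>X\<in>Obj C. \<forall>\<xi>\<in>hom_dual K C M X. h \<cdot> cone_of M i X \<xi> = cone_of M i' X \<xi>)" .
      moreover have iff: "h \<in> hom_set C Z Z' \<and> (\<forall>X\<in>Obj C. h \<cdot> i X = i' X) \<longleftrightarrow>
          h \<in> hom_set C Z Z' \<and> (\<forall>X\<in>Obj C. \<forall>\<xi>\<in>hom_dual K C M X. h \<cdot> cone_of M i X \<xi> = cone_of M i' X \<xi>)" for h
        using eq[OF _ i'] by metis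
      ultimately show "\<exists>!h. h \<in> hom_set C Z Z' \<and> (\<forall>X\<in>Obj C. h \<cdot> i X = i' X)"
        by (simp only: iff)
    qed
  qed
qed

lemma nak_pre:
  assumes f: "f \<in> Arr C" and X: "X \<in> Obj C"
  defines "s \<equiv> ten_map C ten tj (dual_hom (Dom C f) X) (dual_hom (Cod C f) X) (dpre f X) (Id C X)"
  shows "s \<in> Arr C" "Dom C s = ten_hom (Dom C f) X" "Cod C s = ten_hom (Cod C f) X"
    "\<And>\<xi>. \<xi> \<in> hom_dual K C (Dom C f) X \<Longrightarrow>
      s \<cdot> tj_hom (Dom C f) X \<xi> = tj_hom (Cod C f) X (dpre f X \<xi>)"
proof -
  have c: "\<And>v. v \<in> hom_set C (Cod C f) X \<Longrightarrow> v \<cdot> f \<in> hom_set C (Dom C f) X" using f by auto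
  note d = ten_map[OF fd_dual[OF Dom_Obj[OF f] X] fd_dual[OF Cod_Obj[OF f] X] Id_Arr[OF X],
      of "dpre f X", OF dual_pre[OF X f] dual_map_add(1)[OF c] dual_map_add(2)[OF c]]
  show "s \<in> Arr C" "Dom C s = ten_hom (Dom C f) X" "Cod C s = ten_hom (Cod C f) X"
    using d(1-3) X unfolding s_def by auto
  show "s \<cdot> tj_hom (Dom C f) X \<xi> = tj_hom (Cod C f) X (dpre f X \<xi>)"
    if x: "\<xi> \<in> hom_dual K C (Dom C f) X" for \<xi>
  proof -
    have "s \<cdot> tj_hom (Dom C f) X \<xi> = tj_hom (Cod C f) X (dpre f X \<xi>) \<cdot> Id C X"
      using d(4)[of \<xi>] x X unfolding s_def by simp
    then show ?thesis using tj_simps[OF fd_dual[OF Cod_Obj[OF f] X] X dual_pre[OF X f x]] by simp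
  qed
qed

lemma nakayama_nak_functor:
  assumes N: "nakayama K C ten tj N i"
  shows "nak_functor K C N (\<lambda>M. cone_of M (i M))"
  unfolding nak_functor_def
proof (intro conjI ballI)
  show fN: "is_functor C C N" using N by (simp add: nakayama_def)
  interpret N: fctr C C N using fN by (simp add: fctr_def)
  have co: "is_coend C C (nak_obj K C ten M) (nak_arr K C ten tj M) (FO N M) (i M)" if "M \<in> Obj C" for M
    using N that by (simp add: nakayama_def)
  then have d: "dinat M (FO N M) (i M)" if "M \<in> Obj C" for M using that by (simp add: is_coend_def)
  show "nak_rep K C M (FO N M) (cone_of M (i M))" if "M \<in> Obj C" for M
    using co[OF that] coend_iff_rep[OF that d[OF that]] by blast
  fix f X \<xi> assume f: "f \<in> Arr C" and X: "X \<in> Obj C" and x: "\<xi> \<in> hom_dual K C (Dom C f) X"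
  let ?s = "ten_map C ten tj (dual_hom (Dom C f) X) (dual_hom (Cod C f) X) (dpre f X) (Id C X)"
  have i1: "i (Dom C f) X \<in> Arr C" "Dom C (i (Dom C f) X) = ten_hom (Dom C f) X" "Cod C (i (Dom C f) X) = FO N (Dom C f)"
    using d[OF Dom_Obj[OF f]] X unfolding dinatural_cone[OF Dom_Obj[OF f]] by auto
  have i2: "i (Cod C f) X \<in> Arr C" "Dom C (i (Cod C f) X) = ten_hom (Cod C f) X" "Cod C (i (Cod C f) X) = FO N (Cod C f)"
    using d[OF Cod_Obj[OF f]] X unfolding dinatural_cone[OF Cod_Obj[OF f]] by auto
  have "FA N f \<cdot> i (Dom C f) X = i (Cod C f) X \<cdot> ?s" using N f X by (simp add: nakayama_def)
  then have "(FA N f \<cdot> i (Dom C f) X) \<cdot> tj_hom (Dom C f) X \<xi> = i (Cod C f) X \<cdot> (?s \<cdot> tj_hom (Dom C f) X \<xi>)"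
    using nak_pre(1-3)[OF f X] i2 x X fd_dual[OF Dom_Obj[OF f] X] by simp
  then show "FA N f \<cdot> cone_of (Dom C f) (i (Dom C f)) X \<xi> =
    cone_of (Cod C f) (i (Cod C f)) X (dpre f X \<xi>)"
    unfolding nak_pre(4)[OF f X x] cone_of_def restrict_apply'[OF x] restrict_apply'[OF dual_pre[OF X f x]]
    using i1 f x X fd_dual[OF Dom_Obj[OF f] X] by simp
qed

lemma nak_functor_nakayama:
  assumes N: "nak_functor K C N \<iota>"
  shows "is_nakayama_functor K C N"
proof -
  interpret N: fctr C C N using nak_functorD(1)[OF N] by (simp add: fctr_def)
  have "\<forall>M\<in>Obj C. \<exists>i. dinat M (FO N M) i \<and> nak_rep K C M (FO N M) (cone_of M i) \<and>
    (\<forall>X\<in>Obj C. \<forall>\<xi>\<in>hom_dual K C M X. i X \<cdot> tj_hom M X \<xi> = \<iota> M X \<xi>)"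
  proof
    fix M assume M: "M \<in> Obj C"
    note rep = nak_functorD(2)[OF N M]
    obtain i where i: "dinat M (FO N M) i" "\<And>X. X \<in> Obj C \<Longrightarrow> cone_of M i X = \<iota> M X"
      "\<And>X \<xi>. X \<in> Obj C \<Longrightarrow> \<xi> \<in> hom_dual K C M X \<Longrightarrow> i X \<cdot> tj_hom M X \<xi> = \<iota> M X \<xi>"
      by (rule cone_dinatural[OF M nak_rep_cone[OF rep]]) blast
    have "nak_cone K C M (FO N M) (cone_of M i)" using i(1) unfolding dinatural_cone[OF M] by blast
    then have "nak_rep K C M (FO N M) (cone_of M i)"
      using rep i(2) unfolding nak_rep_def by (simp cong: ball_cong)
    then show "\<exists>i. dinat M (FO N M) i \<and> nak_rep K C M (FO N M) (cone_of M i) \<and>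
      (\<forall>X\<in>Obj C. \<forall>\<xi>\<in>hom_dual K C M X. i X \<cdot> tj_hom M X \<xi> = \<iota> M X \<xi>)" using i by blast
  qed
  from bchoice[OF this] obtain i where i: "\<And>M. M \<in> Obj C \<Longrightarrow> dinat M (FO N M) (i M)"
    "\<And>M. M \<in> Obj C \<Longrightarrow> nak_rep K C M (FO N M) (cone_of M (i M))"
    "\<And>M X \<xi>. M \<in> Obj C \<Longrightarrow> X \<in> Obj C \<Longrightarrow> \<xi> \<in> hom_dual K C M X \<Longrightarrow> i M X \<cdot> tj_hom M X \<xi> = \<iota> M X \<xi>" by blast
  have "nakayama K C ten tj N i"
    unfolding nakayama_def
  proof (intro conjI ballI copowers N.is_functor)
    show "is_coend C C (nak_obj K C ten M) (nak_arr K C ten tj M) (FO N M) (i M)" if "M \<in> Obj C" for M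
      using coend_iff_rep[OF that i(1)[OF that]] i(2)[OF that] by blast
    fix f X assume f: "f \<in> Arr C" and X: "X \<in> Obj C"
    let ?s = "ten_map C ten tj (dual_hom (Dom C f) X) (dual_hom (Cod C f) X) (dpre f X) (Id C X)"
    have i1: "i (Dom C f) X \<in> Arr C" "Dom C (i (Dom C f) X) = ten_hom (Dom C f) X" "Cod C (i (Dom C f) X) = FO N (Dom C f)"
      using i(1)[OF Dom_Obj[OF f]] X unfolding dinatural_cone[OF Dom_Obj[OF f]] by auto
    have i2: "i (Cod C f) X \<in> Arr C" "Dom C (i (Cod C f) X) = ten_hom (Cod C f) X" "Cod C (i (Cod C f) X) = FO N (Cod C f)"
      using i(1)[OF Cod_Obj[OF f]] X unfolding dinatural_cone[OF Cod_Obj[OF f]] by auto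
    note fd = fd_dual[OF Dom_Obj[OF f] X]
    show "FA N f \<cdot> i (Dom C f) X = i (Cod C f) X \<cdot> ?s"
    proof (rule tj_eqI[OF fd X])
      fix \<xi> assume x: "\<xi> \<in> hom_dual K C (Dom C f) X"
      have "(FA N f \<cdot> i (Dom C f) X) \<cdot> tj_hom (Dom C f) X \<xi> = FA N f \<cdot> (i (Dom C f) X \<cdot> tj_hom (Dom C f) X \<xi>)"
        using i1 f x X fd by simp
      also have "\<dots> = \<iota> (Cod C f) X (dpre f X \<xi>)"
        unfolding i(3)[OF Dom_Obj[OF f] X x] by (rule nak_functorD(3)[OF N f X x])
      also have "\<dots> = i (Cod C f) X \<cdot> (?s \<cdot> tj_hom (Dom C f) X \<xi>)"
        unfolding nak_pre(4)[OF f X x] i(3)[OF Cod_Obj[OF f] X dual_pre[OF X f x]] ..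
      also have "\<dots> = (i (Cod C f) X \<cdot> ?s) \<cdot> tj_hom (Dom C f) X \<xi>"
        using i2 nak_pre(1-3)[OF f X] x X fd by simp
      finally show "(FA N f \<cdot> i (Dom C f) X) \<cdot> tj_hom (Dom C f) X \<xi> = (i (Cod C f) X \<cdot> ?s) \<cdot> tj_hom (Dom C f) X \<xi>" .
    qed (use i1 i2 f nak_pre(1-3)[OF f X] in auto)
  qed
  then show ?thesis unfolding is_nakayama_functor_def by blast
qed

end

section \<open>The tensor product with the left adjoint\<close>

text \<open>A monad with two left adjoints.  A module over the monad \<open>T\<^sup>l\<^sup>l\<^sup>a = LL\<close> is the same as a comodule
  over the comonad \<open>T\<^sup>l\<^sup>a = L\<close>, by transposing the action \<open>LL(M) \<rightarrow> M\<close> to a coaction \<open>M \<rightarrow> L(M)\<close>.\<close>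

locale monad_la = lmonad K C T \<mu> \<eta> + A: adj C L T u e + B: adj C LL L u' e'
  for K :: "'k ring" and C :: "('k, 'o, 'm) lincat" (structure) and T :: "('o, 'm, 'o, 'm) ftr"
    and \<mu> \<eta> :: "'o \<Rightarrow> 'm" and L :: "('o, 'm, 'o, 'm) ftr" and u e :: "'o \<Rightarrow> 'm"
    and LL :: "('o, 'm, 'o, 'm) ftr" and u' e' :: "'o \<Rightarrow> 'm"
begin

lemma L_linear: "linear_functor K C C L"
  by (rule A.linear_F[OF T_linear])

abbreviation \<delta> where "\<delta> \<equiv> la_comult C T \<mu> L u e"
abbreviation \<epsilon> where "\<epsilon> \<equiv> la_counit C \<eta> L e"
abbreviation bact where "bact \<equiv> la_right_action C T \<mu> L u e"
abbreviation lmult where "lmult \<equiv> lla_mult C T \<mu> L u e LL u' e'"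
abbreviation lunit where "lunit \<equiv> lla_unit C \<eta> L e LL u'"
abbreviation LLMod where "LLMod \<equiv> tmod C LL lmult lunit"
abbreviation LLMods where "LLMods \<equiv> monad_modules C LL lmult lunit"

lemma delta_eq:
  "X \<in> Obj C \<Longrightarrow> \<delta> X = e (FO L (FO L X)) \<cdot> FA L (\<mu> (FO L (FO L X)) \<cdot> (FA T (u (FO L X)) \<cdot> u X))"
  by (simp add: la_comult_def conjugate_def comp_unit_def)

lemma delta_simps [simp]:
  assumes "X \<in> Obj C"
  shows "\<delta> X \<in> Arr C" "Dom C (\<delta> X) = FO L X" "Cod C (\<delta> X) = FO L (FO L X)"
  using assms by (simp_all add: delta_eq)

lemma delta_transpose:
  assumes "X \<in> Obj C"
  shows "FA T (\<delta> X) \<cdot> u X = \<mu> (FO L (FO L X)) \<cdot> (FA T (u (FO L X)) \<cdot> u X)"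
  unfolding delta_eq[OF assms]
  using A.inverse_transpose[of "\<mu> (FO L (FO L X)) \<cdot> (FA T (u (FO L X)) \<cdot> u X)" "FO L (FO L X)"] assms
  by simp

lemma eps_eq: "X \<in> Obj C \<Longrightarrow> \<epsilon> X = e X \<cdot> FA L (\<eta> X)"
  by (simp add: la_counit_def conjugate_def)

lemma eps_simps [simp]:
  assumes "X \<in> Obj C"
  shows "\<epsilon> X \<in> Arr C" "Dom C (\<epsilon> X) = FO L X" "Cod C (\<epsilon> X) = X"
  using assms by (simp_all add: eps_eq)

lemma eps_transpose: "X \<in> Obj C \<Longrightarrow> FA T (\<epsilon> X) \<cdot> u X = \<eta> X"
  unfolding eps_eq using A.inverse_transpose[of "\<eta> X" X] by simp

lemma bact_eq: "X \<in> Obj C \<Longrightarrow> bact X = e (FO L X) \<cdot> FA L (\<mu> (FO L X) \<cdot> FA T (u X))"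
  by (simp add: la_right_action_def)

lemma bact_simps [simp]:
  assumes "X \<in> Obj C"
  shows "bact X \<in> Arr C" "Dom C (bact X) = FO L (FO T X)" "Cod C (bact X) = FO L X"
  using assms by (simp_all add: bact_eq)

lemma bact_transpose: "X \<in> Obj C \<Longrightarrow> FA T (bact X) \<cdot> u (FO T X) = \<mu> (FO L X) \<cdot> FA T (u X)"
  unfolding bact_eq using A.inverse_transpose[of "\<mu> (FO L X) \<cdot> FA T (u X)" "FO L X"] by simp

text \<open>Equations between arrows out of \<open>L(X)\<close> are checked on their transposes.\<close>

lemma delta_natural:
  assumes f: "f \<in> Arr C"
  shows "\<delta> (Cod C f) \<cdot> FA L f = FA L (FA L f) \<cdot> \<delta> (Dom C f)"
proof (rule A.transpose_inj[of _ _ "Dom C f"])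
  let ?X = "Dom C f" and ?Y = "Cod C f"
  have "FA T (\<delta> ?Y \<cdot> FA L f) \<cdot> u ?X = (FA T (\<delta> ?Y) \<cdot> u ?Y) \<cdot> f"
    using f by (simp add: A.unit_natural)
  also have "\<dots> = \<mu> (FO L (FO L ?Y)) \<cdot> (FA T (u (FO L ?Y)) \<cdot> (FA T (FA L f) \<cdot> u ?X))"
    using f by (simp add: delta_transpose A.unit_natural)
  also have "\<dots> = \<mu> (FO L (FO L ?Y)) \<cdot> (FA T (u (FO L ?Y) \<cdot> FA L f) \<cdot> u ?X)" using f by simp
  also have "u (FO L ?Y) \<cdot> FA L f = FA T (FA L (FA L f)) \<cdot> u (FO L ?X)"
    using f A.unit_natural[of "FA L f" "FO L ?X"] by simp
  also have "\<mu> (FO L (FO L ?Y)) \<cdot> (FA T (FA T (FA L (FA L f)) \<cdot> u (FO L ?X)) \<cdot> u ?X) =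
      (\<mu> (FO L (FO L ?Y)) \<cdot> FA T (FA T (FA L (FA L f)))) \<cdot> (FA T (u (FO L ?X)) \<cdot> u ?X)"
    using f by simp
  also have "\<dots> = FA T (FA L (FA L f)) \<cdot> (FA T (\<delta> ?X) \<cdot> u ?X)"
    using f by (simp add: mu_natural delta_transpose)
  also have "\<dots> = FA T (FA L (FA L f) \<cdot> \<delta> ?X) \<cdot> u ?X" using f by simp
  finally show "FA T (\<delta> ?Y \<cdot> FA L f) \<cdot> u ?X = FA T (FA L (FA L f) \<cdot> \<delta> ?X) \<cdot> u ?X" .
qed (use f in simp_all)

lemma eps_natural:
  assumes f: "f \<in> Arr C"
  shows "\<epsilon> (Cod C f) \<cdot> FA L f = f \<cdot> \<epsilon> (Dom C f)"
proof -
  have "\<epsilon> (Cod C f) \<cdot> FA L f = e (Cod C f) \<cdot> FA L (\<eta> (Cod C f) \<cdot> f)" using f by (simp add: eps_eq)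
  also have "\<eta> (Cod C f) \<cdot> f = FA T f \<cdot> \<eta> (Dom C f)" using f by (simp add: eta_natural)
  also have "e (Cod C f) \<cdot> FA L (FA T f \<cdot> \<eta> (Dom C f)) = (e (Cod C f) \<cdot> FA L (FA T f)) \<cdot> FA L (\<eta> (Dom C f))"
    using f by simp
  also have "\<dots> = f \<cdot> \<epsilon> (Dom C f)" using f by (simp add: A.counit_natural eps_eq)
  finally show ?thesis .
qed

text \<open>The counit of the composite adjunction turns \<open>\<delta>\<close> into \<open>\<mu>\<close>, as they are conjugate.\<close>

lemma delta_counit:
  assumes X: "X \<in> Obj C"
  shows "e X \<cdot> (FA L (e (FO T X)) \<cdot> \<delta> (FO T (FO T X))) = e X \<cdot> FA L (\<mu> X)"
proof (rule A.transpose_inj[of _ _ "FO T (FO T X)"])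
  let ?Y = "FO T (FO T X)"
  let ?g = "e X \<cdot> FA L (e (FO T X))"
  have g: "?g \<in> Arr C" "Dom C ?g = FO L (FO L ?Y)" "Cod C ?g = X" using X by simp_all
  have "FA T (e X \<cdot> (FA L (e (FO T X)) \<cdot> \<delta> ?Y)) \<cdot> u ?Y = FA T ?g \<cdot> (FA T (\<delta> ?Y) \<cdot> u ?Y)"
    using X by simp
  also have "\<dots> = (FA T ?g \<cdot> \<mu> (FO L (FO L ?Y))) \<cdot> (FA T (u (FO L ?Y)) \<cdot> u ?Y)"
    unfolding delta_transpose[OF T.FO_Obj[OF T.FO_Obj[OF X]]] using g X by simp
  also have "\<dots> = (\<mu> X \<cdot> FA T (FA T ?g)) \<cdot> (FA T (u (FO L ?Y)) \<cdot> u ?Y)"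
    using mu_natural[of ?g X] g by simp
  also have "\<dots> = \<mu> X \<cdot> (FA T (FA T ?g \<cdot> u (FO L ?Y)) \<cdot> u ?Y)" using g X by simp
  also have "FA T ?g \<cdot> u (FO L ?Y) = FA T (e X) \<cdot> (FA T (FA L (e (FO T X))) \<cdot> u (FO L ?Y))" using X by simp
  also have "\<dots> = (FA T (e X) \<cdot> u (FO T X)) \<cdot> e (FO T X)" using X by (simp add: A.unit_natural)
  also have "\<dots> = e (FO T X)" using X by (simp add: A.triangle_G)
  also have "FA T (e (FO T X)) \<cdot> u ?Y = Id C ?Y" using X by (simp add: A.triangle_G)
  also have "\<mu> X \<cdot> Id C ?Y = \<mu> X" using X by simp
  also have "\<mu> X = FA T (e X \<cdot> FA L (\<mu> X)) \<cdot> u ?Y"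
    using A.inverse_transpose[of "\<mu> X" X] X by simp
  finally show "FA T (e X \<cdot> (FA L (e (FO T X)) \<cdot> \<delta> ?Y)) \<cdot> u ?Y = FA T (e X \<cdot> FA L (\<mu> X)) \<cdot> u ?Y" .
qed (use X in simp_all)

subsection \<open>Modules over the double left adjoint as comodules\<close>

definition coact :: "'o \<times> 'm \<Rightarrow> 'm" where
  "coact y = FA L (snd y) \<cdot> u' (fst y)"

lemma lmult_eq:
  assumes "X \<in> Obj C"
  shows "lmult X = e' (FO LL X) \<cdot> FA LL (e' (FO L (FO LL X)) \<cdot> FA LL (\<delta> (FO LL X) \<cdot> u' X))"
  using assms by (simp add: lla_mult_def conjugate_def comp_counit_def)

lemma lunit_eq: "X \<in> Obj C \<Longrightarrow> lunit X = \<epsilon> (FO LL X) \<cdot> u' X"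
  by (simp add: lla_unit_def conjugate_def)

lemma lmult_simps [simp]:
  assumes "X \<in> Obj C"
  shows "lmult X \<in> Arr C" "Dom C (lmult X) = FO LL (FO LL X)" "Cod C (lmult X) = FO LL X"
  using assms by (simp_all add: lmult_eq)

lemma LLmod_iff:
  assumes M: "fst y \<in> Obj C" and a: "snd y \<in> Arr C" "Dom C (snd y) = FO LL (fst y)" "Cod C (snd y) = fst y"
  shows "y \<in> LLMods \<longleftrightarrow>
    \<delta> (fst y) \<cdot> coact y = FA L (coact y) \<cdot> coact y \<and> \<epsilon> (fst y) \<cdot> coact y = Id C (fst y)"
proof -
  let ?M = "fst y" and ?r = "snd y" and ?\<rho> = "coact y"
  have rho: "?\<rho> \<in> Arr C" "Dom C ?\<rho> = ?M" "Cod C ?\<rho> = FO L ?M" using M a by (simp_all add: coact_def)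
  have r: "?r = e' ?M \<cdot> FA LL ?\<rho>"
    using B.transpose_inverse[of ?r ?M] M a by (simp add: coact_def)
  have "?r \<cdot> lmult ?M = (?r \<cdot> e' (FO LL ?M)) \<cdot> FA LL (e' (FO L (FO LL ?M)) \<cdot> FA LL (\<delta> (FO LL ?M) \<cdot> u' ?M))"
    using M a by (simp add: lmult_eq)
  also have "?r \<cdot> e' (FO LL ?M) = e' ?M \<cdot> FA LL (FA L ?r)" using M a by (simp add: B.counit_natural)
  also have "(e' ?M \<cdot> FA LL (FA L ?r)) \<cdot> FA LL (e' (FO L (FO LL ?M)) \<cdot> FA LL (\<delta> (FO LL ?M) \<cdot> u' ?M)) =
      e' ?M \<cdot> FA LL ((FA L ?r \<cdot> e' (FO L (FO LL ?M))) \<cdot> FA LL (\<delta> (FO LL ?M) \<cdot> u' ?M))" using M a by simp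
  also have "FA L ?r \<cdot> e' (FO L (FO LL ?M)) = e' (FO L ?M) \<cdot> FA LL (FA L (FA L ?r))"
    using M a by (simp add: B.counit_natural)
  also have "(e' (FO L ?M) \<cdot> FA LL (FA L (FA L ?r))) \<cdot> FA LL (\<delta> (FO LL ?M) \<cdot> u' ?M) =
      e' (FO L ?M) \<cdot> FA LL ((FA L (FA L ?r) \<cdot> \<delta> (FO LL ?M)) \<cdot> u' ?M)" using M a by simp
  also have "FA L (FA L ?r) \<cdot> \<delta> (FO LL ?M) = \<delta> ?M \<cdot> FA L ?r" using delta_natural[of ?r] a by simp
  also have "(\<delta> ?M \<cdot> FA L ?r) \<cdot> u' ?M = \<delta> ?M \<cdot> ?\<rho>" using M a by (simp add: coact_def)
  finally have 1: "?r \<cdot> lmult ?M = e' ?M \<cdot> FA LL (e' (FO L ?M) \<cdot> FA LL (\<delta> ?M \<cdot> ?\<rho>))" .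
  have "?r \<cdot> FA LL ?r = e' ?M \<cdot> FA LL (?\<rho> \<cdot> ?r)"
    by (subst (1) r) (use M a rho in simp)
  also have "?\<rho> \<cdot> ?r = (?\<rho> \<cdot> e' ?M) \<cdot> FA LL ?\<rho>" by (subst r) (use M rho in simp)
  also have "?\<rho> \<cdot> e' ?M = e' (FO L ?M) \<cdot> FA LL (FA L ?\<rho>)" using M rho by (simp add: B.counit_natural)
  also have "(e' (FO L ?M) \<cdot> FA LL (FA L ?\<rho>)) \<cdot> FA LL ?\<rho> = e' (FO L ?M) \<cdot> FA LL (FA L ?\<rho> \<cdot> ?\<rho>)"
    using M rho by simp
  finally have 2: "?r \<cdot> FA LL ?r = e' ?M \<cdot> FA LL (e' (FO L ?M) \<cdot> FA LL (FA L ?\<rho> \<cdot> ?\<rho>))" .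
  have 3: "?r \<cdot> lmult ?M = ?r \<cdot> FA LL ?r \<longleftrightarrow> \<delta> ?M \<cdot> ?\<rho> = FA L ?\<rho> \<cdot> ?\<rho>"
  proof
    assume "?r \<cdot> lmult ?M = ?r \<cdot> FA LL ?r"
    then have "e' ?M \<cdot> FA LL (e' (FO L ?M) \<cdot> FA LL (\<delta> ?M \<cdot> ?\<rho>)) = e' ?M \<cdot> FA LL (e' (FO L ?M) \<cdot> FA LL (FA L ?\<rho> \<cdot> ?\<rho>))"
      unfolding 1 2 .
    then have "e' (FO L ?M) \<cdot> FA LL (\<delta> ?M \<cdot> ?\<rho>) = e' (FO L ?M) \<cdot> FA LL (FA L ?\<rho> \<cdot> ?\<rho>)"
      by (rule B.inverse_transpose_inj[rotated -1]) (use M rho in simp_all)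
    then show "\<delta> ?M \<cdot> ?\<rho> = FA L ?\<rho> \<cdot> ?\<rho>"
      by (rule B.inverse_transpose_inj[rotated -1]) (use M rho in simp_all)
  qed (simp add: 1 2)
  have 4: "?r \<cdot> lunit ?M = \<epsilon> ?M \<cdot> ?\<rho>"
  proof -
    have "?r \<cdot> lunit ?M = (?r \<cdot> \<epsilon> (FO LL ?M)) \<cdot> u' ?M" using M a by (simp add: lunit_eq)
    also have "?r \<cdot> \<epsilon> (FO LL ?M) = \<epsilon> ?M \<cdot> FA L ?r" using eps_natural[of ?r] a by simp
    finally show ?thesis using M a by (simp add: coact_def)
  qed
  show ?thesis unfolding monad_modules_iff 3 4 using M a by blast
qed

lemma coact_of_comodule:
  assumes "M \<in> Obj C" "\<rho> \<in> Arr C" "Dom C \<rho> = M" "Cod C \<rho> = FO L M"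
  shows "coact (M, e' M \<cdot> FA LL \<rho>) = \<rho>"
  using B.inverse_transpose[of \<rho> M] assms by (simp add: coact_def)

lemma LLMod_map_iff:
  assumes y: "y \<in> LLMods" and z: "z \<in> LLMods"
    and f: "f \<in> Arr C" "Dom C f = fst y" "Cod C f = fst z"
  shows "f \<cdot> snd y = snd z \<cdot> FA LL f \<longleftrightarrow> FA L f \<cdot> coact y = coact z \<cdot> f"
proof -
  have Y: "fst y \<in> Obj C" "snd y \<in> Arr C" "Dom C (snd y) = FO LL (fst y)" "Cod C (snd y) = fst y"
    and Z: "fst z \<in> Obj C" "snd z \<in> Arr C" "Dom C (snd z) = FO LL (fst z)" "Cod C (snd z) = fst z"
    using y z unfolding monad_modules_iff by blast+
  have 1: "FA L (f \<cdot> snd y) \<cdot> u' (fst y) = FA L f \<cdot> coact y" using Y f by (simp add: coact_def)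
  have "FA L (snd z \<cdot> FA LL f) \<cdot> u' (fst y) = FA L (snd z) \<cdot> (FA L (FA LL f) \<cdot> u' (fst y))"
    using Y Z f by simp
  also have "\<dots> = coact z \<cdot> f" using Y Z f by (simp add: coact_def B.unit_natural)
  finally have 2: "FA L (snd z \<cdot> FA LL f) \<cdot> u' (fst y) = coact z \<cdot> f" .
  show ?thesis
  proof
    assume "FA L f \<cdot> coact y = coact z \<cdot> f"
    then have "FA L (f \<cdot> snd y) \<cdot> u' (fst y) = FA L (snd z \<cdot> FA LL f) \<cdot> u' (fst y)" unfolding 1 2 .
    then show "f \<cdot> snd y = snd z \<cdot> FA LL f"
      by (rule B.transpose_inj[rotated -1]) (use Y Z f in simp_all)
  qed (metis 1 2)
qed

end

subsection \<open>The universal property of the tensor product\<close>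

text \<open>The module map \<open>\<sigma> x\<close> from \<open>x\<close> to the free module on \<open>T\<^sup>l\<^sup>a \<otimes>\<^sub>T x\<close> is universal, so
  \<open>T\<^sup>l\<^sup>a \<otimes>\<^sub>T -\<close> is left adjoint to the free module functor.  The coaction of \<open>T\<^sup>l\<^sup>a\<close> on \<open>T\<^sup>l\<^sup>a \<otimes>\<^sub>T x\<close> and all its
  properties are derived from this.\<close>

locale monad_tensor = monad_la +
  fixes Q :: "'b \<times> 'c \<Rightarrow> 'b" and q :: "'b \<times> 'c \<Rightarrow> 'c"
  assumes coequalizers: "tensor_coequalizers C T \<mu> \<eta> L u e Q q"
begin

lemma q_coequalizer: "x \<in> Mods \<Longrightarrow> is_coequalizer C (bact (fst x)) (FA L (snd x)) (Q x) (q x)"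
  using coequalizers by (simp add: tensor_coequalizers_def)

lemma q_simps [simp]:
  assumes "x \<in> Mods"
  shows "Q x \<in> Obj C" "q x \<in> Arr C" "Dom C (q x) = FO L (fst x)" "Cod C (q x) = Q x"
  using q_coequalizer[OF assms] assms by (simp_all add: is_coequalizer_def)

lemma q_eq: "x \<in> Mods \<Longrightarrow> q x \<cdot> bact (fst x) = q x \<cdot> FA L (snd x)"
  using q_coequalizer by (simp add: is_coequalizer_def)

lemma q_ex1:
  assumes "x \<in> Mods" "h \<in> Arr C" "Dom C h = FO L (fst x)" "h \<cdot> bact (fst x) = h \<cdot> FA L (snd x)"
  shows "\<exists>!k. k \<in> hom_set C (Q x) (Cod C h) \<and> k \<cdot> q x = h"
proof -
  have "\<forall>Z\<in>Obj C. \<forall>h\<in>hom_set C (Cod C (bact (fst x))) Z. h \<cdot> bact (fst x) = h \<cdot> FA L (snd x) \<longrightarrow>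
        (\<exists>!k. k \<in> hom_set C (Q x) Z \<and> k \<cdot> q x = h)"
    using q_coequalizer[OF assms(1)] unfolding is_coequalizer_def by blast
  then show ?thesis using assms by simp
qed

lemma q_epic:
  assumes x: "x \<in> Mods"
  shows "jointly_epic C (Q x) {q x}"
  unfolding jointly_epic_def
proof (intro conjI ballI impI)
  fix f g assume f: "f \<in> Arr C" and g: "g \<in> Arr C"
    and *: "Dom C f = Q x \<and> Dom C g = Q x \<and> Cod C f = Cod C g \<and> (\<forall>s\<in>{q x}. f \<cdot> s = g \<cdot> s)"
  have "\<exists>!k. k \<in> hom_set C (Q x) (Cod C (g \<cdot> q x)) \<and> k \<cdot> q x = g \<cdot> q x"
  proof (rule q_ex1[OF x])
    show "(g \<cdot> q x) \<cdot> bact (fst x) = (g \<cdot> q x) \<cdot> FA L (snd x)" using x g * q_eq[OF x] by simp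
  qed (use x g * in simp_all)
  moreover have "f \<in> hom_set C (Q x) (Cod C (g \<cdot> q x))" "f \<cdot> q x = g \<cdot> q x"
    "g \<in> hom_set C (Q x) (Cod C (g \<cdot> q x))" using x f g * by simp_all
  ultimately show "f = g" by blast
qed (use x in simp_all)

definition \<sigma> :: "'b \<times> 'c \<Rightarrow> 'c" where
  "\<sigma> x = FA T (q x) \<cdot> u (fst x)"

lemma sigma_simps [simp]:
  assumes "x \<in> Mods"
  shows "\<sigma> x \<in> Arr C" "Dom C (\<sigma> x) = fst x" "Cod C (\<sigma> x) = FO T (Q x)"
  using assms by (simp_all add: \<sigma>_def)

lemma coequalizes_iff_linear:
  assumes x: "x \<in> Mods" and g: "g \<in> Arr C" "Dom C g = FO L (fst x)"
  shows "g \<cdot> bact (fst x) = g \<cdot> FA L (snd x) \<longleftrightarrow>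
    (FA T g \<cdot> u (fst x)) \<cdot> snd x = \<mu> (Cod C g) \<cdot> FA T (FA T g \<cdot> u (fst x))"
proof -
  let ?M = "fst x"
  have "FA T (g \<cdot> bact ?M) \<cdot> u (FO T ?M) = FA T g \<cdot> (FA T (bact ?M) \<cdot> u (FO T ?M))" using x g by simp
  also have "\<dots> = (FA T g \<cdot> \<mu> (FO L ?M)) \<cdot> FA T (u ?M)" using x g by (simp add: bact_transpose)
  also have "FA T g \<cdot> \<mu> (FO L ?M) = \<mu> (Cod C g) \<cdot> FA T (FA T g)" using mu_natural[of g] g by simp
  also have "(\<mu> (Cod C g) \<cdot> FA T (FA T g)) \<cdot> FA T (u ?M) = \<mu> (Cod C g) \<cdot> FA T (FA T g \<cdot> u ?M)"
    using x g by simp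
  finally have 1: "FA T (g \<cdot> bact ?M) \<cdot> u (FO T ?M) = \<mu> (Cod C g) \<cdot> FA T (FA T g \<cdot> u ?M)" .
  have 2: "FA T (g \<cdot> FA L (snd x)) \<cdot> u (FO T ?M) = (FA T g \<cdot> u ?M) \<cdot> snd x"
    using x g by (simp add: A.unit_natural)
  show ?thesis
  proof
    assume "(FA T g \<cdot> u ?M) \<cdot> snd x = \<mu> (Cod C g) \<cdot> FA T (FA T g \<cdot> u ?M)"
    then have "FA T (g \<cdot> bact ?M) \<cdot> u (FO T ?M) = FA T (g \<cdot> FA L (snd x)) \<cdot> u (FO T ?M)" unfolding 1 2 by simp
    then show "g \<cdot> bact ?M = g \<cdot> FA L (snd x)"
      by (rule A.transpose_inj[rotated -1]) (use x g in simp_all)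
  qed (metis 1 2)
qed

lemma sigma_linear: "x \<in> Mods \<Longrightarrow> \<sigma> x \<cdot> snd x = \<mu> (Q x) \<cdot> FA T (\<sigma> x)"
  using coequalizes_iff_linear[of x "q x"] q_eq[of x] by (simp add: \<sigma>_def)

lemma sigma_inj:
  assumes x: "x \<in> Mods" and f: "f \<in> Arr C" "g \<in> Arr C" "Dom C f = Q x" "Dom C g = Q x" "Cod C f = Cod C g"
    and eq: "FA T f \<cdot> \<sigma> x = FA T g \<cdot> \<sigma> x"
  shows "f = g"
proof -
  have "FA T (f \<cdot> q x) \<cdot> u (fst x) = FA T (g \<cdot> q x) \<cdot> u (fst x)" using eq x f by (simp add: \<sigma>_def)
  then have "f \<cdot> q x = g \<cdot> q x"
    by (rule A.transpose_inj[rotated -1]) (use x f in simp_all)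
  then show ?thesis using jointly_epicD[OF q_epic[OF x] f] by simp
qed

lemma sigma_universal:
  assumes x: "x \<in> Mods" and X: "X \<in> Obj C" and f: "f \<in> Arr C" "Dom C f = fst x" "Cod C f = FO T X"
    and lin: "f \<cdot> snd x = \<mu> X \<cdot> FA T f"
  obtains k where "k \<in> Arr C" "Dom C k = Q x" "Cod C k = X" "FA T k \<cdot> \<sigma> x = f"
proof -
  let ?g = "e X \<cdot> FA L f"
  have gf: "FA T ?g \<cdot> u (fst x) = f" using A.inverse_transpose[of f X] X f by simp
  have g: "?g \<in> Arr C" "Dom C ?g = FO L (fst x)" "Cod C ?g = X" using x X f by simp_all
  have "?g \<cdot> bact (fst x) = ?g \<cdot> FA L (snd x)"
    unfolding coequalizes_iff_linear[OF x g(1,2)] gf g(3) by (rule lin)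
  from q_ex1[OF x g(1,2) this] obtain k where k: "k \<in> Arr C" "Dom C k = Q x" "Cod C k = X" "k \<cdot> q x = ?g"
    using g(3) by auto
  have "FA T k \<cdot> \<sigma> x = FA T (k \<cdot> q x) \<cdot> u (fst x)" using x k(1-3) by (simp add: \<sigma>_def)
  then have "FA T k \<cdot> \<sigma> x = f" unfolding k(4) gf .
  then show thesis using that k by blast
qed

text \<open>The coaction corresponds to the module map from \<open>x\<close> to the free module on \<open>T\<^sup>l\<^sup>a(P)\<close> that is induced by
  the unit \<open>P \<rightarrow> T(T\<^sup>l\<^sup>a(P))\<close>; so its laws follow from the transposes of \<open>\<delta>\<close> and \<open>\<epsilon>\<close>.\<close>

lemma rho_ex:
  assumes x: "x \<in> Mods"
  shows "\<exists>\<rho>. \<rho> \<in> Arr C \<and> Dom C \<rho> = Q x \<and> Cod C \<rho> = FO L (Q x) \<and>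
    FA T \<rho> \<cdot> \<sigma> x = \<mu> (FO L (Q x)) \<cdot> (FA T (u (Q x)) \<cdot> \<sigma> x)"
proof -
  let ?P = "Q x" and ?f = "\<mu> (FO L (Q x)) \<cdot> (FA T (u (Q x)) \<cdot> \<sigma> x)"
  have "?f \<cdot> snd x = \<mu> (FO L ?P) \<cdot> (FA T (u ?P) \<cdot> (\<sigma> x \<cdot> snd x))" using x by simp
  also have "\<dots> = \<mu> (FO L ?P) \<cdot> ((FA T (u ?P) \<cdot> \<mu> ?P) \<cdot> FA T (\<sigma> x))" using x by (simp add: sigma_linear)
  also have "FA T (u ?P) \<cdot> \<mu> ?P = \<mu> (FO T (FO L ?P)) \<cdot> FA T (FA T (u ?P))"
    using mu_natural[of "u ?P"] x by simp
  also have "\<mu> (FO L ?P) \<cdot> ((\<mu> (FO T (FO L ?P)) \<cdot> FA T (FA T (u ?P))) \<cdot> FA T (\<sigma> x)) =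
    (\<mu> (FO L ?P) \<cdot> \<mu> (FO T (FO L ?P))) \<cdot> (FA T (FA T (u ?P)) \<cdot> FA T (\<sigma> x))" using x by simp
  also have "\<mu> (FO L ?P) \<cdot> \<mu> (FO T (FO L ?P)) = \<mu> (FO L ?P) \<cdot> FA T (\<mu> (FO L ?P))" using x by (simp add: mu_assoc)
  also have "(\<mu> (FO L ?P) \<cdot> FA T (\<mu> (FO L ?P))) \<cdot> (FA T (FA T (u ?P)) \<cdot> FA T (\<sigma> x)) = \<mu> (FO L ?P) \<cdot> FA T ?f"
    using x by simp
  finally have lin: "?f \<cdot> snd x = \<mu> (FO L ?P) \<cdot> FA T ?f" .
  obtain k where "k \<in> Arr C" "Dom C k = Q x" "Cod C k = FO L ?P" "FA T k \<cdot> \<sigma> x = ?f"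
    by (rule sigma_universal[OF x _ _ _ _ lin]) (use x in simp_all)
  then show ?thesis by blast
qed

definition \<rho> :: "'b \<times> 'c \<Rightarrow> 'c" where
  "\<rho> x = (SOME r. r \<in> Arr C \<and> Dom C r = Q x \<and> Cod C r = FO L (Q x) \<and>
    FA T r \<cdot> \<sigma> x = \<mu> (FO L (Q x)) \<cdot> (FA T (u (Q x)) \<cdot> \<sigma> x))"

lemma rho_simps [simp]:
  assumes "x \<in> Mods"
  shows "\<rho> x \<in> Arr C" "Dom C (\<rho> x) = Q x" "Cod C (\<rho> x) = FO L (Q x)"
  using someI_ex[OF rho_ex[OF assms]] unfolding \<rho>_def by blast+

lemma rho_sigma: "x \<in> Mods \<Longrightarrow> FA T (\<rho> x) \<cdot> \<sigma> x = \<mu> (FO L (Q x)) \<cdot> (FA T (u (Q x)) \<cdot> \<sigma> x)"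
  using someI_ex[OF rho_ex] unfolding \<rho>_def by blast

lemma rho_q:
  assumes x: "x \<in> Mods"
  shows "\<rho> x \<cdot> q x = FA L (q x) \<cdot> \<delta> (fst x)"
proof (rule A.transpose_inj[of _ _ "fst x"])
  let ?P = "Q x" and ?M = "fst x"
  have "FA T (\<rho> x \<cdot> q x) \<cdot> u ?M = FA T (\<rho> x) \<cdot> \<sigma> x" using x by (simp add: \<sigma>_def)
  also have "\<dots> = \<mu> (FO L ?P) \<cdot> (FA T (u ?P \<cdot> q x) \<cdot> u ?M)" unfolding rho_sigma[OF x] using x by (simp add: \<sigma>_def)
  also have "u ?P \<cdot> q x = FA T (FA L (q x)) \<cdot> u (FO L ?M)" using x by (simp add: A.unit_natural)
  also have "\<mu> (FO L ?P) \<cdot> (FA T (FA T (FA L (q x)) \<cdot> u (FO L ?M)) \<cdot> u ?M) =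
    (\<mu> (FO L ?P) \<cdot> FA T (FA T (FA L (q x)))) \<cdot> (FA T (u (FO L ?M)) \<cdot> u ?M)" using x by simp
  also have "\<mu> (FO L ?P) \<cdot> FA T (FA T (FA L (q x))) = FA T (FA L (q x)) \<cdot> \<mu> (FO L (FO L ?M))"
    using mu_natural[of "FA L (q x)"] x by simp
  also have "(FA T (FA L (q x)) \<cdot> \<mu> (FO L (FO L ?M))) \<cdot> (FA T (u (FO L ?M)) \<cdot> u ?M) =
    FA T (FA L (q x)) \<cdot> (FA T (\<delta> ?M) \<cdot> u ?M)" using x by (simp add: delta_transpose)
  also have "\<dots> = FA T (FA L (q x) \<cdot> \<delta> ?M) \<cdot> u ?M" using x by simp
  finally show "FA T (\<rho> x \<cdot> q x) \<cdot> u ?M = FA T (FA L (q x) \<cdot> \<delta> ?M) \<cdot> u ?M" .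
qed (use x in simp_all)

lemma rho_coassoc:
  assumes x: "x \<in> Mods"
  shows "\<delta> (Q x) \<cdot> \<rho> x = FA L (\<rho> x) \<cdot> \<rho> x"
proof (rule sigma_inj[OF x])
  let ?P = "Q x" and ?m = "\<mu> (FO L (FO L (Q x)))"
  have "FA T (\<delta> ?P \<cdot> \<rho> x) \<cdot> \<sigma> x = FA T (\<delta> ?P) \<cdot> (FA T (\<rho> x) \<cdot> \<sigma> x)" using x by simp
  also have "\<dots> = (FA T (\<delta> ?P) \<cdot> \<mu> (FO L ?P)) \<cdot> (FA T (u ?P) \<cdot> \<sigma> x)" unfolding rho_sigma[OF x] using x by simp
  also have "FA T (\<delta> ?P) \<cdot> \<mu> (FO L ?P) = ?m \<cdot> FA T (FA T (\<delta> ?P))" using mu_natural[of "\<delta> ?P"] x by simp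
  also have "(?m \<cdot> FA T (FA T (\<delta> ?P))) \<cdot> (FA T (u ?P) \<cdot> \<sigma> x) = ?m \<cdot> (FA T (FA T (\<delta> ?P) \<cdot> u ?P) \<cdot> \<sigma> x)" using x by simp
  also have "FA T (\<delta> ?P) \<cdot> u ?P = ?m \<cdot> (FA T (u (FO L ?P)) \<cdot> u ?P)" using x by (simp add: delta_transpose)
  also have "?m \<cdot> (FA T (?m \<cdot> (FA T (u (FO L ?P)) \<cdot> u ?P)) \<cdot> \<sigma> x) =
    (?m \<cdot> FA T ?m) \<cdot> (FA T (FA T (u (FO L ?P))) \<cdot> (FA T (u ?P) \<cdot> \<sigma> x))" using x by simp
  also have "?m \<cdot> FA T ?m = ?m \<cdot> \<mu> (FO T (FO L (FO L ?P)))" using x by (simp add: mu_assoc)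
  also have "(?m \<cdot> \<mu> (FO T (FO L (FO L ?P)))) \<cdot> (FA T (FA T (u (FO L ?P))) \<cdot> (FA T (u ?P) \<cdot> \<sigma> x)) =
    ?m \<cdot> ((\<mu> (FO T (FO L (FO L ?P))) \<cdot> FA T (FA T (u (FO L ?P)))) \<cdot> (FA T (u ?P) \<cdot> \<sigma> x))" using x by simp
  also have "\<mu> (FO T (FO L (FO L ?P))) \<cdot> FA T (FA T (u (FO L ?P))) = FA T (u (FO L ?P)) \<cdot> \<mu> (FO L ?P)"
    using mu_natural[of "u (FO L ?P)"] x by simp
  also have "?m \<cdot> ((FA T (u (FO L ?P)) \<cdot> \<mu> (FO L ?P)) \<cdot> (FA T (u ?P) \<cdot> \<sigma> x)) =
    ?m \<cdot> (FA T (u (FO L ?P)) \<cdot> (FA T (\<rho> x) \<cdot> \<sigma> x))" unfolding rho_sigma[OF x] using x by simp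
  also have "\<dots> = ?m \<cdot> (FA T (u (FO L ?P) \<cdot> \<rho> x) \<cdot> \<sigma> x)" using x by simp
  also have "u (FO L ?P) \<cdot> \<rho> x = FA T (FA L (\<rho> x)) \<cdot> u ?P" using x by (simp add: A.unit_natural)
  also have "?m \<cdot> (FA T (FA T (FA L (\<rho> x)) \<cdot> u ?P) \<cdot> \<sigma> x) =
    (?m \<cdot> FA T (FA T (FA L (\<rho> x)))) \<cdot> (FA T (u ?P) \<cdot> \<sigma> x)" using x by simp
  also have "?m \<cdot> FA T (FA T (FA L (\<rho> x))) = FA T (FA L (\<rho> x)) \<cdot> \<mu> (FO L ?P)"
    using mu_natural[of "FA L (\<rho> x)"] x by simp
  also have "(FA T (FA L (\<rho> x)) \<cdot> \<mu> (FO L ?P)) \<cdot> (FA T (u ?P) \<cdot> \<sigma> x) = FA T (FA L (\<rho> x)) \<cdot> (FA T (\<rho> x) \<cdot> \<sigma> x)"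
    unfolding rho_sigma[OF x] using x by simp
  also have "\<dots> = FA T (FA L (\<rho> x) \<cdot> \<rho> x) \<cdot> \<sigma> x" using x by simp
  finally show "FA T (\<delta> ?P \<cdot> \<rho> x) \<cdot> \<sigma> x = FA T (FA L (\<rho> x) \<cdot> \<rho> x) \<cdot> \<sigma> x" .
qed (use x in simp_all)

lemma rho_counit:
  assumes x: "x \<in> Mods"
  shows "\<epsilon> (Q x) \<cdot> \<rho> x = Id C (Q x)"
proof (rule sigma_inj[OF x])
  let ?P = "Q x"
  have "FA T (\<epsilon> ?P \<cdot> \<rho> x) \<cdot> \<sigma> x = FA T (\<epsilon> ?P) \<cdot> (FA T (\<rho> x) \<cdot> \<sigma> x)" using x by simp
  also have "\<dots> = (FA T (\<epsilon> ?P) \<cdot> \<mu> (FO L ?P)) \<cdot> (FA T (u ?P) \<cdot> \<sigma> x)" unfolding rho_sigma[OF x] using x by simp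
  also have "FA T (\<epsilon> ?P) \<cdot> \<mu> (FO L ?P) = \<mu> ?P \<cdot> FA T (FA T (\<epsilon> ?P))" using mu_natural[of "\<epsilon> ?P"] x by simp
  also have "(\<mu> ?P \<cdot> FA T (FA T (\<epsilon> ?P))) \<cdot> (FA T (u ?P) \<cdot> \<sigma> x) = \<mu> ?P \<cdot> (FA T (FA T (\<epsilon> ?P) \<cdot> u ?P) \<cdot> \<sigma> x)"
    using x by simp
  also have "FA T (\<epsilon> ?P) \<cdot> u ?P = \<eta> ?P" using x by (simp add: eps_transpose)
  also have "\<mu> ?P \<cdot> (FA T (\<eta> ?P) \<cdot> \<sigma> x) = (\<mu> ?P \<cdot> FA T (\<eta> ?P)) \<cdot> \<sigma> x" using x by simp
  also have "\<dots> = FA T (Id C ?P) \<cdot> \<sigma> x" using x by (simp add: mu_T_eta)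
  finally show "FA T (\<epsilon> ?P \<cdot> \<rho> x) \<cdot> \<sigma> x = FA T (Id C ?P) \<cdot> \<sigma> x" .
qed (use x in simp_all)

subsection \<open>The tensor functor\<close>

abbreviation Tensor where "Tensor \<equiv> tensor_functor C T \<mu> L u e LL e' Q q"

definition tens :: "'b \<times> 'c \<Rightarrow> 'b \<times> 'c" where
  "tens x = (Q x, e' (Q x) \<cdot> FA LL (\<rho> x))"

lemma fst_tens [simp]: "fst (tens x) = Q x"
  by (simp add: tens_def)

lemma snd_tens_simps [simp]:
  assumes "x \<in> Mods"
  shows "snd (tens x) \<in> Arr C" "Dom C (snd (tens x)) = FO LL (Q x)" "Cod C (snd (tens x)) = Q x"
  using assms by (simp_all add: tens_def)

lemma coact_tens: "x \<in> Mods \<Longrightarrow> coact (tens x) = \<rho> x"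
  unfolding tens_def by (rule coact_of_comodule) simp_all

lemma tens_module: "x \<in> Mods \<Longrightarrow> tens x \<in> LLMods"
  by (subst LLmod_iff) (simp_all add: coact_tens rho_coassoc rho_counit)

lemma LLq_epic: "x \<in> Mods \<Longrightarrow> jointly_epic C (FO LL (Q x)) {FA LL (q x)}"
  using B.jointly_epic_F[OF q_epic] by simp

lemma FO_Tensor:
  assumes x: "x \<in> Mods"
  shows "FO Tensor x = tens x"
proof -
  let ?r = "e' (Q x) \<cdot> FA LL (\<rho> x)"
  have r: "?r \<in> hom_set C (FO LL (Q x)) (Q x)" using x by simp
  have "?r \<cdot> FA LL (q x) = e' (Q x) \<cdot> FA LL (\<rho> x \<cdot> q x)" using x by simp
  also have "\<dots> = (e' (Q x) \<cdot> FA LL (FA L (q x))) \<cdot> FA LL (\<delta> (fst x))" unfolding rho_q[OF x] using x by simp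
  also have "\<dots> = q x \<cdot> la_left_action C T \<mu> L u e LL e' (fst x)"
    using x by (simp add: B.counit_natural la_left_action_def)
  finally have rq: "?r \<cdot> FA LL (q x) = q x \<cdot> la_left_action C T \<mu> L u e LL e' (fst x)" .
  have "(THE r. r \<in> hom_set C (FO LL (Q x)) (Q x) \<and> r \<cdot> FA LL (q x) = q x \<cdot> la_left_action C T \<mu> L u e LL e' (fst x)) = ?r"
  proof (rule the_equality)
    show "?r \<in> hom_set C (FO LL (Q x)) (Q x) \<and> ?r \<cdot> FA LL (q x) = q x \<cdot> la_left_action C T \<mu> L u e LL e' (fst x)"
      using r rq by blast
    fix s assume "s \<in> hom_set C (FO LL (Q x)) (Q x) \<and> s \<cdot> FA LL (q x) = q x \<cdot> la_left_action C T \<mu> L u e LL e' (fst x)"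
    then have s: "s \<in> Arr C" "Dom C s = FO LL (Q x)" "Cod C s = Q x" "s \<cdot> FA LL (q x) = ?r \<cdot> FA LL (q x)"
      using rq by auto
    show "s = ?r"
      by (rule jointly_epicD[OF LLq_epic[OF x]]) (use x s in auto)
  qed
  then show ?thesis by (simp add: tensor_functor_def Let_def tens_def)
qed

text \<open>The arrow \<open>T\<^sup>l\<^sup>a \<otimes>\<^sub>T f\<close> underlying a module map.\<close>

definition tmap :: "'b \<times> 'c \<Rightarrow> 'c \<Rightarrow> 'b \<times> 'c \<Rightarrow> 'c" where
  "tmap x f y = (THE g. g \<in> hom_set C (Q x) (Q y) \<and> g \<cdot> q x = q y \<cdot> FA L f)"

lemma tmap:
  assumes f: "(x, f, y) \<in> Arr TMod"
  shows "tmap x f y \<in> Arr C" "Dom C (tmap x f y) = Q x" "Cod C (tmap x f y) = Q y"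
    "FA T (tmap x f y) \<cdot> \<sigma> x = \<sigma> y \<cdot> f"
proof -
  have x: "x \<in> Mods" and y: "y \<in> Mods" and f': "f \<in> Arr C" "Dom C f = fst x" "Cod C f = fst y"
    "f \<cdot> snd x = snd y \<cdot> FA T f" using f by (simp_all add: tmod_Arr)
  let ?h = "q y \<cdot> FA L f"
  have h: "?h \<in> Arr C" "Dom C ?h = FO L (fst x)" "Cod C ?h = Q y" using y f' by simp_all
  have hs: "FA T ?h \<cdot> u (fst x) = \<sigma> y \<cdot> f" using x y f' by (simp add: \<sigma>_def A.unit_natural)
  have "(\<sigma> y \<cdot> f) \<cdot> snd x = (\<sigma> y \<cdot> snd y) \<cdot> FA T f" using x y f' by simp
  also have "\<dots> = \<mu> (Q y) \<cdot> FA T (\<sigma> y \<cdot> f)" using y f' by (simp add: sigma_linear)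
  finally have "?h \<cdot> bact (fst x) = ?h \<cdot> FA L (snd x)"
    unfolding coequalizes_iff_linear[OF x h(1,2)] hs h(3) .
  from theI'[OF q_ex1[OF x h(1,2) this]] h(3)
  have g: "tmap x f y \<in> hom_set C (Q x) (Q y) \<and> tmap x f y \<cdot> q x = ?h" unfolding tmap_def by simp
  then show g': "tmap x f y \<in> Arr C" "Dom C (tmap x f y) = Q x" "Cod C (tmap x f y) = Q y" by auto
  have "FA T (tmap x f y) \<cdot> \<sigma> x = FA T (tmap x f y \<cdot> q x) \<cdot> u (fst x)" using x g' by (simp add: \<sigma>_def)
  then show "FA T (tmap x f y) \<cdot> \<sigma> x = \<sigma> y \<cdot> f" using g hs by simp
qed

lemma tmap_eqI:
  assumes f: "(x, f, y) \<in> Arr TMod" and g: "g \<in> Arr C" "Dom C g = Q x" "Cod C g = Q y"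
    and eq: "FA T g \<cdot> \<sigma> x = \<sigma> y \<cdot> f"
  shows "tmap x f y = g"
proof -
  have x: "x \<in> Mods" using f by (simp add: tmod_Arr)
  show ?thesis by (rule sigma_inj[OF x]) (use tmap[OF f] g eq in simp_all)
qed

lemma FA_Tensor: "(x, f, y) \<in> Arr TMod \<Longrightarrow> FA Tensor (x, f, y) = (tens x, tmap x f y, tens y)"
  using FO_Tensor[of x] FO_Tensor[of y] by (simp add: tensor_functor_def Let_def tmap_def tmod_Arr)

lemma tmap_comodule:
  assumes f: "(x, f, y) \<in> Arr TMod"
  shows "FA L (tmap x f y) \<cdot> \<rho> x = \<rho> y \<cdot> tmap x f y"
proof -
  have x: "x \<in> Mods" and y: "y \<in> Mods" and f': "f \<in> Arr C" "Dom C f = fst x" "Cod C f = fst y"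
    using f by (simp_all add: tmod_Arr)
  let ?g = "tmap x f y"
  note g = tmap[OF f]
  show ?thesis
  proof (rule sigma_inj[OF x])
    have "FA T (FA L ?g \<cdot> \<rho> x) \<cdot> \<sigma> x = FA T (FA L ?g) \<cdot> (FA T (\<rho> x) \<cdot> \<sigma> x)" using x y g by simp
    also have "\<dots> = (FA T (FA L ?g) \<cdot> \<mu> (FO L (Q x))) \<cdot> (FA T (u (Q x)) \<cdot> \<sigma> x)"
      unfolding rho_sigma[OF x] using x y g by simp
    also have "FA T (FA L ?g) \<cdot> \<mu> (FO L (Q x)) = \<mu> (FO L (Q y)) \<cdot> FA T (FA T (FA L ?g))"
      using mu_natural[of "FA L ?g"] x y g by simp
    also have "(\<mu> (FO L (Q y)) \<cdot> FA T (FA T (FA L ?g))) \<cdot> (FA T (u (Q x)) \<cdot> \<sigma> x) =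
      \<mu> (FO L (Q y)) \<cdot> (FA T (FA T (FA L ?g) \<cdot> u (Q x)) \<cdot> \<sigma> x)" using x y g by simp
    also have "FA T (FA L ?g) \<cdot> u (Q x) = u (Q y) \<cdot> ?g" using g(1-3) A.unit_natural[of ?g] by simp
    also have "\<mu> (FO L (Q y)) \<cdot> (FA T (u (Q y) \<cdot> ?g) \<cdot> \<sigma> x) = \<mu> (FO L (Q y)) \<cdot> (FA T (u (Q y)) \<cdot> (FA T ?g \<cdot> \<sigma> x))"
      using x y g(1-3) by simp
    also have "\<dots> = (\<mu> (FO L (Q y)) \<cdot> (FA T (u (Q y)) \<cdot> \<sigma> y)) \<cdot> f" unfolding g(4) using x y f' by simp
    also have "\<dots> = FA T (\<rho> y) \<cdot> (\<sigma> y \<cdot> f)" unfolding rho_sigma[OF y, symmetric] using x y f' by simp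
    also have "\<dots> = FA T (\<rho> y \<cdot> ?g) \<cdot> \<sigma> x" unfolding g(4)[symmetric] using x y g(1-3) by simp
    finally show "FA T (FA L ?g \<cdot> \<rho> x) \<cdot> \<sigma> x = FA T (\<rho> y \<cdot> ?g) \<cdot> \<sigma> x" .
  qed (use x y g in simp_all)
qed

lemma Tensor_functor: "is_functor TMod LLMod Tensor"
proof (rule is_functorI)
  show "category TMod" by (rule TMod.category)
  show "category LLMod" by (rule tmod_category[OF B.F.is_functor])
  show "FO Tensor x \<in> Obj LLMod" if "x \<in> Obj TMod" for x
    using that by (simp add: FO_Tensor tens_module)
  show "FA Tensor (Id TMod x) = Id LLMod (FO Tensor x)" if "x \<in> Obj TMod" for x
  proof -
    have x: "x \<in> Mods" and f: "(x, Id C (fst x), x) \<in> Arr TMod" using that TMod.Id_Arr[OF that] by auto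
    have "tmap x (Id C (fst x)) x = Id C (Q x)" by (rule tmap_eqI[OF f]) (use x in simp_all)
    then show ?thesis using FA_Tensor[OF f] x by (simp add: FO_Tensor)
  qed
  show "FA Tensor \<phi> \<in> Arr LLMod \<and> Dom LLMod (FA Tensor \<phi>) = FO Tensor (Dom TMod \<phi>) \<and>
    Cod LLMod (FA Tensor \<phi>) = FO Tensor (Cod TMod \<phi>)" if h: "\<phi> \<in> Arr TMod" for \<phi>
  proof -
    obtain x f y where f: "\<phi> = (x, f, y)" "x \<in> Mods" "y \<in> Mods" using h by (rule tmod_ArrE)
    have f': "(x, f, y) \<in> Arr TMod" using h f by simp
    have "tmap x f y \<cdot> snd (tens x) = snd (tens y) \<cdot> FA LL (tmap x f y)"
      using LLMod_map_iff[OF tens_module[OF f(2)] tens_module[OF f(3)]] tmap[OF f'] tmap_comodule[OF f'] f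
      by (simp add: coact_tens)
    then show ?thesis
      using f FA_Tensor[OF f'] tmap[OF f'] tens_module by (simp add: FO_Tensor tmod_Arr)
  qed
  show "FA Tensor (\<psi> \<cdot>\<^bsub>TMod\<^esub> \<phi>) = FA Tensor \<psi> \<cdot>\<^bsub>LLMod\<^esub> FA Tensor \<phi>"
    if h: "\<phi> \<in> Arr TMod" "\<psi> \<in> Arr TMod" "Cod TMod \<phi> = Dom TMod \<psi>" for \<phi> \<psi>
  proof -
    obtain x f y where f: "\<phi> = (x, f, y)" "f \<in> Arr C" "Dom C f = fst x" "Cod C f = fst y" "x \<in> Mods" "y \<in> Mods"
      using h(1) by (rule tmod_ArrE)
    obtain z g where g: "\<psi> = (y, g, z)" "g \<in> Arr C" "Dom C g = fst y" "Cod C g = fst z" "z \<in> Mods"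
      using h(2,3) f(1) by (auto elim!: tmod_ArrE)
    have f': "(x, f, y) \<in> Arr TMod" and g': "(y, g, z) \<in> Arr TMod" using h f g by simp_all
    have gf: "(x, g \<cdot> f, z) \<in> Arr TMod" using TMod.comp_Arr[OF h] f g by simp
    have "tmap x (g \<cdot> f) z = tmap y g z \<cdot> tmap x f y"
    proof (rule tmap_eqI[OF gf])
      have "FA T (tmap y g z \<cdot> tmap x f y) \<cdot> \<sigma> x = FA T (tmap y g z) \<cdot> (FA T (tmap x f y) \<cdot> \<sigma> x)"
        using tmap(1-3)[OF f'] tmap(1-3)[OF g'] f by simp
      also have "\<dots> = (FA T (tmap y g z) \<cdot> \<sigma> y) \<cdot> f"
        unfolding tmap(4)[OF f'] using tmap(1-3)[OF g'] f by simp
      also have "\<dots> = \<sigma> z \<cdot> (g \<cdot> f)" unfolding tmap(4)[OF g'] using f g by simp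
      finally show "FA T (tmap y g z \<cdot> tmap x f y) \<cdot> \<sigma> x = \<sigma> z \<cdot> (g \<cdot> f)" .
    qed (use tmap(1-3)[OF f'] tmap(1-3)[OF g'] in simp_all)
    then show ?thesis using FA_Tensor[OF f'] FA_Tensor[OF g'] FA_Tensor[OF gf] f g by simp
  qed
qed

end

section \<open>The lift of the Nakayama functor to modules\<close>

locale nak_setting = monad_tensor K C T \<mu> \<eta> L u e LL u' e' Q q + R: adj C T R v w + lcat_copowers K C ten tj
  for K :: "'k ring" and C :: "('k, 'o, 'm) lincat" (structure) and T :: "('o, 'm, 'o, 'm) ftr"
    and \<mu> \<eta> :: "'o \<Rightarrow> 'm" and L :: "('o, 'm, 'o, 'm) ftr" and u e :: "'o \<Rightarrow> 'm"
    and LL :: "('o, 'm, 'o, 'm) ftr" and u' e' :: "'o \<Rightarrow> 'm"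
    and Q :: "'o \<times> 'm \<Rightarrow> 'o" and q :: "'o \<times> 'm \<Rightarrow> 'm"
    and R :: "('o, 'm, 'o, 'm) ftr" and v w :: "'o \<Rightarrow> 'm"
    and ten :: "('k, 'm \<Rightarrow> 'k) module \<Rightarrow> 'o \<Rightarrow> 'o" and tj :: "('k, 'm \<Rightarrow> 'k) module \<Rightarrow> 'o \<Rightarrow> ('m \<Rightarrow> 'k) \<Rightarrow> 'm" +
  fixes N :: "('o, 'm, 'o, 'm) ftr" and i :: "'o \<Rightarrow> 'o \<Rightarrow> 'm"
  assumes nakayama: "nakayama K C ten tj N i"
begin

definition \<iota> :: "'o \<Rightarrow> 'o \<Rightarrow> ('m \<Rightarrow> 'k) \<Rightarrow> 'm" where
  "\<iota> M = cone_of M (i M)"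

lemma N_nak: "nak_functor K C N \<iota>"
  using nakayama_nak_functor[OF nakayama] by (simp add: \<iota>_def[abs_def])

sublocale N: fctr C C N
  using nak_functorD(1)[OF N_nak] by (simp add: fctr_def)

lemmas N_rep = nak_functorD(2)[OF N_nak]
lemmas iota = nak_coneD[OF nak_rep_cone[OF N_rep]]
lemmas iota_map = nak_functorD(3)[OF N_nak]

lemma iota_simps [simp]:
  assumes "M \<in> Obj C" "X \<in> Obj C" "\<xi> \<in> hom_dual K C M X"
  shows "\<iota> M X \<xi> \<in> Arr C" "Dom C (\<iota> M X \<xi>) = X" "Cod C (\<iota> M X \<xi>) = FO N M"
  using iota(2-4)[OF assms] by simp_all

lemma i_simps:
  assumes "M \<in> Obj C" "X \<in> Obj C"
  shows "i M X \<in> Arr C" "Dom C (i M X) = ten_hom M X" "Cod C (i M X) = FO N M"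
proof -
  have "dinat M (FO N M) (i M)" using nakayama assms by (simp add: nakayama_def is_coend_def)
  then show "i M X \<in> Arr C" "Dom C (i M X) = ten_hom M X" "Cod C (i M X) = FO N M"
    using assms(2) unfolding dinatural_cone[OF assms(1)] by auto
qed

lemma iota_i: "\<xi> \<in> hom_dual K C M X \<Longrightarrow> \<iota> M X \<xi> = i M X \<cdot> tj_hom M X \<xi>"
  unfolding \<iota>_def cone_of_def by simp

text \<open>As \<open>T\<close> is a left adjoint, arrows out of \<open>T(N(M))\<close> are determined by their composites with the
  \<open>T(\<iota> M X \<xi>)\<close>.\<close>

lemma TN_eqI:
  assumes M: "M \<in> Obj C" and f: "f \<in> Arr C" "g \<in> Arr C" "Dom C f = FO T (FO N M)" "Dom C g = FO T (FO N M)" "Cod C f = Cod C g"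
    and eq: "\<And>X \<xi>. X \<in> Obj C \<Longrightarrow> \<xi> \<in> hom_dual K C M X \<Longrightarrow> f \<cdot> FA T (\<iota> M X \<xi>) = g \<cdot> FA T (\<iota> M X \<xi>)"
  shows "f = g"
proof (rule jointly_epicD[OF R.jointly_epic_F[OF nak_rep_jointly_epic[OF M N_rep[OF M]]] f])
  fix s assume "s \<in> FA T ` nak_arrows M (\<iota> M)"
  then obtain X \<xi> where "s = FA T (\<iota> M X \<xi>)" "X \<in> Obj C" "\<xi> \<in> hom_dual K C M X"
    unfolding nak_arrows_def by blast
  then show "f \<cdot> s = g \<cdot> s" using eq by simp
qed

lemma TTN_eqI:
  assumes M: "M \<in> Obj C" and f: "f \<in> Arr C" "g \<in> Arr C" "Dom C f = FO T (FO T (FO N M))" "Dom C g = FO T (FO T (FO N M))" "Cod C f = Cod C g"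
    and eq: "\<And>X \<xi>. X \<in> Obj C \<Longrightarrow> \<xi> \<in> hom_dual K C M X \<Longrightarrow> f \<cdot> FA T (FA T (\<iota> M X \<xi>)) = g \<cdot> FA T (FA T (\<iota> M X \<xi>))"
  shows "f = g"
proof (rule jointly_epicD[OF R.jointly_epic_F[OF R.jointly_epic_F[OF nak_rep_jointly_epic[OF M N_rep[OF M]]]] f])
  fix s assume "s \<in> FA T ` FA T ` nak_arrows M (\<iota> M)"
  then obtain X \<xi> where "s = FA T (FA T (\<iota> M X \<xi>))" "X \<in> Obj C" "\<xi> \<in> hom_dual K C M X"
    unfolding nak_arrows_def by blast
  then show "f \<cdot> s = g \<cdot> s" using eq by simp
qed

subsection \<open>The canonical isomorphism\<close>

abbreviation tt where "tt \<equiv> can_t C L u' e"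

lemma tt_simps [simp]:
  assumes "M \<in> Obj C" "X \<in> Obj C" "f \<in> Arr C" "Dom C f = FO LL M" "Cod C f = FO T X"
  shows "tt M X f \<in> Arr C" "Dom C (tt M X f) = M" "Cod C (tt M X f) = X"
  using assms by (simp_all add: can_t_def)

lemma tt_add:
  assumes "M \<in> Obj C" "X \<in> Obj C" "f \<in> hom_set C (FO LL M) (FO T X)"
  shows "g \<in> hom_set C (FO LL M) (FO T X) \<Longrightarrow> tt M X (HAdd C f g) = HAdd C (tt M X f) (tt M X g)"
    and "c \<in> carrier K \<Longrightarrow> tt M X (HSmult C c f) = HSmult C c (tt M X f)"
  using assms
  by (auto simp: can_t_def linear_functorD(4,5)[OF L_linear] HAdd_comp comp_HAdd comp_HSmult)

lemma tt_dual:
  assumes "M \<in> Obj C" "X \<in> Obj C" "\<xi> \<in> hom_dual K C M X"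
  shows "dual_map (Hom C (FO LL M) (FO T X)) (tt M X) \<xi> \<in> hom_dual K C (FO LL M) (FO T X)"
  by (rule dual_map_dual[OF _ assms(3)]) (use assms(1,2) in \<open>auto simp: hom_module tt_add\<close>)

abbreviation tdual where "tdual M X \<equiv> dual_map (Hom C (FO LL M) (FO T X)) (tt M X)"

lemma tdual_post:
  assumes M: "M \<in> Obj C" and f: "f \<in> Arr C" and x: "\<xi> \<in> hom_dual K C M (Cod C f)"
  shows "tdual M (Dom C f) (dpost M f \<xi>) =
    dual_map (Hom C (FO LL M) (FO T (Dom C f))) (\<lambda>h. FA T f \<cdot> h) (tdual M (Cod C f) \<xi>)"
proof -
  have "f \<cdot> tt M (Dom C f) h = tt M (Cod C f) (FA T f \<cdot> h)" if "h \<in> hom_set C (FO LL M) (FO T (Dom C f))" for h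
  proof -
    have "f \<cdot> tt M (Dom C f) h = (f \<cdot> e (Dom C f)) \<cdot> (FA L h \<cdot> u' M)" using that f M by (auto simp: can_t_def)
    also have "f \<cdot> e (Dom C f) = e (Cod C f) \<cdot> FA L (FA T f)" using f by (simp add: A.counit_natural)
    finally show ?thesis using that f M by (auto simp: can_t_def)
  qed
  then have "dual_map (Hom C (FO LL M) (FO T (Dom C f))) (\<lambda>h. f \<cdot> tt M (Dom C f) h) \<xi> =
    dual_map (Hom C (FO LL M) (FO T (Dom C f))) (\<lambda>h. tt M (Cod C f) (FA T f \<cdot> h)) \<xi>"
    by (rule dual_map_cong)
  then show ?thesis using M f by (subst dual_map_comp, force, subst dual_map_comp, force)
qed

abbreviation \<phi> where "\<phi> \<equiv> can_phi K C ten tj N i LL L T u' e"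

text \<open>Transposed along \<open>T \<stileturn> R\<close>, the arrow sought is one out of \<open>N(M)\<close>, which is defined by a family.\<close>

lemma phi_ex:
  assumes M: "M \<in> Obj C"
  shows "\<exists>p. p \<in> hom_set C (FO T (FO N M)) (FO N (FO LL M)) \<and>
    (\<forall>X\<in>Obj C. \<forall>\<xi>\<in>hom_dual K C M X. p \<cdot> FA T (\<iota> M X \<xi>) = \<iota> (FO LL M) (FO T X) (tdual M X \<xi>))"
proof -
  let ?Z = "FO N (FO LL M)" and ?i = "\<lambda>X \<xi>. \<iota> (FO LL M) (FO T X) (tdual M X \<xi>)"
  let ?\<kappa> = "\<lambda>X \<xi>. FA R (?i X \<xi>) \<cdot> v X"
  note lR = R.linear_G[OF T_linear]
  have i: "?i X \<xi> \<in> Arr C" "Dom C (?i X \<xi>) = FO T X" "Cod C (?i X \<xi>) = ?Z"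
    if "X \<in> Obj C" "\<xi> \<in> hom_dual K C M X" for X \<xi>
    using tt_dual[OF M that] M that by simp_all
  have th: "\<And>X h. X \<in> Obj C \<Longrightarrow> h \<in> hom_set C (FO LL M) (FO T X) \<Longrightarrow> tt M X h \<in> hom_set C M X" using M by simp
  have cone: "nak_cone K C M (FO R ?Z) (\<lambda>X. restrict (?\<kappa> X) (hom_dual K C M X))"
  proof (rule nak_coneI[OF lcat_axioms M])
    show "FO R ?Z \<in> Obj C" using M by simp
    fix X \<xi> assume X: "X \<in> Obj C" and x: "\<xi> \<in> hom_dual K C M X"
    show "?\<kappa> X \<xi> \<in> hom_set C X (FO R ?Z)" using i[OF X x] X by simp
    show "?\<kappa> X (\<xi> \<oplus>\<^bsub>dual_hom M X\<^esub> \<zeta>) = HAdd C (?\<kappa> X \<xi>) (?\<kappa> X \<zeta>)" if z: "\<zeta> \<in> hom_dual K C M X" for \<zeta>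
    proof -
      have "?i X (\<xi> \<oplus>\<^bsub>dual_hom M X\<^esub> \<zeta>) = HAdd C (?i X \<xi>) (?i X \<zeta>)"
        using dual_map_add(1)[where V = "Hom C (FO LL M) (FO T X)" and h = "tt M X", OF th[OF X], where K = K and \<xi> = \<xi> and \<zeta> = \<zeta>]
          iota(5)[OF B.F.FO_Obj[OF M] T.FO_Obj[OF X] tt_dual[OF M X x] tt_dual[OF M X z]] by simp
      then show ?thesis using i[OF X x] i[OF X z] X by (simp add: linear_functorD(4)[OF lR] HAdd_comp)
    qed
    show "?\<kappa> X (c \<odot>\<^bsub>dual_hom M X\<^esub> \<xi>) = HSmult C c (?\<kappa> X \<xi>)" if c: "c \<in> carrier K" for c
    proof -
      have "?i X (c \<odot>\<^bsub>dual_hom M X\<^esub> \<xi>) = HSmult C c (?i X \<xi>)"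
        using dual_map_add(2)[where V = "Hom C (FO LL M) (FO T X)" and h = "tt M X", OF th[OF X], where K = K and \<xi> = \<xi> and c = c]
          iota(6)[OF B.F.FO_Obj[OF M] T.FO_Obj[OF X] tt_dual[OF M X x] c] by simp
      then show ?thesis using i[OF X x] X c by (simp add: linear_functorD(5)[OF lR] comp_HSmult)
    qed
  next
    fix f \<xi> assume f: "f \<in> Arr C" and x: "\<xi> \<in> hom_dual K C M (Cod C f)"
    have t: "tdual M (Cod C f) \<xi> \<in> hom_dual K C (FO LL M) (Cod C (FA T f))" using tt_dual[OF M _ x] f by simp
    have "?i (Dom C f) (dpost M f \<xi>) = ?i (Cod C f) \<xi> \<cdot> FA T f"
      unfolding tdual_post[OF M f x] using iota(7)[OF B.F.FO_Obj[OF M] T.FA_Arr[OF f] t] f by simp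
    then show "?\<kappa> (Dom C f) (dpost M f \<xi>) = ?\<kappa> (Cod C f) \<xi> \<cdot> f"
      using i[OF Cod_Obj[OF f] x] f by (simp add: R.unit_natural)
  qed
  obtain k where k: "k \<in> Arr C" "Dom C k = FO N M" "Cod C k = FO R ?Z"
    "\<And>X \<xi>. X \<in> Obj C \<Longrightarrow> \<xi> \<in> hom_dual K C M X \<Longrightarrow> k \<cdot> \<iota> M X \<xi> = restrict (?\<kappa> X) (hom_dual K C M X) \<xi>"
    by (rule nak_repE[OF N_rep[OF M] cone]) blast
  have "(w ?Z \<cdot> FA T k) \<cdot> FA T (\<iota> M X \<xi>) = ?i X \<xi>" if X: "X \<in> Obj C" and x: "\<xi> \<in> hom_dual K C M X" for X \<xi>
  proof -
    have "(w ?Z \<cdot> FA T k) \<cdot> FA T (\<iota> M X \<xi>) = w ?Z \<cdot> FA T (k \<cdot> \<iota> M X \<xi>)" using k(1-3) M X x by simp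
    also have "k \<cdot> \<iota> M X \<xi> = FA R (?i X \<xi>) \<cdot> v X" using k(4)[OF X x] unfolding restrict_apply'[OF x] .
    also have "w ?Z \<cdot> FA T (FA R (?i X \<xi>) \<cdot> v X) = ?i X \<xi>"
      using R.transpose_inverse[of "?i X \<xi>" X] i[OF X x] X by simp
    finally show ?thesis .
  qed
  moreover have "w ?Z \<cdot> FA T k \<in> hom_set C (FO T (FO N M)) ?Z" using k(1-3) M by simp
  ultimately show ?thesis by blast
qed

text \<open>The condition that defines \<open>\<phi> M\<close>, composed with the universal maps of the copowers.\<close>

lemma phi_condition_iff:
  assumes M: "M \<in> Obj C" and p: "p \<in> hom_set C (FO T (FO N M)) (FO N (FO LL M))" and X: "X \<in> Obj C"
  shows "p \<cdot> (FA T (i M X) \<cdot> ten_comparison C ten tj T (dual_hom M X) X) =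
      i (FO LL M) (FO T X) \<cdot> ten_map C ten tj (dual_hom M X) (dual_hom (FO LL M) (FO T X)) (tdual M X) (Id C (FO T X)) \<longleftrightarrow>
    (\<forall>\<xi>\<in>hom_dual K C M X. p \<cdot> FA T (\<iota> M X \<xi>) = \<iota> (FO LL M) (FO T X) (tdual M X \<xi>))" (is "?l = ?r \<longleftrightarrow> _")
proof -
  let ?V = "dual_hom M X" and ?W = "dual_hom (FO LL M) (FO T X)"
  have V: "fd_space K ?V" by (rule fd_dual[OF M X])
  have W: "fd_space K ?W" using M X by (simp add: fd_dual)
  have TX: "FO T X \<in> Obj C" and LM: "FO LL M \<in> Obj C" using M X by simp_all
  have th: "\<And>h. h \<in> hom_set C (FO LL M) (FO T X) \<Longrightarrow> tt M X h \<in> hom_set C M X" using M X by simp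
  let ?m = "ten_map C ten tj ?V ?W (tdual M X) (Id C (FO T X))"
  have m: "?m \<in> Arr C" "Dom C ?m = ten ?V (FO T X)" "Cod C ?m = ten ?W (FO T X)"
    "\<And>\<xi>. \<xi> \<in> carrier ?V \<Longrightarrow> ?m \<cdot> tj ?V (FO T X) \<xi> = tj ?W (FO T X) (tdual M X \<xi>)"
  proof -
    note d = ten_map[OF V W Id_Arr[OF TX], of "tdual M X", OF tt_dual[OF M X] dual_map_add(1)[OF th] dual_map_add(2)[OF th]]
    show "?m \<in> Arr C" "Dom C ?m = ten ?V (FO T X)" "Cod C ?m = ten ?W (FO T X)" using d(1-3) TX by simp_all
    fix \<xi> assume x: "\<xi> \<in> carrier ?V"
    have "?m \<cdot> tj ?V (FO T X) \<xi> = tj ?W (FO T X) (tdual M X \<xi>) \<cdot> Id C (FO T X)" using d(4)[of \<xi>] x TX by simp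
    then show "?m \<cdot> tj ?V (FO T X) \<xi> = tj ?W (FO T X) (tdual M X \<xi>)"
      using tj_simps[OF W TX tt_dual[OF M X x]] by simp
  qed
  let ?c = "ten_comparison C ten tj T ?V X"
  have c: "?c \<in> Arr C" "Dom C ?c = ten ?V (FO T X)" "Cod C ?c = FO T (ten ?V X)"
    "\<And>\<xi>. \<xi> \<in> carrier ?V \<Longrightarrow> ?c \<cdot> tj ?V (FO T X) \<xi> = FA T (tj ?V X \<xi>)"
  proof -
    note l = tj_linear[OF V X]
    have h1: "\<And>\<xi>. \<xi> \<in> carrier ?V \<Longrightarrow> FA T (tj ?V X \<xi>) \<in> hom_set C (FO T X) (FO T (ten ?V X))"
      using tj_simps[OF V X] by simp
    have h2: "FA T (tj ?V X (\<xi> \<oplus>\<^bsub>?V\<^esub> \<zeta>)) = HAdd C (FA T (tj ?V X \<xi>)) (FA T (tj ?V X \<zeta>))"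
      if "\<xi> \<in> carrier ?V" "\<zeta> \<in> carrier ?V" for \<xi> \<zeta>
      using linear_maps_add[OF l that] tj_simps[OF V X that(1)] tj_simps[OF V X that(2)]
      by (simp add: linear_functorD(4)[OF T_linear])
    have h3: "FA T (tj ?V X (c \<odot>\<^bsub>?V\<^esub> \<xi>)) = HSmult C c (FA T (tj ?V X \<xi>))"
      if "c \<in> carrier K" "\<xi> \<in> carrier ?V" for \<xi> c
      using linear_maps_smult[OF l that] tj_simps[OF V X that(2)] that(1)
      by (simp add: linear_functorD(5)[OF T_linear])
    show "?c \<in> Arr C" "Dom C ?c = ten ?V (FO T X)" "Cod C ?c = FO T (ten ?V X)"
      "\<And>\<xi>. \<xi> \<in> carrier ?V \<Longrightarrow> ?c \<cdot> tj ?V (FO T X) \<xi> = FA T (tj ?V X \<xi>)"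
      using the_copower_map[OF V TX T.FO_Obj[OF ten_Obj[OF V X]] h1 h2 h3] unfolding ten_comparison_def by auto
  qed
  note iM = i_simps[OF M X] and iL = i_simps[OF LM TX]
  have p': "p \<in> Arr C" "Dom C p = FO T (FO N M)" "Cod C p = FO N (FO LL M)" using p by auto
  have l: "?l \<cdot> tj ?V (FO T X) \<xi> = p \<cdot> FA T (\<iota> M X \<xi>)"
    and r: "?r \<cdot> tj ?V (FO T X) \<xi> = \<iota> (FO LL M) (FO T X) (tdual M X \<xi>)" if x: "\<xi> \<in> carrier ?V" for \<xi>
  proof -
    have "?l \<cdot> tj ?V (FO T X) \<xi> = p \<cdot> (FA T (i M X) \<cdot> (?c \<cdot> tj ?V (FO T X) \<xi>))"
      using p' iM c(1-3) tj_simps[OF V TX x] by simp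
    also have "\<dots> = p \<cdot> FA T (i M X \<cdot> tj ?V X \<xi>)"
      unfolding c(4)[OF x] using p' iM tj_simps[OF V X x] by simp
    finally show "?l \<cdot> tj ?V (FO T X) \<xi> = p \<cdot> FA T (\<iota> M X \<xi>)" unfolding iota_i[OF x] .
    have "?r \<cdot> tj ?V (FO T X) \<xi> = i (FO LL M) (FO T X) \<cdot> (?m \<cdot> tj ?V (FO T X) \<xi>)"
      using iL m(1-3) tj_simps[OF V TX x] by simp
    then show "?r \<cdot> tj ?V (FO T X) \<xi> = \<iota> (FO LL M) (FO T X) (tdual M X \<xi>)"
      unfolding m(4)[OF x] iota_i[OF tt_dual[OF M X x]] .
  qed
  show ?thesis
  proof
    assume "?l = ?r"
    then show "\<forall>\<xi>\<in>hom_dual K C M X. p \<cdot> FA T (\<iota> M X \<xi>) = \<iota> (FO LL M) (FO T X) (tdual M X \<xi>)"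
      using l r by metis
  next
    assume *: "\<forall>\<xi>\<in>hom_dual K C M X. p \<cdot> FA T (\<iota> M X \<xi>) = \<iota> (FO LL M) (FO T X) (tdual M X \<xi>)"
    show "?l = ?r"
    proof (rule tj_eqI[OF V TX])
      fix \<xi> assume x: "\<xi> \<in> carrier ?V"
      then show "?l \<cdot> tj ?V (FO T X) \<xi> = ?r \<cdot> tj ?V (FO T X) \<xi>" unfolding l[OF x] r[OF x] using * by blast
    qed (use p' iM iL c(1-3) m(1-3) in simp_all)
  qed
qed

lemma phi:
  assumes M: "M \<in> Obj C"
  shows "\<phi> M \<in> Arr C" "Dom C (\<phi> M) = FO T (FO N M)" "Cod C (\<phi> M) = FO N (FO LL M)"
    "\<And>X \<xi>. X \<in> Obj C \<Longrightarrow> \<xi> \<in> hom_dual K C M X \<Longrightarrow>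
      \<phi> M \<cdot> FA T (\<iota> M X \<xi>) = \<iota> (FO LL M) (FO T X) (tdual M X \<xi>)"
proof -
  let ?A = "\<lambda>p. p \<in> hom_set C (FO T (FO N M)) (FO N (FO LL M)) \<and>
        (\<forall>X\<in>Obj C. p \<cdot> (FA T (i M X) \<cdot> ten_comparison C ten tj T (dual_hom M X) X) =
           i (FO LL M) (FO T X) \<cdot> ten_map C ten tj (dual_hom M X) (dual_hom (FO LL M) (FO T X)) (tdual M X) (Id C (FO T X)))"
  let ?B = "\<lambda>p. p \<in> hom_set C (FO T (FO N M)) (FO N (FO LL M)) \<and>
    (\<forall>X\<in>Obj C. \<forall>\<xi>\<in>hom_dual K C M X. p \<cdot> FA T (\<iota> M X \<xi>) = \<iota> (FO LL M) (FO T X) (tdual M X \<xi>))"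
  have iff: "?A p \<longleftrightarrow> ?B p" for p using phi_condition_iff[OF M] by blast
  obtain p where p: "?B p" using phi_ex[OF M] by blast
  have uniq: "p' = p" if p': "?B p'" for p'
  proof (rule TN_eqI[OF M])
    fix X \<xi> assume "X \<in> Obj C" "\<xi> \<in> hom_dual K C M X"
    then show "p' \<cdot> FA T (\<iota> M X \<xi>) = p \<cdot> FA T (\<iota> M X \<xi>)" using p p' by metis
  qed (use p p' in auto)
  have "\<phi> M = p" unfolding can_phi_def
  proof (rule the_equality)
    show "?A p" unfolding iff by (rule p)
    show "p' = p" if "?A p'" for p' using uniq that unfolding iff .
  qed
  then show "\<phi> M \<in> Arr C" "Dom C (\<phi> M) = FO T (FO N M)" "Cod C (\<phi> M) = FO N (FO LL M)"
    "\<And>X \<xi>. X \<in> Obj C \<Longrightarrow> \<xi> \<in> hom_dual K C M X \<Longrightarrow>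
      \<phi> M \<cdot> FA T (\<iota> M X \<xi>) = \<iota> (FO LL M) (FO T X) (tdual M X \<xi>)" using p by auto
qed

subsection \<open>The lifted functor\<close>

abbreviation Ntilde where "Ntilde \<equiv> nak_lift K C ten tj N i LL L T u' e"

definition nact :: "'o \<times> 'm \<Rightarrow> 'm" where
  "nact y = FA N (snd y) \<cdot> \<phi> (fst y)"

definition nakm :: "'o \<times> 'm \<Rightarrow> 'o \<times> 'm" where
  "nakm y = (FO N (fst y), nact y)"

lemma nakm_simps [simp]: "fst (nakm y) = FO N (fst y)" "snd (nakm y) = nact y"
  by (simp_all add: nakm_def)

lemma FO_Ntilde: "FO Ntilde y = nakm y"
  by (cases y) (simp add: nak_lift_def Let_def nakm_def nact_def)

lemma FA_Ntilde: "FA Ntilde (y, f, z) = (nakm y, FA N f, nakm z)"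
  by (cases y, cases z) (simp add: nak_lift_def Let_def nakm_def nact_def)

text \<open>The comodule \<open>y\<close> turns arrows into \<open>T(X)\<close> into arrows into \<open>X\<close>; the dual of this map describes
  the action of \<open>T\<close> on the Nakayama functor.\<close>

definition st :: "'o \<times> 'm \<Rightarrow> 'o \<Rightarrow> 'm \<Rightarrow> 'm" where
  "st y X f = e X \<cdot> (FA L f \<cdot> coact y)"

lemma LLmod_simps [simp]:
  assumes "y \<in> LLMods"
  shows "fst y \<in> Obj C" "snd y \<in> Arr C" "Dom C (snd y) = FO LL (fst y)" "Cod C (snd y) = fst y"
  using assms unfolding monad_modules_iff by blast+

lemma coact_simps [simp]:
  assumes "y \<in> LLMods"
  shows "coact y \<in> Arr C" "Dom C (coact y) = fst y" "Cod C (coact y) = FO L (fst y)"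
  using assms by (simp_all add: coact_def)

lemma coact_laws:
  assumes "y \<in> LLMods"
  shows "\<delta> (fst y) \<cdot> coact y = FA L (coact y) \<cdot> coact y" "\<epsilon> (fst y) \<cdot> coact y = Id C (fst y)"
  using assms LLmod_iff[of y] by simp_all

lemma st_simps [simp]:
  assumes "y \<in> LLMods" "X \<in> Obj C" "f \<in> Arr C" "Dom C f = fst y" "Cod C f = FO T X"
  shows "st y X f \<in> Arr C" "Dom C (st y X f) = fst y" "Cod C (st y X f) = X"
  using assms by (simp_all add: st_def)

lemma st_linear:
  assumes "y \<in> LLMods" "X \<in> Obj C" "f \<in> hom_set C (fst y) (FO T X)"
  shows "g \<in> hom_set C (fst y) (FO T X) \<Longrightarrow> st y X (HAdd C f g) = HAdd C (st y X f) (st y X g)"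
    and "c \<in> carrier K \<Longrightarrow> st y X (HSmult C c f) = HSmult C c (st y X f)"
  using assms
  by (auto simp: st_def linear_functorD(4,5)[OF L_linear] HAdd_comp comp_HAdd comp_HSmult)

abbreviation sdual where "sdual y X \<equiv> dual_map (Hom C (fst y) (FO T X)) (st y X)"

lemma sdual:
  assumes "y \<in> LLMods" "X \<in> Obj C" "\<xi> \<in> hom_dual K C (fst y) X"
  shows "sdual y X \<xi> \<in> hom_dual K C (fst y) (FO T X)"
  by (rule dual_map_dual[OF _ assms(3)]) (use assms(1,2) in \<open>auto simp: hom_module st_linear\<close>)

lemma st_eta:
  assumes y: "y \<in> LLMods" and X: "X \<in> Obj C" and f: "f \<in> Arr C" "Dom C f = fst y" "Cod C f = X"
  shows "st y X (\<eta> X \<cdot> f) = f"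
proof -
  have "st y X (\<eta> X \<cdot> f) = (\<epsilon> X \<cdot> FA L f) \<cdot> coact y" using y X f by (simp add: st_def eps_eq)
  also have "\<epsilon> X \<cdot> FA L f = f \<cdot> \<epsilon> (fst y)" using eps_natural[of f] f by simp
  also have "(f \<cdot> \<epsilon> (fst y)) \<cdot> coact y = f" using y f coact_laws(2)[OF y] by simp
  finally show ?thesis .
qed

text \<open>The comultiplication \<open>\<delta>\<close> enters through the coassociativity of the coaction, and it becomes \<open>\<mu>\<close> by
  conjugation.\<close>

lemma st_mu:
  assumes y: "y \<in> LLMods" and X: "X \<in> Obj C" and f: "f \<in> Arr C" "Dom C f = fst y" "Cod C f = FO T (FO T X)"
  shows "st y X (\<mu> X \<cdot> f) = st y X (st y (FO T X) f)"
proof -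
  let ?r = "coact y" and ?Y = "FO T (FO T X)"
  have "st y X (\<mu> X \<cdot> f) = (e X \<cdot> FA L (\<mu> X)) \<cdot> (FA L f \<cdot> ?r)" using y X f by (simp add: st_def)
  also have "\<dots> = e X \<cdot> (FA L (e (FO T X)) \<cdot> ((\<delta> ?Y \<cdot> FA L f) \<cdot> ?r))"
    unfolding delta_counit[OF X, symmetric] using y X f by simp
  also have "\<delta> ?Y \<cdot> FA L f = FA L (FA L f) \<cdot> \<delta> (fst y)" using delta_natural[of f] f by simp
  also have "(FA L (FA L f) \<cdot> \<delta> (fst y)) \<cdot> ?r = FA L (FA L f) \<cdot> (FA L ?r \<cdot> ?r)"
    using y f coact_laws(1)[OF y] by simp
  finally show ?thesis using y X f by (simp add: st_def)
qed

lemma nact_simps [simp]: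
  assumes "y \<in> LLMods"
  shows "nact y \<in> Arr C" "Dom C (nact y) = FO T (FO N (fst y))" "Cod C (nact y) = FO N (fst y)"
  using assms phi[of "fst y"] by (simp_all add: nact_def)

text \<open>The functional \<open>\<xi>\<close> is pulled back along \<open>t\<close> by \<open>\<phi>\<close>, and along the composition with the action by \<open>N\<close>;
  together these two maps are \<open>st\<close>.\<close>

lemma nact_iota:
  assumes y: "y \<in> LLMods" and X: "X \<in> Obj C" and x: "\<xi> \<in> hom_dual K C (fst y) X"
  shows "nact y \<cdot> FA T (\<iota> (fst y) X \<xi>) = \<iota> (fst y) (FO T X) (sdual y X \<xi>)"
proof -
  let ?M = "fst y"
  have M: "?M \<in> Obj C" using y by simp
  have t: "tdual ?M X \<xi> \<in> hom_dual K C (Dom C (snd y)) (FO T X)" using tt_dual[OF M X x] y by simp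
  have "nact y \<cdot> FA T (\<iota> ?M X \<xi>) = FA N (snd y) \<cdot> (\<phi> ?M \<cdot> FA T (\<iota> ?M X \<xi>))"
    using y X x phi(1-3)[OF M] by (simp add: nact_def)
  also have "\<dots> = FA N (snd y) \<cdot> \<iota> (Dom C (snd y)) (FO T X) (tdual ?M X \<xi>)" using phi(4)[OF M X x] y by simp
  also have "\<dots> = \<iota> ?M (FO T X) (dual_map (Hom C ?M (FO T X)) (\<lambda>h. h \<cdot> snd y) (tdual ?M X \<xi>))"
    using iota_map[OF _ T.FO_Obj[OF X] t] y by simp
  also have "dual_map (Hom C ?M (FO T X)) (\<lambda>h. h \<cdot> snd y) (tdual ?M X \<xi>) =
    dual_map (Hom C ?M (FO T X)) (\<lambda>h. tt ?M X (h \<cdot> snd y)) \<xi>"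
    by (rule dual_map_comp) (use y in auto)
  also have "\<dots> = sdual y X \<xi>"
    by (rule dual_map_cong) (use y X in \<open>auto simp: can_t_def st_def coact_def\<close>)
  finally show ?thesis .
qed

lemma nakm_module:
  assumes y: "y \<in> LLMods"
  shows "nakm y \<in> Mods"
proof -
  let ?M = "fst y"
  have M: "?M \<in> Obj C" using y by simp
  have "nact y \<cdot> \<mu> (FO N ?M) = nact y \<cdot> FA T (nact y)"
  proof (rule TTN_eqI[OF M])
    fix X \<xi> assume X: "X \<in> Obj C" and x: "\<xi> \<in> hom_dual K C ?M X"
    have TX: "FO T X \<in> Obj C" using X by simp
    note s1 = sdual[OF y X x] and s2 = sdual[OF y TX sdual[OF y X x]]
    have "(nact y \<cdot> \<mu> (FO N ?M)) \<cdot> FA T (FA T (\<iota> ?M X \<xi>)) = (nact y \<cdot> FA T (\<iota> ?M X \<xi>)) \<cdot> \<mu> X"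
      using y X x by (simp add: mu_natural)
    also have "\<dots> = \<iota> ?M (FO T (FO T X)) (dual_map (Hom C ?M (FO T (FO T X))) (\<lambda>h. \<mu> X \<cdot> h) (sdual y X \<xi>))"
      unfolding nact_iota[OF y X x] using iota(7)[OF M mu_simps(1)[OF X], of "sdual y X \<xi>"] s1 X by simp
    also have "dual_map (Hom C ?M (FO T (FO T X))) (\<lambda>h. \<mu> X \<cdot> h) (sdual y X \<xi>) =
      dual_map (Hom C ?M (FO T (FO T X))) (\<lambda>h. st y X (\<mu> X \<cdot> h)) \<xi>"
      by (rule dual_map_comp) (use X in auto)
    also have "\<dots> = dual_map (Hom C ?M (FO T (FO T X))) (\<lambda>h. st y X (st y (FO T X) h)) \<xi>"
      by (rule dual_map_cong) (use y X st_mu in simp)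
    also have "\<dots> = sdual y (FO T X) (sdual y X \<xi>)"
      by (rule dual_map_comp[symmetric]) (use y X in auto)
    also have "\<iota> ?M (FO T (FO T X)) \<dots> = nact y \<cdot> FA T (nact y \<cdot> FA T (\<iota> ?M X \<xi>))"
      unfolding nact_iota[OF y TX s1, symmetric] nact_iota[OF y X x] ..
    also have "\<dots> = (nact y \<cdot> FA T (nact y)) \<cdot> FA T (FA T (\<iota> ?M X \<xi>))" using y X x by simp
    finally show "(nact y \<cdot> \<mu> (FO N ?M)) \<cdot> FA T (FA T (\<iota> ?M X \<xi>)) = (nact y \<cdot> FA T (nact y)) \<cdot> FA T (FA T (\<iota> ?M X \<xi>))" .
  qed (use y in simp_all)
  moreover have "nact y \<cdot> \<eta> (FO N ?M) = Id C (FO N ?M)"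
  proof (rule nak_rep_eqI[OF M N_rep[OF M]])
    fix X \<xi> assume X: "X \<in> Obj C" and x: "\<xi> \<in> hom_dual K C ?M X"
    have "(nact y \<cdot> \<eta> (FO N ?M)) \<cdot> \<iota> ?M X \<xi> = (nact y \<cdot> FA T (\<iota> ?M X \<xi>)) \<cdot> \<eta> X"
      using y X x by (simp add: eta_natural)
    also have "\<dots> = \<iota> ?M X (dual_map (Hom C ?M X) (\<lambda>h. \<eta> X \<cdot> h) (sdual y X \<xi>))"
      unfolding nact_iota[OF y X x] using iota(7)[OF M eta_simps(1)[OF X], of "sdual y X \<xi>"] sdual[OF y X x] X by simp
    also have "dual_map (Hom C ?M X) (\<lambda>h. \<eta> X \<cdot> h) (sdual y X \<xi>) = dual_map (Hom C ?M X) (\<lambda>h. st y X (\<eta> X \<cdot> h)) \<xi>"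
      by (rule dual_map_comp) (use X in auto)
    also have "\<dots> = \<xi>" by (rule dual_map_id[OF x]) (use y X st_eta in simp)
    finally show "(nact y \<cdot> \<eta> (FO N ?M)) \<cdot> \<iota> ?M X \<xi> = Id C (FO N ?M) \<cdot> \<iota> ?M X \<xi>" using M X x by simp
  qed (use y in simp_all)
  ultimately show ?thesis
    unfolding monad_modules_iff[of "nakm y"] nakm_simps using nact_simps[OF y] N.FO_Obj[OF M] by blast
qed

lemma nakm_map:
  assumes f: "(y, f, z) \<in> Arr LLMod"
  shows "FA N f \<cdot> nact y = nact z \<cdot> FA T (FA N f)"
proof -
  have y: "y \<in> LLMods" and z: "z \<in> LLMods" and f': "f \<in> Arr C" "Dom C f = fst y" "Cod C f = fst z"
    "f \<cdot> snd y = snd z \<cdot> FA LL f" using f by (simp_all add: tmod_Arr)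
  have co: "FA L f \<cdot> coact y = coact z \<cdot> f" using LLMod_map_iff[OF y z f'(1-3)] f'(4) by blast
  have My: "fst y \<in> Obj C" and Mz: "fst z \<in> Obj C" using y z by simp_all
  show ?thesis
  proof (rule TN_eqI[OF My])
    fix X \<xi> assume X: "X \<in> Obj C" and x: "\<xi> \<in> hom_dual K C (fst y) X"
    have TX: "FO T X \<in> Obj C" using X by simp
    have s: "sdual y X \<xi> \<in> hom_dual K C (Dom C f) (FO T X)" using sdual[OF y X x] f' by simp
    have x': "\<xi> \<in> hom_dual K C (Dom C f) X" using x f' by simp
    have d: "dual_map (Hom C (fst z) X) (\<lambda>h. h \<cdot> f) \<xi> \<in> hom_dual K C (fst z) X"
      using dual_pre[OF X f'(1) x'] f' by simp
    have Nf: "FA N f \<cdot> \<iota> (fst y) X \<xi> = \<iota> (fst z) X (dual_map (Hom C (fst z) X) (\<lambda>h. h \<cdot> f) \<xi>)"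
      using iota_map[OF f'(1) X x'] f' by simp
    have "(FA N f \<cdot> nact y) \<cdot> FA T (\<iota> (fst y) X \<xi>) = FA N f \<cdot> \<iota> (fst y) (FO T X) (sdual y X \<xi>)"
      unfolding nact_iota[OF y X x, symmetric] using y X x f' by simp
    also have "\<dots> = \<iota> (fst z) (FO T X) (dual_map (Hom C (fst z) (FO T X)) (\<lambda>h. h \<cdot> f) (sdual y X \<xi>))"
      using iota_map[OF f'(1) TX s] f' by simp
    also have "dual_map (Hom C (fst z) (FO T X)) (\<lambda>h. h \<cdot> f) (sdual y X \<xi>) =
      dual_map (Hom C (fst z) (FO T X)) (\<lambda>h. st y X (h \<cdot> f)) \<xi>"
      by (rule dual_map_comp) (use f' in auto)
    also have "\<dots> = dual_map (Hom C (fst z) (FO T X)) (\<lambda>h. st z X h \<cdot> f) \<xi>"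
      by (rule dual_map_cong) (use y z X f' co in \<open>auto simp: st_def\<close>)
    also have "\<dots> = sdual z X (dual_map (Hom C (fst z) X) (\<lambda>h. h \<cdot> f) \<xi>)"
      by (rule dual_map_comp[symmetric]) (use z X in auto)
    also have "\<iota> (fst z) (FO T X) \<dots> = nact z \<cdot> FA T (FA N f \<cdot> \<iota> (fst y) X \<xi>)"
      unfolding Nf by (rule nact_iota[OF z X d, symmetric])
    also have "\<dots> = (nact z \<cdot> FA T (FA N f)) \<cdot> FA T (\<iota> (fst y) X \<xi>)" using y z X x f' by simp
    finally show "(FA N f \<cdot> nact y) \<cdot> FA T (\<iota> (fst y) X \<xi>) = (nact z \<cdot> FA T (FA N f)) \<cdot> FA T (\<iota> (fst y) X \<xi>)" .
  qed (use y z f' in simp_all)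
qed

lemma Ntilde_functor: "is_functor LLMod TMod Ntilde"
proof (rule is_functorI)
  show "category TMod" by (rule TMod.category)
  show "category LLMod" by (rule tmod_category[OF B.F.is_functor])
  show "FO Ntilde y \<in> Obj TMod" "FA Ntilde (Id LLMod y) = Id TMod (FO Ntilde y)" if "y \<in> Obj LLMod" for y
    using that by (simp_all add: FO_Ntilde FA_Ntilde nakm_module)
  show "FA Ntilde \<phi> \<in> Arr TMod \<and> Dom TMod (FA Ntilde \<phi>) = FO Ntilde (Dom LLMod \<phi>) \<and>
    Cod TMod (FA Ntilde \<phi>) = FO Ntilde (Cod LLMod \<phi>)" if h: "\<phi> \<in> Arr LLMod" for \<phi>
  proof -
    obtain y f z where f: "\<phi> = (y, f, z)" "f \<in> Arr C" "Dom C f = fst y" "Cod C f = fst z" "y \<in> LLMods" "z \<in> LLMods"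
      using h by (rule tmod_ArrE)
    then show ?thesis using h nakm_map[of y f z] nakm_module by (simp add: FO_Ntilde FA_Ntilde tmod_Arr)
  qed
  show "FA Ntilde (\<psi> \<cdot>\<^bsub>LLMod\<^esub> \<phi>) = FA Ntilde \<psi> \<cdot>\<^bsub>TMod\<^esub> FA Ntilde \<phi>"
    if "\<phi> \<in> Arr LLMod" "\<psi> \<in> Arr LLMod" "Cod LLMod \<phi> = Dom LLMod \<psi>" for \<phi> \<psi>
    using that by (auto elim!: tmod_ArrE simp: FA_Ntilde)
qed

end

section \<open>The Nakayama functor of the category of modules\<close>

context nak_setting
begin

text \<open>Under the bijection \<open>k \<mapsto> T(k) \<sigma>\<close> with module maps into free modules, \<open>st\<close> is the composition with
  \<open>\<mu>\<close>, because the coaction corresponds to the unit of \<open>T\<^sup>l\<^sup>a \<stileturn> T\<close>.\<close>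

lemma st_sigma:
  assumes x: "x \<in> Mods" and X: "X \<in> Obj C" and f: "f \<in> Arr C" "Dom C f = Q x" "Cod C f = FO T X"
  shows "FA T (st (tens x) X f) \<cdot> \<sigma> x = \<mu> X \<cdot> (FA T f \<cdot> \<sigma> x)"
proof -
  let ?g = "e X \<cdot> FA L f"
  have g: "?g \<in> Arr C" "Dom C ?g = FO L (Q x)" "Cod C ?g = X" using x X f by simp_all
  have "FA T (st (tens x) X f) \<cdot> \<sigma> x = FA T ?g \<cdot> (FA T (\<rho> x) \<cdot> \<sigma> x)"
    using x X f by (simp add: st_def coact_tens)
  also have "\<dots> = (FA T ?g \<cdot> \<mu> (FO L (Q x))) \<cdot> (FA T (u (Q x)) \<cdot> \<sigma> x)"
    unfolding rho_sigma[OF x] using x g by simp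
  also have "FA T ?g \<cdot> \<mu> (FO L (Q x)) = \<mu> X \<cdot> FA T (FA T ?g)" using mu_natural[of ?g X] g by simp
  also have "(\<mu> X \<cdot> FA T (FA T ?g)) \<cdot> (FA T (u (Q x)) \<cdot> \<sigma> x) = \<mu> X \<cdot> (FA T (FA T ?g \<cdot> u (Q x)) \<cdot> \<sigma> x)"
    using x X g by simp
  also have "FA T ?g \<cdot> u (Q x) = f" using A.inverse_transpose[of f X] X f by simp
  finally show ?thesis .
qed

text \<open>A module structure on \<open>fst z\<close> turns arrows \<open>T\<^sup>l\<^sup>a \<otimes>\<^sub>T x \<rightarrow> fst z\<close> into module maps \<open>x \<rightarrow> z\<close>.\<close>

definition \<theta> :: "'o \<times> 'm \<Rightarrow> 'o \<times> 'm \<Rightarrow> 'm \<Rightarrow> ('o \<times> 'm) \<times> 'm \<times> ('o \<times> 'm)" where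
  "\<theta> x z k = (x, lift z k \<cdot> \<sigma> x, z)"

lemma theta_Arr [simp]:
  assumes x: "x \<in> Mods" and z: "z \<in> Mods" and k: "k \<in> Arr C" "Dom C k = Q x" "Cod C k = fst z"
  shows "\<theta> x z k \<in> Arr TMod" "Dom TMod (\<theta> x z k) = x" "Cod TMod (\<theta> x z k) = z"
proof -
  have "(lift z k \<cdot> \<sigma> x) \<cdot> snd x = (lift z k \<cdot> \<mu> (Q x)) \<cdot> FA T (\<sigma> x)"
    using x z k by (simp add: sigma_linear)
  also have "lift z k \<cdot> \<mu> (Q x) = snd z \<cdot> FA T (lift z k)" using lift_linear[OF z k(1,3)] k by simp
  finally have "(lift z k \<cdot> \<sigma> x) \<cdot> snd x = snd z \<cdot> FA T (lift z k \<cdot> \<sigma> x)" using x z k by simp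
  then show "\<theta> x z k \<in> Arr TMod" using x z k by (simp add: \<theta>_def tmod_Arr)
qed (simp_all add: \<theta>_def)

lemma theta_linear:
  assumes x: "x \<in> Mods" and z: "z \<in> Mods" and k: "k \<in> Arr C" "Dom C k = Q x" "Cod C k = fst z"
  shows "k' \<in> Arr C \<Longrightarrow> Dom C k' = Q x \<Longrightarrow> Cod C k' = fst z \<Longrightarrow>
      \<theta> x z (HAdd C k k') = HAdd TMod (\<theta> x z k) (\<theta> x z k')"
    and "c \<in> carrier K \<Longrightarrow> \<theta> x z (HSmult C c k) = HSmult TMod c (\<theta> x z k)"
  using assms
  by (auto simp: \<theta>_def lift_def linear_functorD(4,5)[OF T_linear] HAdd_comp comp_HAdd comp_HSmult)

text \<open>This equation makes the universal arrows \<open>iotaT\<close> linear.\<close>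

lemma theta_st:
  assumes x: "x \<in> Mods" and z: "z \<in> Mods" and k: "k \<in> Arr C" "Dom C k = Q x" "Cod C k = FO T (fst z)"
  shows "\<theta> x z (st (tens x) (fst z) k) = \<theta> x z (snd z \<cdot> k)"
proof -
  have s: "st (tens x) (fst z) k \<in> Arr C" "Dom C (st (tens x) (fst z) k) = Q x" "Cod C (st (tens x) (fst z) k) = fst z"
    using tens_module[OF x] z k by simp_all
  have "lift z (st (tens x) (fst z) k) \<cdot> \<sigma> x = snd z \<cdot> (FA T (st (tens x) (fst z) k) \<cdot> \<sigma> x)"
    using x z s by (simp add: lift_def)
  also have "\<dots> = (snd z \<cdot> \<mu> (fst z)) \<cdot> (FA T k \<cdot> \<sigma> x)"
    unfolding st_sigma[OF x act_simps(1)[OF z] k] using x z k by simp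
  also have "\<dots> = (snd z \<cdot> FA T (snd z)) \<cdot> (FA T k \<cdot> \<sigma> x)" unfolding act_assoc[OF z] ..
  also have "\<dots> = lift z (snd z \<cdot> k) \<cdot> \<sigma> x" using x z k by (simp add: lift_def)
  finally show ?thesis by (simp add: \<theta>_def)
qed

lemma theta_post:
  assumes x: "x \<in> Mods" and g: "(z, g, z') \<in> Arr TMod" and k: "k \<in> Arr C" "Dom C k = Q x" "Cod C k = fst z"
  shows "(z, g, z') \<cdot>\<^bsub>TMod\<^esub> \<theta> x z k = \<theta> x z' (g \<cdot> k)"
proof -
  have z: "z \<in> Mods" "z' \<in> Mods" and g': "g \<in> Arr C" "Dom C g = fst z" "Cod C g = fst z'" "g \<cdot> snd z = snd z' \<cdot> FA T g"
    using g by (simp_all add: tmod_Arr)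
  have "g \<cdot> (lift z k \<cdot> \<sigma> x) = (g \<cdot> lift z k) \<cdot> \<sigma> x" using x z k g' by simp
  then show ?thesis using module_map_lift[OF z k(1,3) g'] by (simp add: \<theta>_def)
qed

lemma theta_pre:
  assumes f: "(x, f, x') \<in> Arr TMod" and z: "z \<in> Mods" and k: "k \<in> Arr C" "Dom C k = Q x'" "Cod C k = fst z"
  shows "\<theta> x' z k \<cdot>\<^bsub>TMod\<^esub> (x, f, x') = \<theta> x z (k \<cdot> tmap x f x')"
proof -
  have x: "x \<in> Mods" "x' \<in> Mods" and f': "f \<in> Arr C" "Dom C f = fst x" "Cod C f = fst x'"
    using f by (simp_all add: tmod_Arr)
  have "(lift z k \<cdot> \<sigma> x') \<cdot> f = lift z k \<cdot> (FA T (tmap x f x') \<cdot> \<sigma> x)"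
    unfolding tmap(4)[OF f] using x z k f' by simp
  also have "\<dots> = lift z (k \<cdot> tmap x f x') \<cdot> \<sigma> x" using lift_comp[OF z k(1,3)] tmap(1-3)[OF f] x z k by simp
  finally show ?thesis by (simp add: \<theta>_def)
qed

abbreviation thdual where "thdual x z \<equiv> dual_map (Hom C (Q x) (fst z)) (\<theta> x z)"

lemma thdual:
  assumes "x \<in> Mods" "z \<in> Mods" "\<zeta> \<in> hom_dual K TMod x z"
  shows "thdual x z \<zeta> \<in> hom_dual K C (Q x) (fst z)"
  by (rule dual_map_dual[OF _ assms(3)]) (use assms(1,2) in \<open>auto simp: hom_module theta_linear\<close>)

text \<open>The universal family of the category of modules.  A functional on module maps \<open>x \<rightarrow> z\<close> is pulled back
  along \<open>\<theta>\<close> to one on the arrows \<open>T\<^sup>l\<^sup>a \<otimes>\<^sub>T x \<rightarrow> fst z\<close>, to which the universal family of \<open>C\<close> applies.\<close>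

definition iotaT :: "'o \<times> 'm \<Rightarrow> 'o \<times> 'm \<Rightarrow> (('o \<times> 'm) \<times> 'm \<times> ('o \<times> 'm) \<Rightarrow> 'k) \<Rightarrow> ('o \<times> 'm) \<times> 'm \<times> ('o \<times> 'm)" where
  "iotaT x z \<zeta> = (z, \<iota> (Q x) (fst z) (thdual x z \<zeta>), nakm (tens x))"

lemma iotaT_Arr [simp]:
  assumes x: "x \<in> Mods" and z: "z \<in> Mods" and t: "\<zeta> \<in> hom_dual K TMod x z"
  shows "iotaT x z \<zeta> \<in> Arr TMod" "Dom TMod (iotaT x z \<zeta>) = z" "Cod TMod (iotaT x z \<zeta>) = nakm (tens x)"
proof -
  let ?\<xi> = "thdual x z \<zeta>" and ?Z = "fst z" and ?y = "tens x"
  have y: "?y \<in> LLMods" by (rule tens_module[OF x])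
  have Z: "?Z \<in> Obj C" and P: "Q x \<in> Obj C" using x z by simp_all
  note d = thdual[OF x z t]
  have "nact ?y \<cdot> FA T (\<iota> (Q x) ?Z ?\<xi>) = \<iota> (Q x) (FO T ?Z) (sdual ?y ?Z ?\<xi>)"
    using nact_iota[OF y Z, of ?\<xi>] d by simp
  also have "sdual ?y ?Z ?\<xi> = dual_map (Hom C (Q x) (FO T ?Z)) (\<lambda>k. \<theta> x z (st ?y ?Z k)) \<zeta>"
    unfolding fst_tens by (rule dual_map_comp) (use y Z in simp)
  also have "\<dots> = dual_map (Hom C (Q x) (FO T ?Z)) (\<lambda>k. \<theta> x z (snd z \<cdot> k)) \<zeta>"
    by (rule dual_map_cong) (use theta_st[OF x z] in simp)
  also have "\<dots> = dual_map (Hom C (Q x) (FO T ?Z)) (\<lambda>k. snd z \<cdot> k) ?\<xi>"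
    by (rule dual_map_comp[symmetric]) (use z in simp)
  also have "\<iota> (Q x) (FO T ?Z) \<dots> = \<iota> (Q x) ?Z ?\<xi> \<cdot> snd z"
    using iota(7)[OF P, of "snd z" ?\<xi>] d z by simp
  finally show "iotaT x z \<zeta> \<in> Arr TMod" using d x z P Z nakm_module[OF y] by (simp add: iotaT_def tmod_Arr)
qed (simp_all add: iotaT_def)

lemma iotaT_cone:
  assumes x: "x \<in> Mods"
  shows "nak_cone K TMod x (nakm (tens x)) (\<lambda>z. restrict (iotaT x z) (hom_dual K TMod x z))"
proof (rule nak_coneI[OF TMod.lcat_axioms])
  have P: "Q x \<in> Obj C" using x by simp
  show "x \<in> Obj TMod" "nakm (tens x) \<in> Obj TMod" using x nakm_module[OF tens_module[OF x]] by simp_all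
  fix z \<zeta> assume z': "z \<in> Obj TMod" and t: "\<zeta> \<in> hom_dual K TMod x z"
  have z: "z \<in> Mods" using z' by simp
  have th: "\<And>k. k \<in> hom_set C (Q x) (fst z) \<Longrightarrow> \<theta> x z k \<in> hom_set TMod x z" using x z by simp
  show "iotaT x z \<zeta> \<in> hom_set TMod z (nakm (tens x))" using x z t by simp
  show "iotaT x z (\<zeta> \<oplus>\<^bsub>dual K (Hom TMod x z)\<^esub> \<zeta>') = HAdd TMod (iotaT x z \<zeta>) (iotaT x z \<zeta>')"
    if t': "\<zeta>' \<in> hom_dual K TMod x z" for \<zeta>'
    using dual_map_add(1)[where V = "Hom C (Q x) (fst z)" and h = "\<theta> x z", OF th, where K = K and \<xi> = \<zeta> and \<zeta> = \<zeta>']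
      iota(5)[OF P act_simps(1)[OF z] thdual[OF x z t] thdual[OF x z t']] by (simp add: iotaT_def)
  show "iotaT x z (c \<odot>\<^bsub>dual K (Hom TMod x z)\<^esub> \<zeta>) = HSmult TMod c (iotaT x z \<zeta>)" if c: "c \<in> carrier K" for c
    using dual_map_add(2)[where V = "Hom C (Q x) (fst z)" and h = "\<theta> x z", OF th, where K = K and \<xi> = \<zeta> and c = c]
      iota(6)[OF P act_simps(1)[OF z] thdual[OF x z t] c] by (simp add: iotaT_def)
next
  have P: "Q x \<in> Obj C" using x by simp
  fix f \<zeta> assume f: "f \<in> Arr TMod" and t: "\<zeta> \<in> hom_dual K TMod x (Cod TMod f)"
  obtain z g z' where g: "f = (z, g, z')" "g \<in> Arr C" "Dom C g = fst z" "Cod C g = fst z'" "z \<in> Mods" "z' \<in> Mods"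
    using f by (rule tmod_ArrE)
  have g': "(z, g, z') \<in> Arr TMod" and t': "\<zeta> \<in> hom_dual K TMod x z'" using f g(1) t by simp_all
  have "thdual x z (dual_map (Hom TMod x z) (\<lambda>h. f \<cdot>\<^bsub>TMod\<^esub> h) \<zeta>) =
      dual_map (Hom C (Q x) (fst z)) (\<lambda>k. f \<cdot>\<^bsub>TMod\<^esub> \<theta> x z k) \<zeta>"
    by (rule dual_map_comp) (use x g in simp)
  also have "\<dots> = dual_map (Hom C (Q x) (fst z)) (\<lambda>k. \<theta> x z' (g \<cdot> k)) \<zeta>"
    by (rule dual_map_cong) (use theta_post[OF x g'] g in simp)
  also have "\<dots> = dual_map (Hom C (Q x) (fst z)) (\<lambda>k. g \<cdot> k) (thdual x z' \<zeta>)"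
    by (rule dual_map_comp[symmetric]) (use g in simp)
  finally have "\<iota> (Q x) (fst z) (thdual x z (dual_map (Hom TMod x z) (\<lambda>h. f \<cdot>\<^bsub>TMod\<^esub> h) \<zeta>)) =
      \<iota> (Q x) (fst z') (thdual x z' \<zeta>) \<cdot> g"
    using iota(7)[OF P g(2), of "thdual x z' \<zeta>"] thdual[OF x g(6) t'] g by simp
  then show "iotaT x (Dom TMod f) (dual_map (Hom TMod x (Dom TMod f)) (\<lambda>h. f \<cdot>\<^bsub>TMod\<^esub> h) \<zeta>) =
      iotaT x (Cod TMod f) \<zeta> \<cdot>\<^bsub>TMod\<^esub> f" unfolding g(1) by (simp add: iotaT_def)
qed

lemma iotaT_natural:
  assumes f: "(x, f, x') \<in> Arr TMod" and z: "z \<in> Mods" and t: "\<zeta> \<in> hom_dual K TMod x z"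
  shows "FA N (tmap x f x') \<cdot> \<iota> (Q x) (fst z) (thdual x z \<zeta>) =
    \<iota> (Q x') (fst z) (thdual x' z (dual_map (Hom TMod x' z) (\<lambda>h. h \<cdot>\<^bsub>TMod\<^esub> (x, f, x')) \<zeta>))"
proof -
  have x: "x \<in> Mods" "x' \<in> Mods" using f by (simp_all add: tmod_Arr)
  note m = tmap(1-3)[OF f]
  have "thdual x' z (dual_map (Hom TMod x' z) (\<lambda>h. h \<cdot>\<^bsub>TMod\<^esub> (x, f, x')) \<zeta>) =
      dual_map (Hom C (Q x') (fst z)) (\<lambda>k. \<theta> x' z k \<cdot>\<^bsub>TMod\<^esub> (x, f, x')) \<zeta>"
    by (rule dual_map_comp) (use x z in simp)
  also have "\<dots> = dual_map (Hom C (Q x') (fst z)) (\<lambda>k. \<theta> x z (k \<cdot> tmap x f x')) \<zeta>"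
    by (rule dual_map_cong) (use theta_pre[OF f z] in simp)
  also have "\<dots> = dual_map (Hom C (Q x') (fst z)) (\<lambda>k. k \<cdot> tmap x f x') (thdual x z \<zeta>)"
    by (rule dual_map_comp[symmetric]) (use m in simp)
  finally show ?thesis
    using iota_map[OF m(1) act_simps(1)[OF z], of "thdual x z \<zeta>"] thdual[OF x(1) z t] m by simp
qed

subsection \<open>Universality\<close>

text \<open>The inverse of the bijection between arrows \<open>T\<^sup>l\<^sup>a \<otimes>\<^sub>T x \<rightarrow> X\<close> and module maps into the free module.\<close>

definition \<tau> :: "'o \<times> 'm \<Rightarrow> 'o \<Rightarrow> ('o \<times> 'm) \<times> 'm \<times> ('o \<times> 'm) \<Rightarrow> 'm" where
  "\<tau> x X h = (SOME k. k \<in> Arr C \<and> Dom C k = Q x \<and> Cod C k = X \<and> FA T k \<cdot> \<sigma> x = fst (snd h))"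

lemma tau:
  assumes x: "x \<in> Mods" and X: "X \<in> Obj C" and h: "h \<in> Arr TMod" "Dom TMod h = x" "Cod TMod h = free X"
  shows "\<tau> x X h \<in> Arr C" "Dom C (\<tau> x X h) = Q x" "Cod C (\<tau> x X h) = X" "FA T (\<tau> x X h) \<cdot> \<sigma> x = fst (snd h)"
proof -
  obtain f where f: "h = (x, f, free X)" "f \<in> Arr C" "Dom C f = fst x" "Cod C f = FO T X" "f \<cdot> snd x = \<mu> X \<cdot> FA T f"
    using h by (auto elim!: tmod_ArrE)
  obtain k where "k \<in> Arr C" "Dom C k = Q x" "Cod C k = X" "FA T k \<cdot> \<sigma> x = f"
    by (rule sigma_universal[OF x X f(2-5)])
  then have "\<exists>k. k \<in> Arr C \<and> Dom C k = Q x \<and> Cod C k = X \<and> FA T k \<cdot> \<sigma> x = fst (snd h)" using f(1) by auto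
  from someI_ex[OF this]
  show "\<tau> x X h \<in> Arr C" "Dom C (\<tau> x X h) = Q x" "Cod C (\<tau> x X h) = X" "FA T (\<tau> x X h) \<cdot> \<sigma> x = fst (snd h)"
    unfolding \<tau>_def by blast+
qed

lemma tau_eqI:
  assumes x: "x \<in> Mods" and X: "X \<in> Obj C" and h: "h \<in> Arr TMod" "Dom TMod h = x" "Cod TMod h = free X"
    and k: "k \<in> Arr C" "Dom C k = Q x" "Cod C k = X" "FA T k \<cdot> \<sigma> x = fst (snd h)"
  shows "\<tau> x X h = k"
  by (rule sigma_inj[OF x]) (use tau[OF x X h] k in simp_all)

lemma tau_linear:
  assumes x: "x \<in> Mods" and X: "X \<in> Obj C" and h: "h \<in> hom_set TMod x (free X)"
  shows "h' \<in> hom_set TMod x (free X) \<Longrightarrow> \<tau> x X (HAdd TMod h h') = HAdd C (\<tau> x X h) (\<tau> x X h')"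
    and "c \<in> carrier K \<Longrightarrow> \<tau> x X (HSmult TMod c h) = HSmult C c (\<tau> x X h)"
proof -
  have h1: "h \<in> Arr TMod" "Dom TMod h = x" "Cod TMod h = free X" using h by simp_all
  note t = tau[OF x X h1]
  show "\<tau> x X (HAdd TMod h h') = HAdd C (\<tau> x X h) (\<tau> x X h')" if h': "h' \<in> hom_set TMod x (free X)"
  proof -
    have h2: "h' \<in> Arr TMod" "Dom TMod h' = x" "Cod TMod h' = free X" using h' by simp_all
    note t' = tau[OF x X h2]
    have "FA T (HAdd C (\<tau> x X h) (\<tau> x X h')) \<cdot> \<sigma> x = HAdd C (fst (snd h)) (fst (snd h'))"
      unfolding t(4)[symmetric] t'(4)[symmetric] using t(1-3) t'(1-3) x
      by (simp add: linear_functorD(4)[OF T_linear] HAdd_comp)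
    also have "\<dots> = fst (snd (HAdd TMod h h'))" by (cases h, cases h') simp
    finally show ?thesis using t(1-3) t'(1-3) h1 h2 by (intro tau_eqI[OF x X]) simp_all
  qed
  show "\<tau> x X (HSmult TMod c h) = HSmult C c (\<tau> x X h)" if c: "c \<in> carrier K"
  proof -
    have "FA T (HSmult C c (\<tau> x X h)) \<cdot> \<sigma> x = HSmult C c (fst (snd h))"
      unfolding t(4)[symmetric] using t(1-3) x c by (simp add: linear_functorD(5)[OF T_linear] comp_HSmult)
    also have "\<dots> = fst (snd (HSmult TMod c h))" by (cases h) simp
    finally show ?thesis using t(1-3) h1 c by (intro tau_eqI[OF x X]) simp_all
  qed
qed

abbreviation taudual where "taudual x X \<equiv> dual_map (Hom TMod x (free X)) (\<tau> x X)"

lemma taudual: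
  assumes "x \<in> Mods" "X \<in> Obj C" "\<xi> \<in> hom_dual K C (Q x) X"
  shows "taudual x X \<xi> \<in> hom_dual K TMod x (free X)"
  by (rule dual_map_dual[OF _ assms(3)])
    (use assms(1,2) tau in \<open>auto simp: TMod.hom_module tau_linear\<close>)

text \<open>The maps \<open>st\<close> and \<open>\<theta>\<close> and the composition with \<open>f\<close> are, up to the bijection \<open>\<tau>\<close>, the compositions with
  the module maps \<open>\<mu>\<close>, \<open>snd z\<close> and \<open>T(f)\<close> out of free modules.\<close>

lemma mu_map: "X \<in> Obj C \<Longrightarrow> (free (FO T X), \<mu> X, free X) \<in> Arr TMod"
  by (simp add: tmod_Arr mu_assoc)

lemma act_map: "z \<in> Mods \<Longrightarrow> (free (fst z), snd z, z) \<in> Arr TMod"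
  by (simp add: tmod_Arr act_assoc)

lemma taudual_post:
  assumes x: "x \<in> Mods" and f: "f \<in> Arr C"
  shows "taudual x (Dom C f) (dual_map (Hom C (Q x) (Dom C f)) (\<lambda>k. f \<cdot> k) \<xi>) =
    dual_map (Hom TMod x (free (Dom C f))) (\<lambda>h. (free (Dom C f), FA T f, free (Cod C f)) \<cdot>\<^bsub>TMod\<^esub> h) (taudual x (Cod C f) \<xi>)"
proof -
  let ?X = "Dom C f" and ?Y = "Cod C f"
  let ?F = "(free ?X, FA T f, free ?Y)"
  have F: "?F \<in> Arr TMod" by (rule free_map[OF f])
  have X: "?X \<in> Obj C" "?Y \<in> Obj C" using f by simp_all
  have eq: "f \<cdot> \<tau> x ?X h = \<tau> x ?Y (?F \<cdot>\<^bsub>TMod\<^esub> h)" if h': "h \<in> hom_set TMod x (free ?X)" for h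
  proof -
    have h: "h \<in> Arr TMod" "Dom TMod h = x" "Cod TMod h = free ?X" using h' by simp_all
    note t = tau[OF x X(1) h]
    have Fh: "?F \<cdot>\<^bsub>TMod\<^esub> h \<in> Arr TMod" "Dom TMod (?F \<cdot>\<^bsub>TMod\<^esub> h) = x" "Cod TMod (?F \<cdot>\<^bsub>TMod\<^esub> h) = free ?Y"
      using h F by simp_all
    have "FA T (f \<cdot> \<tau> x ?X h) \<cdot> \<sigma> x = FA T f \<cdot> fst (snd h)" unfolding t(4)[symmetric] using t(1-3) x f by simp
    also have "\<dots> = fst (snd (?F \<cdot>\<^bsub>TMod\<^esub> h))" by (cases h) simp
    finally show ?thesis using t(1-3) f by (intro tau_eqI[OF x X(2) Fh, symmetric]) simp_all
  qed
  have "taudual x ?X (dual_map (Hom C (Q x) ?X) (\<lambda>k. f \<cdot> k) \<xi>) =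
      dual_map (Hom TMod x (free ?X)) (\<lambda>h. f \<cdot> \<tau> x ?X h) \<xi>"
    by (rule dual_map_comp) (use tau[OF x X(1)] in simp)
  also have "\<dots> = dual_map (Hom TMod x (free ?X)) (\<lambda>h. \<tau> x ?Y (?F \<cdot>\<^bsub>TMod\<^esub> h)) \<xi>"
    by (rule dual_map_cong) (rule eq)
  also have "\<dots> = dual_map (Hom TMod x (free ?X)) (\<lambda>h. ?F \<cdot>\<^bsub>TMod\<^esub> h) (taudual x ?Y \<xi>)"
    by (rule dual_map_comp[symmetric]) (use F in simp)
  finally show ?thesis .
qed

lemma taudual_sdual:
  assumes x: "x \<in> Mods" and X: "X \<in> Obj C"
  shows "taudual x (FO T X) (sdual (tens x) X \<xi>) =
    dual_map (Hom TMod x (free (FO T X))) (\<lambda>h. (free (FO T X), \<mu> X, free X) \<cdot>\<^bsub>TMod\<^esub> h) (taudual x X \<xi>)"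
proof -
  let ?F = "(free (FO T X), \<mu> X, free X)"
  note F = mu_map[OF X] and y = tens_module[OF x]
  have TX: "FO T X \<in> Obj C" using X by simp
  have eq: "st (tens x) X (\<tau> x (FO T X) h) = \<tau> x X (?F \<cdot>\<^bsub>TMod\<^esub> h)" if h': "h \<in> hom_set TMod x (free (FO T X))" for h
  proof -
    have h: "h \<in> Arr TMod" "Dom TMod h = x" "Cod TMod h = free (FO T X)" using h' by simp_all
    note t = tau[OF x TX h]
    have Fh: "?F \<cdot>\<^bsub>TMod\<^esub> h \<in> Arr TMod" "Dom TMod (?F \<cdot>\<^bsub>TMod\<^esub> h) = x" "Cod TMod (?F \<cdot>\<^bsub>TMod\<^esub> h) = free X"
      using h F by simp_all
    have "FA T (st (tens x) X (\<tau> x (FO T X) h)) \<cdot> \<sigma> x = \<mu> X \<cdot> fst (snd h)"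
      unfolding st_sigma[OF x X t(1-3)] t(4) ..
    also have "\<dots> = fst (snd (?F \<cdot>\<^bsub>TMod\<^esub> h))" by (cases h) simp
    finally show ?thesis using t(1-3) y X by (intro tau_eqI[OF x X Fh, symmetric]) simp_all
  qed
  have "taudual x (FO T X) (sdual (tens x) X \<xi>) =
      dual_map (Hom TMod x (free (FO T X))) (\<lambda>h. st (tens x) X (\<tau> x (FO T X) h)) \<xi>"
    by (rule dual_map_comp) (use tau[OF x TX] in simp)
  also have "\<dots> = dual_map (Hom TMod x (free (FO T X))) (\<lambda>h. \<tau> x X (?F \<cdot>\<^bsub>TMod\<^esub> h)) \<xi>"
    by (rule dual_map_cong) (rule eq)
  also have "\<dots> = dual_map (Hom TMod x (free (FO T X))) (\<lambda>h. ?F \<cdot>\<^bsub>TMod\<^esub> h) (taudual x X \<xi>)"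
    by (rule dual_map_comp[symmetric]) (use F in simp)
  finally show ?thesis .
qed

lemma taudual_thdual:
  assumes x: "x \<in> Mods" and z: "z \<in> Mods"
  shows "taudual x (fst z) (thdual x z \<zeta>) =
    dual_map (Hom TMod x (free (fst z))) (\<lambda>h. (free (fst z), snd z, z) \<cdot>\<^bsub>TMod\<^esub> h) \<zeta>"
proof -
  let ?F = "(free (fst z), snd z, z)"
  have Z: "fst z \<in> Obj C" using z by simp
  have eq: "\<theta> x z (\<tau> x (fst z) h) = ?F \<cdot>\<^bsub>TMod\<^esub> h" if h': "h \<in> hom_set TMod x (free (fst z))" for h
  proof -
    have h: "h \<in> Arr TMod" "Dom TMod h = x" "Cod TMod h = free (fst z)" using h' by simp_all
    note t = tau[OF x Z h]
    have "lift z (\<tau> x (fst z) h) \<cdot> \<sigma> x = snd z \<cdot> fst (snd h)"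
      unfolding t(4)[symmetric] using t(1-3) x z by (simp add: lift_def)
    then show ?thesis using h by (cases h) (simp add: \<theta>_def)
  qed
  have "taudual x (fst z) (thdual x z \<zeta>) =
      dual_map (Hom TMod x (free (fst z))) (\<lambda>h. \<theta> x z (\<tau> x (fst z) h)) \<zeta>"
    by (rule dual_map_comp) (use tau[OF x Z] in simp)
  also have "\<dots> = dual_map (Hom TMod x (free (fst z))) (\<lambda>h. ?F \<cdot>\<^bsub>TMod\<^esub> h) \<zeta>"
    by (rule dual_map_cong) (rule eq)
  finally show ?thesis .
qed

text \<open>The universal arrows of \<open>N(T\<^sup>l\<^sup>a \<otimes>\<^sub>T x)\<close> are recovered from the \<open>iotaT x z\<close> with free modules \<open>z\<close>.\<close>

lemma iota_eq_iotaT: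
  assumes x: "x \<in> Mods" and X: "X \<in> Obj C" and k: "\<xi> \<in> hom_dual K C (Q x) X"
  shows "\<iota> (Q x) X \<xi> = fst (snd (iotaT x (free X) (taudual x X \<xi>))) \<cdot> \<eta> X"
proof -
  let ?y = "tens x"
  note y = tens_module[OF x]
  have P: "Q x \<in> Obj C" and F: "free X \<in> Mods" and k': "\<xi> \<in> hom_dual K C (fst ?y) X" using x X k by simp_all
  have s: "sdual ?y X \<xi> \<in> hom_dual K C (Q x) (FO T X)" using sdual[OF y X k'] by simp
  have eq: "\<tau> x X (\<theta> x (free X) h) = st ?y X h" if "h \<in> hom_set C (Q x) (FO T X)" for h
  proof -
    have h: "h \<in> Arr C" "Dom C h = Q x" "Cod C h = FO T X" using that by simp_all
    have th: "\<theta> x (free X) h \<in> Arr TMod" "Dom TMod (\<theta> x (free X) h) = x" "Cod TMod (\<theta> x (free X) h) = free X"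
      using theta_Arr[OF x F h(1,2)] h(3) by simp_all
    have "FA T (st ?y X h) \<cdot> \<sigma> x = fst (snd (\<theta> x (free X) h))"
      unfolding st_sigma[OF x X h] using x X h by (simp add: \<theta>_def lift_def)
    then show ?thesis using y X h by (intro tau_eqI[OF x X th]) simp_all
  qed
  have "thdual x (free X) (taudual x X \<xi>) = dual_map (Hom C (Q x) (FO T X)) (\<lambda>h. \<tau> x X (\<theta> x (free X) h)) \<xi>"
    unfolding fst_free by (rule dual_map_comp) (use x F in simp)
  also have "\<dots> = sdual ?y X \<xi>" unfolding fst_tens by (rule dual_map_cong) (rule eq)
  finally have "fst (snd (iotaT x (free X) (taudual x X \<xi>))) \<cdot> \<eta> X = \<iota> (Q x) (FO T X) (sdual ?y X \<xi>) \<cdot> \<eta> X"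
    by (simp add: iotaT_def)
  also have "\<dots> = \<iota> (Q x) X (dual_map (Hom C (Q x) X) (\<lambda>h. \<eta> X \<cdot> h) (sdual ?y X \<xi>))"
    using iota(7)[OF P eta_simps(1)[OF X], of "sdual ?y X \<xi>"] s X by simp
  also have "dual_map (Hom C (Q x) X) (\<lambda>h. \<eta> X \<cdot> h) (sdual ?y X \<xi>) =
      dual_map (Hom C (Q x) X) (\<lambda>h. st ?y X (\<eta> X \<cdot> h)) \<xi>"
    by (rule dual_map_comp) (use X in simp)
  also have "\<dots> = \<xi>" by (rule dual_map_id[OF k]) (use st_eta[OF y X] in simp)
  finally show ?thesis by simp
qed

text \<open>The values of \<open>\<kappa>\<close> at free modules, composed with \<open>\<eta>\<close>, form a family on \<open>C\<close> and so define an arrow \<open>g\<close>.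
  Naturality of \<open>\<kappa>\<close> along \<open>\<mu>\<close> makes \<open>g\<close> linear, and naturality along the action \<open>T(z) \<rightarrow> z\<close> shows that \<open>g\<close>
  induces \<open>\<kappa>\<close> at every module \<open>z\<close>.\<close>

lemma iotaT_universal:
  assumes x: "x \<in> Mods" and cone: "nak_cone K TMod x Y \<kappa>"
  obtains g where "(nakm (tens x), g, Y) \<in> Arr TMod"
    "\<And>z \<zeta>. z \<in> Mods \<Longrightarrow> \<zeta> \<in> hom_dual K TMod x z \<Longrightarrow> (nakm (tens x), g, Y) \<cdot>\<^bsub>TMod\<^esub> iotaT x z \<zeta> = \<kappa> z \<zeta>"
proof -
  note c = TMod.nak_coneD[OF cone]
  have Y: "Y \<in> Mods" using c(1) by simp
  let ?y = "tens x"
  note y = tens_module[OF x]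
  have P: "Q x \<in> Obj C" using x by simp
  define a where "a z \<zeta> = fst (snd (\<kappa> z \<zeta>))" for z \<zeta>
  have ka: "\<kappa> z \<zeta> = (z, a z \<zeta>, Y)" if "z \<in> Mods" "\<zeta> \<in> hom_dual K TMod x z" for z \<zeta>
    using c(2-4)[of z \<zeta>] that unfolding a_def by (cases "\<kappa> z \<zeta>") simp
  have a: "a z \<zeta> \<in> Arr C" "Dom C (a z \<zeta>) = fst z" "Cod C (a z \<zeta>) = fst Y" "a z \<zeta> \<cdot> snd z = snd Y \<cdot> FA T (a z \<zeta>)"
    if "z \<in> Mods" "\<zeta> \<in> hom_dual K TMod x z" for z \<zeta>
    using c(2)[of z \<zeta>] that ka[OF that] by (simp_all add: tmod_Arr)
  have a_add: "a z (\<zeta> \<oplus>\<^bsub>dual K (Hom TMod x z)\<^esub> \<zeta>') = HAdd C (a z \<zeta>) (a z \<zeta>')"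
    if "z \<in> Mods" "\<zeta> \<in> hom_dual K TMod x z" "\<zeta>' \<in> hom_dual K TMod x z" for z \<zeta> \<zeta>'
  proof -
    have "a z (\<zeta> \<oplus>\<^bsub>dual K (Hom TMod x z)\<^esub> \<zeta>') = fst (snd (HAdd TMod (\<kappa> z \<zeta>) (\<kappa> z \<zeta>')))"
      unfolding a_def using c(5)[of z \<zeta> \<zeta>'] that by simp
    then show ?thesis unfolding ka[OF that(1,2)] ka[OF that(1,3)] by simp
  qed
  have a_smult: "a z (r \<odot>\<^bsub>dual K (Hom TMod x z)\<^esub> \<zeta>) = HSmult C r (a z \<zeta>)"
    if "z \<in> Mods" "\<zeta> \<in> hom_dual K TMod x z" "r \<in> carrier K" for z \<zeta> r
  proof -
    have "a z (r \<odot>\<^bsub>dual K (Hom TMod x z)\<^esub> \<zeta>) = fst (snd (HSmult TMod r (\<kappa> z \<zeta>)))"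
      unfolding a_def using c(6)[of z \<zeta> r] that by simp
    then show ?thesis unfolding ka[OF that(1,2)] by simp
  qed
  have a_nat: "a z (dual_map (Hom TMod x z) (\<lambda>h. (z, g, z') \<cdot>\<^bsub>TMod\<^esub> h) \<zeta>) = a z' \<zeta> \<cdot> g"
    if "(z, g, z') \<in> Arr TMod" "\<zeta> \<in> hom_dual K TMod x z'" for z g z' \<zeta>
  proof -
    have "a z (dual_map (Hom TMod x z) (\<lambda>h. (z, g, z') \<cdot>\<^bsub>TMod\<^esub> h) \<zeta>) = fst (snd (\<kappa> z' \<zeta> \<cdot>\<^bsub>TMod\<^esub> (z, g, z')))"
      unfolding a_def using c(7)[OF that(1), of \<zeta>] that(2) by simp
    moreover have "z' \<in> Mods" using that(1) by (simp add: tmod_Arr)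
    ultimately show ?thesis using that(2) by (simp add: ka)
  qed
  \<comment> \<open>the family on \<open>C\<close> obtained from the values of \<open>\<kappa>\<close> at free modules\<close>
  let ?k = "\<lambda>X \<xi>. a (free X) (taudual x X \<xi>) \<cdot> \<eta> X"
  have k: "?k X \<xi> \<in> Arr C" "Dom C (?k X \<xi>) = X" "Cod C (?k X \<xi>) = fst Y"
    if "X \<in> Obj C" "\<xi> \<in> hom_dual K C (Q x) X" for X \<xi>
    using a[OF free_module[OF that(1)] taudual[OF x that]] that by simp_all
  have coneC: "nak_cone K C (Q x) (fst Y) (\<lambda>X. restrict (?k X) (hom_dual K C (Q x) X))"
  proof (rule nak_coneI[OF lcat_axioms P])
    show "fst Y \<in> Obj C" using Y by simp
    fix X \<xi> assume X: "X \<in> Obj C" and xi: "\<xi> \<in> hom_dual K C (Q x) X"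
    have F: "free X \<in> Mods" using X by simp
    note t = taudual[OF x X xi]
    have th: "\<And>h. h \<in> hom_set TMod x (free X) \<Longrightarrow> \<tau> x X h \<in> hom_set C (Q x) X" using tau[OF x X] by simp
    show "?k X \<xi> \<in> hom_set C X (fst Y)" using k[OF X xi] by simp
    show "?k X (\<xi> \<oplus>\<^bsub>dual K (Hom C (Q x) X)\<^esub> \<xi>') = HAdd C (?k X \<xi>) (?k X \<xi>')" if xi': "\<xi>' \<in> hom_dual K C (Q x) X" for \<xi>'
      unfolding dual_map_add(1)[where V = "Hom TMod x (free X)" and h = "\<tau> x X", OF th, where K = K and \<xi> = \<xi> and \<zeta> = \<xi>', simplified]
        a_add[OF F t taudual[OF x X xi']]
      using a[OF F t] a[OF F taudual[OF x X xi']] X by (simp add: HAdd_comp)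
    show "?k X (r \<odot>\<^bsub>dual K (Hom C (Q x) X)\<^esub> \<xi>) = HSmult C r (?k X \<xi>)" if r: "r \<in> carrier K" for r
      unfolding dual_map_add(2)[where V = "Hom TMod x (free X)" and h = "\<tau> x X", OF th, where K = K and \<xi> = \<xi> and c = r, simplified]
        a_smult[OF F t r]
      using a[OF F t] r X by (simp add: comp_HSmult)
  next
    fix f \<xi> assume f: "f \<in> Arr C" and xi: "\<xi> \<in> hom_dual K C (Q x) (Cod C f)"
    have F: "free (Cod C f) \<in> Mods" using f by simp
    note t = taudual[OF x Cod_Obj[OF f] xi]
    have "?k (Dom C f) (dpost (Q x) f \<xi>) =
        (a (free (Cod C f)) (taudual x (Cod C f) \<xi>) \<cdot> FA T f) \<cdot> \<eta> (Dom C f)"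
      unfolding taudual_post[OF x f] a_nat[OF free_map[OF f] t] ..
    also have "\<dots> = ?k (Cod C f) \<xi> \<cdot> f" using a[OF F t] f by (simp add: eta_natural)
    finally show "?k (Dom C f) (dpost (Q x) f \<xi>) = ?k (Cod C f) \<xi> \<cdot> f" .
  qed
  obtain g where g: "g \<in> Arr C" "Dom C g = FO N (Q x)" "Cod C g = fst Y"
    "\<And>X \<xi>. X \<in> Obj C \<Longrightarrow> \<xi> \<in> hom_dual K C (Q x) X \<Longrightarrow> g \<cdot> \<iota> (Q x) X \<xi> = restrict (?k X) (hom_dual K C (Q x) X) \<xi>"
    by (rule nak_repE[OF N_rep[OF P] coneC]) blast
  have gk: "g \<cdot> \<iota> (Q x) X \<xi> = ?k X \<xi>" if "X \<in> Obj C" "\<xi> \<in> hom_dual K C (Q x) X" for X \<xi>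
    using g(4)[OF that] that(2) by simp
  have "g \<cdot> nact ?y = snd Y \<cdot> FA T g"
  proof (rule TN_eqI[OF P])
    fix X \<xi> assume X: "X \<in> Obj C" and xi: "\<xi> \<in> hom_dual K C (Q x) X"
    have F: "free X \<in> Mods" and TX: "FO T X \<in> Obj C" using X by simp_all
    have s: "sdual ?y X \<xi> \<in> hom_dual K C (Q x) (FO T X)" using sdual[OF y X] xi by simp
    note t = taudual[OF x X xi]
    let ?a = "a (free X) (taudual x X \<xi>)"
    note a' = a[OF F t]
    have "(g \<cdot> nact ?y) \<cdot> FA T (\<iota> (Q x) X \<xi>) = g \<cdot> (nact ?y \<cdot> FA T (\<iota> (Q x) X \<xi>))" using g(1-3) y X xi P by simp
    also have "nact ?y \<cdot> FA T (\<iota> (Q x) X \<xi>) = \<iota> (Q x) (FO T X) (sdual ?y X \<xi>)"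
      using nact_iota[OF y X, of \<xi>] xi by simp
    also have "g \<cdot> \<dots> = (?a \<cdot> \<mu> X) \<cdot> \<eta> (FO T X)"
      unfolding gk[OF TX s] taudual_sdual[OF x X] a_nat[OF mu_map[OF X] t] ..
    also have "\<dots> = ?a" using a'(1-3) X by (simp add: mu_eta)
    also have "\<dots> = lift Y (?a \<cdot> \<eta> X)" using lift_unique[OF Y a'(1,3) _ X] a' by simp
    also have "\<dots> = (snd Y \<cdot> FA T g) \<cdot> FA T (\<iota> (Q x) X \<xi>)"
      unfolding gk[OF X xi, symmetric] lift_def using g(1-3) Y X xi P by simp
    finally show "(g \<cdot> nact ?y) \<cdot> FA T (\<iota> (Q x) X \<xi>) = (snd Y \<cdot> FA T g) \<cdot> FA T (\<iota> (Q x) X \<xi>)" .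
  qed (use g(1-3) y Y in simp_all)
  then have gA: "(nakm ?y, g, Y) \<in> Arr TMod" using g(1-3) Y nakm_module[OF y] by (simp add: tmod_Arr)
  have "g \<cdot> \<iota> (Q x) (fst z) (thdual x z \<zeta>) = a z \<zeta>" if z: "z \<in> Mods" and t: "\<zeta> \<in> hom_dual K TMod x z" for z \<zeta>
  proof -
    have "g \<cdot> \<iota> (Q x) (fst z) (thdual x z \<zeta>) = (a z \<zeta> \<cdot> snd z) \<cdot> \<eta> (fst z)"
      unfolding gk[OF act_simps(1)[OF z] thdual[OF x z t]] taudual_thdual[OF x z] a_nat[OF act_map[OF z] t] ..
    also have "\<dots> = a z \<zeta>" using a(1-3)[OF z t] z by (simp add: act_unit)
    finally show ?thesis .
  qed
  then have "(nakm ?y, g, Y) \<cdot>\<^bsub>TMod\<^esub> iotaT x z \<zeta> = \<kappa> z \<zeta>" if "z \<in> Mods" "\<zeta> \<in> hom_dual K TMod x z" for z \<zeta>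
    using ka that by (simp add: iotaT_def)
  then show thesis using that[OF gA] by blast
qed

lemma iotaT_rep:
  assumes x: "x \<in> Mods"
  shows "nak_rep K TMod x (nakm (tens x)) (\<lambda>z. restrict (iotaT x z) (hom_dual K TMod x z))"
  unfolding nak_rep_def
proof (intro conjI allI impI)
  let ?Z = "nakm (tens x)" and ?i = "\<lambda>z. restrict (iotaT x z) (hom_dual K TMod x z)"
  show "nak_cone K TMod x ?Z ?i" by (rule iotaT_cone[OF x])
  fix Y \<kappa> assume cone: "nak_cone K TMod x Y \<kappa>"
  have P: "Q x \<in> Obj C" using x by simp
  obtain g where g: "(?Z, g, Y) \<in> Arr TMod"
    "\<And>z \<zeta>. z \<in> Mods \<Longrightarrow> \<zeta> \<in> hom_dual K TMod x z \<Longrightarrow> (?Z, g, Y) \<cdot>\<^bsub>TMod\<^esub> iotaT x z \<zeta> = \<kappa> z \<zeta>"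
    by (rule iotaT_universal[OF x cone]) blast
  show "\<exists>!h. h \<in> hom_set TMod ?Z Y \<and> (\<forall>z\<in>Obj TMod. \<forall>\<zeta>\<in>hom_dual K TMod x z. h \<cdot>\<^bsub>TMod\<^esub> ?i z \<zeta> = \<kappa> z \<zeta>)"
  proof (rule ex1I[of _ "(?Z, g, Y)"])
    show "(?Z, g, Y) \<in> hom_set TMod ?Z Y \<and>
        (\<forall>z\<in>Obj TMod. \<forall>\<zeta>\<in>hom_dual K TMod x z. (?Z, g, Y) \<cdot>\<^bsub>TMod\<^esub> ?i z \<zeta> = \<kappa> z \<zeta>)" using g by simp
  next
    fix h assume h: "h \<in> hom_set TMod ?Z Y \<and> (\<forall>z\<in>Obj TMod. \<forall>\<zeta>\<in>hom_dual K TMod x z. h \<cdot>\<^bsub>TMod\<^esub> ?i z \<zeta> = \<kappa> z \<zeta>)"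
    obtain h' where h': "h = (?Z, h', Y)" "h' \<in> Arr C" "Dom C h' = FO N (Q x)" "Cod C h' = fst Y"
      using h by (auto elim!: tmod_ArrE)
    have g': "g \<in> Arr C" "Dom C g = FO N (Q x)" "Cod C g = fst Y" using g(1) by (simp_all add: tmod_Arr)
    have "h' = g"
    proof (rule nak_rep_eqI[OF P N_rep[OF P]])
      fix X \<xi> assume X: "X \<in> Obj C" and xi: "\<xi> \<in> hom_dual K C (Q x) X"
      have F: "free X \<in> Mods" using X by simp
      note t = taudual[OF x X xi]
      obtain i' where i: "iotaT x (free X) (taudual x X \<xi>) = (free X, i', ?Z)" "i' \<in> Arr C" "Dom C i' = FO T X" "Cod C i' = FO N (Q x)"
        using iotaT_Arr[OF x F t] by (auto simp: iotaT_def tmod_Arr)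
      have "h \<cdot>\<^bsub>TMod\<^esub> iotaT x (free X) (taudual x X \<xi>) = (?Z, g, Y) \<cdot>\<^bsub>TMod\<^esub> iotaT x (free X) (taudual x X \<xi>)"
        using h[THEN conjunct2, rule_format, of "free X" "taudual x X \<xi>"] t F g(2)[OF F t] by simp
      then have "h' \<cdot> i' = g \<cdot> i'" unfolding i(1) h'(1) by simp
      then have "(h' \<cdot> i') \<cdot> \<eta> X = (g \<cdot> i') \<cdot> \<eta> X" by simp
      then show "h' \<cdot> \<iota> (Q x) X \<xi> = g \<cdot> \<iota> (Q x) X \<xi>"
        unfolding iota_eq_iotaT[OF x X xi] i(1) using h' g' i(2-4) X by simp
    qed (use h' g' in simp_all)
    then show "h = (?Z, g, Y)" using h'(1) by simp
  qed
qed

lemma tmod_nak_functor: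
  "nak_functor K TMod (ftr_comp Ntilde Tensor) (\<lambda>x z. restrict (iotaT x z) (hom_dual K TMod x z))"
  unfolding nak_functor_def
proof (intro conjI ballI)
  show "is_functor TMod TMod (ftr_comp Ntilde Tensor)"
    by (rule is_functor_comp[OF Tensor_functor Ntilde_functor])
  show "nak_rep K TMod x (FO (ftr_comp Ntilde Tensor) x) (\<lambda>z. restrict (iotaT x z) (hom_dual K TMod x z))"
    if "x \<in> Obj TMod" for x
    using iotaT_rep[of x] that by (simp add: FO_Tensor FO_Ntilde)
  fix f z \<zeta> assume f: "f \<in> Arr TMod" and z: "z \<in> Obj TMod" and t: "\<zeta> \<in> hom_dual K TMod (Dom TMod f) z"
  obtain x g x' where g: "f = (x, g, x')" "x \<in> Mods" "x' \<in> Mods" using f by (rule tmod_ArrE)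
  have f': "(x, g, x') \<in> Arr TMod" and z': "z \<in> Mods" and t': "\<zeta> \<in> hom_dual K TMod x z" using f g(1) z t by simp_all
  have d: "dual_map (Hom TMod x' z) (\<lambda>h. h \<cdot>\<^bsub>TMod\<^esub> f) \<zeta> \<in> hom_dual K TMod x' z"
    using TMod.dual_pre[OF z f t] g(1) by simp
  have "FA (ftr_comp Ntilde Tensor) f \<cdot>\<^bsub>TMod\<^esub> iotaT x z \<zeta> = iotaT x' z (dual_map (Hom TMod x' z) (\<lambda>h. h \<cdot>\<^bsub>TMod\<^esub> f) \<zeta>)"
    using iotaT_natural[OF f' z' t'] FA_Tensor[OF f'] g(1) by (simp add: FA_Ntilde iotaT_def)
  then show "FA (ftr_comp Ntilde Tensor) f \<cdot>\<^bsub>TMod\<^esub> restrict (iotaT (Dom TMod f) z) (hom_dual K TMod (Dom TMod f) z) \<zeta> =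
      restrict (iotaT (Cod TMod f) z) (hom_dual K TMod (Cod TMod f) z)
        (dual_map (Hom TMod (Cod TMod f) z) (\<lambda>h. h \<cdot>\<^bsub>TMod\<^esub> f) \<zeta>)"
    using t' d g(1) by simp
qed

end

section \<open>Existence and uniqueness of the Nakayama functor\<close>

lemma finite_abelian_copowers:
  fixes K :: "'k ring" and C :: "('k, 'o, 'm) lincat"
  assumes K: "field K" and C: "finite_abelian K C"
  obtains ten :: "('k, 'v) module \<Rightarrow> 'o \<Rightarrow> 'o" and tj where "copowers K C ten tj"
proof -
  have ex: "\<exists>z. is_copower K C V X (fst z) (snd z)" if V: "fd_space K V" and X: "X \<in> Obj C"
    for V :: "('k, 'v) module" and X
  proof -
    obtain Q j where "is_copower K C V X Q j" by (rule finite_abelian_copower[OF K C V X])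
    then show ?thesis by (intro exI[of _ "(Q, j)"]) simp
  qed
  define z where "z V X = (SOME z. is_copower K C V X (fst z) (snd z))" for V :: "('k, 'v) module" and X
  have "is_copower K C V X (fst (z V X)) (snd (z V X))" if "fd_space K V" "X \<in> Obj C" for V X
    unfolding z_def by (rule someI_ex[OF ex[OF that]])
  then have "copowers K C (\<lambda>V X. fst (z V X)) (\<lambda>V X. snd (z V X))" by (simp add: copowers_def)
  then show thesis by (rule that)
qed

lemma finite_abelian_lcat_copowers:
  assumes K: "field K" and C: "finite_abelian K C" and ten: "copowers K C ten tj"
  shows "lcat_copowers K C ten tj"
proof -
  have lin: "linear_category K C" using C by (simp add: finite_abelian_def)
  have "fd_space K (dual K (Hom C M X))" if "M \<in> Obj C" "X \<in> Obj C" for M X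
    by (rule fd_space_dual[OF K]) (use finite_abelian_hom_finite[OF K C] that in \<open>simp add: hom_finite_def\<close>)
  then show ?thesis using lin ten by (simp add: lcat_copowers_def lcat_copowers_axioms_def lcat_def)
qed

lemma nakayama_functor_unique:
  assumes K: "field K" and C: "finite_abelian K C" and N: "nak_functor K C N \<iota>"
    and N': "is_nakayama_functor K C N'"
  shows "naturally_isomorphic C C N' N"
proof -
  obtain ten tj i where n: "nakayama K C ten tj N' i" using N' by (auto simp: is_nakayama_functor_def)
  interpret lcat_copowers K C ten tj
    by (rule finite_abelian_lcat_copowers[OF K C]) (use n in \<open>simp add: nakayama_def\<close>)
  show ?thesis by (rule nak_functor_unique[OF nakayama_nak_functor[OF n] N])
qed

lemma nak_functor_is_nakayama:
  fixes K :: "'k ring" and C :: "('k, 'o, 'm) lincat"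
  assumes K: "field K" and C: "finite_abelian K C" and N: "nak_functor K C N \<iota>"
  shows "is_nakayama_functor K C N"
proof -
  obtain ten :: "('k, 'm \<Rightarrow> 'k) module \<Rightarrow> 'o \<Rightarrow> 'o" and tj where t: "copowers K C ten tj"
    by (rule finite_abelian_copowers[OF K C])
  interpret lcat_copowers K C ten tj by (rule finite_abelian_lcat_copowers[OF K C t])
  show ?thesis by (rule nak_functor_nakayama[OF N])
qed

theorem theorem1p1:
  fixes K :: "'k ring"
    and C :: "('k, 'o, 'm) lincat"
    and T Tla Tlla N :: "('o, 'm, 'o, 'm) ftr"
    and \<mu> \<eta> u e u' e' :: "'o \<Rightarrow> 'm"
    and ten :: "('k, 'm \<Rightarrow> 'k) module \<Rightarrow> 'o \<Rightarrow> 'o"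
    and tj :: "('k, 'm \<Rightarrow> 'k) module \<Rightarrow> 'o \<Rightarrow> ('m \<Rightarrow> 'k) \<Rightarrow> 'm"
    and i :: "'o \<Rightarrow> 'o \<Rightarrow> 'm"
    and Q :: "'o \<times> 'm \<Rightarrow> 'o"
    and q :: "'o \<times> 'm \<Rightarrow> 'm"
  assumes "field K"
    and "finite_abelian K C"
    and "monad C T \<mu> \<eta>"
    and "linear_functor K C C T"
    and "adjunction C C Tla T u e"
    and "adjunction C C Tlla Tla u' e'"
    and "has_double_right_adjoint C T"
    and "nakayama K C ten tj N i"
    and "tensor_coequalizers C T \<mu> \<eta> Tla u e Q q"
  defines "TMod \<equiv> tmod C T \<mu> \<eta>"
    and "TllaMod \<equiv> tmod C Tlla (lla_mult C T \<mu> Tla u e Tlla u' e') (lla_unit C \<eta> Tla e Tlla u')"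
    and "Tensor \<equiv> tensor_functor C T \<mu> Tla u e Tlla e' Q q"
    and "Ntilde \<equiv> nak_lift K C ten tj N i Tlla Tla T u' e"
  shows "finite_abelian K TMod
    \<and> is_functor TMod TllaMod Tensor
    \<and> is_functor TllaMod TMod Ntilde
    \<and> (\<exists>N'. is_nakayama_functor K TMod N')
    \<and> (\<forall>N'. is_nakayama_functor K TMod N' \<longrightarrow>
          naturally_isomorphic TMod TMod N' (ftr_comp Ntilde Tensor))"
proof -
  note K = \<open>field K\<close> and C = \<open>finite_abelian K C\<close>
  note monad = \<open>monad C T \<mu> \<eta>\<close> and T = \<open>linear_functor K C C T\<close>
  note A = \<open>adjunction C C Tla T u e\<close> and B = \<open>adjunction C C Tlla Tla u' e'\<close>
  note N = \<open>nakayama K C ten tj N i\<close> and Q = \<open>tensor_coequalizers C T \<mu> \<eta> Tla u e Q q\<close>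
  obtain R v w where R: "adjunction C C T R v w"
    using \<open>has_double_right_adjoint C T\<close> by (auto simp: has_double_right_adjoint_def)
  obtain P where P: "progenerator K C P" by (rule finite_abelian_progenerator[OF K C])
  have lm: "lmonad K C T \<mu> \<eta>" using monad T by (simp add: lmonad_def)
  interpret M: lmonad_adj K C T \<mu> \<eta> R v w P
    using lm R P by (simp add: lmonad_adj_def lmonad_adj_axioms_def adj_def)
  have fin: "finite_abelian K TMod"
    unfolding TMod_def by (rule M.tmod_finite_abelian[OF K finite_abelian_hom_finite[OF K C]])
  have cop: "lcat_copowers K C ten tj"
    by (rule finite_abelian_lcat_copowers[OF K C]) (use N in \<open>simp add: nakayama_def\<close>)
  interpret S: nak_setting K C T \<mu> \<eta> Tla u e Tlla u' e' Q q R v w ten tj N i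
    using lm A B Q R cop N
    by (simp add: nak_setting_def nak_setting_axioms_def monad_tensor_def monad_tensor_axioms_def monad_la_def adj_def)
  note nak = S.tmod_nak_functor[folded TMod_def Tensor_def Ntilde_def]
  show ?thesis
    using fin S.Tensor_functor[folded TMod_def TllaMod_def Tensor_def]
      S.Ntilde_functor[folded TMod_def TllaMod_def Ntilde_def]
      nak_functor_is_nakayama[OF K fin nak] nakayama_functor_unique[OF K fin nak]
    by blast
qed

end
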